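(* Suppose that $K$ is a number field or a real closed field and let $\{q_1,q_2\}$ be a nonsingular pair of quadratic forms on a finite-dimensional $K$-vector space $V$. Then the following conditions are equivalent: (a) $n\times\{q_i\}_{i=1,2}$ is hyperbolic for some $n\in\mathbb{N}$. (b) Every $q\in\mathrm{Cl}\{q_1,q_2\}$ has signature $0$.
   Context: $\mathbb{N}$ denotes the positive integers. The same letter denotes a quadratic form $q:V\to K$ and its bilinear form $q(x,y)=\frac12(q(x+y)-q(x)-q(y))$; quadratic forms need not be unimodular (i.e. nondegenerate). $n\times q$ is the quadratic form $(v_1,\dots,v_n)\mapsto\sum_i q(v_i)$ on $V^n$, and $n\times\{q_i\}_{i\in I}=\{n\times q_i\}_{i\in I}$. A system $\{q_i\}_{i\in I}$ of quadratic forms on $V$ is hyperbolic if $V=U\oplus U'$ for $K$-subspaces $U,U'$ such that every $q_i$ vanishes on $U$ and on $U'$. It is nonsingular if there is a field extension $L/K$ such that $\mathrm{span}_L\{(q_i)_L : i\in I\}$ contains a unimodular quadratic form over $L$, where $(q_i)_L$ is the base change of $q_i$ to $V\otimes_K L$. The algebra of adjoints $A(\{q_i\}_{i\in I})$ is the $K$-subalgebra of $\mathrm{End}_K(V)\times\mathrm{End}_K(V)^{\mathrm{op}}$ of pairs $(\phi,\psi^{\mathrm{op}})$ with $q_i(\psi x,y)=q_i(x,\phi y)$ for all $x,y\in V$, $i\in I$. $\mathrm{Cl}\{q_i : i\in I\}$ is the $K$-vector space of all quadratic forms $q:V\to K$ such that adjoining $q$ to the system does not change the algebra of adjoints, i.e.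 $q(\psi x,y)=q(x,\phi y)$ for all $x,y\in V$ and all $(\phi,\psi^{\mathrm{op}})\in A(\{q_i\}_{i\in I})$. For an ordering $P$ of $K$ and a possibly degenerate quadratic form $q$, $\mathrm{sgn}_P q$ is the largest dimension of a subspace on which $q$ is positive definite relative to $P$ minus the largest dimension of a subspace on which it is negative definite. "$q$ has signature $0$" means $\mathrm{sgn}_P q=0$ for every ordering $P$ of $K$. *)

theory Defs
  imports
    "HOL-Library.Function_Algebras"
    "HOL-Computational_Algebra.Polynomial"
begin

text \<open>
  A \<open>K\<close>-vector space is a type together with a scalar multiplication \<open>s\<close> satisfying
  \<^locale>\<open>vector_space\<close>. Linear algebra is used through the constants of the locale, applied
  to \<open>s\<close>: \<open>module.subspace s\<close>, \<open>module.span s\<close>, \<open>vector_space.dim s\<close>, and so on.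
\<close>


section \<open>Fields\<close>

definition number_field :: "'k::field_char_0 itself \<Rightarrow> bool" where
  "number_field _ \<longleftrightarrow>
     (\<exists>B :: 'k set. finite B \<and> module.span (\<lambda>(r::rat) x. of_rat r * x) B = UNIV)"

text \<open>Field orderings are given by their sets of nonnegative elements.\<close>

definition field_ordering :: "'k::field set \<Rightarrow> bool" where
  "field_ordering P \<longleftrightarrow>
     (\<forall>x\<in>P. \<forall>y\<in>P. x + y \<in> P) \<and> (\<forall>x\<in>P. \<forall>y\<in>P. x * y \<in> P) \<and>
     P \<union> uminus ` P = UNIV \<and> P \<inter> uminus ` P = {0}"

definition real_closed_field :: "'k::field itself \<Rightarrow> bool" where
  "real_closed_field _ \<longleftrightarrow>
     (\<exists>P :: 'k set. field_ordering P \<and> (\<forall>a\<in>P. \<exists>b. a = b ^ 2)) \<and>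
     (\<forall>p :: 'k poly. odd (degree p) \<longrightarrow> (\<exists>x. poly p x = 0))"

definition field_embedding :: "('k::field \<Rightarrow> 'l::field) \<Rightarrow> bool" where
  "field_embedding h \<longleftrightarrow>
     h 1 = 1 \<and> (\<forall>x y. h (x + y) = h x + h y) \<and> (\<forall>x y. h (x * y) = h x * h y)"


section \<open>Quadratic forms\<close>

definition finite_dim_vector_space :: "('k::field \<Rightarrow> 'v::ab_group_add \<Rightarrow> 'v) \<Rightarrow> bool" where
  "finite_dim_vector_space s \<longleftrightarrow>
     vector_space s \<and> (\<exists>B. finite B \<and> module.span s B = UNIV)"

definition bil :: "('v::ab_group_add \<Rightarrow> 'k::field) \<Rightarrow> 'v \<Rightarrow> 'v \<Rightarrow> 'k" where
  "bil q x y = (q (x + y) - q x - q y) / 2"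

definition quadratic_form ::
    "('k::field \<Rightarrow> 'v::ab_group_add \<Rightarrow> 'v) \<Rightarrow> ('v \<Rightarrow> 'k) \<Rightarrow> bool" where
  "quadratic_form s q \<longleftrightarrow>
     (\<forall>c x. q (s c x) = c ^ 2 * q x) \<and>
     (\<forall>y. Vector_Spaces.linear s (*) (\<lambda>x. bil q x y)) \<and>
     (\<forall>x. Vector_Spaces.linear s (*) (\<lambda>y. bil q x y))"

definition unimodular :: "('v::ab_group_add \<Rightarrow> 'k::field) \<Rightarrow> bool" where
  "unimodular q \<longleftrightarrow> (\<forall>x. (\<forall>y. bil q x y = 0) \<longrightarrow> x = 0)"

text \<open>
  The space \<open>V\<^sup>n\<close> is the subspace \<open>power_space n\<close> of the space of all sequences in \<open>V\<close>, with
  pointwise operations.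
\<close>

definition power_space :: "nat \<Rightarrow> (nat \<Rightarrow> 'v::zero) set" where
  "power_space n = {v. \<forall>i\<ge>n. v i = 0}"

definition power_scale :: "('k \<Rightarrow> 'v \<Rightarrow> 'v) \<Rightarrow> 'k \<Rightarrow> (nat \<Rightarrow> 'v) \<Rightarrow> nat \<Rightarrow> 'v" where
  "power_scale s c v = (\<lambda>i. s c (v i))"

definition times_form :: "nat \<Rightarrow> ('v \<Rightarrow> 'k::comm_monoid_add) \<Rightarrow> (nat \<Rightarrow> 'v) \<Rightarrow> 'k" where
  "times_form n q v = (\<Sum>i<n. q (v i))"

text \<open>
  A system is represented by the set of its members, as all notions below depend only on this
  set. In the next definition \<open>V\<close> is a subspace of the ambient type.
\<close>

definition hyperbolic ::
    "('k::field \<Rightarrow> 'v::ab_group_add \<Rightarrow> 'v) \<Rightarrow> 'v set \<Rightarrow> ('v \<Rightarrow> 'k) set \<Rightarrow> bool" where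
  "hyperbolic s V Q \<longleftrightarrow>
     (\<exists>U U'. module.subspace s U \<and> module.subspace s U' \<and>
        V = {u + u' | u u'. u \<in> U \<and> u' \<in> U'} \<and> U \<inter> U' = {0} \<and>
        (\<forall>q\<in>Q. (\<forall>u\<in>U. q u = 0) \<and> (\<forall>u'\<in>U'. q u' = 0)))"


section \<open>Base change and nonsingular systems\<close>

text \<open>
  \<open>base_change h s t j\<close>: via \<open>j\<close>, the \<open>L\<close>-vector space with scalar multiplication \<open>t\<close> is the base
  change of the \<open>K\<close>-vector space with scalar multiplication \<open>s\<close> along \<open>h : K \<rightarrow> L\<close>; \<open>j x\<close> is
  \<open>x \<otimes> 1\<close>. The universal property of the tensor product is
  \<open>base_change_universal\<close> below.
\<close>

definition base_change ::
    "('k::field \<Rightarrow> 'l::field) \<Rightarrow> ('k \<Rightarrow> 'v::ab_group_add \<Rightarrow> 'v) \<Rightarrow>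
     ('l \<Rightarrow> 'w::ab_group_add \<Rightarrow> 'w) \<Rightarrow> ('v \<Rightarrow> 'w) \<Rightarrow> bool" where
  "base_change h s t j \<longleftrightarrow>
     field_embedding h \<and> vector_space s \<and> vector_space t \<and>
     Vector_Spaces.linear s (\<lambda>c. t (h c)) j \<and>
     module.span t (range j) = UNIV \<and>
     (\<forall>B. \<not> module.dependent s B \<longrightarrow> inj_on j B \<and> \<not> module.dependent t (j ` B))"

text \<open>
  By \<open>base_change_form_unique\<close> below, a quadratic form has exactly one base change if \<open>2 \<noteq> 0\<close>.
\<close>

definition base_change_form ::
    "('k::field \<Rightarrow> 'l::field) \<Rightarrow> ('l \<Rightarrow> 'w::ab_group_add \<Rightarrow> 'w) \<Rightarrow> ('v::ab_group_add \<Rightarrow> 'w) \<Rightarrow>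
     ('v \<Rightarrow> 'k) \<Rightarrow> ('w \<Rightarrow> 'l) \<Rightarrow> bool" where
  "base_change_form h t j q r \<longleftrightarrow>
     quadratic_form t r \<and> (\<forall>x y. bil r (j x) (j y) = h (bil q x y))"

text \<open>
  Nonsingularity of a system \<open>Q\<close> means that \<open>nonsingular_over h t j Q\<close> holds for some field
  extension \<open>h\<close> and base change \<open>(t, j)\<close> along \<open>h\<close>.
\<close>

definition nonsingular_over ::
    "('k::field \<Rightarrow> 'l::field) \<Rightarrow> ('l \<Rightarrow> 'w::ab_group_add \<Rightarrow> 'w) \<Rightarrow> ('v::ab_group_add \<Rightarrow> 'w) \<Rightarrow>
     ('v \<Rightarrow> 'k) set \<Rightarrow> bool" where
  "nonsingular_over h t j Q \<longleftrightarrow>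
     (\<exists>r \<in> module.span (\<lambda>c f x. c * f x) {r. \<exists>q\<in>Q. base_change_form h t j q r}. unimodular r)"

lemma field_embedding_0: "field_embedding h \<Longrightarrow> h 0 = 0"
  by (metis add_cancel_right_right field_embedding_def)

lemma vector_space_restrict_scalars:
  assumes "field_embedding h" and "vector_space t"
  shows "vector_space (\<lambda>c. t (h c))"
  using assms by (simp add: vector_space_def field_embedding_def)

lemma base_change_eq:
  assumes bc: "base_change h s t j"
    and g: "Vector_Spaces.linear t u g" "Vector_Spaces.linear t u g'"
    and eq: "\<And>x. g (j x) = g' (j x)"
  shows "g = g'"
proof
  fix w
  interpret vector_space_pair t u
    using g(1) by (simp add: vector_space_pair_def Vector_Spaces.linear_iff)
  have "w \<in> module.span t (range j)"
    using bc by (simp add: base_change_def)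
  then show "g w = g' w"
    by (rule linear_eq_on_span[OF g, rotated]) (use eq in auto)
qed

lemma base_change_universal:
  assumes bc: "base_change h s t j" and u: "vector_space u"
    and f: "Vector_Spaces.linear s (\<lambda>c. u (h c)) f"
  shows "\<exists>!g. Vector_Spaces.linear t u g \<and> (\<forall>x. g (j x) = f x)"
proof -
  have h: "field_embedding h" and s: "vector_space s" and t: "vector_space t"
    and j: "Vector_Spaces.linear s (\<lambda>c. t (h c)) j"
    using bc by (auto simp: base_change_def)
  interpret V: vector_space s by (rule s)
  interpret vector_space_pair t u
    using t u by (simp add: vector_space_pair_def)
  interpret R: vector_space_pair s "\<lambda>c. u (h c)"
    using s vector_space_restrict_scalars[OF h u] by (simp add: vector_space_pair_def)
  obtain B where B: "\<not> V.dependent B" "V.span B = UNIV"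
    using V.maximal_independent_subset[of UNIV] by (metis UNIV_I subset_antisym subset_UNIV)
  have jB: "inj_on j B" "\<not> module.dependent t (j ` B)"
    using bc B(1) by (auto simp: base_change_def)
  obtain g where g: "Vector_Spaces.linear t u g" "\<forall>w\<in>j ` B. g w = f (inv_into B j w)"
    using linear_independent_extend[OF jB(2), of "\<lambda>w. f (inv_into B j w)"] by blast
  have "Vector_Spaces.linear s (\<lambda>c. u (h c)) (\<lambda>x. g (j x))"
    using j g(1) s vector_space_restrict_scalars[OF h u] by (simp add: Vector_Spaces.linear_iff)
  moreover have "g (j x) = f x" if "x \<in> B" for x
    using that g(2) jB(1) by simp
  ultimately have "g (j x) = f x" for x
    using R.linear_eq_on_span[OF _ f, of "\<lambda>x. g (j x)" B x] B(2) by simp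
  then show ?thesis
    using g(1) base_change_eq[OF bc] by (metis (no_types, lifting))
qed

lemma field_embedding_2_neq_0:
  fixes h :: "'k::field \<Rightarrow> 'l::field"
  assumes h: "field_embedding h" and two: "(2::'k) \<noteq> 0"
  shows "(2::'l) \<noteq> 0"
proof -
  have "h (2 * (1 / 2)) = h 2 * h (1 / 2)" and "h (1 + 1) = 1 + 1"
    using h unfolding field_embedding_def by metis+
  then have "1 = 2 * h (1 / 2)"
    using h two by (simp add: field_embedding_def)
  then show ?thesis
    by (metis mult_zero_left zero_neq_one)
qed

lemma bil_self:
  fixes q :: "'v::ab_group_add \<Rightarrow> 'k::field"
  assumes "quadratic_form s q" and "vector_space s" and "(2::'k) \<noteq> 0"
  shows "bil q x x = q x"
proof -
  interpret vector_space s by fact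
  have "q (x + x) = q (s 2 x)"
    by (metis one_add_one scale_left_distrib scale_one)
  also have "\<dots> = 2 ^ 2 * q x"
    using assms(1) by (simp add: quadratic_form_def)
  finally have "q (x + x) - q x - q x = 2 * q x"
    by (simp add: power2_eq_square algebra_simps)
  then show ?thesis
    using assms(3) by (simp add: bil_def)
qed

lemma base_change_form_unique:
  fixes h :: "'k::field \<Rightarrow> 'l::field"
    and s :: "'k \<Rightarrow> 'v::ab_group_add \<Rightarrow> 'v" and t :: "'l \<Rightarrow> 'w::ab_group_add \<Rightarrow> 'w"
  assumes bc: "base_change h s t j" and q: "quadratic_form s q" and two: "(2::'k) \<noteq> 0"
  shows "\<exists>!r. base_change_form h t j q r"
proof (rule ex_ex1I)
  have h: "field_embedding h" and s: "vector_space s" and t: "vector_space t"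
    and j: "Vector_Spaces.linear s (\<lambda>c. t (h c)) j"
    using bc by (auto simp: base_change_def)
  note two_L = field_embedding_2_neq_0[OF h two]
  have L: "vector_space ((*) :: 'l \<Rightarrow> 'l \<Rightarrow> 'l)"
    by unfold_locales (auto simp: algebra_simps)
  have fun_space: "vector_space (\<lambda>c (f :: 'w \<Rightarrow> 'l) w. c * f w)"
    by unfold_locales (auto simp: algebra_simps fun_eq_iff)
  show "\<exists>r. base_change_form h t j q r"
  proof -
    have "\<exists>g. Vector_Spaces.linear t (*) g \<and> (\<forall>y. g (j y) = h (bil q x y))" for x
    proof (rule ex1_implies_ex, rule base_change_universal[OF bc L])
      show "Vector_Spaces.linear s (\<lambda>c. (*) (h c)) (\<lambda>y. h (bil q x y))"
        using q h vector_space_restrict_scalars[OF h L]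
        by (auto simp: quadratic_form_def Vector_Spaces.linear_iff field_embedding_def)
    qed
    then obtain g where g: "\<And>x. Vector_Spaces.linear t (*) (g x)"
      and gj: "\<And>x y. g x (j y) = h (bil q x y)"
      by metis
    have "Vector_Spaces.linear s (\<lambda>c (f :: 'w \<Rightarrow> 'l) w. h c * f w) g"
      unfolding Vector_Spaces.linear_iff
    proof (intro conjI allI)
      show "vector_space s" by (rule s)
      show "vector_space (\<lambda>c (f :: 'w \<Rightarrow> 'l) w. h c * f w)"
        using vector_space_restrict_scalars[OF h fun_space] .
      show "g (x + y) = g x + g y" for x y
      proof (rule base_change_eq[OF bc g])
        show "Vector_Spaces.linear t (*) (g x + g y)"
          using g[of x] g[of y] by (simp add: Vector_Spaces.linear_iff algebra_simps)
        show "g (x + y) (j z) = (g x + g y) (j z)" for z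
          using q h by (auto simp: gj quadratic_form_def Vector_Spaces.linear_iff field_embedding_def)
      qed
      show "g (s c x) = (\<lambda>w. h c * g x w)" for c x
      proof (rule base_change_eq[OF bc g])
        show "Vector_Spaces.linear t (*) (\<lambda>w. h c * g x w)"
          using g[of x] by (simp add: Vector_Spaces.linear_iff algebra_simps)
        show "g (s c x) (j z) = h c * g x (j z)" for z
          using q h by (auto simp: gj quadratic_form_def Vector_Spaces.linear_iff field_embedding_def)
      qed
    qed
    then obtain G where G: "Vector_Spaces.linear t (\<lambda>c (f :: 'w \<Rightarrow> 'l) w. c * f w) G"
      and Gj: "\<And>x. G (j x) = g x"
      using base_change_universal[OF bc fun_space] by blast
    have G2: "Vector_Spaces.linear t (*) (G w)" for w
    proof -
      interpret vector_space t by (rule t)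
      have "w \<in> span (range j)"
        using bc by (simp add: base_change_def)
      then show ?thesis
      proof (induction rule: span_induct_alt)
        case base
        have "G 0 = 0"
          using G unfolding Vector_Spaces.linear_iff by (metis add_cancel_right_right)
        then show ?case
          using t L by (simp add: Vector_Spaces.linear_iff)
      next
        case (step c x y)
        then obtain v where "x = j v" by auto
        then have "G (t c x + y) = (\<lambda>w. c * g v w + G y w)"
          using G by (auto simp: Vector_Spaces.linear_iff Gj)
        then show ?case
          using g[of v] step by (simp add: Vector_Spaces.linear_iff algebra_simps)
      qed
    qed
    have add: "G (x + y) z = G x z + G y z" "G z (x + y) = G z x + G z y"
      and scale: "G (t c x) z = c * G x z" "G z (t c x) = c * G z x" for x y z c
      using G G2[of z] by (auto simp: Vector_Spaces.linear_iff)
    define r where "r w = G w w" for w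
    have bil_r: "bil r x y = (G x y + G y x) / 2" for x y
      by (simp add: bil_def r_def add)
    have "quadratic_form t r"
      using t L by (simp add: quadratic_form_def bil_r Vector_Spaces.linear_iff add scale r_def
          power2_eq_square algebra_simps add_divide_distrib)
    moreover have "bil r (j x) (j y) = h (bil q x y)" for x y
    proof -
      have "bil q y x = bil q x y"
        by (simp add: bil_def algebra_simps)
      then show ?thesis
        using two_L by (simp add: bil_r Gj gj flip: mult_2)
    qed
    ultimately show ?thesis
      unfolding base_change_form_def by blast
  qed
  show "r = r'" if r: "base_change_form h t j q r" and r': "base_change_form h t j q r'" for r r'
  proof
    fix w
    note rr' = r[unfolded base_change_form_def quadratic_form_def]
      r'[unfolded base_change_form_def quadratic_form_def]
    have "bil r (j x) = bil r' (j x)" for x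
      by (rule base_change_eq[OF bc]) (use rr' in auto)
    then have "(\<lambda>x. bil r x y) = (\<lambda>x. bil r' x y)" for y
      by (intro base_change_eq[OF bc]) (use rr' in auto)
    then have "bil r w w = bil r' w w"
      by meson
    then show "r w = r' w"
      using bil_self[OF _ t two_L] r r' by (simp add: base_change_form_def)
  qed
qed


section \<open>Adjoints, closure and signature\<close>

definition adjoints ::
    "('k::field \<Rightarrow> 'v::ab_group_add \<Rightarrow> 'v) \<Rightarrow> ('v \<Rightarrow> 'k) set \<Rightarrow> (('v \<Rightarrow> 'v) \<times> ('v \<Rightarrow> 'v)) set" where
  "adjoints s Q =
     {(\<phi>, \<psi>). Vector_Spaces.linear s s \<phi> \<and> Vector_Spaces.linear s s \<psi> \<and>
        (\<forall>q\<in>Q. \<forall>x y. bil q (\<psi> x) y = bil q x (\<phi> y))}"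

definition Cl ::
    "('k::field \<Rightarrow> 'v::ab_group_add \<Rightarrow> 'v) \<Rightarrow> ('v \<Rightarrow> 'k) set \<Rightarrow> ('v \<Rightarrow> 'k) set" where
  "Cl s Q =
     {q. quadratic_form s q \<and>
        (\<forall>(\<phi>, \<psi>) \<in> adjoints s Q. \<forall>x y. bil q (\<psi> x) y = bil q x (\<phi> y))}"

definition pos_definite_on :: "'k::field set \<Rightarrow> ('v::ab_group_add \<Rightarrow> 'k) \<Rightarrow> 'v set \<Rightarrow> bool" where
  "pos_definite_on P q U \<longleftrightarrow> (\<forall>x\<in>U. x \<noteq> 0 \<longrightarrow> q x \<in> P \<and> q x \<noteq> 0)"

definition neg_definite_on :: "'k::field set \<Rightarrow> ('v::ab_group_add \<Rightarrow> 'k) \<Rightarrow> 'v set \<Rightarrow> bool" where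
  "neg_definite_on P q U \<longleftrightarrow> (\<forall>x\<in>U. x \<noteq> 0 \<longrightarrow> - q x \<in> P \<and> q x \<noteq> 0)"

definition sgn_form ::
    "('k::field \<Rightarrow> 'v::ab_group_add \<Rightarrow> 'v) \<Rightarrow> 'k set \<Rightarrow> ('v \<Rightarrow> 'k) \<Rightarrow> int" where
  "sgn_form s P q =
     int (Max {vector_space.dim s U | U. module.subspace s U \<and> pos_definite_on P q U}) -
     int (Max {vector_space.dim s U | U. module.subspace s U \<and> neg_definite_on P q U})"

definition signature_zero ::
    "('k::field \<Rightarrow> 'v::ab_group_add \<Rightarrow> 'v) \<Rightarrow> ('v \<Rightarrow> 'k) \<Rightarrow> bool" where
  "signature_zero s q \<longleftrightarrow> (\<forall>P. field_ordering P \<longrightarrow> sgn_form s P q = 0)"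

end

theory Submission
  imports Defs
    "HOL-Library.Multiset"
    "HOL-Computational_Algebra.Polynomial_Factorial"
    "HOL-Computational_Algebra.Polynomial_FPS"
    "HOL-Algebra.Algebraic_Closure_Type"
    "Jordan_Normal_Form.Determinant"
begin

hide_const (open) UnivPoly.coeff UnivPoly.monom Polynomials.lead_coeff Polynomials.degree
  Divisibility.irreducible Module.smult
no_notation Polynomials.var (\<open>X\<index>\<close>)
no_notation Group.m_inv (\<open>(\<open>open_block notation=\<open>prefix inv\<close>\<close>inv\<index> _)\<close> [81] 80)
declare mult_hom.hom_sum_mset [simp del]

text \<open>
  Some combination \<open>r = \<alpha> q\<^sub>1 + \<beta> q\<^sub>2\<close> is unimodular already over \<open>K\<close>, because the determinant of the
  pencil is a nonzero polynomial. Hence there is an \<open>r\<close>-selfadjoint operator \<open>T\<close> on \<open>V\<close> such that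
  \<open>q\<^sub>1\<close> and \<open>q\<^sub>2\<close> are of the form \<open>r (x, f (T) x)\<close> with \<open>f \<in> K[X]\<close>, and all forms of this shape lie in
  the closure. As a \<open>K[X]\<close>-module with form, \<open>V\<close> is an orthogonal sum of cyclic modules \<open>K[X]/(p ^ k)\<close>,
  each with a form \<open>(f, g) \<mapsto> \<lambda> (u f g)\<close>, where \<open>\<lambda>\<close> is the top coefficient modulo \<open>p ^ k\<close> and \<open>u\<close> is a
  unit. The classes of the units may be changed by the moves \<open>u \<leadsto> u v\<^sup>2\<close> and
  \<open>(u, v) \<leadsto> (u + v, u v (u + v))\<close>, which are the relations of the Witt ring. By Hensel's lemma and
  Pfister's local-global principle a multiple of the units for \<open>p ^ k\<close> can be moved to a sum of pairs
  \<open>(u, - u)\<close> once their signs cancel at each real place of \<open>K[X]/(p)\<close>, and the signatures of the forms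
  \<open>r (x, f (T) x)\<close> detect these signs.

  Conversely, let \<open>E\<close> be the projection of \<open>V\<^sup>n\<close> onto one of two complementary isotropic subspaces. It is
  adjoint to \<open>1 - E\<close>, so its \<open>n \<times> n\<close> blocks belong to the algebra of adjoints, and the adjunction
  holds for \<open>n \<times> q\<close> for each \<open>q\<close> in the closure. Then \<open>2 E - 1\<close> is an isometry from \<open>n \<times> q\<close> to its negative.
\<close>

section \<open>Orderings and signatures\<close>

text \<open>The units are tracked in multisets of pairs (modulus, unit), without the vectors that
  realize them. This separates the arithmetic of the residue fields from \<open>V\<close>, which
  enters only through signatures and through the passage from moves to isotropic subspaces. A
  multiple has to be taken because signatures see a form only up to torsion in the Witt ring; the
  multiples for different moduli are reconciled by a common one. Two obstacles shape the arithmetic.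
  An ordering of \<open>K\<close> can extend to several real places of the residue field, and a
  signature over \<open>K\<close> yields a signed sum over them; the single places are separated by
  multiplying with \<open>X - c\<close>, where the rational \<open>c\<close> passes one root of
  \<open>p\<close>. Further, a unit that is positive wherever some entry is positive is built
  without weak approximation. This rests on bounds for the values at all real places at once, which
  exist since the residue field of a number field is finite-dimensional over the rationals. Over a
  real closed field only linear and quadratic \<open>p\<close> occur, and in the quadratic case -1
  is a square modulo \<open>p\<close>.\<close>

definition sgn_in :: "'k::field set \<Rightarrow> 'k \<Rightarrow> int" where
  "sgn_in P a = (if a = 0 then 0 else if a \<in> P then 1 else -1)"

lemma field_ordering_add: "field_ordering P \<Longrightarrow> a \<in> P \<Longrightarrow> b \<in> P \<Longrightarrow> a + b \<in> P"
  and field_ordering_mult: "field_ordering P \<Longrightarrow> a \<in> P \<Longrightarrow> b \<in> P \<Longrightarrow> a * b \<in> P"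
  by (simp_all add: field_ordering_def)

lemma field_ordering_total: "field_ordering P \<Longrightarrow> a \<in> P \<or> - a \<in> P"
proof -
  assume "field_ordering P"
  then have "a \<in> P \<union> uminus ` P" by (simp add: field_ordering_def)
  then show ?thesis by auto
qed

lemma field_ordering_antisym:
  assumes "field_ordering P" "a \<in> P" "- a \<in> P" shows "a = 0"
proof -
  have "a \<in> uminus ` P" using assms(3) by (metis image_eqI minus_minus)
  then show ?thesis using assms by (auto simp: field_ordering_def)
qed

lemma field_ordering_0: "field_ordering P \<Longrightarrow> 0 \<in> P"
  by (auto simp: field_ordering_def)

lemma field_ordering_square: "field_ordering P \<Longrightarrow> a * a \<in> P"
  using field_ordering_total[of P a] field_ordering_mult[of P a a] field_ordering_mult[of P "-a" "-a"]
  by auto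

lemma field_ordering_1: "field_ordering P \<Longrightarrow> 1 \<in> P"
  using field_ordering_square[of P 1] by simp

lemma sgn_in_0 [simp]: "sgn_in P 0 = 0"
  by (simp add: sgn_in_def)

lemma sgn_in_minus: "field_ordering P \<Longrightarrow> sgn_in P (- a) = - sgn_in P a"
  using field_ordering_total[of P a] field_ordering_antisym[of P a] by (auto simp: sgn_in_def)

lemma sgn_in_mult:
  assumes "field_ordering P" shows "sgn_in P (a * b) = sgn_in P a * sgn_in P b"
proof -
  have pos: "sgn_in P (a * b) = sgn_in P b" if "a \<in> P" "a \<noteq> 0" for a b
  proof (cases "b \<in> P")
    case True
    then show ?thesis using that field_ordering_mult[OF assms] by (simp add: sgn_in_def)
  next
    case False
    then have "-b \<in> P" "b \<noteq> 0"
      using field_ordering_total[OF assms, of b] field_ordering_0[OF assms] by auto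
    then have "sgn_in P (a * (-b)) = 1"
      using that field_ordering_mult[OF assms, of a "-b"] by (simp add: sgn_in_def)
    then show ?thesis using False \<open>b \<noteq> 0\<close> sgn_in_minus[OF assms, of "a * b"] by (simp add: sgn_in_def)
  qed
  show ?thesis
  proof (cases "a \<in> P \<or> a = 0")
    case True
    then show ?thesis using pos[of a b] by (cases "a = 0") (auto simp: sgn_in_def[of P a])
  next
    case False
    then have "-a \<in> P" "-a \<noteq> 0"
      using field_ordering_total[OF assms, of a] by auto
    then show ?thesis using pos[of "-a" b] False sgn_in_minus[OF assms, of "a * b"]
      by (simp add: sgn_in_def)
  qed
qed

section \<open>Sylvester's law of inertia over an ordered field\<close>

locale sym_bilinear = vector_space s
  for s :: "'k::field_char_0 \<Rightarrow> 'a::ab_group_add \<Rightarrow> 'a" +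
  fixes b :: "'a \<Rightarrow> 'a \<Rightarrow> 'k"
  assumes b_add_left: "b (x + y) z = b x z + b y z"
    and b_scale_left: "b (s c x) z = c * b x z"
    and b_commute: "b x y = b y x"
begin

lemma b_add_right: "b x (y + z) = b x y + b x z"
  using b_add_left b_commute by metis

lemma b_scale_right: "b x (s c y) = c * b x y"
  using b_scale_left b_commute by metis

lemma b_0_left [simp]: "b 0 y = 0" and b_0_right [simp]: "b y 0 = 0"
  using b_scale_left[of 0 0 y] b_commute[of y 0] by auto

lemma b_minus_left: "b (- x) y = - b x y" and b_minus_right: "b y (- x) = - b y x"
  using b_add_left[of x "-x" y] b_add_right[of y x "-x"] by (auto simp: eq_neg_iff_add_eq_0 add.commute)

lemma b_diff_left: "b (x - z) y = b x y - b z y" and b_diff_right: "b y (x - z) = b y x - b y z"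
  using b_add_left[of x "-z" y] b_add_right[of y x "-z"] b_minus_left b_minus_right by auto

lemma b_sum_left: "b (sum f A) y = (\<Sum>x\<in>A. b (f x) y)"
  by (induction A rule: infinite_finite_induct) (auto simp: b_add_left)

lemma b_sum_right: "b y (sum f A) = (\<Sum>x\<in>A. b y (f x))"
  by (induction A rule: infinite_finite_induct) (auto simp: b_add_right)

lemma b_span_left_0: "x \<in> span A \<Longrightarrow> (\<And>a. a \<in> A \<Longrightarrow> b a y = 0) \<Longrightarrow> b x y = 0"
  by (induction rule: span_induct_alt) (auto simp: b_add_left b_scale_left)

definition orthobasis :: "'a set \<Rightarrow> 'a set \<Rightarrow> bool" where
  "orthobasis W X \<longleftrightarrow> finite X \<and> independent X \<and> span X = W \<and>
     (\<forall>x\<in>X. \<forall>y\<in>X. x \<noteq> y \<longrightarrow> b x y = 0)"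

text \<open>A relation, because independence of the orthogonal basis is proved only afterwards, and
  taken on a subspace \<open>W\<close>, because cyclic summands and the powers of \<open>V\<close>
  are subspaces of larger types. Basis vectors in the radical contribute 0.\<close>

definition has_sig :: "'k set \<Rightarrow> 'a set \<Rightarrow> int \<Rightarrow> bool" where
  "has_sig P W z \<longleftrightarrow> (\<exists>X. orthobasis W X \<and> z = (\<Sum>x\<in>X. sgn_in P (b x x)))"

lemma b_orthogonal_sum:
  assumes "finite X" "\<forall>x\<in>X. \<forall>y\<in>X. x \<noteq> y \<longrightarrow> b x y = 0"
  shows "b (\<Sum>x\<in>X. s (f x) x) (\<Sum>x\<in>X. s (f x) x) = (\<Sum>x\<in>X. (f x)\<^sup>2 * b x x)"
proof -
  have "b (\<Sum>x\<in>X. s (f x) x) (\<Sum>x\<in>X. s (f x) x) = (\<Sum>x\<in>X. \<Sum>y\<in>X. f x * (f y * b x y))"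
    unfolding b_sum_left b_scale_left unfolding b_sum_right b_scale_right by (simp add: sum_distrib_left)
  also have "\<dots> = (\<Sum>x\<in>X. \<Sum>y\<in>X. if y = x then (f x)\<^sup>2 * b x x else 0)"
    using assms by (intro sum.cong refl) (auto simp: power2_eq_square)
  finally show ?thesis using assms(1) by simp
qed

lemma orthogonal_span_nonneg:
  assumes P: "field_ordering P" and X: "finite X" "\<forall>x\<in>X. \<forall>y\<in>X. x \<noteq> y \<longrightarrow> b x y = 0"
    and nn: "\<And>x. x \<in> X \<Longrightarrow> b x x \<in> P" and v: "v \<in> span X"
  shows "b v v \<in> P"
proof -
  obtain f where f: "v = (\<Sum>x\<in>X. s (f x) x)"
    using v span_finite[OF X(1)] by auto
  have "(\<Sum>x\<in>A. (f x)\<^sup>2 * b x x) \<in> P" if "A \<subseteq> X" "finite A" for A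
    using that(2,1) by (induction)
      (auto intro!: field_ordering_add[OF P] field_ordering_mult[OF P _ nn] field_ordering_0[OF P]
        simp: power2_eq_square field_ordering_square[OF P])
  then show ?thesis unfolding f b_orthogonal_sum[OF X] using X(1) by blast
qed

lemma orthogonal_span_pos:
  assumes P: "field_ordering P" and X: "finite X" "\<forall>x\<in>X. \<forall>y\<in>X. x \<noteq> y \<longrightarrow> b x y = 0"
    and pos: "\<And>x. x \<in> X \<Longrightarrow> b x x \<in> P \<and> b x x \<noteq> 0" and v: "v \<in> span X" "v \<noteq> 0"
  shows "b v v \<in> P \<and> b v v \<noteq> 0"
proof -
  obtain f where f: "v = (\<Sum>x\<in>X. s (f x) x)"
    using v span_finite[OF X(1)] by auto
  have nn: "(\<Sum>x\<in>A. (f x)\<^sup>2 * b x x) \<in> P" if "A \<subseteq> X" "finite A" for A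
    using that(2,1) by (induction)
      (auto intro!: field_ordering_add[OF P] field_ordering_mult[OF P _ conjunct1[OF pos]] field_ordering_0[OF P]
        simp: power2_eq_square field_ordering_square[OF P])
  obtain x where x: "x \<in> X" "f x \<noteq> 0"
    using v(2) f by (metis (no_types, lifting) scale_zero_left sum.neutral)
  have "(\<Sum>x\<in>X. (f x)\<^sup>2 * b x x) \<noteq> 0"
  proof
    assume 0: "(\<Sum>x\<in>X. (f x)\<^sup>2 * b x x) = 0"
    then have "- ((f x)\<^sup>2 * b x x) = (\<Sum>x\<in>X-{x}. (f x)\<^sup>2 * b x x)"
      using X(1) x(1) by (simp add: sum.remove neg_eq_iff_add_eq_0)
    then have "- ((f x)\<^sup>2 * b x x) \<in> P" using nn[of "X - {x}"] X(1) by auto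
    moreover have "(f x)\<^sup>2 * b x x \<in> P"
      using pos[OF x(1)] by (intro field_ordering_mult[OF P]) (auto simp: power2_eq_square field_ordering_square[OF P])
    ultimately show False using field_ordering_antisym[OF P] x pos[OF x(1)] by fastforce
  qed
  then show ?thesis unfolding f b_orthogonal_sum[OF X] using nn X(1) by blast
qed

lemma independent_Un_disjoint_span:
  assumes "finite A" "independent A" "independent N" "span A \<inter> span N = {0}"
  shows "independent (A \<union> N) \<and> A \<inter> N = {}"
  using assms(1,2,4)
proof (induction A)
  case empty
  then show ?case using assms(3) by simp
next
  case (insert a A)
  have "span A \<inter> span N = {0}"
    using insert.prems(2) span_mono[of A "insert a A"] span_zero by blast
  then have IH: "independent (A \<union> N)" "A \<inter> N = {}"
    using insert independent_mono[of "insert a A" A] by auto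
  have "a \<notin> span (A \<union> N)"
  proof
    assume "a \<in> span (A \<union> N)"
    then obtain x n where xn: "a = x + n" "x \<in> span A" "n \<in> span N" unfolding span_Un by blast
    then have "n = a - x" by simp
    then have "n \<in> span (insert a A)"
      using xn(2) span_mono[of A "insert a A"] by (metis insertI1 span_base span_diff subset_insertI subsetD)
    then have "n = 0" using insert.prems(2) xn(3) by blast
    then show False using xn insert.prems(1) insert.hyps(2) by (simp add: independent_insert)
  qed
  then show ?case using IH insert.hyps span_base[of a "A \<union> N"]
    by (auto simp: independent_insert)
qed

text \<open>The basis vectors that are not positive span a space \<open>span N\<close> on which the
  form is nowhere positive. It meets \<open>span A\<close> only in 0, so the two dimensions add up
  to at most \<open>card X\<close>.\<close>

lemma pos_definite_card_le:
  assumes P: "field_ordering P" and X: "orthobasis W X"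
    and A: "independent A" "A \<subseteq> W" "\<And>v. v \<in> span A \<Longrightarrow> v \<noteq> 0 \<Longrightarrow> b v v \<in> P \<and> b v v \<noteq> 0"
  shows "card A \<le> card {x\<in>X. b x x \<in> P \<and> b x x \<noteq> 0}"
proof -
  define N where "N = {x\<in>X. \<not> (b x x \<in> P \<and> b x x \<noteq> 0)}"
  have fin: "finite X" and W: "span X = W" and ind: "independent X"
    using X by (auto simp: orthobasis_def)
  have finA: "finite A" using A(1,2) W fin independent_span_bound by blast
  interpret neg: sym_bilinear s "\<lambda>x y. - b x y"
    by unfold_locales (auto simp: b_add_left b_scale_left intro: b_commute)
  have N: "finite N" "independent N" using fin ind independent_mono[of X N] by (auto simp: N_def)
  have "- b v v \<in> P" if "v \<in> span N" for v
  proof (rule neg.orthogonal_span_nonneg[OF P N(1) _ _ that])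
    show "\<forall>x\<in>N. \<forall>y\<in>N. x \<noteq> y \<longrightarrow> - b x y = 0" using X by (auto simp: orthobasis_def N_def)
    show "- b x x \<in> P" if "x \<in> N" for x
      using that field_ordering_total[OF P, of "b x x"] field_ordering_0[OF P] by (auto simp: N_def)
  qed
  then have "span A \<inter> span N = {0}"
    using A(3) field_ordering_antisym[OF P] span_zero by blast
  then have "independent (A \<union> N)" "A \<inter> N = {}"
    using independent_Un_disjoint_span[OF finA A(1) N(2)] by auto
  moreover have "A \<union> N \<subseteq> span X" using A(2) W span_superset by (auto simp: N_def)
  ultimately have "card A + card N \<le> card X"
    using independent_span_bound[OF fin, of "A \<union> N"] card_Un_disjoint[OF finA N(1)] by auto
  moreover have "card X = card {x\<in>X. b x x \<in> P \<and> b x x \<noteq> 0} + card N"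
    unfolding N_def using fin by (subst card_Un_disjoint[symmetric]) (auto intro: arg_cong[where f = card])
  ultimately show ?thesis by simp
qed

lemma sym_bilinear_minus: "sym_bilinear s (\<lambda>x y. - b x y)"
  by unfold_locales (auto simp: b_add_left b_scale_left intro: b_commute)

lemma orthobasis_minus: "sym_bilinear.orthobasis s (\<lambda>x y. - b x y) W X = orthobasis W X"
  unfolding sym_bilinear.orthobasis_def[OF sym_bilinear_minus] orthobasis_def by simp

lemma neg_definite_card_le:
  assumes P: "field_ordering P" and X: "orthobasis W X"
    and A: "independent A" "A \<subseteq> W" "\<And>v. v \<in> span A \<Longrightarrow> v \<noteq> 0 \<Longrightarrow> - b v v \<in> P \<and> b v v \<noteq> 0"
  shows "card A \<le> card {x\<in>X. - b x x \<in> P \<and> b x x \<noteq> 0}"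
  using sym_bilinear.pos_definite_card_le[OF sym_bilinear_minus P, of W X A] assms orthobasis_minus
  by simp

lemma orthobasis_pos_part:
  assumes P: "field_ordering P" and X: "orthobasis W X"
  defines "A \<equiv> {x\<in>X. b x x \<in> P \<and> b x x \<noteq> 0}"
  shows "finite A" "independent A" "A \<subseteq> W" "v \<in> span A \<Longrightarrow> v \<noteq> 0 \<Longrightarrow> b v v \<in> P \<and> b v v \<noteq> 0"
proof -
  show "finite A" "independent A" "A \<subseteq> W"
    using X independent_mono[of X A] span_superset by (auto simp: orthobasis_def A_def)
  have "\<forall>x\<in>A. \<forall>y\<in>A. x \<noteq> y \<longrightarrow> b x y = 0" "\<And>x. x \<in> A \<Longrightarrow> b x x \<in> P \<and> b x x \<noteq> 0"
    using X by (simp_all add: orthobasis_def A_def)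
  then show "v \<in> span A \<Longrightarrow> v \<noteq> 0 \<Longrightarrow> b v v \<in> P \<and> b v v \<noteq> 0"
    by (rule orthogonal_span_pos[OF P \<open>finite A\<close>])
qed

lemma orthobasis_neg_part:
  assumes P: "field_ordering P" and X: "orthobasis W X"
  defines "A \<equiv> {x\<in>X. - b x x \<in> P \<and> b x x \<noteq> 0}"
  shows "finite A" "independent A" "A \<subseteq> W" "v \<in> span A \<Longrightarrow> v \<noteq> 0 \<Longrightarrow> - b v v \<in> P \<and> b v v \<noteq> 0"
proof -
  note part = sym_bilinear.orthobasis_pos_part[OF sym_bilinear_minus P, unfolded orthobasis_minus, OF X,
      unfolded neg_equal_0_iff_equal, folded A_def]
  show "finite A" "independent A" "A \<subseteq> W" "v \<in> span A \<Longrightarrow> v \<noteq> 0 \<Longrightarrow> - b v v \<in> P \<and> b v v \<noteq> 0"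
    by (fact part)+
qed

lemma sum_sgn_in:
  assumes P: "field_ordering P" and fin: "finite X"
  shows "(\<Sum>x\<in>X. sgn_in P (q x)) =
    int (card {x\<in>X. q x \<in> P \<and> q x \<noteq> 0}) - int (card {x\<in>X. - q x \<in> P \<and> q x \<noteq> 0})"
proof -
  have "(\<Sum>x\<in>X. sgn_in P (q x)) = (\<Sum>x\<in>X. (if q x \<in> P \<and> q x \<noteq> 0 then 1 else 0) - (if - q x \<in> P \<and> q x \<noteq> 0 then 1 else 0))"
    using field_ordering_total[OF P] field_ordering_antisym[OF P]
    by (intro sum.cong refl) (auto simp: sgn_in_def)
  then show ?thesis using fin by (simp add: sum_subtractf flip: sum.inter_filter)
qed

text \<open>Sylvester's law: the positive part of either basis is a positive definite family for the
  other one, so the counts agree by symmetry; likewise for the negative parts.\<close>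

lemma has_sig_unique:
  assumes P: "field_ordering P" and "has_sig P W z" "has_sig P W z'"
  shows "z = z'"
proof -
  obtain X Y where X: "orthobasis W X" "z = (\<Sum>x\<in>X. sgn_in P (b x x))"
    and Y: "orthobasis W Y" "z' = (\<Sum>x\<in>Y. sgn_in P (b x x))"
    using assms by (auto simp: has_sig_def)
  have "card {x\<in>X. b x x \<in> P \<and> b x x \<noteq> 0} = card {x\<in>Y. b x x \<in> P \<and> b x x \<noteq> 0}"
    using pos_definite_card_le[OF P X(1) orthobasis_pos_part(2-4)[OF P Y(1)]]
      pos_definite_card_le[OF P Y(1) orthobasis_pos_part(2-4)[OF P X(1)]] by simp
  moreover have "card {x\<in>X. - b x x \<in> P \<and> b x x \<noteq> 0} = card {x\<in>Y. - b x x \<in> P \<and> b x x \<noteq> 0}"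
    using neg_definite_card_le[OF P X(1) orthobasis_neg_part(2-4)[OF P Y(1)]]
      neg_definite_card_le[OF P Y(1) orthobasis_neg_part(2-4)[OF P X(1)]] by simp
  moreover have "finite X" "finite Y" using X Y by (auto simp: orthobasis_def)
  ultimately show ?thesis using X(2) Y(2) sum_sgn_in[OF P, of _ "\<lambda>x. b x x"] by simp
qed

text \<open>A vector \<open>w\<close> with \<open>b w w\<close> nonzero splits off from its
  orthogonal complement. If there is none, polarization makes the form vanish on the whole span, and
  any basis is orthogonal.\<close>

lemma orthobasis_exists_aux:
  assumes "independent A" "finite A"
  shows "\<exists>X. orthobasis (span A) X"
  using assms
proof (induction "card A" arbitrary: A rule: less_induct)
  case less
  show ?case
  proof (cases "\<forall>x\<in>span A. b x x = 0")
    case True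
    have "b x y = 0" if "x \<in> span A" "y \<in> span A" for x y
    proof -
      have "b (x + y) (x + y) = 0" using True that span_add by blast
      then have "2 * b x y = 0" using True that by (simp add: b_add_left b_add_right b_commute[of y x])
      then show ?thesis by simp
    qed
    then have "orthobasis (span A) A" using less.prems span_base by (auto simp: orthobasis_def)
    then show ?thesis by blast
  next
    case False
    then obtain w where w: "w \<in> span A" "b w w \<noteq> 0" by auto
    define W where "W = {x\<in>span A. b x w = 0}"
    have sub: "subspace W"
      by (auto simp: W_def subspace_def span_zero span_add span_scale b_add_left b_scale_left)
    obtain A' where A': "A' \<subseteq> W" "independent A'" "W \<subseteq> span A'" using maximal_independent_subset by blast
    have spanA': "span A' = W" using A' sub span_subspace by blast
    have wA': "w \<notin> span A'" using w spanA' by (simp add: W_def)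
    have "independent (insert w A')" using A'(2) wA' by (simp add: independent_insertI)
    moreover have "insert w A' \<subseteq> span A" using w A'(1) by (auto simp: W_def)
    ultimately have fin: "finite A'" "card (insert w A') \<le> card A"
      using independent_span_bound[OF less.prems(2), of "insert w A'"] by auto
    moreover have "w \<notin> A'" using wA' span_base by blast
    ultimately have "card A' < card A" by simp
    then obtain X where X: "orthobasis W X" using less.hyps[of A'] A'(2) fin spanA' by auto
    then have XW: "finite X" "independent X" "span X = W" by (auto simp: orthobasis_def)
    then have XW: "X \<subseteq> W" "finite X" "independent X" "span X = W" using span_superset[of X] by auto
    have "span (insert w X) = span A"
    proof
      show "span (insert w X) \<subseteq> span A" using w XW(1) by (intro span_minimal) (auto simp: W_def)
      show "span A \<subseteq> span (insert w X)"
      proof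
        fix x assume x: "x \<in> span A"
        have "x - s (b x w / b w w) w \<in> W"
          using x w by (auto simp: W_def span_diff span_scale b_diff_left b_scale_left)
        then show "x \<in> span (insert w X)" unfolding span_breakdown_eq XW(4) by blast
      qed
    qed
    moreover have "w \<notin> span X" using XW(4) w(2) by (simp add: W_def)
    then have "independent (insert w X)" using XW(3) by (rule independent_insertI)
    moreover have "\<forall>x\<in>insert w X. \<forall>y\<in>insert w X. x \<noteq> y \<longrightarrow> b x y = 0"
    proof -
      have "b w x = 0 \<and> b x w = 0" if "x \<in> X" for x
        using XW(1) that b_commute[of w x] by (auto simp: W_def)
      then show ?thesis using X by (auto simp: orthobasis_def)
    qed
    ultimately have "orthobasis (span A) (insert w X)" using XW(2) by (simp add: orthobasis_def)
    then show ?thesis by blast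
  qed
qed

lemma orthobasis_exists:
  assumes "subspace W" "W \<subseteq> span F" "finite F"
  shows "\<exists>X. orthobasis W X"
proof -
  obtain A where A: "A \<subseteq> W" "independent A" "W \<subseteq> span A" using maximal_independent_subset by blast
  then have "span A = W" "finite A"
    using assms span_subspace independent_span_bound[OF assms(3) A(2)] by auto
  then show ?thesis using orthobasis_exists_aux A(2) by metis
qed

lemma has_sig_exists:
  assumes "subspace W" "W \<subseteq> span F" "finite F"
  shows "\<exists>z. has_sig P W z"
  using orthobasis_exists[OF assms] by (auto simp: has_sig_def)

lemma has_sig_orthogonal_sum:
  assumes "has_sig P U z" "has_sig P W z'"
    and "\<And>x y. x \<in> U \<Longrightarrow> y \<in> W \<Longrightarrow> b x y = 0" and int: "U \<inter> W = {0}"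
  shows "has_sig P {u + w | u w. u \<in> U \<and> w \<in> W} (z + z')"
proof -
  obtain X Y where X: "orthobasis U X" "z = (\<Sum>x\<in>X. sgn_in P (b x x))"
    and Y: "orthobasis W Y" "z' = (\<Sum>x\<in>Y. sgn_in P (b x x))"
    using assms by (auto simp: has_sig_def)
  have XU: "X \<subseteq> U" "Y \<subseteq> W" using X Y span_superset by (auto simp: orthobasis_def)
  have ind: "independent (X \<union> Y)" "X \<inter> Y = {}"
    using independent_Un_disjoint_span[of X Y] X Y int by (auto simp: orthobasis_def)
  have "b x y = 0" if "x \<in> X \<union> Y" "y \<in> X \<union> Y" "x \<noteq> y" for x y
    using that X(1) Y(1) assms(3)[of x y] assms(3)[of y x] XU b_commute[of x y]
    by (auto simp: orthobasis_def)
  then have "orthobasis {u + w | u w. u \<in> U \<and> w \<in> W} (X \<union> Y)"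
    using X(1) Y(1) ind unfolding orthobasis_def span_Un by simp
  moreover have "z + z' = (\<Sum>x\<in>X \<union> Y. sgn_in P (b x x))"
    using X Y ind(2) by (simp add: sum.union_disjoint orthobasis_def)
  ultimately show ?thesis by (auto simp: has_sig_def)
qed

lemma has_sig_zero: "has_sig P {0} 0"
  unfolding has_sig_def by (rule exI[of _ "{}"]) (auto simp: orthobasis_def independent_empty)

end

text \<open>Similitudes: the factor \<open>c\<close> is 1 where summands are compared with residue
  rings and coordinates of a power with \<open>V\<close>, and -1 where a form is compared with its
  negative.\<close>

lemma has_sig_image:
  assumes "sym_bilinear s b" "sym_bilinear s' b'" and P: "field_ordering P"
    and g: "Vector_Spaces.linear s s' g" "inj_on g W"
    and gb: "\<And>x y. x \<in> W \<Longrightarrow> y \<in> W \<Longrightarrow> b' (g x) (g y) = c * b x y"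
    and sig: "sym_bilinear.has_sig s b P W z"
  shows "sym_bilinear.has_sig s' b' P (g ` W) (sgn_in P c * z)"
proof -
  interpret A: sym_bilinear s b by fact
  interpret B: sym_bilinear s' b' by fact
  interpret g: Vector_Spaces.linear s s' g by fact
  obtain X where X: "A.orthobasis W X" "z = (\<Sum>x\<in>X. sgn_in P (b x x))"
    using sig by (auto simp: A.has_sig_def)
  then have "finite X" "A.span X = W" "A.independent X" by (auto simp: A.orthobasis_def)
  then have XW: "X \<subseteq> W" "finite X" "A.span X = W" "A.independent X" using A.span_superset[of X] by auto
  have inj: "inj_on g X" using g(2) XW(1) inj_on_subset by blast
  have "B.orthobasis (g ` W) (g ` X)"
    unfolding B.orthobasis_def
  proof (intro conjI)
    show "finite (g ` X)" using XW by simp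
    show "B.independent (g ` X)" using g.independent_injective_image XW g(2) by simp
    show "B.span (g ` X) = g ` W" using g.span_image XW by simp
    show "\<forall>x\<in>g ` X. \<forall>y\<in>g ` X. x \<noteq> y \<longrightarrow> b' x y = 0"
      using X XW(1) gb by (auto simp: A.orthobasis_def subset_iff)
  qed
  moreover have "(\<Sum>x\<in>g ` X. sgn_in P (b' x x)) = sgn_in P c * z"
    using XW(1) by (auto simp: sum.reindex[OF inj] X(2) sum_distrib_left gb subset_iff
        sgn_in_mult[OF P] intro!: sum.cong)
  ultimately show ?thesis unfolding B.has_sig_def by metis
qed

lemma quadratic_form_sym_bilinear:
  fixes s :: "'k::field_char_0 \<Rightarrow> 'v::ab_group_add \<Rightarrow> 'v"
  assumes "vector_space s" "quadratic_form s q"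
  shows "sym_bilinear s (bil q)"
proof -
  interpret vector_space s by fact
  show ?thesis
  proof
    show "bil q (x + y) z = bil q x z + bil q y z" "bil q (s c x) z = c * bil q x z" for x y z c
      using assms(2) by (auto simp: quadratic_form_def Vector_Spaces.linear_iff)
    show "bil q x y = bil q y x" for x y by (simp add: bil_def add.commute)
  qed
qed

text \<open>The maxima in \<open>sgn_form\<close> are attained at the spans of the positive and of
  the negative basis vectors. The bounds from the law of inertia also make the two sets of
  dimensions finite, without which \<open>Max\<close> would say nothing.\<close>

lemma sgn_form_eq:
  fixes s :: "'k::field_char_0 \<Rightarrow> 'v::ab_group_add \<Rightarrow> 'v"
  assumes V: "finite_dim_vector_space s" and q: "quadratic_form s q" and P: "field_ordering P"
    and sig: "sym_bilinear.has_sig s (bil q) P UNIV z"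
  shows "sgn_form s P q = z"
proof -
  have s: "vector_space s" using V by (simp add: finite_dim_vector_space_def)
  interpret sym_bilinear s "bil q" using quadratic_form_sym_bilinear[OF s q] .
  have qq: "bil q x x = q x" for x using bil_self[OF q s] by simp
  obtain X where X: "orthobasis UNIV X" "z = (\<Sum>x\<in>X. sgn_in P (bil q x x))"
    using sig by (auto simp: has_sig_def)
  have fX: "finite X" "span X = UNIV" using X by (auto simp: orthobasis_def)
  have fin: "finite A" if "independent A" for A using independent_span_bound[OF fX(1) that] fX by auto
  have "Max {dim U | U. subspace U \<and> pos_definite_on P q U} = card {x\<in>X. q x \<in> P \<and> q x \<noteq> 0}"
  proof (rule Max_eqI)
    show le: "y \<le> card {x\<in>X. q x \<in> P \<and> q x \<noteq> 0}" if "y \<in> {dim U | U. subspace U \<and> pos_definite_on P q U}" for y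
    proof -
      obtain U where U: "y = dim U" "subspace U" "pos_definite_on P q U" using \<open>y \<in> _\<close> by blast
      obtain A where A: "A \<subseteq> U" "independent A" "U \<subseteq> span A" "card A = dim U" using basis_exists by blast
      have "span A = U" using A U(2) span_subspace by blast
      then show ?thesis using pos_definite_card_le[OF P X(1) A(2)] U A(4)
        by (auto simp: pos_definite_on_def qq)
    qed
    show "finite {dim U | U. subspace U \<and> pos_definite_on P q U}"
      using le by (intro finite_subset[OF subsetI finite_atMost[of "card {x\<in>X. q x \<in> P \<and> q x \<noteq> 0}"]]) (simp only: atMost_iff)
    define A where "A = {x\<in>X. q x \<in> P \<and> q x \<noteq> 0}"
    have "dim (span A) = card A" "pos_definite_on P q (span A)"
      using orthobasis_pos_part[OF P X(1)] dim_span_eq_card_independent[of A]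
      unfolding A_def pos_definite_on_def qq by blast+
    then show "card A \<in> {dim U | U. subspace U \<and> pos_definite_on P q U}"
      by (metis (mono_tags, lifting) mem_Collect_eq subspace_span)
  qed
  moreover have "Max {dim U | U. subspace U \<and> neg_definite_on P q U} = card {x\<in>X. - q x \<in> P \<and> q x \<noteq> 0}"
  proof (rule Max_eqI)
    show le: "y \<le> card {x\<in>X. - q x \<in> P \<and> q x \<noteq> 0}" if "y \<in> {dim U | U. subspace U \<and> neg_definite_on P q U}" for y
    proof -
      obtain U where U: "y = dim U" "subspace U" "neg_definite_on P q U" using \<open>y \<in> _\<close> by blast
      obtain A where A: "A \<subseteq> U" "independent A" "U \<subseteq> span A" "card A = dim U" using basis_exists by blast
      have "span A = U" using A U(2) span_subspace by blast
      then show ?thesis using neg_definite_card_le[OF P X(1) A(2)] U A(4)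
        by (auto simp: neg_definite_on_def qq)
    qed
    show "finite {dim U | U. subspace U \<and> neg_definite_on P q U}"
      using le by (intro finite_subset[OF subsetI finite_atMost[of "card {x\<in>X. - q x \<in> P \<and> q x \<noteq> 0}"]]) (simp only: atMost_iff)
    define A where "A = {x\<in>X. - q x \<in> P \<and> q x \<noteq> 0}"
    have "dim (span A) = card A" "neg_definite_on P q (span A)"
      using orthobasis_neg_part[OF P X(1)] dim_span_eq_card_independent[of A]
      unfolding A_def neg_definite_on_def qq by blast+
    then show "card A \<in> {dim U | U. subspace U \<and> neg_definite_on P q U}"
      by (metis (mono_tags, lifting) mem_Collect_eq subspace_span)
  qed
  ultimately show ?thesis using X(2) sum_sgn_in[OF P fX(1), of q] by (simp add: sgn_form_def qq)
qed


section \<open>Polynomials modulo a monic polynomial\<close>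

abbreviation nonconst_monic :: "'k::field poly \<Rightarrow> bool" where
  "nonconst_monic m \<equiv> lead_coeff m = 1 \<and> 0 < degree m"

text \<open>Units of \<open>K[X]/(m)\<close>, in terms of representatives, since the modulus varies
  throughout.\<close>

definition unit_mod :: "'k::field poly \<Rightarrow> 'k poly \<Rightarrow> bool" where
  "unit_mod m u \<longleftrightarrow> (\<exists>v. m dvd u * v - 1)"

lemma dvd_smaller_degree: "m dvd x \<Longrightarrow> degree x < degree m \<Longrightarrow> x = (0 :: 'k::field poly)"
  using dvd_imp_degree_le[of m x] by fastforce

lemma degree_mod_less_pos: "0 < degree m \<Longrightarrow> degree (f mod m) < degree (m :: 'k::field poly)"
  using degree_mod_less'[of m f] by (cases "f mod m = 0"; cases "m = 0") simp_all

lemma mod_eq_if_dvd_diff: "m dvd f - g \<Longrightarrow> f mod m = g mod (m :: 'k::field poly)"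
  by (metis diff_eq_diff_eq diff_self dvd_imp_mod_0 poly_mod_diff_left)

lemma unit_mod_1 [simp]: "unit_mod m 1"
  by (auto simp: unit_mod_def intro: exI[of _ 1])

lemma unit_mod_mult: assumes "unit_mod m u" "unit_mod m v" shows "unit_mod m (u * v)"
proof -
  obtain a c where "m dvd u * a - 1" "m dvd v * c - 1" using assms by (auto simp: unit_mod_def)
  then have "m dvd (u * a - 1) * (v * c) + (v * c - 1)" by (simp add: dvd_add)
  also have "(u * a - 1) * (v * c) + (v * c - 1) = (u * v) * (a * c) - 1" by (simp add: algebra_simps)
  finally show ?thesis by (auto simp: unit_mod_def)
qed

lemma unit_mod_factor: assumes "unit_mod m (u * v)" shows "unit_mod m u"
  using assms unfolding unit_mod_def by (metis mult.assoc)

lemma unit_mod_cong: assumes "unit_mod m u" "m dvd u - u'" shows "unit_mod m u'"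
proof -
  obtain v where "m dvd u * v - 1" using assms by (auto simp: unit_mod_def)
  then have "m dvd (u * v - 1) - (u - u') * v" using assms(2) by (simp add: dvd_diff)
  also have "(u * v - 1) - (u - u') * v = u' * v - 1" by (simp add: algebra_simps)
  finally show ?thesis by (auto simp: unit_mod_def)
qed

lemma unit_mod_minus: assumes "unit_mod m u" shows "unit_mod m (- u)"
  using assms unfolding unit_mod_def by (metis minus_mult_minus)

lemma unit_mod_power: "unit_mod m u \<Longrightarrow> unit_mod m (u ^ n)"
  by (induction n) (auto intro: unit_mod_mult)

lemma unit_mod_dvd: "unit_mod m u \<Longrightarrow> n dvd m \<Longrightarrow> unit_mod n u"
  unfolding unit_mod_def using dvd_trans by blast

text \<open>A Bezout identity is symmetric in \<open>m\<close> and \<open>u\<close>. The symmetry is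
  what extends units modulo \<open>m\<close> to units modulo its powers.\<close>

lemma unit_mod_commute: "unit_mod m u \<Longrightarrow> unit_mod u m"
  unfolding unit_mod_def dvd_def
proof clarify
  fix v k assume "u * v - 1 = m * k"
  then have "m * (-k) - 1 = u * (- v)" by (simp add: algebra_simps)
  then show "\<exists>v k. m * v - 1 = u * k" by blast
qed

lemma unit_mod_dvd_cancel: assumes "unit_mod m u" "m dvd u * x" shows "m dvd x"
proof -
  obtain v where "m dvd u * v - 1" using assms by (auto simp: unit_mod_def)
  then have "m dvd (u * x) * v - (u * v - 1) * x" using assms by (simp add: dvd_diff)
  then show ?thesis by (simp add: algebra_simps)
qed

lemma unit_mod_power_modulus: assumes "unit_mod m u" shows "unit_mod (m ^ k) u"
  using unit_mod_commute[OF unit_mod_power[OF unit_mod_commute[OF assms]]] .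

text \<open>A nonzero element \<open>g\<close> of least degree in the ideal generated by
  \<open>u\<close> and \<open>p\<close> divides both generators by division with remainder, so it is
  a unit.\<close>

lemma unit_mod_irreducible:
  fixes p :: "'k::field poly"
  assumes p: "irreducible p" and u: "\<not> p dvd u"
  shows "unit_mod p u"
proof -
  define I where "I = {a * u + c * p | a c. a * u + c * p \<noteq> 0}"
  have "1 * u + 0 * p \<in> I" using u unfolding I_def by (smt (verit) dvd_0_right mem_Collect_eq mult_zero_left add.right_neutral mult_1)
  then obtain g where g: "g \<in> I" "\<And>h. h \<in> I \<Longrightarrow> degree g \<le> degree h"
    using ex_has_least_nat[of "\<lambda>h. h \<in> I" _ degree] by metis
  then obtain a c where ac: "g = a * u + c * p" "g \<noteq> 0" by (auto simp: I_def)
  have dvd: "g dvd x" if x: "x = e * u + f * p" for x e f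
  proof (rule ccontr)
    assume "\<not> g dvd x"
    then have 1: "x mod g \<noteq> 0" by (simp add: mod_eq_0_iff_dvd)
    have "x mod g = x - x div g * g" by (simp add: minus_div_mult_eq_mod)
    also have "\<dots> = (e - x div g * a) * u + (f - x div g * c) * p" by (simp add: x ac algebra_simps)
    finally have "x mod g = (e - x div g * a) * u + (f - x div g * c) * p" .
    then have "x mod g \<in> I" using 1 unfolding I_def by (metis (mono_tags, lifting) mem_Collect_eq)
    then show False using g(2)[of "x mod g"] degree_mod_less[OF ac(2), of x] 1 by simp
  qed
  have "g dvd p" "g dvd u" using dvd[of p 0 1] dvd[of u 1 0] by auto
  then have "is_unit g" using p u by (metis dvd_trans Factorial_Ring.irreducibleD')
  then obtain k where "g * k = 1" by (metis dvdE)
  then have "u * (a * k) - 1 = p * (- c * k)" using ac(1) by (simp add: algebra_simps)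
  then show ?thesis unfolding unit_mod_def by (metis dvd_triv_left)
qed

lemma irreducible_not_unit_mod:
  fixes p :: "'k::field poly"
  assumes "irreducible p" "unit_mod p u" shows "\<not> p dvd u"
proof
  assume "p dvd u"
  obtain v where v: "p dvd u * v - 1" using assms(2) by (auto simp: unit_mod_def)
  have "p dvd u * v - (u * v - 1)" by (rule dvd_diff[OF dvd_mult2[OF \<open>p dvd u\<close>] v])
  then show False using assms(1) by (simp add: irreducible_not_unit)
qed

lemma irreducible_dvd_mult:
  fixes p :: "'k::field poly"
  assumes "irreducible p" "p dvd u * v" shows "p dvd u \<or> p dvd v"
  using unit_mod_irreducible[OF assms(1), of u] unit_mod_dvd_cancel assms(2) by blast

text \<open>For monic nonconstant \<open>m\<close> this generates the dual of
  \<open>K[X]/(m)\<close>: every linear form is \<open>f \<mapsto> top_coeff m (g * f)\<close> for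
  some \<open>g\<close>. In contrast to the trace, it gives a nondegenerate form also for moduli
  with multiple factors.\<close>

definition top_coeff :: "'k::field poly \<Rightarrow> 'k poly \<Rightarrow> 'k" where
  "top_coeff m f = coeff (f mod m) (degree m - 1)"

lemma top_coeff_add: "top_coeff m (f + g) = top_coeff m f + top_coeff m g"
  by (simp add: top_coeff_def poly_mod_add_left)

lemma top_coeff_smult: "top_coeff m (smult c f) = c * top_coeff m f"
  by (simp add: top_coeff_def mod_smult_left)

lemma top_coeff_0 [simp]: "top_coeff m 0 = 0"
  by (simp add: top_coeff_def)

lemma top_coeff_minus: "top_coeff m (- f) = - top_coeff m f"
  using top_coeff_smult[of m "-1" f] by simp

lemma top_coeff_cong: "m dvd f - g \<Longrightarrow> top_coeff m f = top_coeff m g"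
  by (simp only: top_coeff_def mod_eq_if_dvd_diff)

lemma top_coeff_dvd: "m dvd f \<Longrightarrow> top_coeff m f = 0"
  using top_coeff_cong[of m f 0] by simp

text \<open>Multiplication by \<open>n\<close> maps \<open>K[X]/(m)\<close> onto the ideal
  \<open>(n)\<close> of \<open>K[X]/(m * n)\<close> and shifts degrees by \<open>degree n\<close>.
  Leading coefficients are preserved as \<open>n\<close> is monic.\<close>

lemma top_coeff_mult_modulus:
  fixes m n :: "'k::field poly"
  assumes m: "nonconst_monic m" and n: "lead_coeff n = 1"
  shows "top_coeff (m * n) (n * f) = top_coeff m f"
proof -
  define r where "r = f mod m"
  have m0: "m \<noteq> 0" "n \<noteq> 0" using m n by auto
  have r: "degree r \<le> degree m - 1"
    using degree_mod_less_pos[of m f] m unfolding r_def by simp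
  have "(n * f) mod (m * n) = n * r"
    by (simp only: r_def mult_mod_right mult.commute[of m])
  moreover have "degree (m * n) - 1 = degree n + (degree m - 1)"
    using m m0 by (simp add: degree_mult_eq)
  moreover have "coeff (n * r) (degree n + (degree m - 1)) = coeff r (degree m - 1)"
  proof (cases "degree r = degree m - 1")
    case True
    then show ?thesis using coeff_mult_degree_sum[of n r] n by simp
  next
    case False
    then have "degree r < degree m - 1" using r by simp
    then show ?thesis using degree_mult_le[of n r] by (simp add: coeff_eq_0)
  qed
  ultimately show ?thesis by (simp add: top_coeff_def r_def)
qed

text \<open>A monomial factor moves the leading coefficient of the nonzero residue of
  \<open>f\<close> into position \<open>degree m - 1\<close>.\<close>

lemma top_coeff_nondegenerate:
  fixes m :: "'k::field poly"
  assumes m: "nonconst_monic m" and f: "\<And>g. top_coeff m (f * g) = 0"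
  shows "m dvd f"
proof (rule ccontr)
  assume "\<not> m dvd f"
  define r where "r = f mod m"
  have r: "r \<noteq> 0" "degree r < degree m"
    using \<open>\<not> m dvd f\<close> degree_mod_less_pos[of m f] m by (simp_all add: r_def mod_eq_0_iff_dvd)
  define g where "g = monom (1::'k) (degree m - 1 - degree r)"
  have deg: "degree (r * g) = degree m - 1"
    using r by (simp add: g_def degree_mult_eq degree_monom_eq)
  have "top_coeff m (f * g) = top_coeff m (r * g)"
    by (rule top_coeff_cong) (simp add: r_def flip: left_diff_distrib minus_mod_eq_mult_div)
  also have "\<dots> = coeff (r * g) (degree (r * g))"
    using deg m by (simp add: top_coeff_def mod_poly_less)
  also have "\<dots> \<noteq> 0"
    using r(1) deg by (metis g_def leading_coeff_0_iff monom_eq_0_iff no_zero_divisors one_neq_zero)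
  finally show False using f by simp
qed

text \<open>The values at the monomials form a triangular system: adding
  \<open>monom c (d - 1 - n)\<close> to \<open>g\<close> corrects the value at the
  \<open>n\<close>-th power of \<open>X\<close> and leaves those at lower powers unchanged.\<close>

lemma top_coeff_represents:
  fixes m :: "'k::field poly"
  assumes m: "nonconst_monic m"
    and add: "\<And>f g. \<phi> (f + g) = \<phi> f + \<phi> g" and scale: "\<And>c f. \<phi> (smult c f) = c * \<phi> f"
    and dvd: "\<And>f. m dvd f \<Longrightarrow> \<phi> f = 0"
  shows "\<exists>g. \<forall>f. \<phi> f = top_coeff m (g * f)"
proof -
  define d where "d = degree m"
  have ex: "n \<le> d \<Longrightarrow> \<exists>g. \<forall>j<n. \<phi> (monom 1 j) = top_coeff m (g * monom 1 j)" for n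
  proof (induction n)
    case (Suc n)
    then obtain g where g: "\<And>j. j < n \<Longrightarrow> \<phi> (monom 1 j) = top_coeff m (g * monom 1 j)" by auto
    define c where "c = \<phi> (monom 1 n) - top_coeff m (g * monom 1 n)"
    have mon: "top_coeff m (monom c (d - 1 - n) * monom 1 j) = (if j = n then c else 0)" if "j \<le> n" for j
    proof -
      have "degree (monom c (d - 1 - n + j)) < degree m"
        using that Suc.prems d_def degree_monom_le[of c "d - 1 - n + j"] by linarith
      then have "top_coeff m (monom c (d - 1 - n) * monom 1 j) = coeff (monom c (d - 1 - n + j)) (d - 1)"
        by (simp add: top_coeff_def mult_monom mod_poly_less d_def)
      then show ?thesis using that Suc.prems by (auto simp: coeff_monom)
    qed
    have "\<phi> (monom 1 j) = top_coeff m ((g + monom c (d - 1 - n)) * monom 1 j)" if "j < Suc n" for j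
      using that g mon[of j] by (cases "j = n") (auto simp: distrib_right top_coeff_add c_def)
    then show ?case by blast
  qed simp
  obtain g where g: "\<And>j. j < d \<Longrightarrow> \<phi> (monom 1 j) = top_coeff m (g * monom 1 j)" using ex[of d] by auto
  have small: "\<phi> f = top_coeff m (g * f)" if "degree f < d" for f
  proof -
    have \<phi>sum: "\<phi> (\<Sum>i\<in>A. smult (a i) (h i)) = (\<Sum>i\<in>A. a i * \<phi> (h i))" if "finite A" for A :: "nat set" and a h
      using that scale[of 0 0] by (induction A) (auto simp: add scale)
    have tsum: "top_coeff m (g * (\<Sum>i\<in>A. smult (a i) (h i))) = (\<Sum>i\<in>A. a i * top_coeff m (g * h i))" if "finite A" for A :: "nat set" and a h
      using that by (induction A) (auto simp: top_coeff_add top_coeff_smult distrib_left)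
    have f: "f = (\<Sum>i\<le>degree f. smult (coeff f i) (monom 1 i))"
      by (simp add: smult_monom poly_as_sum_of_monoms)
    show ?thesis
      using \<phi>sum[of "{..degree f}" "coeff f" "monom 1"] tsum[of "{..degree f}" "coeff f" "monom 1"] g that
      by (subst (1 2) f) auto
  qed
  have "\<phi> f = top_coeff m (g * f)" for f
  proof -
    have 1: "f = m * (f div m) + f mod m" by simp
    have "degree (f mod m) < d" using degree_mod_less_pos[of m f] m d_def by simp
    then have "\<phi> (f mod m) = top_coeff m (g * (f mod m))" by (rule small)
    moreover have "\<phi> f = \<phi> (f mod m)" using 1 add[of "m * (f div m)" "f mod m"] dvd[of "m * (f div m)"] by simp
    moreover have "top_coeff m (g * f) = top_coeff m (g * (f mod m))"
      by (rule top_coeff_cong) (metis dvd_minus_mod dvd_mult right_diff_distrib)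
    ultimately show ?thesis by simp
  qed
  then show ?thesis by blast
qed

subsection \<open>Signatures of the forms on residue rings\<close>

interpretation poly_space: vector_space "smult :: 'k::field \<Rightarrow> 'k poly \<Rightarrow> 'k poly"
  by unfold_locales (auto simp: smult_add_right smult_add_left)

definition residue_form :: "'k::field poly \<Rightarrow> 'k poly \<Rightarrow> 'k poly \<Rightarrow> 'k poly \<Rightarrow> 'k" where
  "residue_form m u x y = top_coeff m (u * x * y)"

definition residues :: "'k::field poly \<Rightarrow> 'k poly set" where
  "residues m = {x. degree x < degree m}"

lemma sym_bilinear_residue_form:
  "sym_bilinear (smult :: 'k::field_char_0 \<Rightarrow> _) (residue_form m u)"
  by unfold_locales
    (auto simp: residue_form_def distrib_left distrib_right top_coeff_add top_coeff_smult mult.commute mult.left_commute)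

lemma subspace_residues: "0 < degree m \<Longrightarrow> poly_space.subspace (residues m)"
  by (auto simp: residues_def poly_space.subspace_def degree_add_less intro: le_less_trans[OF degree_smult_le])

lemma residues_subset_span: "residues m \<subseteq> poly_space.span ((monom 1) ` {..<degree m})"
proof
  fix x assume "x \<in> residues m"
  then have "(\<Sum>i\<le>degree x. smult (coeff x i) (monom 1 i)) \<in> poly_space.span ((monom 1) ` {..<degree m})"
    by (intro poly_space.span_sum poly_space.span_scale poly_space.span_base) (auto simp: residues_def)
  then show "x \<in> poly_space.span ((monom 1) ` {..<degree m})"
    by (simp add: smult_monom poly_as_sum_of_monoms)
qed

lemma mod_in_residues: "0 < degree m \<Longrightarrow> f mod m \<in> residues m"
  using degree_mod_less_pos[of m f] by (simp add: residues_def)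

definition residue_sig :: "'k::field_char_0 set \<Rightarrow> 'k poly \<Rightarrow> 'k poly \<Rightarrow> int" where
  "residue_sig P m u = (THE z. sym_bilinear.has_sig smult (residue_form m u) P (residues m) z)"

lemma residue_sig_iff:
  assumes P: "field_ordering P" and m: "0 < degree m"
  shows "sym_bilinear.has_sig smult (residue_form m u) P (residues m) z \<longleftrightarrow> z = residue_sig P m u"
proof -
  interpret sym_bilinear smult "residue_form m u" by (rule sym_bilinear_residue_form)
  obtain z' where z': "has_sig P (residues m) z'"
    using has_sig_exists[OF subspace_residues[OF m] residues_subset_span] by auto
  have "residue_sig P m u = z'"
    unfolding residue_sig_def using z' has_sig_unique[OF P _ z'] by blast
  then show ?thesis using z' has_sig_unique[OF P _ z'] by blast
qed

lemma residue_sig_cong: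
  assumes "m dvd u - u'" shows "residue_sig P m u = residue_sig P m u'"
proof -
  have "residue_form m u = residue_form m u'"
    unfolding residue_form_def using assms
    by (intro ext top_coeff_cong) (metis dvd_mult2 left_diff_distrib)
  then show ?thesis by (simp add: residue_sig_def)
qed

lemma has_sig_zero_form:
  assumes "sym_bilinear s b" "module.subspace s W" "W \<subseteq> module.span s F" "finite F"
    and 0: "\<And>x. x \<in> W \<Longrightarrow> b x x = 0"
  shows "sym_bilinear.has_sig s b P W 0"
proof -
  interpret sym_bilinear s b by fact
  obtain X where X: "orthobasis W X" using orthobasis_exists[OF assms(2-4)] by blast
  then have "X \<subseteq> W" using span_superset[of X] by (simp add: orthobasis_def)
  then have "(\<Sum>x\<in>X. sgn_in P (b x x)) = 0" using 0 by (intro sum.neutral) auto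
  then show ?thesis using X unfolding has_sig_def by metis
qed

lemma residue_sig_0:
  assumes P: "field_ordering P" and m: "0 < degree m" and dvd: "m dvd u"
  shows "residue_sig P m u = 0"
proof -
  have "sym_bilinear.has_sig smult (residue_form m u) P (residues m) 0"
    by (rule has_sig_zero_form[OF sym_bilinear_residue_form subspace_residues[OF m] residues_subset_span])
      (auto simp: residue_form_def dvd intro!: top_coeff_dvd)
  then show ?thesis using residue_sig_iff[OF P m] by metis
qed

text \<open>Multiplication by the unit \<open>v\<close>, reduced modulo \<open>m\<close>, is a
  bijection of the residues; multiplication by \<open>w\<close> inverts it.\<close>

lemma residue_sig_image:
  assumes P: "field_ordering P" and m: "0 < degree m" and v: "unit_mod m v"
    and form: "\<And>x y. residue_form m u (v * x) (v * y) = c * residue_form m u' x y"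
  shows "residue_sig P m u = sgn_in P c * residue_sig P m u'"
proof -
  define g where "g x = (v * x) mod m" for x
  obtain w where w: "m dvd v * w - 1" using v by (auto simp: unit_mod_def)
  have inv: "(w * ((v * x) mod m)) mod m = x" "(v * ((w * x) mod m)) mod m = x" if "x \<in> residues m" for x
  proof -
    have "m dvd v * (w * x) - x" using dvd_mult2[OF w, of x] by (simp add: algebra_simps)
    then have "(v * (w * x)) mod m = x mod m" by (rule mod_eq_if_dvd_diff)
    then have "(v * (w * x)) mod m = x" using that by (simp add: mod_poly_less residues_def)
    then show "(w * ((v * x) mod m)) mod m = x" "(v * ((w * x) mod m)) mod m = x"
      by (simp_all add: mod_mult_right_eq mult.left_commute)
  qed
  have img: "g ` residues m = residues m"
  proof
    show "g ` residues m \<subseteq> residues m" using mod_in_residues[OF m] by (auto simp: g_def)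
    show "residues m \<subseteq> g ` residues m"
    proof
      fix x assume "x \<in> residues m"
      then have "x = g ((w * x) mod m)" using inv by (simp add: g_def)
      then show "x \<in> g ` residues m" using mod_in_residues[OF m] by blast
    qed
  qed
  have "sym_bilinear.has_sig smult (residue_form m u) P (g ` residues m) (sgn_in P c * residue_sig P m u')"
  proof (rule has_sig_image[OF sym_bilinear_residue_form sym_bilinear_residue_form P])
    show "Vector_Spaces.linear smult smult g"
      unfolding Vector_Spaces.linear_iff using poly_space.vector_space_axioms
      by (auto simp: g_def distrib_left poly_mod_add_left mod_smult_left)
    show "inj_on g (residues m)" 
      by (rule inj_on_inverseI[where g = "\<lambda>y. (w * y) mod m"]) (simp add: g_def inv)
    show "residue_form m u (g x) (g y) = c * residue_form m u' x y" for x y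
    proof -
      have "m dvd u * (v * x) * (v * y) - u * g x * g y"
      proof -
        have "m dvd v * x - g x" "m dvd v * y - g y" by (simp_all add: g_def)
        then have "m dvd u * ((v * x - g x) * (v * y) + g x * (v * y - g y))"
          by (intro dvd_mult[of _ _ u] dvd_add dvd_mult dvd_mult2)
        then show ?thesis by (simp add: algebra_simps)
      qed
      then have "residue_form m u (v * x) (v * y) = residue_form m u (g x) (g y)"
        unfolding residue_form_def by (rule top_coeff_cong)
      then show ?thesis using form[of x y] by metis
    qed
    show "sym_bilinear.has_sig smult (residue_form m u') P (residues m) (residue_sig P m u')"
      using residue_sig_iff[OF P m] by blast
  qed
  then show ?thesis unfolding img using residue_sig_iff[OF P m] by metis
qed

lemma residue_sig_minus:
  assumes P: "field_ordering P" and m: "0 < degree m"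
  shows "residue_sig P m (- u) = - residue_sig P m u"
proof -
  have "residue_sig P m (- u) = sgn_in P (-1) * residue_sig P m u"
    by (rule residue_sig_image[OF P m unit_mod_1]) (simp add: residue_form_def top_coeff_minus)
  moreover have "sgn_in P (-1) = -1"
    using sgn_in_minus[OF P, of 1] field_ordering_1[OF P] by (simp add: sgn_in_def)
  ultimately show ?thesis by simp
qed

text \<open>For arguments \<open>n * x\<close> and \<open>n * y\<close> one factor \<open>n\<close>
  disappears together with the modulus by \<open>top_coeff_mult_modulus\<close>, and the other one
  stays in the coefficient \<open>u * n\<close>.\<close>

lemma residue_sig_part:
  assumes P: "field_ordering P" and m: "nonconst_monic m" and n: "lead_coeff n = 1"
  shows "sym_bilinear.has_sig smult (residue_form (m * n) u) P (((*) n) ` residues m) (residue_sig P m (u * n))"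
proof -
  have "sym_bilinear.has_sig smult (residue_form (m * n) u) P (((*) n) ` residues m) (sgn_in P 1 * residue_sig P m (u * n))"
  proof (rule has_sig_image[OF sym_bilinear_residue_form sym_bilinear_residue_form P])
    show "Vector_Spaces.linear smult smult ((*) n)"
      unfolding Vector_Spaces.linear_iff using poly_space.vector_space_axioms by (auto simp: distrib_left)
    show "inj_on ((*) n) (residues m)" using n by (intro inj_onI) auto
    show "residue_form (m * n) u (n * x) (n * y) = 1 * residue_form m (u * n) x y" for x y
      using top_coeff_mult_modulus[OF m n, of "u * n * x * y"]
      by (simp add: residue_form_def mult.commute mult.left_commute)
    show "sym_bilinear.has_sig smult (residue_form m (u * n)) P (residues m) (residue_sig P m (u * n))"
      using residue_sig_iff[OF P] m by blast
  qed
  then show ?thesis using field_ordering_1[OF P] by (simp add: sgn_in_def)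
qed

lemma degree_mult_residue:
  fixes m n x :: "'k::field poly"
  assumes "lead_coeff n = 1" "x \<in> residues m" "0 < degree m"
  shows "n * x \<in> residues (m * n)"
proof -
  have "m \<noteq> 0" "n \<noteq> 0" using assms by auto
  then show ?thesis using assms degree_mult_le[of n x] by (auto simp: residues_def degree_mult_eq)
qed

text \<open>Chinese remainder theorem: the ideals \<open>(n)\<close> and \<open>(m)\<close> of
  \<open>K[X]/(m * n)\<close> are complementary, and orthogonal since products of their elements
  vanish. The ideal \<open>(n)\<close> is a rescaled copy of \<open>K[X]/(m)\<close> and vice versa,
  whence the twists by \<open>n\<close> and \<open>m\<close>.\<close>

lemma residue_sig_coprime:
  assumes P: "field_ordering P" and m: "nonconst_monic m" and n: "nonconst_monic n"
    and cop: "unit_mod m n"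
  shows "residue_sig P (m * n) u = residue_sig P m (u * n) + residue_sig P n (u * m)"
proof -
  interpret sym_bilinear smult "residue_form (m * n) u" by (rule sym_bilinear_residue_form)
  have mn: "0 < degree (m * n)" using m n by (subst degree_mult_eq) auto
  have "has_sig P {x + y | x y. x \<in> ((*) n) ` residues m \<and> y \<in> ((*) m) ` residues n}
      (residue_sig P m (u * n) + residue_sig P n (u * m))"
  proof (rule has_sig_orthogonal_sum)
    show "has_sig P (((*) n) ` residues m) (residue_sig P m (u * n))"
      using residue_sig_part[OF P m, of n u] n by simp
    show "has_sig P (((*) m) ` residues n) (residue_sig P n (u * m))"
      using residue_sig_part[OF P n, of m u] m by (simp add: mult.commute)
    show "residue_form (m * n) u x y = 0" if xy: "x \<in> ((*) n) ` residues m" "y \<in> ((*) m) ` residues n" for x y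
    proof -
      obtain a c where "x = n * a" "y = m * c" using xy by auto
      then have "u * x * y = (m * n) * (u * a * c)" by (simp add: algebra_simps)
      then show ?thesis unfolding residue_form_def by (metis dvd_triv_left top_coeff_dvd)
    qed
    show "((*) n) ` residues m \<inter> ((*) m) ` residues n = {0}"
    proof -
      have "x = 0" if "n * x = m * y" "x \<in> residues m" for x y
      proof -
        have "m dvd n * x" using that(1) by simp
        then have "m dvd x" using unit_mod_dvd_cancel[OF cop] by blast
        then show "x = 0" using that(2) dvd_smaller_degree by (auto simp: residues_def)
      qed
      note 0 = this
      have "0 \<in> residues m" "0 \<in> residues n" using m n by (auto simp: residues_def)
      then have "n * 0 \<in> ((*) n) ` residues m" "m * 0 \<in> ((*) m) ` residues n" by blast+
      moreover have "x \<in> {0}" if x: "x \<in> ((*) n) ` residues m \<inter> ((*) m) ` residues n" for x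
      proof -
        obtain a c where ac: "x = n * a" "x = m * c" "a \<in> residues m" using x by blast
        then have "n * a = m * c" by simp
        then have "a = 0" using 0 ac(3) by blast
        then show ?thesis using ac(1) by simp
      qed
      ultimately show ?thesis by auto
    qed
  qed
  moreover have "{x + y | x y. x \<in> ((*) n) ` residues m \<and> y \<in> ((*) m) ` residues n} = residues (m * n)" (is "?L = ?R")
  proof
    have "n * x \<in> residues (m * n)" "m * y \<in> residues (m * n)" if "x \<in> residues m" "y \<in> residues n" for x y
      using degree_mult_residue[of n x m] degree_mult_residue[of m y n] that m n by (auto simp: mult.commute)
    then show "?L \<subseteq> ?R" using poly_space.subspace_add[OF subspace_residues[OF mn]] by blast
    show "?R \<subseteq> ?L"
    proof
      fix x assume x: "x \<in> ?R"
      obtain e f where ef: "n * e - 1 = m * f" using cop by (auto simp: unit_mod_def)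
      \<comment> \<open>The Bezout identity writes \<open>x\<close> as
        \<open>x * (n * e) - x * (m * f)\<close>. Both cofactors are reduced, and the error is 0
        because it is divisible by \<open>m * n\<close> and of smaller degree.\<close>
      define a where "a = (x * e) mod m"
      define c where "c = (- x * f) mod n"
      have mem: "a \<in> residues m" "c \<in> residues n" using m n by (simp_all only: a_def c_def mod_in_residues)
      have "m dvd x * e - a" "n dvd - x * f - c" by (simp_all only: a_def c_def dvd_minus_mod)
      then obtain k l where kl: "a = x * e - m * k" "c = - x * f - n * l" by (metis add_diff_cancel_left' diff_add_cancel dvdE)
      have "x = x * (n * e) - x * (m * f)" using ef by (simp flip: right_diff_distrib) (metis add_diff_cancel_left' diff_diff_eq2 mult.right_neutral)
      then have "x - (n * a + m * c) = m * n * (k + l)" by (simp add: kl algebra_simps)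
      moreover have "x - (n * a + m * c) \<in> residues (m * n)"
        using x mem degree_mult_residue[of n a m] degree_mult_residue[of m c n] m n subspace_residues[OF mn]
        by (intro poly_space.subspace_diff poly_space.subspace_add) (auto simp: mult.commute)
      ultimately have "x - (n * a + m * c) = 0" using dvd_smaller_degree by (metis dvd_triv_left mem_Collect_eq residues_def)
      then have "x = n * a + m * c" by simp
      then show "x \<in> ?L" using mem by blast
    qed
  qed
  ultimately show ?thesis using residue_sig_iff[OF P mn] by simp
qed

text \<open>With \<open>n\<close> in the coefficient the multiples of \<open>m\<close> lie in the
  radical, and by division with remainder the rest is the form on \<open>K[X]/(m)\<close>. For
  \<open>n = p ^ (k - 1)\<close> this reduces a form modulo \<open>p ^ k\<close> to the residue
  field.\<close>

lemma residue_sig_mult_modulus: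
  assumes P: "field_ordering P" and m: "nonconst_monic m" and n: "lead_coeff n = 1"
  shows "residue_sig P (m * n) (n * u) = residue_sig P m u"
proof (cases "degree n = 0")
  case True
  then obtain c where "n = [:c:]" by (rule degree_eq_zeroE)
  then have "n = 1" using n by simp
  then show ?thesis by simp
next
  case False
  then have n': "nonconst_monic n" using n by simp
  interpret sym_bilinear smult "residue_form (m * n) (n * u)" by (rule sym_bilinear_residue_form)
  have mn: "0 < degree (m * n)" using m n' by (subst degree_mult_eq) auto
  have form: "residue_form (m * n) (n * u) x y = residue_form m u x y" for x y
    using top_coeff_mult_modulus[OF m n, of "u * x * y"] by (simp add: residue_form_def mult.assoc)
  have "has_sig P {x + y | x y. x \<in> residues m \<and> y \<in> ((*) m) ` residues n} (residue_sig P m u + 0)"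
  proof (rule has_sig_orthogonal_sum)
    have "residue_form (m * n) (n * u) = residue_form m u" using form by blast
    then show "has_sig P (residues m) (residue_sig P m u)" using residue_sig_iff[OF P, of m u] m by simp
    show "has_sig P (((*) m) ` residues n) 0"
    proof (rule has_sig_zero_form[OF sym_bilinear_residue_form _ order_trans[OF _ residues_subset_span[of "m * n"]]])
      show "poly_space.subspace (((*) m) ` residues n)"
        using subspace_residues[of n] n'
        by (auto simp: poly_space.subspace_def image_iff simp flip: distrib_left mult_smult_right) 
      show "((*) m) ` residues n \<subseteq> residues (m * n)"
        using degree_mult_residue[of m _ n] m n' by (auto simp: mult.commute)
    qed (auto simp: form residue_form_def mult.left_commute intro!: top_coeff_dvd)
    show "residue_form (m * n) (n * u) x y = 0" if "x \<in> residues m" "y \<in> ((*) m) ` residues n" for x y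
      using that by (auto simp: form residue_form_def mult.left_commute intro!: top_coeff_dvd)
    show "residues m \<inter> ((*) m) ` residues n = {0}"
    proof (intro equalityI subsetI)
      fix x assume "x \<in> residues m \<inter> ((*) m) ` residues n"
      then show "x \<in> {0}" using dvd_smaller_degree[of m x] by (auto simp: residues_def)
    next
      fix x :: "'a poly" assume "x \<in> {0}"
      then have "x \<in> residues m" "x = m * 0" "0 \<in> residues n" using m n' by (auto simp: residues_def)
      then show "x \<in> residues m \<inter> ((*) m) ` residues n" by blast
    qed
  qed
  moreover have "{x + y | x y. x \<in> residues m \<and> y \<in> ((*) m) ` residues n} = residues (m * n)" (is "?L = ?R")
  proof
    have "m * y \<in> residues (m * n)" if "y \<in> residues n" for y
      using degree_mult_residue[of m y n] that m n' by (auto simp: mult.commute)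
    moreover have "residues m \<subseteq> residues (m * n)" using m n' by (subst residues_def, subst residues_def, subst degree_mult_eq) auto
    ultimately show "?L \<subseteq> ?R" using poly_space.subspace_add[OF subspace_residues[OF mn]] by blast
    show "?R \<subseteq> ?L"
    proof
      fix x assume x: "x \<in> ?R"
      have deg: "degree (m * n) = degree m + degree n" using m n' by (subst degree_mult_eq) auto
      have "x div m \<in> residues n"
      proof (cases "x div m = 0")
        case False
        have "m * (x div m) = x - x mod m" by (simp add: minus_mod_eq_mult_div)
        then have "degree (m * (x div m)) < degree (m * n)"
          using x deg degree_mod_less_pos[of m x] m by (simp add: residues_def degree_diff_less)
        then show ?thesis using False m deg by (subst (asm) degree_mult_eq) (auto simp: residues_def)
      qed (use n' in \<open>simp add: residues_def\<close>)
      moreover have "x mod m \<in> residues m" using m mod_in_residues by blast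
      moreover have "x = x mod m + m * (x div m)" by simp
      ultimately show "x \<in> ?L" by blast
    qed
  qed
  ultimately show ?thesis using residue_sig_iff[OF P mn] by simp
qed

lemma top_coeff_linear: "top_coeff [:- a, 1:] f = poly f a"
proof -
  have "f = [:- a, 1:] * synthetic_div f a + [:poly f a:]"
    using synthetic_div_correct'[of a f] by simp
  then have "top_coeff [:- a, 1:] f = top_coeff [:- a, 1:] [:poly f a:]"
    by (intro top_coeff_cong) (metis add_diff_cancel_right' dvd_triv_left)
  then show ?thesis by (simp add: top_coeff_def mod_poly_less)
qed

lemma residue_sig_linear:
  assumes P: "field_ordering P"
  shows "residue_sig P [:- a, 1:] u = sgn_in P (poly u a)"
proof -
  interpret sym_bilinear smult "residue_form [:-a, 1:] u" by (rule sym_bilinear_residue_form)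
  have "orthobasis (residues [:-a, 1:]) {1}"
    by (auto simp: orthobasis_def poly_space.span_singleton residues_def image_iff)
      (metis degree_eq_zeroE mult.right_neutral pCons_one smult_0_right smult_pCons)
  then have "has_sig P (residues [:-a, 1:]) (sgn_in P (poly u a))"
    unfolding has_sig_def by (intro exI[of _ "{1}"]) (simp add: residue_form_def top_coeff_linear)
  then show ?thesis using residue_sig_iff[OF P, of "[:-a, 1:]" u] by simp
qed


section \<open>Cyclic decompositions\<close>

lemma has_irreducible_monic_factor:
  fixes m :: "'k::field poly"
  assumes "0 < degree m"
  obtains p where "irreducible p" "lead_coeff p = 1" "p dvd m"
proof -
  have "\<exists>p. p dvd m \<and> 0 < degree p \<and> (\<forall>q. q dvd m \<and> 0 < degree q \<longrightarrow> degree p \<le> degree q)"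
    using ex_has_least_nat[of "\<lambda>q. q dvd m \<and> 0 < degree q" m degree] assms by auto
  then obtain p where p: "p dvd m" "0 < degree p" "\<And>q. q dvd m \<Longrightarrow> 0 < degree q \<Longrightarrow> degree p \<le> degree q"
    by blast
  define p' where "p' = smult (inverse (lead_coeff p)) p"
  have nz: "lead_coeff p \<noteq> 0" using p(2) by auto
  have deg: "degree p' = degree p" using nz by (simp add: p'_def)
  have m0: "m \<noteq> 0" using assms by auto
  have p': "lead_coeff p' = 1" "p' dvd m" using nz p(1) by (auto simp: p'_def smult_dvd_iff)
  moreover have "irreducible p'"
  proof (rule Factorial_Ring.irreducibleI)
    show "p' \<noteq> 0" using deg p(2) by auto
    then show "\<not> is_unit p'" using deg p(2) by (simp add: is_unit_iff_degree)
    fix a b assume ab: "p' = a * b"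
    have nz: "a \<noteq> 0" "b \<noteq> 0" using ab \<open>p' \<noteq> 0\<close> by auto
    show "is_unit a \<or> is_unit b"
    proof (rule ccontr)
      assume "\<not> ?thesis"
      then have "0 < degree a" "0 < degree b" using nz by (auto simp: is_unit_iff_degree)
      moreover have "a dvd m" using p'(2) ab dvd_trans by (metis dvd_triv_left)
      ultimately show False using p(3)[of a] deg ab nz by (simp add: degree_mult_eq)
    qed
  qed
  ultimately show ?thesis using that by blast
qed

lemma prime_power_factorization:
  fixes m p :: "'k::field poly"
  assumes "m \<noteq> 0" "p dvd m" "irreducible p"
  obtains k c where "0 < k" "m = p ^ k * c" "\<not> p dvd c"
proof -
  have p0: "p \<noteq> 0" "\<not> is_unit p" using assms(3) by (auto simp: Factorial_Ring.irreducible_def)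
  then have dp: "0 < degree p" using is_unit_iff_degree by blast
  have "k \<le> degree m" if "p ^ k dvd m" for k
  proof -
    have "k * 1 \<le> k * degree p" using dp by (intro mult_le_mono2) simp
    also have "\<dots> = degree (p ^ k)" by (simp add: degree_power_eq p0)
    also have "\<dots> \<le> degree m" using that assms(1) by (rule dvd_imp_degree_le)
    finally show ?thesis by simp
  qed
  then have "\<exists>k. p ^ k dvd m \<and> (\<forall>l. p ^ l dvd m \<longrightarrow> l \<le> k)"
    using ex_has_greatest_nat[of "\<lambda>k. p ^ k dvd m" 0 "\<lambda>k. k" "Suc (degree m)"] by (auto simp: less_Suc_eq_le)
  then obtain k where k: "p ^ k dvd m" "\<And>l. p ^ l dvd m \<Longrightarrow> l \<le> k" by blast
  obtain c where c: "m = p ^ k * c" using k(1) by blast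
  have "\<not> p dvd c"
  proof
    assume "p dvd c"
    then have "p ^ Suc k dvd m" unfolding c by (auto simp: mult_dvd_mono)
    then show False using k(2) by fastforce
  qed
  moreover have "0 < k" using k(2)[of 1] assms(2) by simp
  ultimately show ?thesis using that c by blast
qed

section \<open>Spaces with a selfadjoint operator as modules over \<open>K[X]\<close>\<close>

locale selfadjoint_form = sym_bilinear s b
  for s :: "'k::field_char_0 \<Rightarrow> 'a::ab_group_add \<Rightarrow> 'a" and b +
  fixes T :: "'a \<Rightarrow> 'a"
  assumes T_linear: "Vector_Spaces.linear s s T"
    and T_selfadjoint: "b (T x) y = b x (T y)"
begin

lemma T_add: "T (x + y) = T x + T y" and T_scale: "T (s c x) = s c (T x)"
  using T_linear by (auto simp: Vector_Spaces.linear_iff)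

lemma T_0 [simp]: "T 0 = 0"
  using T_scale[of 0 0] by simp

text \<open>The value of \<open>f\<close> at the operator \<open>T\<close>, applied to
  \<open>x\<close>, by Horner's scheme: the module structure in which \<open>X\<close> acts as
  \<open>T\<close>.\<close>

definition pact :: "'k poly \<Rightarrow> 'a \<Rightarrow> 'a" where
  "pact f x = foldr (\<lambda>c y. s c x + T y) (coeffs f) 0"

lemma pact_0 [simp]: "pact 0 x = 0"
  by (simp add: pact_def)

lemma pact_pCons: "pact (pCons c f) x = s c x + T (pact f x)"
  by (cases "c = 0 \<and> f = 0") (auto simp: pact_def cCons_def)

lemma pact_zero [simp]: "pact f 0 = 0"
  by (induction f) (auto simp: pact_pCons)

lemma pact_const: "pact [:c:] x = s c x"
  by (simp add: pact_pCons)

lemma pact_1 [simp]: "pact 1 x = x"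
  unfolding one_pCons by (simp add: pact_pCons)

lemma pact_X: "pact [:0, 1:] x = T x"
  by (simp add: pact_pCons)

lemma pact_add: "pact (f + g) x = pact f x + pact g x"
proof (induction f arbitrary: g)
  case (pCons a f)
  then show ?case by (cases g) (auto simp: pact_pCons T_add scale_left_distrib)
qed simp

lemma pact_smult: "pact (smult c f) x = s c (pact f x)"
  by (induction f) (auto simp: pact_pCons T_scale scale_right_distrib)

lemma pact_minus: "pact (- f) x = - pact f x"
  using pact_add[of "-f" f x] by (simp add: eq_neg_iff_add_eq_0)

lemma pact_diff: "pact (f - g) x = pact f x - pact g x"
  using pact_add[of f "-g" x] by (simp add: pact_minus)

lemma pact_add_right: "pact f (x + y) = pact f x + pact f y"
  by (induction f) (auto simp: pact_pCons T_add scale_right_distrib)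

lemma pact_scale_right: "pact f (s c x) = s c (pact f x)"
  by (induction f) (auto simp: pact_pCons T_scale scale_right_distrib mult.commute)

lemma pact_minus_right: "pact f (- x) = - pact f x"
  using pact_add_right[of f "-x" x] by (simp add: eq_neg_iff_add_eq_0)

lemma pact_diff_right: "pact f (x - y) = pact f x - pact f y"
  using pact_add_right[of f x "-y"] by (simp add: pact_minus_right)

lemma pact_T: "pact f (T x) = T (pact f x)"
  by (induction f) (auto simp: pact_pCons T_add T_scale)

lemma pact_mult: "pact (f * g) x = pact f (pact g x)"
  by (induction f) (auto simp: pact_pCons pact_add pact_smult)

lemma pact_commute: "pact f (pact g x) = pact g (pact f x)"
  by (metis pact_mult mult.commute)

lemma pact_selfadjoint: "b (pact f x) y = b x (pact f y)"
  by (induction f arbitrary: y) (auto simp: pact_pCons b_add_left b_add_right b_scale_left b_scale_right T_selfadjoint pact_T)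

lemma pact_sum: "pact (sum f A) x = (\<Sum>i\<in>A. pact (f i) x)"
  by (induction A rule: infinite_finite_induct) (auto simp: pact_add)

lemma sym_bilinear_pact: "sym_bilinear s (\<lambda>x y. b x (pact f y))"
proof
  show "b x (pact f y) = b y (pact f x)" for x y using b_commute pact_selfadjoint by metis
qed (simp_all add: b_add_left b_scale_left)

definition tsub :: "'a set \<Rightarrow> bool" where
  "tsub W \<longleftrightarrow> subspace W \<and> (\<forall>x\<in>W. T x \<in> W)"

lemma tsub_subspace: "tsub W \<Longrightarrow> subspace W"
  by (simp add: tsub_def)

lemma tsub_0: "tsub W \<Longrightarrow> 0 \<in> W"
  by (simp add: tsub_def subspace_0)

lemma tsub_add: "tsub W \<Longrightarrow> x \<in> W \<Longrightarrow> y \<in> W \<Longrightarrow> x + y \<in> W"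
  by (simp add: tsub_def subspace_add)

lemma tsub_diff: "tsub W \<Longrightarrow> x \<in> W \<Longrightarrow> y \<in> W \<Longrightarrow> x - y \<in> W"
  by (simp add: tsub_def subspace_diff)

lemma tsub_pact: "tsub W \<Longrightarrow> x \<in> W \<Longrightarrow> pact f x \<in> W"
  by (induction f) (auto simp: pact_pCons tsub_def subspace_0 subspace_add subspace_scale)

definition cyc :: "'a \<Rightarrow> 'a set" where
  "cyc w = range (\<lambda>f. pact f w)"

lemma cyc_self: "w \<in> cyc w"
  unfolding cyc_def by (rule image_eqI[of _ _ 1]) auto

lemma tsub_cyc: "tsub (cyc w)"
  unfolding tsub_def subspace_def cyc_def
proof (intro conjI ballI allI)
  show "0 \<in> range (\<lambda>f. pact f w)" by (rule image_eqI[of _ _ 0]) auto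
  show "x + y \<in> range (\<lambda>f. pact f w)" if "x \<in> range (\<lambda>f. pact f w)" "y \<in> range (\<lambda>f. pact f w)" for x y
    using that by (auto simp flip: pact_add)
  show "s c x \<in> range (\<lambda>f. pact f w)" if "x \<in> range (\<lambda>f. pact f w)" for c x
    using that by (auto simp flip: pact_smult)
  show "T x \<in> range (\<lambda>f. pact f w)" if "x \<in> range (\<lambda>f. pact f w)" for x
    using that by (auto simp flip: pact_X pact_mult)
qed

lemma cyc_subset: "tsub W \<Longrightarrow> w \<in> W \<Longrightarrow> cyc w \<subseteq> W"
  by (auto simp: cyc_def tsub_pact)

definition osum :: "'a set \<Rightarrow> 'a set \<Rightarrow> 'a set" where
  "osum U W = {u + w | u w. u \<in> U \<and> w \<in> W}"

lemma tsub_osum: assumes "tsub U" "tsub W" shows "tsub (osum U W)"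
  using assms subspace_sums[of U W] T_add unfolding tsub_def osum_def by blast

lemma osum_subset: "tsub Z \<Longrightarrow> U \<subseteq> Z \<Longrightarrow> W \<subseteq> Z \<Longrightarrow> osum U W \<subseteq> Z"
  unfolding osum_def using tsub_add by blast

lemma osum_upper: assumes "tsub U" "tsub W" shows "U \<subseteq> osum U W" "W \<subseteq> osum U W"
proof -
  show "U \<subseteq> osum U W" using tsub_0[OF assms(2)] unfolding osum_def by force
  show "W \<subseteq> osum U W" using tsub_0[OF assms(1)] unfolding osum_def by force
qed

lemma osum_left_commute: "osum U (osum W Z) \<subseteq> osum W (osum U Z)"
proof
  fix x assume "x \<in> osum U (osum W Z)"
  then obtain u w z where "x = w + (u + z)" "u \<in> U" "w \<in> W" "z \<in> Z"
    by (auto simp: osum_def add.left_commute)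
  then show "x \<in> osum W (osum U Z)" unfolding osum_def by blast
qed

definition orth :: "'a set \<Rightarrow> 'a set \<Rightarrow> bool" where
  "orth U W \<longleftrightarrow> (\<forall>x\<in>U. \<forall>y\<in>W. b x y = 0)"

lemma orth_sym: "orth U W \<Longrightarrow> orth W U"
  using b_commute unfolding orth_def by metis

lemma orth_osum: "orth U W \<Longrightarrow> orth U Z \<Longrightarrow> orth U (osum W Z)"
  by (auto simp: orth_def osum_def b_add_right)

lemma orth_mono: "orth U W \<Longrightarrow> U' \<subseteq> U \<Longrightarrow> W' \<subseteq> W \<Longrightarrow> orth U' W'"
  by (auto simp: orth_def)

text \<open>The map \<open>f \<mapsto> pact f w\<close> is to identify \<open>K[X]/(m)\<close>, with
  the form of coefficient \<open>u\<close>, with \<open>cyc w\<close>. As \<open>u\<close> is a unit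
  the form is nondegenerate, which makes \<open>m\<close> a generator of the annihilator of
  \<open>w\<close>; only one inclusion is demanded here.\<close>

definition cyclic :: "'k poly \<Rightarrow> 'k poly \<Rightarrow> 'a \<Rightarrow> bool" where
  "cyclic m u w \<longleftrightarrow> nonconst_monic m \<and> unit_mod m u \<and>
     (\<forall>f. b w (pact f w) = top_coeff m (u * f)) \<and> (\<forall>f. m dvd f \<longrightarrow> pact f w = 0)"

lemma cyclic_form: "cyclic m u w \<Longrightarrow> b (pact f w) (pact g w) = top_coeff m (u * (f * g))"
  by (simp add: cyclic_def pact_selfadjoint flip: pact_mult)

lemma cyclic_cong: "cyclic m u w \<Longrightarrow> m dvd f - g \<Longrightarrow> pact f w = pact g w"
  unfolding cyclic_def by (metis eq_iff_diff_eq_0 pact_diff)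

lemma cyclic_zero:
  assumes c: "cyclic m u w" and 0: "\<And>g. b (pact f w) (pact g w) = 0"
  shows "m dvd f"
proof -
  have "top_coeff m ((u * f) * g) = 0" for g using 0[of g] cyclic_form[OF c, of f g] by (simp add: mult.assoc)
  then have "m dvd u * f" using c by (intro top_coeff_nondegenerate) (auto simp: cyclic_def)
  then show ?thesis using c unit_mod_dvd_cancel by (auto simp: cyclic_def)
qed

text \<open>The generators of the summands are forgotten: moves on the multiset change them, while
  the subspace \<open>W\<close> stays fixed.\<close>

inductive frame :: "'a set \<Rightarrow> ('k poly \<times> 'k poly) multiset \<Rightarrow> bool" where
  frame_empty: "frame {0} {#}"
| frame_add: "frame W M \<Longrightarrow> cyclic m u w \<Longrightarrow> orth (cyc w) W \<Longrightarrow> frame (osum (cyc w) W) (add_mset (m, u) M)"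

lemma frame_tsub: "frame W M \<Longrightarrow> tsub W"
  by (induction rule: frame.induct) (auto simp: tsub_osum tsub_cyc, auto simp: tsub_def subspace_def)

lemma frame_nondegenerate:
  assumes "frame W M" "x \<in> W" "\<And>y. y \<in> W \<Longrightarrow> b x y = 0"
  shows "x = 0"
  using assms
proof (induction arbitrary: x rule: frame.induct)
  case (frame_add W M m u w)
  have W: "tsub W" using frame_add frame_tsub by blast
  obtain f y where fy: "x = pact f w + y" "y \<in> W" using frame_add.prems by (auto simp: osum_def cyc_def)
  have wy: "b (pact g w) z = 0" if "z \<in> W" for g z using frame_add(3) that by (auto simp: orth_def cyc_def)
  have 1: "b (pact f w) (pact g w) = 0" for g
  proof -
    have "b x (pact g w) = 0" using frame_add.prems(2)[of "pact g w"] osum_upper(1)[OF tsub_cyc[of w] W] by (auto simp: cyc_def)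
    moreover have "b y (pact g w) = 0" using wy[OF fy(2), of g] b_commute by metis
    ultimately show ?thesis using fy(1) by (simp add: b_add_left)
  qed
  then have "m dvd f" by (rule cyclic_zero[OF frame_add(2)])
  then have "pact f w = 0" using frame_add(2) by (auto simp: cyclic_def)
  then have x: "x = y" using fy by simp
  then show ?case using frame_add.IH[of y] fy(2) frame_add.prems(2) osum_upper(2)[OF tsub_cyc[of w] W] by auto
qed simp

text \<open>The summands of an orthogonal sum can be reordered, so any entry of the multiset may be
  taken as the last one added.\<close>

lemma frame_extract:
  assumes "frame W M" "(m, u) \<in># M"
  shows "\<exists>w W'. cyclic m u w \<and> orth (cyc w) W' \<and> W = osum (cyc w) W' \<and> frame W' (M - {#(m, u)#})"
  using assms
proof (induction rule: frame.induct)
  case (frame_add W M m1 u1 w1)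
  show ?case
  proof (cases "(m, u) = (m1, u1)")
    case True
    then show ?thesis using frame_add by auto
  next
    case False
    then have mem: "(m, u) \<in># M" using frame_add.prems by auto
    then obtain w W' where w: "cyclic m u w" "orth (cyc w) W'" "W = osum (cyc w) W'" "frame W' (M - {#(m, u)#})"
      using frame_add.IH by blast
    have ts: "tsub (cyc w)" "tsub (cyc w1)" "tsub W'" using tsub_cyc frame_tsub[OF w(4)] by auto
    have sub: "cyc w \<subseteq> W" "W' \<subseteq> W" using w(3) osum_upper ts by auto
    have "orth (cyc w1) W'" using frame_add(3) sub orth_mono by blast
    then have "frame (osum (cyc w1) W') (add_mset (m1, u1) (M - {#(m, u)#}))"
      using frame.frame_add[OF w(4) frame_add(2)] by blast
    moreover have "add_mset (m1, u1) M - {#(m, u)#} = add_mset (m1, u1) (M - {#(m, u)#})"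
      using False mem by auto
    moreover have "orth (cyc w) (osum (cyc w1) W')"
      using orth_osum[OF orth_sym[OF orth_mono[OF frame_add(3) order_refl sub(1)]] w(2)] .
    moreover have "osum (cyc w1) W = osum (cyc w) (osum (cyc w1) W')" unfolding w(3)
      by (intro equalityI osum_left_commute)
    ultimately have "cyclic m u w \<and> orth (cyc w) (osum (cyc w1) W') \<and>
        osum (cyc w1) W = osum (cyc w) (osum (cyc w1) W') \<and>
        frame (osum (cyc w1) W') (add_mset (m1, u1) M - {#(m, u)#})" using w(1) by simp
    then show ?thesis by blast
  qed
qed simp

lemma frame_addE:
  assumes "frame W (add_mset (m, u) M)"
  obtains w W' where "cyclic m u w" "orth (cyc w) W'" "W = osum (cyc w) W'" "frame W' M"
  using frame_extract[OF assms, of m u] by auto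

text \<open>Each summand is an isometric image of a residue ring whose coefficient is multiplied by
  \<open>f\<close>. Here signatures of forms on the space turn into signatures of residue
  rings.\<close>

lemma frame_signature:
  assumes P: "field_ordering P" and "frame W M"
  shows "sym_bilinear.has_sig s (\<lambda>x y. b x (pact f y)) P W (\<Sum>(m, u)\<in>#M. residue_sig P m (f * u))"
proof -
  interpret F: sym_bilinear s "\<lambda>x y. b x (pact f y)" by (rule sym_bilinear_pact)
  show ?thesis using assms(2)
  proof (induction rule: frame.induct)
    case frame_empty
    show ?case using F.has_sig_zero by simp
  next
    case (frame_add W M m u w)
    have W: "tsub W" using frame_add frame_tsub by blast
    have m: "nonconst_monic m" using frame_add(2) by (simp add: cyclic_def)
    have wy: "b (pact g w) z = 0" if "z \<in> W" for g z using frame_add(3) that by (auto simp: orth_def cyc_def)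
    have inj: "inj_on (\<lambda>x. pact x w) (residues m)"
    proof (rule inj_onI)
      fix x y assume xy: "x \<in> residues m" "y \<in> residues m" "pact x w = pact y w"
      then have "pact (x - y) w = 0" by (simp add: pact_diff)
      then have "m dvd x - y" by (intro cyclic_zero[OF frame_add(2)]) simp
      moreover have "degree (x - y) < degree m" using xy by (simp add: residues_def degree_diff_less)
      ultimately have "x - y = 0" by (rule dvd_smaller_degree)
      then show "x = y" by simp
    qed
    have img: "(\<lambda>x. pact x w) ` residues m = cyc w"
    proof (intro equalityI subsetI)
      fix y assume "y \<in> cyc w"
      then obtain g where g: "y = pact g w" by (auto simp: cyc_def)
      have "pact g w = pact (g mod m) w" by (rule cyclic_cong[OF frame_add(2)]) simp
      moreover have "g mod m \<in> residues m" using mod_in_residues m by blast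
      ultimately show "y \<in> (\<lambda>x. pact x w) ` residues m" unfolding g by (rule image_eqI)
    qed (auto simp: cyc_def)
    have "F.has_sig P ((\<lambda>x. pact x w) ` residues m) (sgn_in P 1 * residue_sig P m (f * u))"
    proof (rule has_sig_image[OF sym_bilinear_residue_form sym_bilinear_pact P _ inj])
      show "Vector_Spaces.linear smult s (\<lambda>x. pact x w)"
        unfolding Vector_Spaces.linear_iff using poly_space.vector_space_axioms vector_space_axioms
        by (auto simp: pact_add pact_smult)
      show "b (pact x w) (pact f (pact y w)) = 1 * residue_form m (f * u) x y" for x y
        using cyclic_form[OF frame_add(2), of x "f * y"]
        by (simp add: residue_form_def pact_mult mult.commute mult.left_commute)
      show "sym_bilinear.has_sig smult (residue_form m (f * u)) P (residues m) (residue_sig P m (f * u))"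
        using residue_sig_iff[OF P] m by blast
    qed
    then have "F.has_sig P (cyc w) (residue_sig P m (f * u))"
      using field_ordering_1[OF P] unfolding img by (simp add: sgn_in_def)
    moreover have "cyc w \<inter> W = {0}"
    proof -
      have "x = 0" if x: "x \<in> cyc w" "x \<in> W" for x
      proof -
        obtain g where g: "x = pact g w" using x(1) by (auto simp: cyc_def)
        have "m dvd g" using wy[OF x(2)] g b_commute by (intro cyclic_zero[OF frame_add(2)]) metis
        then show ?thesis using frame_add(2) g by (auto simp: cyclic_def)
      qed
      then show ?thesis using tsub_0[OF W] tsub_0[OF tsub_cyc] by blast
    qed
    moreover have "b x (pact f y) = 0" if "x \<in> cyc w" "y \<in> W" for x y
      using frame_add(3) that tsub_pact[OF W] by (auto simp: orth_def)
    ultimately show ?case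
      using F.has_sig_orthogonal_sum[OF _ frame_add.IH, of "cyc w" "residue_sig P m (f * u)"]
      by (simp add: osum_def)
  qed
qed

text \<open>The generator \<open>w\<close> is replaced by \<open>pact v w\<close>, which generates
  the same submodule because \<open>v\<close> is a unit.\<close>

lemma cyclic_scale:
  assumes c: "cyclic m u w" and v: "unit_mod m v" and u': "m dvd u' - u * v\<^sup>2"
  shows "cyclic m u' (pact v w)" "cyc (pact v w) = cyc w"
proof -
  have eq: "b (pact v w) (pact f (pact v w)) = top_coeff m (u' * f)" for f
  proof -
    have "b (pact v w) (pact f (pact v w)) = top_coeff m (u * (v * (f * v)))"
      using cyclic_form[OF c, of v "f * v"] by (simp add: pact_mult)
    also have "\<dots> = top_coeff m (u' * f)"
    proof (rule top_coeff_cong)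
      have "m dvd - ((u' - u * v\<^sup>2) * f)" using u' by simp
      then show "m dvd u * (v * (f * v)) - u' * f" by (simp add: algebra_simps power2_eq_square)
    qed
    finally show ?thesis .
  qed
  have "unit_mod m u'"
    using unit_mod_cong[of m "u * v\<^sup>2" u'] c v u'
    by (simp add: cyclic_def unit_mod_mult unit_mod_power dvd_diff_commute)
  then show "cyclic m u' (pact v w)"
    using c eq by (auto simp: cyclic_def simp flip: pact_mult)
  show "cyc (pact v w) = cyc w"
  proof
    show "cyc (pact v w) \<subseteq> cyc w"
      by (intro cyc_subset tsub_cyc tsub_pact cyc_self)
    obtain e where "m dvd v * e - 1" using v by (auto simp: unit_mod_def)
    then have "pact (v * e) w = pact 1 w" by (rule cyclic_cong[OF c])
    then have "w = pact e (pact v w)" by (simp add: pact_mult pact_commute[of e])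
    then have "w \<in> cyc (pact v w)" unfolding cyc_def by blast
    then show "cyc w \<subseteq> cyc (pact v w)" by (intro cyc_subset tsub_cyc)
  qed
qed

text \<open>The Witt relation for the binary form with entries \<open>u\<close> and
  \<open>v\<close>: \<open>x\<close> represents \<open>u + v\<close>, and \<open>y\<close> is the
  standard vector orthogonal to it. The change of basis is invertible because its determinant is the
  unit \<open>- (u + v)\<close>.\<close>

lemma cyclic_pair:
  assumes w1: "cyclic m u w1" and w2: "cyclic m v w2" and o: "orth (cyc w1) (cyc w2)"
    and uv: "unit_mod m (u + v)"
  defines "x \<equiv> w1 + w2" and "y \<equiv> pact v w1 - pact u w2"
  shows "cyclic m (u + v) x" "cyclic m (u * v * (u + v)) y" "orth (cyc x) (cyc y)"
    "w1 \<in> osum (cyc x) (cyc y)" "w2 \<in> osum (cyc x) (cyc y)"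
proof -
  have o12: "b (pact f w1) (pact g w2) = 0" for f g using o by (auto simp: orth_def cyc_def)
  then have o21: "b (pact f w2) (pact g w1) = 0" for f g using b_commute by metis
  have xx: "b (pact f x) (pact g x) = top_coeff m ((u + v) * (f * g))" for f g
    using cyclic_form[OF w1] cyclic_form[OF w2]
    by (simp add: x_def pact_add_right b_add_left b_add_right o12 o21 distrib_right top_coeff_add)
  have y_pact: "pact f y = pact (f * v) w1 - pact (f * u) w2" for f
    by (simp add: y_def pact_diff_right pact_mult)
  have yy: "b (pact f y) (pact g y) = top_coeff m ((u * v * (u + v)) * (f * g))" for f g
    by (simp add: y_pact b_diff_left b_diff_right o12 o21 cyclic_form[OF w1] cyclic_form[OF w2] flip: top_coeff_add)
      (simp add: algebra_simps)
  have xy: "b (pact f x) (pact g y) = 0" for f g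
  proof -
    have "b (pact f x) (pact g y) = top_coeff m (u * (f * (g * v))) - top_coeff m (v * (f * (g * u)))"
      by (simp add: y_pact x_def pact_add_right b_add_left b_diff_right o12 o21 cyclic_form[OF w1] cyclic_form[OF w2])
    then show ?thesis by (simp add: mult.commute mult.left_commute)
  qed
  have m: "nonconst_monic m" "unit_mod m u" "unit_mod m v" using w1 w2 by (auto simp: cyclic_def)
  have kill: "pact f w1 = 0" "pact f w2 = 0" if "m dvd f" for f using w1 w2 that by (auto simp: cyclic_def)
  have killxy: "pact f x = 0" "pact f y = 0" if "m dvd f" for f
    using kill[OF dvd_mult2[OF that]] kill[OF that] unfolding y_pact by (simp_all add: x_def pact_add_right)
  show "cyclic m (u + v) x"
    using m uv xx[of 1] killxy by (simp add: cyclic_def)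
  show "cyclic m (u * v * (u + v)) y"
    using m uv yy[of 1] killxy by (simp add: cyclic_def unit_mod_mult)
  show "orth (cyc x) (cyc y)" using xy by (auto simp: orth_def cyc_def)
  obtain e where e: "m dvd (u + v) * e - 1" using uv by (auto simp: unit_mod_def)
  have "pact u x + y = pact (u + v) w1" by (simp add: x_def y_def pact_add_right pact_add)
  then have "pact e (pact u x + y) = pact ((u + v) * e) w1" by (simp add: pact_mult mult.commute[of _ e])
  also have "\<dots> = w1" using cyclic_cong[OF w1 e] by simp
  finally have w1': "w1 = pact (e * u) x + pact e y" by (simp add: pact_add_right pact_mult)
  then show w1_in: "w1 \<in> osum (cyc x) (cyc y)" unfolding osum_def cyc_def by blast
  have "w2 = x - w1" by (simp add: x_def)
  moreover have "x \<in> osum (cyc x) (cyc y)" using osum_upper(1) tsub_cyc cyc_self by blast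
  ultimately show "w2 \<in> osum (cyc x) (cyc y)" using w1_in tsub_diff[OF tsub_osum] tsub_cyc by metis
qed

end


section \<open>Moves between diagonal forms\<close>

text \<open>Directed, since frames are transported from left to right; inverses of moves are derived
  where they are used. The pair move demands that the sum be a unit, so for a nonconstant modulus it
  does not apply to a pair \<open>u\<close>, \<open>- u\<close>.\<close>

inductive meq :: "('k::field poly \<times> 'k poly) multiset \<Rightarrow> ('k poly \<times> 'k poly) multiset \<Rightarrow> bool" where
  meq_refl: "meq M M"
| meq_scale: "unit_mod m v \<Longrightarrow> m dvd u' - u * v\<^sup>2 \<Longrightarrow> meq (add_mset (m, u) M) (add_mset (m, u') M)"
| meq_pair: "unit_mod m (u + v) \<Longrightarrow>
    meq (add_mset (m, u) (add_mset (m, v) M)) (add_mset (m, u + v) (add_mset (m, u * v * (u + v)) M))"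
| meq_trans: "meq M N \<Longrightarrow> meq N L \<Longrightarrow> meq M L"

lemma meq_add: "meq M N \<Longrightarrow> meq (M + L) (N + L)"
  by (induction rule: meq.induct) (auto intro: meq.intros)

lemma meq_add2: assumes "meq M N" "meq M' N'" shows "meq (M + M') (N + N')"
  using meq_trans[OF meq_add[OF assms(1), of M'] meq_add[OF assms(2), of N, unfolded add.commute[of _ N]]] .

lemma meq_add_mset: "meq M N \<Longrightarrow> meq (add_mset a M) (add_mset a N)"
  using meq_add[of M N "{#a#}"] by simp

lemma meq_repeat: "meq M N \<Longrightarrow> meq (repeat_mset n M) (repeat_mset n N)"
  by (induction n) (auto intro: meq_refl meq_add2)

inductive hyperbolic_mset :: "('k::field poly \<times> 'k poly) multiset \<Rightarrow> bool" where
  hyperbolic_empty: "hyperbolic_mset {#}"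
| hyperbolic_add: "hyperbolic_mset H \<Longrightarrow> hyperbolic_mset (add_mset (m, u) (add_mset (m, - u) H))"

lemma hyperbolic_mset_plus: "hyperbolic_mset H \<Longrightarrow> hyperbolic_mset H' \<Longrightarrow> hyperbolic_mset (H + H')"
  by (induction rule: hyperbolic_mset.induct) (auto intro: hyperbolic_mset.intros)

lemma hyperbolic_mset_repeat: "hyperbolic_mset H \<Longrightarrow> hyperbolic_mset (repeat_mset n H)"
  by (induction n) (auto intro: hyperbolic_mset.intros hyperbolic_mset_plus)

text \<open>The condition to represent a torsion element of the Witt ring, in terms of
  moves.\<close>

definition weakly_hyperbolic :: "('k::field poly \<times> 'k poly) multiset \<Rightarrow> bool" where
  "weakly_hyperbolic M \<longleftrightarrow> (\<exists>n\<ge>1. \<exists>H. hyperbolic_mset H \<and> meq (repeat_mset n M) H)"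

lemma weakly_hyperbolic_empty: "weakly_hyperbolic {#}"
  unfolding weakly_hyperbolic_def by (rule exI[of _ 1]) (auto intro: meq_refl hyperbolic_empty)

lemma weakly_hyperbolic_plus:
  assumes "weakly_hyperbolic M" "weakly_hyperbolic N" shows "weakly_hyperbolic (M + N)"
proof -
  obtain n H where n: "n \<ge> 1" "hyperbolic_mset H" "meq (repeat_mset n M) H"
    using assms(1) by (auto simp: weakly_hyperbolic_def)
  obtain k J where k: "k \<ge> 1" "hyperbolic_mset J" "meq (repeat_mset k N) J"
    using assms(2) by (auto simp: weakly_hyperbolic_def)
  have "meq (repeat_mset (k * n) (M + N)) (repeat_mset k H + repeat_mset n J)"
    using meq_add2[OF meq_repeat[OF n(3), of k] meq_repeat[OF k(3), of n]]
    by (simp add: mult.commute)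
  moreover have "hyperbolic_mset (repeat_mset k H + repeat_mset n J)"
    using n k by (intro hyperbolic_mset_plus hyperbolic_mset_repeat)
  moreover have "k * n \<ge> 1" using n k by simp
  ultimately show ?thesis unfolding weakly_hyperbolic_def by blast
qed

lemma sum_residue_sig_hyperbolic:
  assumes P: "field_ordering P"
  shows "hyperbolic_mset H \<Longrightarrow> (\<And>a. a \<in># H \<Longrightarrow> 0 < degree (fst a)) \<Longrightarrow> (\<Sum>(m, u)\<in>#H. residue_sig P m (f * u)) = 0"
proof (induction rule: hyperbolic_mset.induct)
  case (hyperbolic_add H m u)
  have "0 < degree m" using hyperbolic_add.prems[of "(m, u)"] by simp
  then have "residue_sig P m (- (f * u)) = - residue_sig P m (f * u)" by (rule residue_sig_minus[OF P])
  then show ?case using hyperbolic_add by simp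
qed simp

context selfadjoint_form
begin

lemma osum_cong_sub:
  assumes "tsub A" "tsub B" "tsub A'" "tsub B'"
    and "A \<subseteq> osum A' B'" "B \<subseteq> osum A' B'" "A' \<subseteq> osum A B" "B' \<subseteq> osum A B"
  shows "osum A (osum B C) = osum A' (osum B' C)"
proof -
  have assoc: "osum X (osum Y C) = osum (osum X Y) C" for X Y
    unfolding osum_def by (auto simp: add.assoc) (metis add.assoc)+
  have "osum A B = osum A' B'"
    by (intro equalityI osum_subset tsub_osum assms)
  then show ?thesis by (simp add: assoc)
qed

lemma frame_meq: "meq M N \<Longrightarrow> frame W M \<Longrightarrow> frame W N"
proof (induction arbitrary: W rule: meq.induct)
  case (meq_scale m v u' u M)
  obtain w W' where w: "cyclic m u w" "orth (cyc w) W'" "W = osum (cyc w) W'" "frame W' M"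
    using frame_addE meq_scale.prems by blast
  show ?case using frame_add[OF w(4) cyclic_scale(1)[OF w(1) meq_scale(1,2)]] w(2,3)
      cyclic_scale(2)[OF w(1) meq_scale(1,2)] by simp
next
  case (meq_pair m u v M)
  obtain w1 W1 where w1: "cyclic m u w1" "orth (cyc w1) W1" "W = osum (cyc w1) W1" "frame W1 (add_mset (m, v) M)"
    using frame_addE meq_pair.prems by blast
  obtain w2 W2 where w2: "cyclic m v w2" "orth (cyc w2) W2" "W1 = osum (cyc w2) W2" "frame W2 M"
    using frame_addE w1(4) by blast
  have W2: "tsub W2" using w2 frame_tsub by blast
  have sub: "cyc w2 \<subseteq> W1" "W2 \<subseteq> W1" using w2(3) osum_upper[OF tsub_cyc W2] by auto
  have o12: "orth (cyc w1) (cyc w2)" "orth (cyc w1) W2" using w1(2) sub orth_mono by blast+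
  define x y where "x = w1 + w2" and "y = pact v w1 - pact u w2"
  note pair = cyclic_pair[OF w1(1) w2(1) o12(1) meq_pair(1), folded x_def y_def]
  have ts: "tsub (cyc w1)" "tsub (cyc w2)" "tsub (cyc x)" "tsub (cyc y)" using tsub_cyc by auto
  have up: "w1 \<in> osum (cyc w1) (cyc w2)" "w2 \<in> osum (cyc w1) (cyc w2)"
    using osum_upper[OF ts(1,2)] cyc_self by blast+
  have xy: "x \<in> osum (cyc w1) (cyc w2)" "y \<in> osum (cyc w1) (cyc w2)"
    unfolding x_def y_def by (intro tsub_add tsub_diff tsub_pact tsub_osum ts up)+
  have "orth W2 (osum (cyc w1) (cyc w2))" using o12(2) w2(2) orth_sym orth_osum by blast
  then have "orth (osum (cyc w1) (cyc w2)) W2" by (rule orth_sym)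
  then have oW: "orth (cyc x) W2" "orth (cyc y) W2"
    using cyc_subset[OF tsub_osum[OF ts(1,2)]] xy by (auto elim!: orth_mono)
  have W: "W = osum (cyc x) (osum (cyc y) W2)"
    unfolding w1(3) w2(3)
    by (intro osum_cong_sub ts cyc_subset tsub_osum pair(4,5) xy)
  show ?case unfolding W
    by (intro frame_add pair w2(4) oW orth_osum)
qed auto

text \<open>For a pair with units \<open>u\<close> and \<open>- u\<close> the vectors
  \<open>w1 + w2\<close> and \<open>w1 - w2\<close> generate totally isotropic submodules. They span
  the same space as \<open>w1\<close> and \<open>w2\<close> since 2 is invertible. One of them is
  added to \<open>U\<close>, the other one to \<open>U'\<close>.\<close>

lemma frame_hyperbolic:
  assumes "hyperbolic_mset H" "frame W H"
  shows "\<exists>U U'. tsub U \<and> tsub U' \<and> W = osum U U' \<and> orth U U \<and> orth U' U'"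
  using assms
proof (induction arbitrary: W rule: hyperbolic_mset.induct)
  case hyperbolic_empty
  have "W = {0}" using hyperbolic_empty by cases auto
  moreover have "tsub {0}" by (auto simp: tsub_def subspace_def)
  moreover have "osum {0} {0} = {0}" "orth {0} {0}" by (auto simp: osum_def orth_def)
  ultimately show ?case by metis
next
  case (hyperbolic_add H m u)
  obtain w1 W1 where w1: "cyclic m u w1" "orth (cyc w1) W1" "W = osum (cyc w1) W1" "frame W1 (add_mset (m, -u) H)"
    using frame_addE hyperbolic_add.prems by blast
  obtain w2 W2 where w2: "cyclic m (-u) w2" "orth (cyc w2) W2" "W1 = osum (cyc w2) W2" "frame W2 H"
    using frame_addE w1(4) by blast
  obtain U U' where U: "tsub U" "tsub U'" "W2 = osum U U'" "orth U U" "orth U' U'"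
    using hyperbolic_add.IH w2(4) by blast
  have W2: "tsub W2" using w2 frame_tsub by blast
  have sub: "cyc w2 \<subseteq> W1" "W2 \<subseteq> W1" using w2(3) osum_upper[OF tsub_cyc W2] by auto
  have o12: "orth (cyc w1) (cyc w2)" "orth (cyc w1) W2" using w1(2) sub orth_mono by blast+
  have b12: "b (pact f w1) (pact g w2) = 0" for f g
    using o12(1) by (auto simp: orth_def cyc_def)
  then have b21: "b (pact f w2) (pact g w1) = 0" for f g
    using b_commute by metis
  define x y where "x = w1 + w2" and "y = w1 - w2"
  have ts: "tsub (cyc w1)" "tsub (cyc w2)" "tsub (cyc x)" "tsub (cyc y)" using tsub_cyc by auto
  have up: "w1 \<in> osum (cyc w1) (cyc w2)" "w2 \<in> osum (cyc w1) (cyc w2)"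
    "x \<in> osum (cyc x) (cyc y)" "y \<in> osum (cyc x) (cyc y)"
    using osum_upper[OF ts(1,2)] osum_upper[OF ts(3,4)] cyc_self by blast+
  have xy: "x \<in> osum (cyc w1) (cyc w2)" "y \<in> osum (cyc w1) (cyc w2)"
    unfolding x_def y_def by (intro tsub_add tsub_diff tsub_osum ts up)+
  have half: "s (1/2) (z + z) = z" for z by (simp add: scale_right_distrib flip: scale_left_distrib)
  have "x + y = w1 + w1" "x - y = w2 + w2" by (simp_all add: x_def y_def)
  then have "w1 = pact [:1/2:] (x + y)" "w2 = pact [:1/2:] (x - y)" by (simp_all only: pact_const half)
  moreover have "pact [:1/2:] (x + y) \<in> osum (cyc x) (cyc y)" "pact [:1/2:] (x - y) \<in> osum (cyc x) (cyc y)"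
    by (intro tsub_pact tsub_add tsub_diff tsub_osum ts up)+
  ultimately have w12: "w1 \<in> osum (cyc x) (cyc y)" "w2 \<in> osum (cyc x) (cyc y)" by metis+
  have "orth W2 (osum (cyc w1) (cyc w2))" using o12(2) w2(2) orth_sym orth_osum by blast
  then have "orth (osum (cyc w1) (cyc w2)) W2" by (rule orth_sym)
  then have oW: "orth (cyc x) W2" "orth (cyc y) W2"
    using cyc_subset[OF tsub_osum[OF ts(1,2)]] xy by (auto elim!: orth_mono)
  have "U \<subseteq> W2" "U' \<subseteq> W2" using U(3) osum_upper[OF U(1,2)] by auto
  then have oU: "orth (cyc x) U" "orth (cyc y) U'" using oW orth_mono by blast+
  have oxx: "orth (cyc x) (cyc x)" "orth (cyc y) (cyc y)"
    using cyclic_form[OF w1(1)] cyclic_form[OF w2(1)]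
    by (auto simp: orth_def cyc_def x_def y_def pact_add_right pact_diff_right b_add_left b_add_right
        b_diff_left b_diff_right b12 b21 top_coeff_minus)
  have "orth (osum (cyc x) U) (osum (cyc x) U)" "orth (osum (cyc y) U') (osum (cyc y) U')"
    by (intro orth_osum orth_sym[OF orth_osum] oxx oU orth_sym[OF oU(1)] orth_sym[OF oU(2)] U)+
  moreover have "W = osum (osum (cyc x) U) (osum (cyc y) U')"
  proof -
    have "W = osum (cyc x) (osum (cyc y) W2)"
      unfolding w1(3) w2(3) by (intro osum_cong_sub ts cyc_subset tsub_osum w12 xy)
    also have "\<dots> = osum (osum (cyc x) U) (osum (cyc y) U')" (is "?L = ?R")
    proof (intro equalityI subsetI)
      fix z assume "z \<in> ?L"
      then obtain a c u u' where "z = a + (c + (u + u'))" "a \<in> cyc x" "c \<in> cyc y" "u \<in> U" "u' \<in> U'"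
        unfolding U(3) osum_def by blast
      then have "z = (a + u) + (c + u')" "a + u \<in> osum (cyc x) U" "c + u' \<in> osum (cyc y) U'"
        by (auto simp: osum_def algebra_simps)
      then show "z \<in> ?R" unfolding osum_def[of "osum (cyc x) U"] by blast
    next
      fix z assume "z \<in> ?R"
      then obtain a c u u' where "z = (a + u) + (c + u')" "a \<in> cyc x" "c \<in> cyc y" "u \<in> U" "u' \<in> U'"
        unfolding osum_def by blast
      moreover from this have "u + u' \<in> W2" unfolding U(3) osum_def by blast
      ultimately have "z = a + (c + (u + u'))" "c + (u + u') \<in> osum (cyc y) W2" "a \<in> cyc x"
        unfolding osum_def by (auto simp: algebra_simps)
      then show "z \<in> ?L" unfolding osum_def[of "cyc x"] by blast
    qed
    finally show ?thesis .
  qed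
  moreover have "tsub (osum (cyc x) U)" "tsub (osum (cyc y) U')" by (intro tsub_osum ts U)+
  ultimately show ?case by blast
qed

section \<open>Existence of the orthogonal decomposition into cyclic modules\<close>

lemma spanning_annihilator:
  assumes A: "finite A" "tsub (span A)"
  shows "\<exists>f. f \<noteq> 0 \<and> (\<forall>x\<in>span A. pact f x = 0)"
proof -
  \<comment> \<open>The first \<open>card A + 1\<close> powers of \<open>T\<close>, applied to
    \<open>a\<close>, are linearly dependent as a family: either two of them coincide, or they form
    a dependent set.\<close>
  have one: "\<exists>f. f \<noteq> 0 \<and> pact f a = 0" if a: "a \<in> span A" for a
  proof (cases "inj_on (\<lambda>i. pact (monom 1 i) a) {..card A}")
    case False
    then obtain i j where ij: "i \<noteq> j" "pact (monom 1 i) a = pact (monom 1 j) a" by (auto simp: inj_on_def)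
    then have "pact (monom 1 i - monom 1 j) a = 0" by (simp add: pact_diff)
    moreover have "monom 1 i - monom (1::'k) j \<noteq> 0" using ij(1) by (simp add: monom_eq_iff')
    ultimately show ?thesis by blast
  next
    case True
    let ?S = "(\<lambda>i. pact (monom 1 i) a) ` {..card A}"
    have S: "card ?S = Suc (card A)" "finite ?S" using True by (auto simp: card_image)
    moreover have "?S \<subseteq> span A" using tsub_pact[OF A(2) a] by auto
    ultimately have "dependent ?S" using independent_span_bound[OF A(1), of ?S] by auto
    then obtain c v where c: "(\<Sum>v\<in>?S. s (c v) v) = 0" "v \<in> ?S" "c v \<noteq> 0"
      using dependent_finite[OF S(2)] by auto
    define f where "f = (\<Sum>i\<le>card A. monom (c (pact (monom 1 i) a)) i)"
    have mon: "pact (monom e i) a = s e (pact (monom 1 i) a)" for e i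
      using pact_smult[of e "monom 1 i" a] by (simp add: smult_monom)
    have "pact f a = (\<Sum>i\<le>card A. s (c (pact (monom 1 i) a)) (pact (monom 1 i) a))"
      unfolding f_def pact_sum by (intro sum.cong refl mon)
    also have "\<dots> = 0" using c(1) by (simp add: sum.reindex[OF True])
    finally have "pact f a = 0" .
    moreover obtain i where i: "i \<le> card A" "v = pact (monom 1 i) a" using c(2) by auto
    have "coeff f i = c v" using i by (simp add: f_def coeff_sum)
    then have "f \<noteq> 0" using c(3) by auto
    ultimately show ?thesis by blast
  qed
  \<comment> \<open>The product of annihilators of the single generators annihilates all of
    them.\<close>
  have "\<exists>f. f \<noteq> 0 \<and> (\<forall>x\<in>B. pact f x = 0)" if "B \<subseteq> span A" "finite B" for B
    using that(2,1)
  proof (induction B)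
    case empty
    show ?case by (rule exI[of _ 1]) auto
  next
    case (insert x B)
    then obtain f g where f: "f \<noteq> 0" "\<forall>x\<in>B. pact f x = 0" and g: "g \<noteq> 0" "pact g x = 0"
      using one[of x] by auto
    have "pact (f * g) y = 0" if "y \<in> insert x B" for y
      using that f g pact_commute[of f g y] by (auto simp: pact_mult)
    moreover have "f * g \<noteq> 0" using f g by simp
    ultimately show ?case by blast
  qed
  from this[OF span_superset A(1)] obtain f where f: "f \<noteq> 0" "\<And>x. x \<in> A \<Longrightarrow> pact f x = 0" by blast
  have "pact f x = 0" if "x \<in> span A" for x
    using that by (induction rule: span_induct_alt) (auto simp: pact_add_right pact_scale_right f(2))
  then show ?thesis using f(1) by blast
qed

lemma minimal_annihilator:
  assumes A: "finite A" "tsub (span A)" and x: "x \<in> span A" "x \<noteq> 0"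
  obtains m where "nonconst_monic m" "\<And>x. x \<in> span A \<Longrightarrow> pact m x = 0"
    "\<And>f. f \<noteq> 0 \<Longrightarrow> degree f < degree m \<Longrightarrow> \<exists>x\<in>span A. pact f x \<noteq> 0"
proof -
  define Q where "Q f \<longleftrightarrow> f \<noteq> 0 \<and> (\<forall>x\<in>span A. pact f x = 0)" for f
  have "\<exists>f. Q f" using spanning_annihilator[OF A] unfolding Q_def .
  then obtain f where f: "Q f" "\<And>g. Q g \<Longrightarrow> degree f \<le> degree g"
    using ex_has_least_nat[of Q _ degree] by blast
  define m where "m = smult (inverse (lead_coeff f)) f"
  have lf: "lead_coeff f \<noteq> 0" using f(1) by (auto simp: Q_def)
  have deg: "degree m = degree f" using lf by (simp add: m_def)
  have "degree f \<noteq> 0"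
  proof
    assume "degree f = 0"
    then obtain c where "f = [:c:]" by (rule degree_eq_zeroE)
    then show False using f(1) x by (auto simp: Q_def pact_const)
  qed
  then have "nonconst_monic m" using lf deg by (simp add: m_def)
  moreover have "\<And>x. x \<in> span A \<Longrightarrow> pact m x = 0" using f(1) by (auto simp: m_def pact_smult Q_def)
  moreover have "\<exists>x\<in>span A. pact g x \<noteq> 0" if "g \<noteq> 0" "degree g < degree m" for g
    using f(2)[of g] that deg by (auto simp: Q_def)
  ultimately show ?thesis using that by blast
qed

text \<open>With \<open>m\<close> the minimal polynomial and \<open>m = p * m'\<close>, the form
  \<open>b x (pact m' y)\<close> is symmetric and nonzero, hence has an anisotropic vector
  \<open>x\<close> by polarization. The component \<open>v\<close> of \<open>x\<close> in the
  \<open>p\<close>-primary part keeps the value, and this value forces the coefficient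
  \<open>u\<close> of the form on \<open>cyc v\<close> to be prime to \<open>p\<close>.\<close>

lemma cyclic_summand:
  assumes A: "finite A" "tsub (span A)" and nd: "\<And>x. x \<in> span A \<Longrightarrow> (\<And>y. y \<in> span A \<Longrightarrow> b x y = 0) \<Longrightarrow> x = 0"
    and x0: "x0 \<in> span A" "x0 \<noteq> 0"
  shows "\<exists>p k u v. irreducible p \<and> lead_coeff p = 1 \<and> 0 < k \<and> cyclic (p ^ k) u v \<and> v \<in> span A \<and> v \<noteq> 0"
proof -
  obtain m where m: "nonconst_monic m" "\<And>x. x \<in> span A \<Longrightarrow> pact m x = 0"
    "\<And>f. f \<noteq> 0 \<Longrightarrow> degree f < degree m \<Longrightarrow> \<exists>x\<in>span A. pact f x \<noteq> 0"
    using minimal_annihilator[OF A x0] by blast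
  obtain p where p: "irreducible p" "lead_coeff p = 1" "p dvd m"
    using has_irreducible_monic_factor m(1) by blast
  have m0: "m \<noteq> 0" using m(1) by auto
  obtain k c where k: "0 < k" "m = p ^ k * c" "\<not> p dvd c"
    using prime_power_factorization[OF m0 p(3,1)] by blast
  define m' where "m' = p ^ (k - 1) * c"
  have pp: "p ^ k = p * p ^ (k - 1)" using k(1) by (simp add: power_eq_if)
  have mm': "m = p * m'" by (simp only: m'_def k(2) pp mult.assoc)
  have p0: "p \<noteq> 0" "0 < degree p" using p(1) is_unit_iff_degree[of p] by (auto simp: Factorial_Ring.irreducible_def)
  have "m' \<noteq> 0" using mm' m0 by auto
  then have "degree m' < degree m" using mm' p0 by (simp add: degree_mult_eq)
  then obtain x1 where x1: "x1 \<in> span A" "pact m' x1 \<noteq> 0" using m(3) \<open>m' \<noteq> 0\<close> by blast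
  have "\<exists>x\<in>span A. b x (pact m' x) \<noteq> 0"
  proof (rule ccontr)
    assume "\<not> ?thesis"
    then have 0: "b x (pact m' x) = 0" if "x \<in> span A" for x using that by blast
    have "b (pact m' x1) y = 0" if y: "y \<in> span A" for y
    proof -
      have "b (x1 + y) (pact m' (x1 + y)) = 0" using 0 x1(1) y span_add by blast
      then have "b x1 (pact m' y) + b y (pact m' x1) = 0"
        using 0[OF x1(1)] 0[OF y] by (simp add: pact_add_right b_add_left b_add_right add.commute)
      moreover have "b y (pact m' x1) = b (pact m' x1) y" "b x1 (pact m' y) = b (pact m' x1) y"
        using b_commute pact_selfadjoint by metis+
      ultimately show ?thesis by simp
    qed
    then show False using nd[of "pact m' x1"] x1 tsub_pact[OF A(2)] by blast
  qed
  then obtain x where x: "x \<in> span A" "b x (pact m' x) \<noteq> 0" by blast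
  have "unit_mod (p ^ k) c" by (rule unit_mod_power_modulus[OF unit_mod_irreducible[OF p(1) k(3)]])
  then obtain e where e: "p ^ k dvd c * e - 1" by (auto simp: unit_mod_def)
  \<comment> \<open>\<open>r\<close> is 1 modulo \<open>p ^ k\<close> and 0 modulo \<open>c\<close>:
    it acts as the projection to the \<open>p\<close>-primary component.\<close>
  define r where "r = c * e"
  define v where "v = pact r x"
  have v: "v \<in> span A" using x(1) tsub_pact[OF A(2)] by (simp add: v_def)
  have kill: "pact f v = 0" if "p ^ k dvd f" for f
  proof -
    obtain g where "f = p ^ k * g" using \<open>p ^ k dvd f\<close> by blast
    then have "f * r = (g * e) * m" by (simp add: r_def k(2) algebra_simps)
    then have "pact f v = pact (g * e) (pact m x)" by (simp add: v_def flip: pact_mult)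
    then show ?thesis using m(2)[OF x(1)] by simp
  qed
  have "m dvd m' * (r * r - 1)"
  proof -
    have "p ^ k dvd (r - 1) * (r + 1)" using e by (simp add: r_def)
    then have "c * p ^ k dvd m' * ((r - 1) * (r + 1))" unfolding m'_def by (intro mult_dvd_mono) auto
    then show ?thesis by (simp add: k(2) algebra_simps)
  qed
  then obtain g where "m' * (r * r - 1) = g * m" by (metis dvdE mult.commute)
  then have "m' * (r * r) = g * m + m'" by (simp add: algebra_simps)
  then have mr: "pact (m' * (r * r)) x = pact m' x" using m(2)[OF x(1)] by (simp add: pact_add pact_mult)
  have "b v (pact m' v) = b x (pact (r * (m' * r)) x)"
    by (simp add: v_def pact_selfadjoint flip: pact_mult)
  also have "r * (m' * r) = m' * (r * r)" by (simp add: algebra_simps)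
  finally have bv: "b v (pact m' v) \<noteq> 0" using x(2) mr by simp
  have "0 < degree (p ^ k)" using p0 k(1) by (simp add: degree_power_eq)
  then have pk: "nonconst_monic (p ^ k)" using lead_coeff_power[of p k] p(2) by simp
  have "\<exists>u. \<forall>f. b v (pact f v) = top_coeff (p ^ k) (u * f)"
    by (rule top_coeff_represents[OF pk]) (simp_all add: kill pact_add b_add_right pact_smult b_scale_right)
  then obtain u where u: "\<And>f. b v (pact f v) = top_coeff (p ^ k) (u * f)" by blast
  \<comment> \<open>Otherwise \<open>u * m'\<close> would be divisible by \<open>p ^ k\<close>, as
    \<open>m'\<close> contains \<open>p ^ (k - 1)\<close>, and \<open>b v (pact m' v)\<close> would
    vanish.\<close>
  have "\<not> p dvd u"
  proof
    assume "p dvd u"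
    then have "p * p ^ (k - 1) dvd u * m'" unfolding m'_def by (intro mult_dvd_mono) auto
    then have "top_coeff (p ^ k) (u * m') = 0" unfolding pp by (rule top_coeff_dvd)
    then show False using bv u by simp
  qed
  then have "unit_mod (p ^ k) u" using unit_mod_power_modulus unit_mod_irreducible p(1) by blast
  then have "cyclic (p ^ k) u v" using pk u kill by (simp add: cyclic_def)
  moreover have "v \<noteq> 0" using bv by auto
  ultimately show ?thesis using p k(1) v by blast
qed

end

definition prime_power_mset :: "('k::field poly \<times> 'k poly) multiset \<Rightarrow> bool" where
  "prime_power_mset M \<longleftrightarrow> (\<forall>(m, u)\<in>#M. unit_mod m u \<and>
     (\<exists>p k. irreducible p \<and> lead_coeff p = 1 \<and> 0 < k \<and> m = p ^ k))"

context selfadjoint_form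
begin

text \<open>The orthogonal complement \<open>W\<close> of a nondegenerate cyclic submodule is again
  a submodule with nondegenerate form, and it has smaller dimension.\<close>

lemma frame_exists:
  assumes "finite A" "independent A" "tsub (span A)"
    and "\<And>x. x \<in> span A \<Longrightarrow> (\<And>y. y \<in> span A \<Longrightarrow> b x y = 0) \<Longrightarrow> x = 0"
  shows "\<exists>M. frame (span A) M \<and> prime_power_mset M"
  using assms
proof (induction "card A" arbitrary: A rule: less_induct)
  case less
  show ?case
  proof (cases "span A = {0}")
    case True
    then show ?thesis using frame_empty by (auto simp: prime_power_mset_def intro!: exI[of _ "{#}"])
  next
    case False
    then obtain x0 where x0: "x0 \<in> span A" "x0 \<noteq> 0" using span_zero[of A] by blast
    obtain p k u v where v: "irreducible p" "lead_coeff p = 1" "0 < k" "cyclic (p ^ k) u v" "v \<in> span A" "v \<noteq> 0"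
      using cyclic_summand[OF less.prems(1,3,4) x0] by blast
    have nm: "nonconst_monic (p ^ k)" "unit_mod (p ^ k) u" using v(4) unfolding cyclic_def by blast+
    define W where "W = {x\<in>span A. \<forall>f. b x (pact f v) = 0}"
    have W: "tsub W"
    proof -
      have "b (T x) (pact f v) = b x (pact ([:0, 1:] * f) v)" for x f
        by (simp only: T_selfadjoint pact_mult pact_X)
      then have "\<forall>x\<in>W. T x \<in> W" using less.prems(3) by (simp add: W_def tsub_def)
      moreover have "subspace W"
        unfolding subspace_def W_def by (simp add: span_zero span_add span_scale b_add_left b_scale_left)
      ultimately show ?thesis by (simp add: tsub_def)
    qed
    have decomp: "span A = osum (cyc v) W"
    proof
      show "osum (cyc v) W \<subseteq> span A"
        using v(5) by (intro osum_subset cyc_subset less.prems) (auto simp: W_def)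
      show "span A \<subseteq> osum (cyc v) W"
      proof
        fix x assume x: "x \<in> span A"
        \<comment> \<open>The linear form that \<open>x\<close> induces on \<open>cyc v\<close> is
          given by some \<open>g\<close>; with \<open>e\<close> inverse to \<open>u\<close>, the
          orthogonal projection of \<open>x\<close> is \<open>pact (g * e) v\<close>.\<close>
        have "\<exists>g. \<forall>f. b x (pact f v) = top_coeff (p ^ k) (g * f)"
          using v(4) by (intro top_coeff_represents[OF nm(1)])
            (simp_all add: pact_add b_add_right pact_smult b_scale_right cyclic_def)
        then obtain g where g: "\<And>f. b x (pact f v) = top_coeff (p ^ k) (g * f)" by blast
        obtain e where e: "p ^ k dvd u * e - 1" using nm(2) by (auto simp: unit_mod_def)
        have "b (pact (g * e) v) (pact f v) = b x (pact f v)" for f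
        proof -
          have "b (pact (g * e) v) (pact f v) = top_coeff (p ^ k) (u * (g * e * f))"
            by (rule cyclic_form[OF v(4)])
          also have "\<dots> = top_coeff (p ^ k) (g * f)"
          proof (rule top_coeff_cong)
            have "p ^ k dvd (u * e - 1) * (g * f)" using e by simp
            then show "p ^ k dvd u * (g * e * f) - g * f" by (simp add: algebra_simps)
          qed
          finally show ?thesis using g by simp
        qed
        then have "x - pact (g * e) v \<in> W"
          using x tsub_pact[OF less.prems(3) v(5)] by (simp add: W_def b_diff_left span_diff)
        moreover have "x = pact (g * e) v + (x - pact (g * e) v)" by simp
        ultimately show "x \<in> osum (cyc v) W" unfolding osum_def cyc_def by blast
      qed
    qed
    have "orth W (cyc v)" by (auto simp: orth_def cyc_def W_def)
    then have ovW: "orth (cyc v) W" by (rule orth_sym)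
    have vW: "v \<notin> W"
    proof
      assume "v \<in> W"
      then have "p ^ k dvd 1" by (intro cyclic_zero[OF v(4)]) (simp add: W_def)
      then show False using nm(1) is_unit_iff_degree[of "p ^ k"] by fastforce
    qed
    obtain B where B: "B \<subseteq> W" "independent B" "W \<subseteq> span B" using maximal_independent_subset by blast
    have spanB: "span B = W" using B tsub_subspace[OF W] span_subspace by blast
    have "independent (insert v B)" using B(2) vW spanB by (simp add: independent_insertI)
    moreover have "insert v B \<subseteq> span A" using v(5) B(1) by (auto simp: W_def)
    ultimately have fin: "finite (insert v B)" "card (insert v B) \<le> card A"
      using independent_span_bound[OF less.prems(1), of "insert v B"] by simp_all
    moreover have "v \<notin> B" using vW B(1) by blast
    ultimately have cB: "finite B" "card B < card A" by auto
    have "\<exists>M. frame (span B) M \<and> prime_power_mset M"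
    proof (rule less.hyps[OF cB(2,1) B(2)])
      show "tsub (span B)" using spanB W by simp
      fix x assume x: "x \<in> span B" "\<And>y. y \<in> span B \<Longrightarrow> b x y = 0"
      show "x = 0"
      proof (rule less.prems(4))
        show "x \<in> span A" using x(1) spanB by (auto simp: W_def)
        fix y assume "y \<in> span A"
        then obtain g z where "y = pact g v + z" "z \<in> W" unfolding decomp osum_def cyc_def by blast
        then show "b x y = 0" using x by (simp add: spanB b_add_right) (simp add: W_def)
      qed
    qed
    then obtain M where M: "frame W M" "prime_power_mset M" using spanB by auto
    have "frame (span A) (add_mset (p ^ k, u) M)"
      unfolding decomp by (rule frame_add[OF M(1) v(4) ovW])
    moreover have "prime_power_mset (add_mset (p ^ k, u) M)"
      using M(2) v(1-3) nm(2) unfolding prime_power_mset_def by auto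
    ultimately show ?thesis by blast
  qed
qed

end


section \<open>Multiples of a form and reduction to residue fields\<close>

text \<open>Adds an isometric copy of a frame, compatible with the operators, to a frame orthogonal
  to it. The coordinates of a power are adjoined one by one in this way.\<close>

lemma frame_embed:
  assumes A: "selfadjoint_form s b T" and B: "selfadjoint_form s' b' T'"
    and \<iota>: "Vector_Spaces.linear s s' \<iota>" "\<And>x. \<iota> (T x) = T' (\<iota> x)" "\<And>x y. b' (\<iota> x) (\<iota> y) = b x y"
    and o: "selfadjoint_form.orth b' (range \<iota>) F" and F: "selfadjoint_form.frame s' b' T' F N"
    and W: "selfadjoint_form.frame s b T W M"
  shows "selfadjoint_form.frame s' b' T' (selfadjoint_form.osum (\<iota> ` W) F) (M + N)"
proof -
  interpret A: selfadjoint_form s b T by fact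
  interpret B: selfadjoint_form s' b' T' by fact
  have add: "\<iota> (x + y) = \<iota> x + \<iota> y" and scale: "\<iota> (s c x) = s' c (\<iota> x)" for x y c
    using \<iota>(1) by (auto simp: Vector_Spaces.linear_iff)
  have zero: "\<iota> 0 = 0" using scale[of 0 0] by simp
  have pact: "\<iota> (A.pact f x) = B.pact f (\<iota> x)" for f x
    by (induction f) (simp_all add: A.pact_pCons B.pact_pCons add scale \<iota>(2) zero)
  have cyc: "\<iota> ` A.cyc w = B.cyc (\<iota> w)" for w
    by (simp add: A.cyc_def B.cyc_def image_image pact)
  show ?thesis using W
  proof (induction rule: A.frame.induct)
    case frame_empty
    then show ?case using F by (simp add: B.osum_def zero)
  next
    case (frame_add W M m u w)
    have c: "B.cyclic m u (\<iota> w)"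
      using frame_add(2) by (simp add: A.cyclic_def B.cyclic_def zero \<iota>(3) flip: pact)
    have "B.orth (B.cyc (\<iota> w)) (\<iota> ` W)"
      using frame_add(3) by (auto simp: B.orth_def A.orth_def \<iota>(3) simp flip: cyc)
    moreover have "B.orth (B.cyc (\<iota> w)) F"
      using o by (auto simp: B.orth_def simp flip: cyc)
    ultimately have "B.frame (B.osum (B.cyc (\<iota> w)) (B.osum (\<iota> ` W) F)) (add_mset (m, u) (M + N))"
      by (intro B.frame_add frame_add.IH c B.orth_osum)
    moreover have "B.osum (B.cyc (\<iota> w)) (B.osum (\<iota> ` W) F) = B.osum (\<iota> ` A.osum (A.cyc w) W) F" (is "?L = ?R")
    proof (intro equalityI subsetI)
      fix z assume "z \<in> ?L"
      then obtain x y v where "z = \<iota> x + (\<iota> y + v)" "x \<in> A.cyc w" "y \<in> W" "v \<in> F"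
        unfolding B.osum_def cyc[symmetric] by blast
      then have "z = \<iota> (x + y) + v" "x + y \<in> A.osum (A.cyc w) W" "v \<in> F" by (auto simp: add add.assoc A.osum_def)
      then show "z \<in> ?R" unfolding B.osum_def by blast
    next
      fix z assume "z \<in> ?R"
      then obtain x y v where "z = \<iota> (x + y) + v" "x \<in> A.cyc w" "y \<in> W" "v \<in> F"
        unfolding B.osum_def A.osum_def by blast
      then have "z = \<iota> x + (\<iota> y + v)" "\<iota> x \<in> B.cyc (\<iota> w)" "\<iota> y + v \<in> B.osum (\<iota> ` W) F"
        by (auto simp: add add.assoc B.osum_def simp flip: cyc)
      then show "z \<in> ?L" unfolding B.osum_def[of "B.cyc (\<iota> w)"] by blast
    qed
    ultimately show ?case by simp
  qed
qed

lemma sum_mset_repeat: "(\<Sum>x\<in>#repeat_mset n M. g x) = int n * (\<Sum>x\<in>#M. g x)"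
  by (induction n) (simp_all add: distrib_right)

lemma vector_space_power_scale: "vector_space s \<Longrightarrow> vector_space (power_scale s)"
  by (simp add: vector_space_def power_scale_def fun_eq_iff)

definition power_form :: "nat \<Rightarrow> ('v \<Rightarrow> 'v \<Rightarrow> 'k::comm_monoid_add) \<Rightarrow> (nat \<Rightarrow> 'v) \<Rightarrow> (nat \<Rightarrow> 'v) \<Rightarrow> 'k" where
  "power_form n b x y = (\<Sum>i<n. b (x i) (y i))"

lemma sym_bilinear_power:
  assumes "sym_bilinear s b" shows "sym_bilinear (power_scale s) (power_form n b)"
proof -
  interpret A: sym_bilinear s b by fact
  interpret B: vector_space "power_scale s" using vector_space_power_scale A.vector_space_axioms .
  show ?thesis
  proof
    show "power_form n b x y = power_form n b y x" for x y
      unfolding power_form_def by (intro sum.cong refl A.b_commute)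
  qed (simp_all add: power_form_def power_scale_def A.b_add_left sum.distrib A.b_scale_left sum_distrib_left)
qed

lemma selfadjoint_form_power:
  assumes "selfadjoint_form s b T" shows "selfadjoint_form (power_scale s) (power_form n b) (\<lambda>x i. T (x i))"
proof -
  interpret A: selfadjoint_form s b T by fact
  interpret B: sym_bilinear "power_scale s" "power_form n b" using sym_bilinear_power A.sym_bilinear_axioms .
  show ?thesis
    by unfold_locales (auto simp: power_form_def A.T_selfadjoint power_scale_def A.T_add A.T_scale fun_eq_iff)
qed

context selfadjoint_form
begin

text \<open>The power form keeps all \<open>n\<close> coordinates while the frame fills the first
  \<open>k\<close>, so that the induction on \<open>k\<close> stays within one space with
  form.\<close>

lemma frame_power:
  assumes W: "frame W M" and n: "k \<le> n"
  shows "selfadjoint_form.frame (power_scale s) (power_form n b) (\<lambda>x i. T (x i))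
    {x. (\<forall>i<k. x i \<in> W) \<and> (\<forall>i\<ge>k. x i = 0)} (repeat_mset k M)"
  using n
proof (induction k)
  interpret B: selfadjoint_form "power_scale s" "power_form n b" "\<lambda>x i. T (x i)"
    using selfadjoint_form_power selfadjoint_form_axioms .
  {
    case 0
    have "{x :: nat \<Rightarrow> 'a. (\<forall>i<0. x i \<in> W) \<and> (\<forall>i\<ge>0. x i = 0)} = {0}" by (auto simp: fun_eq_iff)
    then show ?case using B.frame_empty by (simp only: repeat_mset_0)
  next
    case (Suc k)
    define \<iota> where "\<iota> x = (\<lambda>i. if i = k then x else 0)" for x :: 'a
    let ?F = "{x. (\<forall>i<k. x i \<in> W) \<and> (\<forall>i\<ge>k. x i = 0)}"
    have "B.frame (B.osum (\<iota> ` W) ?F) (M + repeat_mset k M)"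
    proof (rule frame_embed[OF selfadjoint_form_axioms B.selfadjoint_form_axioms _ _ _ _ _ W])
      show "Vector_Spaces.linear s (power_scale s) \<iota>"
        unfolding Vector_Spaces.linear_iff using vector_space_axioms B.vector_space_axioms
        by (auto simp: \<iota>_def power_scale_def fun_eq_iff)
      show "\<iota> (T x) = (\<lambda>i. T (\<iota> x i))" for x by (auto simp: \<iota>_def)
      have "(\<Sum>i<n. b (\<iota> x i) (\<iota> y i)) = (\<Sum>i<n. if i = k then b x y else 0)" for x y
        by (rule sum.cong) (auto simp: \<iota>_def)
      then show "power_form n b (\<iota> x) (\<iota> y) = b x y" for x y
        using Suc.prems by (simp add: power_form_def)
      show "B.orth (range \<iota>) ?F" unfolding B.orth_def power_form_def
        by (auto intro!: sum.neutral simp: \<iota>_def)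
      show "B.frame ?F (repeat_mset k M)" using Suc by simp
    qed
    moreover have "B.osum (\<iota> ` W) ?F = {x. (\<forall>i<Suc k. x i \<in> W) \<and> (\<forall>i\<ge>Suc k. x i = 0)}" (is "?L = ?R")
    proof (intro equalityI subsetI)
      fix x assume "x \<in> ?L"
      then show "x \<in> ?R" by (auto simp: B.osum_def \<iota>_def less_Suc_eq)
    next
      fix x assume x: "x \<in> ?R"
      define y where "y = (\<lambda>i. if i < k then x i else 0)"
      have "x = \<iota> (x k) + y" using x by (auto simp: \<iota>_def y_def fun_eq_iff)
      moreover have "x k \<in> W" "y \<in> ?F" using x by (auto simp: y_def)
      ultimately show "x \<in> ?L" unfolding B.osum_def by blast
    qed
    ultimately show ?case by simp
  }
qed

lemma power_pact:
  "selfadjoint_form.pact (power_scale s) (\<lambda>x i. T (x i)) f x i = pact f (x i)"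
proof -
  interpret B: selfadjoint_form "power_scale s" "power_form 0 b" "\<lambda>x i. T (x i)"
    using selfadjoint_form_power selfadjoint_form_axioms .
  show ?thesis
    by (induction f) (simp_all add: B.pact_pCons pact_pCons, simp_all add: power_scale_def)
qed

lemma frame_moduli: "frame W M \<Longrightarrow> (m, u) \<in># M \<Longrightarrow> nonconst_monic m \<and> unit_mod m u"
  by (induction rule: frame.induct) (auto simp: cyclic_def)

text \<open>Signatures are additive in multiples, invariant under moves, and 0 on hyperbolic
  multisets. With this, a part already known to be weakly hyperbolic can be subtracted from the
  signatures of the whole.\<close>

lemma weakly_hyperbolic_signature:
  assumes P: "field_ordering P" and W: "frame W M" and M: "weakly_hyperbolic M"
  shows "(\<Sum>(m, u)\<in>#M. residue_sig P m (f * u)) = 0"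
proof -
  obtain n H where n: "n \<ge> 1" "hyperbolic_mset H" "meq (repeat_mset n M) H"
    using M by (auto simp: weakly_hyperbolic_def)
  interpret B: selfadjoint_form "power_scale s" "power_form n b" "\<lambda>x i. T (x i)"
    using selfadjoint_form_power selfadjoint_form_axioms .
  interpret C: sym_bilinear "power_scale s" "\<lambda>x y. power_form n b x (B.pact f y)" by (rule B.sym_bilinear_pact)
  let ?W = "{x. (\<forall>i<n. x i \<in> W) \<and> (\<forall>i\<ge>n. x i = 0)}"
  have fr: "B.frame ?W (repeat_mset n M)" using frame_power[OF W order_refl] .
  then have fr': "B.frame ?W H" using B.frame_meq n(3) by blast
  have "(\<Sum>(m, u)\<in>#repeat_mset n M. residue_sig P m (f * u)) = (\<Sum>(m, u)\<in>#H. residue_sig P m (f * u))"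
    using C.has_sig_unique[OF P B.frame_signature[OF P fr] B.frame_signature[OF P fr']] .
  also have "\<dots> = 0"
    using B.frame_moduli[OF fr'] by (intro sum_residue_sig_hyperbolic[OF P n(2)]) auto
  finally have "int n * (\<Sum>(m, u)\<in>#M. residue_sig P m (f * u)) = 0"
    by (simp only: sum_mset_repeat)
  then show ?thesis using n(1) by simp
qed

lemma weakly_hyperbolic_imp_hyperbolic:
  assumes W: "frame UNIV M" and M: "weakly_hyperbolic M"
    and q: "\<And>x. q1 x = b x (pact f1 x)" "\<And>x. q2 x = b x (pact f2 x)"
  shows "\<exists>n\<ge>1. hyperbolic (power_scale s) (power_space n) (times_form n ` {q1, q2})"
proof -
  obtain n H where n: "n \<ge> 1" "hyperbolic_mset H" "meq (repeat_mset n M) H"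
    using M by (auto simp: weakly_hyperbolic_def)
  interpret B: selfadjoint_form "power_scale s" "power_form n b" "\<lambda>x i. T (x i)"
    using selfadjoint_form_power selfadjoint_form_axioms .
  have eq: "{x. (\<forall>i<n. x i \<in> (UNIV :: 'a set)) \<and> (\<forall>i\<ge>n. x i = 0)} = power_space n"
    by (simp add: power_space_def)
  have "B.frame (power_space n) (repeat_mset n M)"
    using frame_power[OF W order_refl, of n] unfolding eq .
  then have fr: "B.frame (power_space n) H" using B.frame_meq n(3) by blast
  obtain U U' where U: "B.tsub U" "B.tsub U'" "power_space n = B.osum U U'" "B.orth U U" "B.orth U' U'"
    using B.frame_hyperbolic[OF n(2) fr] by blast
  have "x = 0" if x: "x \<in> U" "x \<in> U'" for x
  proof (rule B.frame_nondegenerate[OF fr])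
    show "x \<in> power_space n" unfolding U(3) using x B.osum_upper[OF U(1,2)] by blast
    fix y :: "nat \<Rightarrow> 'a" assume "y \<in> power_space n"
    then obtain u u' where "y = u + u'" "u \<in> U" "u' \<in> U'" unfolding U(3) B.osum_def by blast
    then show "power_form n b x y = 0" using U(4,5) x by (auto simp: B.orth_def B.b_add_right)
  qed
  then have int: "U \<inter> U' = {0}" using B.tsub_0 U(1,2) by blast
  \<comment> \<open>The isotropic subspaces are submodules, so they are also isotropic after a twist
    by any polynomial in the operator, in particular for \<open>q1\<close> and
    \<open>q2\<close>.\<close>
  have val: "times_form n q v = 0" if qv: "q = q1 \<or> q = q2" "v \<in> Z" "B.tsub Z" "B.orth Z Z" for q v Z
  proof -
    obtain f where f: "\<And>x. q x = b x (pact f x)" using q qv(1) by blast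
    have "power_form n b v (B.pact f v) = 0"
      using qv(2-4) B.tsub_pact[OF qv(3,2), of f] by (auto simp: B.orth_def)
    then show ?thesis by (simp add: power_form_def times_form_def f power_pact)
  qed
  have "hyperbolic (power_scale s) (power_space n) (times_form n ` {q1, q2})"
    unfolding hyperbolic_def
    using U int val[of _ _ U] val[of _ _ U'] B.tsub_subspace[OF U(1)] B.tsub_subspace[OF U(2)]
    by (intro exI[of _ U] exI[of _ U']) (auto simp: B.osum_def)
  then show ?thesis using n(1) by blast
qed

lemma subframe: "frame W (M + N) \<Longrightarrow> \<exists>W'. frame W' N"
proof (induction M arbitrary: W)
  case (add a M)
  obtain m u where a: "a = (m, u)" by (cases a)
  obtain W' where "frame W' (M + N)" using frame_addE[of W m u "M + N"] add.prems a by auto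
  then show ?case by (rule add.IH)
qed auto

end

lemma irreducible_monic_eq:
  fixes p q :: "'k::field poly"
  assumes "irreducible p" "irreducible q" "lead_coeff p = 1" "lead_coeff q = 1" "p dvd q"
  shows "p = q"
proof -
  obtain c where c: "q = p * c" using assms(5) by blast
  then have "is_unit c" using assms(1,2) by (metis Factorial_Ring.irreducibleD irreducible_not_unit)
  then obtain a where a: "c = [:a:]" by (auto simp: is_unit_poly_iff)
  have "lead_coeff q = lead_coeff p * lead_coeff c" unfolding c by (rule lead_coeff_mult)
  then have "a = 1" using a assms(3,4) by simp
  then show ?thesis using c a by simp
qed

lemma irreducible_dvd_power:
  fixes p :: "'k::field poly"
  shows "irreducible p \<Longrightarrow> p dvd q ^ n \<Longrightarrow> p dvd q"
  by (induction n) (auto dest: irreducible_dvd_mult simp: irreducible_not_unit)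

lemma irreducible_dvd_prod_mset:
  fixes p :: "'k::field poly"
  shows "irreducible p \<Longrightarrow> p dvd prod_mset C \<Longrightarrow> \<exists>c\<in>#C. p dvd c"
  by (induction C) (auto dest: irreducible_dvd_mult simp: irreducible_not_unit)

text \<open>
  The largest power \<open>p ^ k\<close> among the moduli is isolated by multiplying with \<open>p ^ (k - 1)\<close>
  and with the moduli prime to \<open>p\<close>.
\<close>

lemma (in selfadjoint_form) weakly_hyperbolic_if_signature_0:
  assumes local: "\<And>(p :: 'k poly) k U. irreducible p \<Longrightarrow> lead_coeff p = 1 \<Longrightarrow> 0 < k \<Longrightarrow>
      (\<And>u. u \<in># U \<Longrightarrow> unit_mod p u) \<Longrightarrow>
      (\<And>P c. field_ordering P \<Longrightarrow> (\<Sum>u\<in>#U. residue_sig P p (c * u)) = 0) \<Longrightarrow>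
      weakly_hyperbolic (image_mset (Pair (p ^ k)) U)"
    and "frame W M" "prime_power_mset M"
    and "\<And>P f. field_ordering P \<Longrightarrow> (\<Sum>(m, u)\<in>#M. residue_sig P m (f * u)) = 0"
  shows "weakly_hyperbolic M"
  using assms(2-4)
proof (induction "size M" arbitrary: M W rule: less_induct)
  case less
  show ?case
  proof (cases "M = {#}")
    case True
    then show ?thesis using weakly_hyperbolic_empty by simp
  next
    case False
    then obtain m0 u0 where mu0: "(m0, u0) \<in># M" by (metis multiset_nonemptyE surj_pair)
    then obtain p k0 where p: "irreducible p" "lead_coeff p = 1" "0 < k0" "m0 = p ^ k0"
      using less.prems(2) by (fastforce simp: prime_power_mset_def)
    have p0: "0 < degree p" "p \<noteq> 0" using p(1) is_unit_iff_degree[of p] by (auto simp: Factorial_Ring.irreducible_def)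
    define K where "K = (\<lambda>k. p ^ k) -` fst ` set_mset M"
    have inj: "inj (\<lambda>k. p ^ k)"
    proof (rule injI)
      fix i j assume "p ^ i = p ^ j"
      then have "i * degree p = j * degree p" using degree_power_eq[OF p0(2)] by metis
      then show "i = j" using p0 by simp
    qed
    have "finite K" unfolding K_def by (intro finite_vimageI inj) simp
    moreover have "k0 \<in> K" using mu0 p(4) by (force simp: K_def)
    ultimately have k: "Max K \<in> K" "k0 \<le> Max K" "\<And>j. j \<in> K \<Longrightarrow> j \<le> Max K"
      using Max_in[of K] Max_ge[of K] by blast+
    define k where "k = Max K"
    have kpos: "0 < k" using k(2) p(3) by (simp add: k_def)
    define M1 where "M1 = filter_mset (\<lambda>a. fst a = p ^ k) M"
    define M2 where "M2 = filter_mset (\<lambda>a. fst a \<noteq> p ^ k) M"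
    define U where "U = image_mset snd M1"
    have M: "M = M1 + M2" by (simp add: M1_def M2_def)
    have "image_mset (\<lambda>a. (p ^ k, snd a)) M1 = image_mset (\<lambda>a. a) M1"
      by (rule image_mset_cong) (auto simp: M1_def)
    then have M1: "M1 = image_mset (Pair (p ^ k)) U"
      by (simp add: U_def image_mset.compositionality comp_def)
    \<comment> \<open>The moduli prime to \<open>p\<close>. The other ones in \<open>M2\<close> are
      powers of \<open>p\<close> below \<open>p ^ k\<close>, so
      \<open>p ^ (k - 1) * prod_mset C\<close> is divisible by every modulus of
      \<open>M2\<close>.\<close>
    define C where "C = image_mset fst (filter_mset (\<lambda>a. \<not> p dvd fst a) M)"
    have "\<not> p dvd prod_mset C"
      using irreducible_dvd_prod_mset[OF p(1), of C] by (auto simp: C_def)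
    then have cu: "unit_mod p (prod_mset C)" by (rule unit_mod_irreducible[OF p(1)])
    then obtain e where e: "p dvd prod_mset C * e - 1" by (auto simp: unit_mod_def)
    have pk: "p ^ k = p * p ^ (k - 1)" using kpos by (simp add: power_eq_if)
    have pm: "nonconst_monic p" using p(2) p0 by simp
    have pk1: "lead_coeff (p ^ (k - 1)) = 1" using lead_coeff_power[of p "k - 1"] p(2) by simp
    have dvd2: "m dvd p ^ (k - 1) * prod_mset C" if mu: "(m, u) \<in># M2" for m u
    proof (cases "p dvd m")
      case False
      then have "m \<in># C" using mu by (force simp: C_def M2_def)
      then show ?thesis by (simp add: dvd_prod_mset dvd_mult)
    next
      case True
      obtain q j where q: "irreducible q" "lead_coeff q = 1" "m = q ^ j"
        using less.prems(2) mu by (fastforce simp: prime_power_mset_def M2_def)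
      then have "p = q" using True p irreducible_dvd_power irreducible_monic_eq by blast
      then have "j \<in> K" "j \<noteq> k" using mu q(3) by (force simp: K_def M2_def)+
      then have "j \<le> k - 1" using k(3)[of j] by (simp add: k_def)
      then show ?thesis using \<open>p = q\<close> q(3) by (simp add: le_imp_power_dvd)
    qed
    have split: "(\<Sum>(m, u)\<in>#M. residue_sig P m (f * u)) =
        (\<Sum>u\<in>#U. residue_sig P (p ^ k) (f * u)) + (\<Sum>(m, u)\<in>#M2. residue_sig P m (f * u))" for P f
      by (simp add: M M1 image_mset.compositionality comp_def)
    have "(\<Sum>u\<in>#U. residue_sig P p (c * u)) = 0" if P: "field_ordering P" for P c
    proof -
      \<comment> \<open>The factor \<open>p ^ (k - 1) * prod_mset C\<close> kills the summands in
        \<open>M2\<close>, and its first part reduces \<open>p ^ k\<close> to \<open>p\<close>. The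
        factor \<open>e\<close> cancels \<open>prod_mset C\<close> modulo \<open>p\<close>, so that
        \<open>c\<close> remains.\<close>
      define f where "f = p ^ (k - 1) * (prod_mset C * (e * c))"
      have "residue_sig P m (f * u) = 0" if mu: "(m, u) \<in># M2" for m u
      proof (rule residue_sig_0[OF P])
        have "(m, u) \<in># M" using mu by (simp add: M2_def)
        then show "0 < degree m" using frame_moduli[OF less.prems(1)] by blast
        have "p ^ (k - 1) * prod_mset C dvd f * u" by (simp add: f_def mult.assoc)
        then show "m dvd f * u" using dvd2[OF mu] dvd_trans by blast
      qed
      then have "(\<Sum>(m, u)\<in>#M2. residue_sig P m (f * u)) = 0"
        by (intro sum_mset.neutral) auto
      moreover have "residue_sig P (p ^ k) (f * u) = residue_sig P p (c * u)" for u
      proof -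
        have "residue_sig P (p ^ k) (f * u) = residue_sig P p (prod_mset C * (e * c) * u)"
          unfolding pk using residue_sig_mult_modulus[OF P pm pk1] by (simp add: f_def mult.assoc)
        also have "\<dots> = residue_sig P p (c * u)"
        proof (rule residue_sig_cong)
          have "p dvd (prod_mset C * e - 1) * (c * u)" using e by simp
          then show "p dvd prod_mset C * (e * c) * u - c * u" by (simp add: algebra_simps)
        qed
        finally show ?thesis .
      qed
      ultimately show ?thesis using split[of P f] less.prems(3)[OF P, of f] by simp
    qed
    moreover have "unit_mod p u" if "u \<in># U" for u
    proof -
      have "(p ^ k, u) \<in># M" using that by (auto simp: U_def M1_def)
      then have "unit_mod (p ^ k) u" using frame_moduli[OF less.prems(1)] by blast
      then show ?thesis using unit_mod_dvd kpos by (metis dvd_power)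
    qed
    ultimately have wh1: "weakly_hyperbolic M1" unfolding M1 by (intro local p(1,2) kpos) auto
    obtain W1 W2 where W12: "frame W1 M1" "frame W2 M2"
      using subframe[of W M1 M2] subframe[of W M2 M1] less.prems(1) M by (auto simp: add.commute)
    have "weakly_hyperbolic M2"
    proof (rule less.hyps[OF _ W12(2)])
      obtain u where "(p ^ k, u) \<in># M" using k(1) by (force simp: K_def k_def)
      then have "(p ^ k, u) \<in># M1" by (simp add: M1_def)
      then have "0 < size M1" by (auto simp: nonempty_has_size[symmetric])
      then show "size M2 < size M" by (simp add: M)
      show "prime_power_mset M2" using less.prems(2) by (auto simp: prime_power_mset_def M2_def)
      \<comment> \<open>The isolated part contributes 0 for every \<open>f\<close>, since it is
        weakly hyperbolic.\<close>
      show "(\<Sum>(m, u)\<in>#M2. residue_sig P m (f * u)) = 0" if P: "field_ordering P" for P f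
        using less.prems(3)[OF P, of f] weakly_hyperbolic_signature[OF P W12(1) wh1, of f] by (simp add: M)
    qed
    then show ?thesis using wh1 weakly_hyperbolic_plus M by simp
  qed
qed


section \<open>Irreducible polynomials over real closed fields\<close>

definition newton_fps :: "'a::field_char_0 multiset \<Rightarrow> 'a fps" where
  "newton_fps A = (\<Prod>x\<in>#A. 1 - fps_const x * fps_X)"

definition power_sum :: "'a::field_char_0 multiset \<Rightarrow> nat \<Rightarrow> 'a" where
  "power_sum A n = (\<Sum>x\<in>#A. x ^ n)"

text \<open>The logarithmic derivative of the product of the factors \<open>1 - x X\<close> is the
  generating function of the power sums, up to sign and without constant term.\<close>

lemma newton_fps_deriv:
  "fps_X * fps_deriv (newton_fps A) = - (newton_fps A * Abs_fps (\<lambda>n. if n = 0 then 0 else power_sum A n))"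
proof (induction A)
  case empty
  have "Abs_fps (\<lambda>n. if n = 0 then 0 else power_sum {#} n) = (0 :: 'a fps)"
    by (intro fps_ext) (simp add: power_sum_def)
  then show ?case by (simp add: newton_fps_def)
next
  case (add x A)
  define F where "F = newton_fps A"
  define G where "G = Abs_fps (\<lambda>n. if n = 0 then 0 else power_sum A n)"
  define g where "g = Abs_fps (\<lambda>n. if n = 0 then 0 else x ^ n)"
  define l where "l = 1 - fps_const x * fps_X"
  have IH: "fps_X * fps_deriv F = - (F * G)" using add by (simp add: F_def G_def)
  have lg: "l * g = fps_const x * fps_X"
  proof (rule fps_ext)
    fix n
    have "(l * g) $ n = g $ n - x * (fps_X * g) $ n"
      by (simp add: l_def left_diff_distrib mult.assoc)
    also have "\<dots> = (fps_const x * fps_X) $ n"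
      by (cases n; cases "n - 1") (auto simp: g_def)
    finally show "(l * g) $ n = (fps_const x * fps_X) $ n" .
  qed
  have G': "Abs_fps (\<lambda>n. if n = 0 then 0 else power_sum (add_mset x A) n) = G + g"
    by (intro fps_ext) (simp add: G_def g_def power_sum_def)
  have F': "newton_fps (add_mset x A) = l * F" by (simp add: newton_fps_def F_def l_def)
  have dl: "fps_deriv l = - fps_const x" by (simp add: l_def)
  have "fps_X * fps_deriv (l * F) = l * (fps_X * fps_deriv F) - (fps_const x * fps_X) * F"
    by (simp add: dl algebra_simps del: fps_const_neg)
  also have "\<dots> = - (l * F * (G + g))"
    unfolding IH lg[symmetric] by (simp add: algebra_simps)
  finally show ?case unfolding F' G' .
qed

lemma newton_identity:
  assumes "n \<ge> 1"
  shows "of_nat n * newton_fps A $ n = - (\<Sum>i<n. newton_fps A $ i * power_sum A (n - i))"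
proof -
  have "of_nat n * newton_fps A $ n = (fps_X * fps_deriv (newton_fps A)) $ n"
    using assms by (cases n) auto
  also have "\<dots> = - (\<Sum>i=0..n. newton_fps A $ i * (if n - i = 0 then 0 else power_sum A (n - i)))"
    unfolding newton_fps_deriv by (simp add: fps_mult_nth)
  also have "(\<Sum>i=0..n. newton_fps A $ i * (if n - i = 0 then 0 else power_sum A (n - i)))
      = (\<Sum>i<n. newton_fps A $ i * power_sum A (n - i))"
    by (rule sum.mono_neutral_cong_right) auto
  finally show ?thesis .
qed

lemma newton_fps_0: "newton_fps A $ 0 = 1"
  by (induction A) (auto simp: newton_fps_def)

locale subfield_char_0 =
  fixes R :: "'a::field_char_0 set"
  assumes R_1: "1 \<in> R" and R_diff: "x \<in> R \<Longrightarrow> y \<in> R \<Longrightarrow> x - y \<in> R"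
    and R_mult: "x \<in> R \<Longrightarrow> y \<in> R \<Longrightarrow> x * y \<in> R" and R_inverse: "x \<in> R \<Longrightarrow> inverse x \<in> R"
begin

lemma R_0: "0 \<in> R"
  using R_diff[OF R_1 R_1] by simp

lemma R_minus: "x \<in> R \<Longrightarrow> - x \<in> R"
  using R_diff[OF R_0, of x] by simp

lemma R_add: "x \<in> R \<Longrightarrow> y \<in> R \<Longrightarrow> x + y \<in> R"
  using R_diff[of x "-y"] R_minus by auto

lemma R_divide: "x \<in> R \<Longrightarrow> y \<in> R \<Longrightarrow> x / y \<in> R"
  by (simp add: divide_inverse R_mult R_inverse)

lemma R_of_nat: "of_nat n \<in> R"
  by (induction n) (auto intro: R_0 R_1 R_add)

lemma R_numeral: "numeral n \<in> R"
  using R_of_nat[of "numeral n"] by simp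

lemma R_power: "x \<in> R \<Longrightarrow> x ^ n \<in> R"
  by (induction n) (auto intro: R_1 R_mult)

lemma R_sum: "(\<And>i. i \<in> I \<Longrightarrow> f i \<in> R) \<Longrightarrow> sum f I \<in> R"
  by (induction I rule: infinite_finite_induct) (auto intro: R_0 R_add)

lemma newton_fps_in_R:
  assumes "\<And>n. power_sum A n \<in> R" shows "newton_fps A $ n \<in> R"
proof (induction n rule: less_induct)
  case (less n)
  show ?case
  proof (cases "n = 0")
    case True
    then show ?thesis by (simp add: newton_fps_0 R_1)
  next
    case False
    then have "newton_fps A $ n = - (\<Sum>i<n. newton_fps A $ i * power_sum A (n - i)) / of_nat n"
      using newton_identity[of n A] by (simp add: field_simps)
    then show ?thesis using less assms by (auto intro!: R_divide R_minus R_sum R_mult R_of_nat)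
  qed
qed

lemma power_sum_in_R:
  assumes "\<And>n. newton_fps A $ n \<in> R" shows "power_sum A n \<in> R"
proof (induction n rule: less_induct)
  case (less n)
  show ?case
  proof (cases "n = 0")
    case True
    then show ?thesis by (simp add: power_sum_def R_of_nat)
  next
    case False
    then obtain k where k: "n = Suc k" by (cases n) auto
    have "of_nat n * newton_fps A $ n = - (power_sum A n + (\<Sum>i<k. newton_fps A $ Suc i * power_sum A (n - Suc i)))"
      using newton_identity[of n A] unfolding k sum.lessThan_Suc_shift
      by (simp only: newton_fps_0 diff_zero mult_1_left)
    then have "power_sum A n = - (of_nat n * newton_fps A $ n) - (\<Sum>i<k. newton_fps A $ Suc i * power_sum A (n - Suc i))"
      by simp
    moreover have "(\<Sum>i<k. newton_fps A $ Suc i * power_sum A (n - Suc i)) \<in> R"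
      using less k by (intro R_sum R_mult assms) auto
    ultimately show ?thesis
      using assms by (auto intro!: R_diff R_mult R_minus R_of_nat)
  qed
qed

end

lemma fps_of_poly_reflect_roots:
  "fps_of_poly (reflect_poly (\<Prod>x\<in>#A. [:- x, 1:])) = newton_fps A"
proof (induction A)
  case (add x A)
  have 1: "reflect_poly [:- x, 1:] = [:1, - x:]" by (simp add: reflect_poly_def)
  have "fps_of_poly [:1, - x:] = 1 - fps_const x * fps_X"
    by (simp add: fps_of_poly_pCons mult.commute)
  moreover have "(\<Prod>y\<in>#add_mset x A. [:- y, 1:]) = [:- x, 1:] * (\<Prod>y\<in>#A. [:- y, 1:])" by (simp del: mult_pCons_left)
  ultimately show ?case using add by (simp only: reflect_poly_mult 1 fps_of_poly_mult) (simp add: newton_fps_def)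
qed (simp add: newton_fps_def)

lemma roots_poly_monic:
  fixes A :: "'a::field_char_0 multiset"
  shows "lead_coeff (\<Prod>x\<in>#A. [:- x, 1:]) = 1" "degree (\<Prod>x\<in>#A. [:- x, 1:]) = size A"
proof -
  show "degree (\<Prod>x\<in>#A. [:- x, 1:]) = size A"
  proof (induction A)
    case (add x A)
    have "(\<Prod>x\<in>#A. [:- x, 1:]) \<noteq> 0" by (auto simp: prod_mset_zero_iff)
    then show ?case using add by (simp add: degree_mult_eq del: mult_pCons_left)
  qed simp
  show "lead_coeff (\<Prod>x\<in>#A. [:- x, 1:]) = 1"
  proof (induction A)
    case (add x A)
    have "lead_coeff ([:- x, 1:] * (\<Prod>y\<in>#A. [:- y, 1:])) = 1"
      unfolding lead_coeff_mult add.IH by simp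
    then show ?case by (simp del: mult_pCons_left)
  qed simp
qed

lemma roots_poly_coeff:
  fixes A :: "'a::field_char_0 multiset"
  defines "p \<equiv> (\<Prod>x\<in>#A. [:- x, 1:])"
  shows "newton_fps A $ n = (if n \<le> size A then coeff p (size A - n) else 0)"
    "j \<le> size A \<Longrightarrow> coeff p j = newton_fps A $ (size A - j)"
proof -
  have "fps_of_poly (reflect_poly p) $ n = newton_fps A $ n" for n
    using fps_of_poly_reflect_roots[of A] by (simp add: p_def)
  then have *: "coeff (reflect_poly p) n = newton_fps A $ n" for n by simp
  show "newton_fps A $ n = (if n \<le> size A then coeff p (size A - n) else 0)"
    using *[of n, symmetric] roots_poly_monic(2)[of A] by (simp add: coeff_reflect_poly p_def)
  show "j \<le> size A \<Longrightarrow> coeff p j = newton_fps A $ (size A - j)"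
    using *[of "size A - j", symmetric] roots_poly_monic(2)[of A] by (simp add: coeff_reflect_poly p_def)
qed

lemma subfield_to_ac: "subfield_char_0 (range (to_ac :: 'k::field_char_0 \<Rightarrow> _))"
proof
  show "1 \<in> range (to_ac :: 'k \<Rightarrow> _)" by (rule image_eqI[of _ _ 1]) auto
  show "x - y \<in> range (to_ac :: 'k \<Rightarrow> _)" "x * y \<in> range (to_ac :: 'k \<Rightarrow> _)"
    if "x \<in> range (to_ac :: 'k \<Rightarrow> _)" "y \<in> range (to_ac :: 'k \<Rightarrow> _)" for x y
    using that by (auto simp flip: to_ac_diff to_ac_mult)
  show "inverse x \<in> range (to_ac :: 'k \<Rightarrow> _)" if "x \<in> range (to_ac :: 'k \<Rightarrow> _)" for x
    using that by (auto simp flip: to_ac_inverse)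
qed

text \<open>Coefficients and power sums determine each other rationally in characteristic 0. Power
  sums serve as criterion for a polynomial over \<open>K\<close> because those of the pairwise
  products of roots are easily computed.\<close>

lemma power_sum_to_ac_iff:
  fixes A :: "'k::field_char_0 alg_closure multiset"
  shows "(\<forall>n. power_sum A n \<in> range to_ac) \<longleftrightarrow> (\<exists>p. map_poly to_ac p = (\<Prod>x\<in>#A. [:- x, 1:]))"
proof -
  interpret subfield_char_0 "range (to_ac :: 'k \<Rightarrow> _)" by (rule subfield_to_ac)
  let ?p = "\<Prod>x\<in>#A. [:- x, 1:]"
  have "(\<forall>n. power_sum A n \<in> range to_ac) \<longleftrightarrow> (\<forall>n. newton_fps A $ n \<in> range to_ac)"
    using newton_fps_in_R power_sum_in_R by blast
  also have "\<dots> \<longleftrightarrow> (\<forall>j. coeff ?p j \<in> range to_ac)"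
  proof (intro iffI allI)
    fix j assume *: "\<forall>n. newton_fps A $ n \<in> range to_ac"
    show "coeff ?p j \<in> range to_ac"
    proof (cases "j \<le> size A")
      case True
      then show ?thesis using * roots_poly_coeff(2)[of j A] by simp
    next
      case False
      then show ?thesis using roots_poly_monic(2)[of A] R_0 by (simp add: coeff_eq_0)
    qed
  next
    fix n assume "\<forall>j. coeff ?p j \<in> range to_ac"
    then show "newton_fps A $ n \<in> range to_ac" using roots_poly_coeff(1)[of A n] R_0 by auto
  qed
  also have "\<dots> \<longleftrightarrow> (\<exists>p. map_poly to_ac p = ?p)"
  proof
    assume *: "\<forall>j. coeff ?p j \<in> range (to_ac :: 'k \<Rightarrow> _)"
    define p where "p = map_poly (inv_into UNIV (to_ac :: 'k \<Rightarrow> _)) ?p"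
    have 0: "inv_into UNIV (to_ac :: 'k \<Rightarrow> _) 0 = 0" by (metis to_ac_0 inv_into_f_f inj_to_ac UNIV_I)
    have "map_poly to_ac p = ?p"
      using * by (intro poly_eqI) (auto simp: p_def coeff_map_poly 0 f_inv_into_f)
    then show "\<exists>p. map_poly to_ac p = ?p" by blast
  next
    assume "\<exists>p. map_poly to_ac p = ?p"
    then show "\<forall>j. coeff ?p j \<in> range (to_ac :: 'k \<Rightarrow> _)" by (metis coeff_map_poly rangeI to_ac_0)
  qed
  finally show ?thesis .
qed

lemma poly_map_to_ac: "poly (map_poly to_ac p) (to_ac x) = to_ac (poly p x)"
  by (induction p) (auto simp: map_poly_pCons)

lemma root_in_roots: "poly (\<Prod>x\<in>#A. [:- x, 1:]) z = 0 \<Longrightarrow> z \<in># (A :: 'a::field multiset)"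
  by (induction A) auto

section \<open>Roots in K(i) of polynomials over a real closed field K\<close>

locale real_closed =
  fixes P :: "'k::field_char_0 set"
  assumes P: "field_ordering P" and P_square: "a \<in> P \<Longrightarrow> \<exists>b. a = b ^ 2"
    and odd_root: "odd (degree (p :: 'k poly)) \<Longrightarrow> \<exists>x. poly p x = 0"
begin

lemma sum_squares_0: fixes a c :: 'k assumes "a * a + c * c = 0" shows "a = 0"
proof -
  have "- (a * a) = c * c" using assms by (simp add: neg_eq_iff_add_eq_0)
  then have "- (a * a) \<in> P" using field_ordering_square[OF P, of c] by simp
  then have "a * a = 0" using field_ordering_antisym[OF P] field_ordering_square[OF P] by blast
  then show ?thesis by simp
qed

definition im :: "'k alg_closure" where
  "im = (SOME i. i * i = - 1)"

lemma im_square: "im * im = - 1"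
proof -
  obtain x where "poly [:1, 0, 1 :: 'k alg_closure:] x = 0"
    using alg_closed_imp_poly_has_root[of "[:1, 0, 1 :: 'k alg_closure:]"] by auto
  then have "x * x = - 1" by (simp add: eq_neg_iff_add_eq_0 add.commute)
  then show ?thesis unfolding im_def by (rule someI)
qed

definition Cx :: "'k alg_closure set" where
  "Cx = {to_ac a + im * to_ac c | a c. True}"

lemma to_ac_Cx: "to_ac a \<in> Cx"
proof -
  have "to_ac a = to_ac a + im * to_ac 0" by simp
  then show ?thesis unfolding Cx_def by blast
qed

lemma subfield_Cx: "subfield_char_0 Cx"
proof
  show "1 \<in> Cx" using to_ac_Cx[of 1] by simp
  fix x y assume "x \<in> Cx" "y \<in> Cx"
  then obtain a c d e where xy: "x = to_ac a + im * to_ac c" "y = to_ac d + im * to_ac e" by (auto simp: Cx_def)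
  have "x - y = to_ac (a - d) + im * to_ac (c - e)" by (simp add: xy algebra_simps)
  then show "x - y \<in> Cx" unfolding Cx_def by blast
  have "x * y = to_ac a * to_ac d + (im * im) * (to_ac c * to_ac e) + im * (to_ac a * to_ac e + to_ac c * to_ac d)"
    by (simp add: xy algebra_simps)
  also have "\<dots> = to_ac (a * d - c * e) + im * to_ac (a * e + c * d)" by (simp add: im_square)
  finally show "x * y \<in> Cx" unfolding Cx_def by blast
next
  fix x assume "x \<in> Cx"
  then obtain a c where x: "x = to_ac a + im * to_ac c" by (auto simp: Cx_def)
  show "inverse x \<in> Cx"
  proof (cases "a * a + c * c = 0")
    case True
    then have "a = 0" "c = 0" using sum_squares_0[of a c] sum_squares_0[of c a] by (auto simp: add.commute)
    then show ?thesis using x to_ac_Cx[of 0] by simp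
  next
    case False
    define n where "n = a * a + c * c"
    have "x * (to_ac (a / n) + im * to_ac (- c / n)) =
        to_ac a * to_ac (a / n) - (im * im) * (to_ac c * to_ac (c / n)) + im * (to_ac c * to_ac (a / n) - to_ac a * to_ac (c / n))"
      by (simp add: x algebra_simps del: to_ac_divide)
    also have "\<dots> = to_ac (a * (a / n) + c * (c / n)) + im * to_ac (c * (a / n) - a * (c / n))"
      by (simp add: im_square)
    also have "a * (a / n) + c * (c / n) = 1" using False by (simp add: n_def flip: add_divide_distrib)
    also have "c * (a / n) - a * (c / n) = 0" by simp
    finally have "inverse x = to_ac (a / n) + im * to_ac (- c / n)" by (simp add: inverse_unique)
    then show ?thesis unfolding Cx_def by blast
  qed
qed

text \<open>With \<open>r\<close> the absolute value of \<open>z\<close>, the parts of the root are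
  square roots of \<open>(r + a) / 2\<close> and \<open>(r - a) / 2\<close>, with a sign fixed by
  \<open>c\<close>. Both radicands are nonnegative: their product is \<open>c * c / 4\<close>, and
  their sum \<open>r\<close> is nonnegative.\<close>

lemma Cx_sqrt: assumes "z \<in> Cx" shows "\<exists>w\<in>Cx. w * w = z"
proof -
  interpret subfield_char_0 Cx by (rule subfield_Cx)
  obtain a c where z: "z = to_ac a + im * to_ac c" using assms by (auto simp: Cx_def)
  obtain r0 where r0: "a * a + c * c = r0 ^ 2"
    using P_square[OF field_ordering_add[OF P field_ordering_square[OF P] field_ordering_square[OF P]]] by blast
  define r where "r = (if r0 \<in> P then r0 else - r0)"
  have r: "r * r = a * a + c * c" "r \<in> P"
    using r0 field_ordering_total[OF P, of r0] by (auto simp: r_def power2_eq_square)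
  have half: "1 / 2 \<in> P"
  proof -
    have "(1 / 2) = (1/2) * (1/2) + (1/2) * (1/2 :: 'k)" by simp
    then show ?thesis using field_ordering_add[OF P] field_ordering_square[OF P] by metis
  qed
  have prod: "(r + a) * (r - a) = c * c" using r(1) by (simp add: algebra_simps)
  have nn: "r + e \<in> P" if e: "(r + e) * (r - e) = c * c" for e
  proof (rule ccontr)
    assume "r + e \<notin> P"
    then have n: "- (r + e) \<in> P" "r + e \<noteq> 0"
      using field_ordering_total[OF P, of "r + e"] field_ordering_0[OF P] by metis+
    have "r - e = r + r + (- (r + e))" by simp
    then have re: "r - e \<in> P" using field_ordering_add[OF P] n(1) r(2) by metis
    then have "- (c * c) \<in> P" using field_ordering_mult[OF P n(1) re] e by (simp add: algebra_simps)
    then have "(r + e) * (r - e) = 0" using e field_ordering_antisym[OF P field_ordering_square[OF P]] by simp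
    then have "r - e = 0" using n(2) by simp
    then have "- (r + r) \<in> P" using n(1) by simp
    then have "r + r = 0" using field_ordering_antisym[OF P field_ordering_add[OF P r(2) r(2)]] by simp
    then have "r = 0" by (metis add_self_div_2 div_0 double_zero mult_2 mult_eq_0_iff zero_neq_numeral)
    then show False using n(2) \<open>r - e = 0\<close> by simp
  qed
  have "(r + a) * (1/2) \<in> P" "(r - a) * (1/2) \<in> P"
    using field_ordering_mult[OF P nn[of a, OF prod] half] field_ordering_mult[OF P nn[of "-a"] half] prod
    by (simp_all add: mult.commute)
  then obtain x y where xy: "(r + a) * (1/2) = x ^ 2" "(r - a) * (1/2) = y ^ 2" using P_square by metis
  have "(2 * x * y) ^ 2 = 4 * x ^ 2 * y ^ 2" by (simp add: power_mult_distrib)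
  also have "\<dots> = 4 * ((r + a) * (1/2)) * ((r - a) * (1/2))" unfolding xy ..
  also have "\<dots> = c ^ 2"
  proof -
    have "4 * (A * (1/2)) * (B * (1/2)) = A * B" for A B :: 'k by simp
    then show ?thesis using prod by (simp only: power2_eq_square)
  qed
  finally have "2 * x * y = c \<or> 2 * x * y = - c" by (simp add: power2_eq_iff)
  moreover have "x ^ 2 - y ^ 2 = a" unfolding xy[symmetric] by (simp add: field_simps)
  ultimately obtain y' where y': "2 * x * y' = c" "x * x - y' * y' = a"
    by (auto simp: power2_eq_square) (metis minus_mult_minus mult_minus_right minus_minus)
  define w where "w = to_ac x + im * to_ac y'"
  have "w * w = to_ac x * to_ac x + (im * im) * (to_ac y' * to_ac y') + im * (2 * to_ac x * to_ac y')"
    by (simp add: w_def algebra_simps)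
  also have "\<dots> = to_ac (x * x - y' * y') + im * to_ac (2 * x * y')" by (simp add: im_square)
  finally have "w * w = z" by (simp add: y' z)
  moreover have "w \<in> Cx" unfolding w_def Cx_def by blast
  ultimately show ?thesis by blast
qed

text \<open>\<open>x - y\<close> is a square root of the discriminant, which lies in
  \<open>Cx\<close>.\<close>

lemma Cx_quadratic:
  assumes "x + y \<in> Cx" "x * y \<in> Cx" shows "x \<in> Cx"
proof -
  interpret subfield_char_0 Cx by (rule subfield_Cx)
  have "(x + y) * (x + y) - 4 * (x * y) \<in> Cx" by (intro R_diff R_mult R_numeral assms)
  then obtain w where w: "w \<in> Cx" "w * w = (x + y) * (x + y) - 4 * (x * y)" using Cx_sqrt by blast
  then have "w ^ 2 = (x - y) ^ 2" by (simp add: power2_eq_square algebra_simps)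
  then have "w = x - y \<or> w = - (x - y)" by (simp add: power2_eq_iff)
  then have "x - y \<in> Cx" using w(1) R_minus[OF w(1)] by (metis minus_minus)
  then have "((x + y) + (x - y)) / 2 \<in> Cx" by (intro R_divide R_add R_numeral assms)
  then show ?thesis by simp
qed

text \<open>
  Laplace's proof of the fundamental theorem of algebra: the products \<open>(x\<^sub>i + c) (x\<^sub>j + c)\<close>
  with \<open>i < j\<close> are the roots of a polynomial whose degree is divisible by a smaller power of two.
\<close>

lemma root_in_Cx:
  assumes "length xs = 2 ^ k * l" "odd l" "\<And>n. power_sum (mset xs) n \<in> range to_ac"
  shows "\<exists>x\<in>set xs. x \<in> Cx"
  using assms
proof (induction k arbitrary: xs l)
  case 0
  obtain p where p: "map_poly to_ac p = (\<Prod>x\<in>#mset xs. [:- x, 1:])" using 0(3) power_sum_to_ac_iff by blast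
  have "degree p = size (mset xs)"
    unfolding roots_poly_monic(2)[of "mset xs", symmetric] p[symmetric]
    by (rule degree_map_poly[symmetric]) auto
  then have "odd (degree p)" using 0 by simp
  then obtain x where "poly p x = 0" using odd_root by blast
  then have "poly (\<Prod>x\<in>#mset xs. [:- x, 1:]) (to_ac x) = 0" unfolding p[symmetric] poly_map_to_ac by simp
  then have "to_ac x \<in> set xs" using root_in_roots[of "mset xs"] by simp
  then show ?case using to_ac_Cx by blast
next
  case (Suc k)
  interpret K: subfield_char_0 "range (to_ac :: 'k \<Rightarrow> _)" by (rule subfield_to_ac)
  interpret C: subfield_char_0 Cx by (rule subfield_Cx)
  define d where "d = length xs"
  \<comment> \<open>Unordered pairs of distinct positions; positions instead of roots keep
    multiplicities.\<close>
  define I where "I = {(i, j). i < j \<and> j < d}"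
  have "I \<subseteq> {..<d} \<times> {..<d}" by (auto simp: I_def)
  then have finI: "finite I" using finite_subset by blast
  have pair_sum: "(\<Sum>i<d. \<Sum>j<d. y i * y j) = (\<Sum>i<d. y i * y i) + 2 * (\<Sum>(i, j)\<in>I. y i * y j)" for y :: "nat \<Rightarrow> 'k alg_closure"
  proof -
    have "(\<Sum>i<d. \<Sum>j<d. y i * y j) = (\<Sum>(i, j)\<in>{..<d} \<times> {..<d}. y i * y j)" by (simp add: sum.cartesian_product)
    also have "{..<d} \<times> {..<d} = (\<lambda>i. (i, i)) ` {..<d} \<union> (I \<union> prod.swap ` I)"
      by (auto simp: I_def image_iff)
    also have "(\<Sum>(i, j)\<in>\<dots>. y i * y j) = (\<Sum>(i, j)\<in>(\<lambda>i. (i, i)) ` {..<d}. y i * y j) + (\<Sum>(i, j)\<in>I \<union> prod.swap ` I. y i * y j)"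
      using finI by (intro sum.union_disjoint) (auto simp: I_def)
    also have "(\<Sum>(i, j)\<in>I \<union> prod.swap ` I. y i * y j) = (\<Sum>(i, j)\<in>I. y i * y j) + (\<Sum>(i, j)\<in>prod.swap ` I. y i * y j)"
      using finI by (intro sum.union_disjoint) (auto simp: I_def)
    also have "(\<Sum>(i, j)\<in>prod.swap ` I. y i * y j) = (\<Sum>(i, j)\<in>I. y i * y j)"
      by (subst sum.reindex) (auto simp: case_prod_unfold mult.commute)
    also have "(\<Sum>(i, j)\<in>(\<lambda>i. (i, i)) ` {..<d}. y i * y j) = (\<Sum>i<d. y i * y i)"
      by (subst sum.reindex) (auto simp: inj_on_def)
    finally show ?thesis by simp
  qed
  obtain ps where ps: "set ps = I" "distinct ps" using finite_distinct_list[OF finI] by blast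
  have "card ({..<d} \<times> {..<d}) = card ((\<lambda>i. (i, i)) ` {..<d} \<union> (I \<union> prod.swap ` I))"
    by (rule arg_cong[where f = card]) (auto simp: I_def image_iff)
  moreover have swap: "card (prod.swap ` I) = card I" by (intro card_image) (auto simp: inj_on_def)
  moreover have "card ((\<lambda>i. (i, i)) ` {..<d} \<union> (I \<union> prod.swap ` I)) = d + (card I + card I)"
    using finI swap by (subst card_Un_disjoint, simp, simp, (auto simp: I_def)[1],
      subst card_Un_disjoint, simp, simp, (auto simp: I_def)[1]) (simp add: card_image inj_on_def)
  ultimately have "d * d = d + 2 * card I" by simp
  \<comment> \<open>The number of pairs is \<open>d * (d - 1) / 2\<close> with \<open>d\<close> even
    and positive, so \<open>d - 1\<close> is odd and the power of two drops by exactly one.\<close>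
  then have "2 * card I = d * (d - 1)" by (simp add: diff_mult_distrib2)
  also have "\<dots> = 2 * (2 ^ k * (l * (d - 1)))" using Suc.prems(1) by (simp add: d_def)
  finally have "length ps = 2 ^ k * (l * (d - 1))" using ps distinct_card[of ps] by simp
  moreover have "even d" "d > 0" using Suc.prems by (auto simp: d_def intro: Nat.gr0I)
  then have "odd (l * (d - 1))" using Suc.prems(2) by simp
  ultimately have len: "length ps = 2 ^ k * (l * (d - 1))" "odd (l * (d - 1))" .
  have ex: "\<exists>ij\<in>I. (xs ! fst ij + of_nat c) * (xs ! snd ij + of_nat c) \<in> Cx" for c
  proof -
    define y where "y i = xs ! i + of_nat c" for i
    define ys where "ys = map (\<lambda>(i, j). y i * y j) ps"
    have shift: "(\<Sum>i<d. y i ^ n) \<in> range to_ac" for n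
    proof -
      have "(\<Sum>i<d. y i ^ n) = (\<Sum>i<d. \<Sum>m\<le>n. of_nat (n choose m) * (xs ! i) ^ m * of_nat c ^ (n - m))"
        by (simp add: y_def binomial_ring)
      also have "\<dots> = (\<Sum>m\<le>n. of_nat (n choose m) * of_nat c ^ (n - m) * (\<Sum>i<d. (xs ! i) ^ m))"
        by (subst sum.swap) (simp add: sum_distrib_left algebra_simps)
      also have "\<dots> \<in> range to_ac"
      proof (rule K.R_sum, rule K.R_mult, intro K.R_mult K.R_of_nat K.R_power)
        fix m
        have "(\<Sum>i<d. (xs ! i) ^ m) = power_sum (mset xs) m"
          by (simp add: power_sum_def d_def sum_mset_sum_list sum_list_sum_nth atLeast0LessThan flip: mset_map)
        then show "(\<Sum>i<d. (xs ! i) ^ m) \<in> range (to_ac :: 'k \<Rightarrow> _)" using Suc.prems(3) by simp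
      qed
      finally show ?thesis .
    qed
    have "power_sum (mset ys) n \<in> range to_ac" for n
    proof -
      have "power_sum (mset ys) n = (\<Sum>(i, j)\<in>I. y i ^ n * y j ^ n)"
        using ps by (simp add: power_sum_def ys_def sum_mset_sum_list sum_list_distinct_conv_sum_set
            case_prod_unfold power_mult_distrib comp_def flip: mset_map)
      \<comment> \<open>The square of a power sum counts each pair twice, and its diagonal is the
        power sum of the doubled exponent.\<close>
      also have "\<dots> = ((\<Sum>i<d. y i ^ n) * (\<Sum>i<d. y i ^ n) - (\<Sum>i<d. y i ^ (2 * n))) / 2"
      proof -
        have "(\<Sum>i<d. y i ^ n) * (\<Sum>i<d. y i ^ n) = (\<Sum>i<d. \<Sum>j<d. y i ^ n * y j ^ n)"
          by (rule sum_product)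
        also have "\<dots> = (\<Sum>i<d. y i ^ n * y i ^ n) + 2 * (\<Sum>(i, j)\<in>I. y i ^ n * y j ^ n)"
          by (rule pair_sum)
        also have "(\<Sum>i<d. y i ^ n * y i ^ n) = (\<Sum>i<d. y i ^ (2 * n))"
          by (simp only: mult_2 power_add)
        finally show ?thesis by simp
      qed
      finally show ?thesis by (simp only:) (intro K.R_divide K.R_diff K.R_mult K.R_numeral shift)
    qed
    then have "\<exists>x\<in>set ys. x \<in> Cx"
      using len by (intro Suc.IH[of ys "l * (d - 1)"]) (auto simp: ys_def)
    then obtain ij where "ij \<in> I" "y (fst ij) * y (snd ij) \<in> Cx" using ps by (auto simp: ys_def)
    then show ?thesis unfolding y_def by blast
  qed
  \<comment> \<open>There are infinitely many \<open>c\<close> and finitely many pairs, so one pair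
    serves two values \<open>c\<close> and \<open>e\<close>. The two products determine
    \<open>x + y\<close> and \<open>x * y\<close> in \<open>Cx\<close>, and a quadratic equation
    over \<open>Cx\<close> has its roots there.\<close>
  define g where "g c = (SOME ij. ij \<in> I \<and> (xs ! fst ij + of_nat c) * (xs ! snd ij + of_nat c) \<in> Cx)" for c
  have g: "g c \<in> I" "(xs ! fst (g c) + of_nat c) * (xs ! snd (g c) + of_nat c) \<in> Cx" for c
    using someI_ex[of "\<lambda>ij. ij \<in> I \<and> (xs ! fst ij + of_nat c) * (xs ! snd ij + of_nat c) \<in> Cx"] ex[of c]
    unfolding g_def by blast+
  have "\<not> inj_on g UNIV"
    using g(1) finI by (metis finite_imageD finite_subset image_subsetI infinite_UNIV_nat)
  then obtain c e where ce: "c \<noteq> e" "g c = g e" by (auto simp: inj_on_def)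
  define x where "x = xs ! fst (g c)"
  define y where "y = xs ! snd (g c)"
  have c1: "(x + of_nat c) * (y + of_nat c) \<in> Cx" "(x + of_nat e) * (y + of_nat e) \<in> Cx"
    using g(2)[of c] g(2)[of e] ce(2) by (auto simp: x_def y_def)
  have nz: "of_nat c - of_nat e \<noteq> (0 :: 'k alg_closure)" using ce(1) by simp
  have "x + y = ((x + of_nat c) * (y + of_nat c) - (x + of_nat e) * (y + of_nat e)) / (of_nat c - of_nat e) - (of_nat c + of_nat e)"
    using nz by (simp add: field_simps)
  then have s: "x + y \<in> Cx" using c1 by (auto intro!: C.R_diff C.R_divide C.R_add C.R_of_nat)
  have "x * y = (x + of_nat c) * (y + of_nat c) - of_nat c * (x + y) - of_nat c * of_nat c"
    by (simp add: algebra_simps)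
  then have "x * y \<in> Cx" using c1 s by (auto intro!: C.R_diff C.R_mult C.R_of_nat)
  then have "x \<in> Cx" using s Cx_quadratic by blast
  moreover have "x \<in> set xs" using g(1)[of c] by (auto simp: x_def I_def d_def)
  ultimately show ?case by blast
qed

lemma irreducible_cases:
  fixes p :: "'k poly"
  assumes p: "irreducible p" "lead_coeff p = 1"
  shows "(\<exists>a. p = [:- a, 1:]) \<or> (\<exists>a c. c \<noteq> 0 \<and> p = [:a * a + c * c, - (2 * a), 1:])"
proof -
  let ?q = "map_poly to_ac p"
  have lead: "lead_coeff ?q = 1" "degree ?q = degree p" using p(2)
    by (simp_all add: degree_map_poly coeff_map_poly)
  have dp: "0 < degree p" using p(1) is_unit_iff_degree[of p] by (auto simp: Factorial_Ring.irreducible_def)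
  obtain A where A: "?q = (\<Prod>x\<in>#A. [:- x, 1:])"
    using alg_closed_imp_factorization[of ?q] lead(1) by (cases "?q = 0") auto
  obtain xs where xs: "A = mset xs" by (metis ex_mset)
  have len: "length xs = degree p" using roots_poly_monic(2)[of A] lead(2) A xs by simp
  obtain k l where kl: "length xs = 2 ^ k * l" "odd l"
    using len dp by (metis multiplicity_decompose' not_is_unit_0 not_gr_zero odd_one prime_elem_multiplicity_eq_zero_iff)
  have "\<And>n. power_sum (mset xs) n \<in> range (to_ac :: 'k \<Rightarrow> _)"
    using power_sum_to_ac_iff[of "mset xs"] A xs by metis
  then obtain x where x: "x \<in> set xs" "x \<in> Cx" using root_in_Cx[OF kl] by blast
  obtain a c where ac: "x = to_ac a + im * to_ac c" using x(2) by (auto simp: Cx_def)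
  have "poly (\<Prod>x\<in>#A. [:- x, 1:]) x = 0"
    using x(1) by (simp only: poly_eq_0_iff_dvd xs) (rule dvd_prod_mset, simp)
  then have root: "poly ?q x = 0" using A by simp
  show ?thesis
  proof (cases "c = 0")
    case True
    then have "poly p a = 0" using root ac poly_map_to_ac[of p a] by simp
    then have "[:- a, 1:] dvd p" by (simp add: poly_eq_0_iff_dvd)
    moreover have "irreducible [:- a, 1:]" by (simp add: irreducible_linear_field_poly)
    ultimately have "[:- a, 1:] = p" using p by (intro irreducible_monic_eq) auto
    then show ?thesis by blast
  next
    case False
    let ?r = "[:a * a + c * c, - (2 * a), 1:]"
    have rx: "poly (map_poly to_ac ?r) x = 0"
    proof -
      have "poly (map_poly to_ac ?r) x = to_ac (a * a + c * c) - to_ac (2 * a) * x + x * x"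
        by (simp add: map_poly_pCons algebra_simps)
      also have "\<dots> = to_ac c * to_ac c + (im * im) * (to_ac c * to_ac c)" by (simp add: ac algebra_simps)
      finally show ?thesis by (simp add: im_square)
    qed
    \<comment> \<open>\<open>p\<close> and the quadratic polynomial \<open>?r\<close> share the root
      \<open>x\<close>, so a Bezout identity between them would give \<open>0 = 1\<close> at
      \<open>x\<close>.\<close>
    have "p dvd ?r"
    proof (rule ccontr)
      assume "\<not> p dvd ?r"
      then have "unit_mod p ?r" by (rule unit_mod_irreducible[OF p(1)])
      then obtain v w where "?r * v - 1 = p * w" unfolding unit_mod_def dvd_def by blast
      then have "map_poly to_ac (?r * v) = map_poly to_ac (p * w + 1)" by (simp add: algebra_simps)
      moreover have "map_poly to_ac (f * g) = map_poly to_ac f * map_poly to_ac g" for f g :: "'k poly"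
        by (intro poly_eqI) (simp add: coeff_map_poly coeff_mult to_ac_sum)
      moreover have "map_poly to_ac (f + g) = map_poly to_ac f + map_poly to_ac g" for f g :: "'k poly"
        by (intro poly_eqI) (simp add: coeff_map_poly)
      ultimately have "map_poly to_ac ?r * map_poly to_ac v = ?q * map_poly to_ac w + map_poly to_ac 1" by metis
      then have "poly (map_poly to_ac ?r * map_poly to_ac v) x = poly (?q * map_poly to_ac w + map_poly to_ac 1) x" by simp
      then have "(0 :: 'k alg_closure) = 1" using rx root by (simp del: map_poly_pCons)
      then show False by simp
    qed
    then obtain g where g: "?r = p * g" by blast
    then have nz: "p \<noteq> 0" "g \<noteq> 0" by auto
    have "degree ?r = 2" by simp
    then have deg: "degree p + degree g = 2" using g nz degree_mult_eq[of p g] by metis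
    have "lead_coeff ?r = 1" by simp
    then have lg: "lead_coeff g = 1" using g p(2) lead_coeff_mult[of p g] by (metis mult_1)
    show ?thesis
    proof (cases "degree p = 1")
      case True
      then obtain e f where "p = [:e, f:]" by (metis One_nat_def degree1_coeffs)
      then have "p = [:- (- e), 1:]" using p(2) True by (auto split: if_splits)
      then show ?thesis by blast
    next
      case False
      then have "degree g = 0" using deg dp by simp
      then have "g = 1" using lg by (metis degree_eq_zeroE lead_coeff_pCons(2) coeff_pCons_0 one_pCons)
      then show ?thesis using g \<open>c \<noteq> 0\<close> by auto
    qed
  qed
qed

end


section \<open>Squares and sums of squares modulo prime powers\<close>

text \<open>Newton's step for the equation \<open>u = v\<^sup>2\<close>: the defect
  \<open>p ^ Suc k * g\<close> is removed up to one more factor \<open>p\<close> by adding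
  \<open>p ^ Suc k * t\<close> to \<open>v\<close>, where \<open>2 * v * t\<close> agrees with
  \<open>g\<close> modulo \<open>p\<close>.\<close>

lemma hensel_square:
  fixes p :: "'k::field_char_0 poly"
  assumes w: "unit_mod p w" "p dvd u - w\<^sup>2"
  shows "\<exists>v. unit_mod p v \<and> p ^ Suc k dvd u - v\<^sup>2"
proof (induction k)
  case 0
  then show ?case using w by auto
next
  case (Suc k)
  then obtain v g where v: "unit_mod p v" "u - v\<^sup>2 = p ^ Suc k * g" unfolding dvd_def by blast
  obtain e h where e: "v * e - 1 = p * h" using v(1) unfolding unit_mod_def dvd_def by blast
  define t where "t = smult (1 / 2) (g * e)"
  have "t + t = smult (1 / 2 + 1 / 2) (g * e)" by (simp only: t_def smult_add_left)
  then have t: "2 * t = g * e" by (simp only: mult_2) simp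
  define v' where "v' = v + p ^ Suc k * t"
  have "u - v'\<^sup>2 = (u - v\<^sup>2) - p ^ Suc k * v * (2 * t) - (p ^ Suc k * t)\<^sup>2"
    by (simp add: v'_def power2_eq_square algebra_simps)
  also have "\<dots> = - (p ^ Suc k * g * (v * e - 1)) - (p ^ Suc k * t)\<^sup>2"
    unfolding v(2) t by (simp add: algebra_simps)
  also have "\<dots> = p ^ Suc (Suc k) * (- g * h - p ^ k * t\<^sup>2)"
    unfolding e by (simp add: power2_eq_square algebra_simps)
  finally have "p ^ Suc (Suc k) dvd u - v'\<^sup>2" by simp
  moreover have "unit_mod p v'"
    by (rule unit_mod_cong[OF v(1)]) (simp add: v'_def)
  ultimately show ?case by blast
qed

text \<open>If \<open>u / u'\<close> is a square modulo \<open>p\<close>, then Hensel's lemma makes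
  it a square modulo \<open>p ^ k\<close>. So the classes of units matter only modulo
  \<open>p\<close>.\<close>

lemma meq_residue_square:
  fixes p :: "'k::field_char_0 poly"
  assumes k: "0 < k" and w: "unit_mod p w" and u': "unit_mod p u'" and d: "p dvd u - u' * w\<^sup>2"
  shows "meq (add_mset (p ^ k, u') M) (add_mset (p ^ k, u) M)"
proof -
  have "unit_mod (p ^ k) u'" by (rule unit_mod_power_modulus[OF u'])
  then obtain e where e: "p ^ k dvd u' * e - 1" by (auto simp: unit_mod_def)
  then have "p dvd u' * e - 1" using k by (metis dvd_power dvd_trans)
  then have "p dvd (u - u' * w\<^sup>2) * e + w\<^sup>2 * (u' * e - 1)" using d by (intro dvd_add dvd_mult dvd_mult2)
  then have "p dvd u * e - w\<^sup>2" by (simp add: algebra_simps)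
  then obtain v where v: "unit_mod p v" "p ^ k dvd u * e - v\<^sup>2"
    using hensel_square[OF w, of "u * e" "k - 1"] k by auto
  have "p ^ k dvd u' * (u * e - v\<^sup>2) - u * (u' * e - 1)" by (rule dvd_diff[OF dvd_mult[OF v(2)] dvd_mult[OF e]])
  then have "p ^ k dvd u - u' * v\<^sup>2" by (simp add: algebra_simps)
  then show ?thesis using meq_scale unit_mod_power_modulus v(1) by blast
qed

lemma repeat_mset_plus: "repeat_mset (a + b) M = repeat_mset a M + repeat_mset b M"
  by (intro multiset_eqI) (simp add: distrib_right)

definition scale_mset :: "'k::field poly \<Rightarrow> ('k poly \<times> 'k poly) multiset \<Rightarrow> ('k poly \<times> 'k poly) multiset" where
  "scale_mset w M = image_mset (\<lambda>(m, u). (m, w * u)) M"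

lemma scale_mset_simps [simp]:
  "scale_mset w {#} = {#}" "scale_mset w (add_mset (m, u) M) = add_mset (m, w * u) (scale_mset w M)"
  "scale_mset w (M + N) = scale_mset w M + scale_mset w N"
  "scale_mset w (repeat_mset n M) = repeat_mset n (scale_mset w M)"
  by (simp_all add: scale_mset_def) (induction n; simp)

lemma scale_mset_replicate [simp]: "scale_mset w (replicate_mset n (m, u)) = replicate_mset n (m, w * u)"
  by (simp add: scale_mset_def)

text \<open>Scaling by a unit corresponds to tensoring with a form of rank one, which preserves
  isometries. The multiset has a single modulus, so that one unit suits all entries.\<close>

lemma meq_scale_mset:
  assumes "meq M N" "\<And>a. a \<in># M \<Longrightarrow> fst a = m" "unit_mod m w"
  shows "(\<forall>a\<in>#N. fst a = m) \<and> meq (scale_mset w M) (scale_mset w N)"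
  using assms
proof (induction rule: meq.induct)
  case (meq_refl M)
  then show ?case by (auto intro: meq.meq_refl)
next
  case (meq_scale m' v u' u M)
  have "m' dvd w * u' - w * u * v\<^sup>2" using dvd_mult[OF meq_scale(2), of w] by (simp add: algebra_simps)
  moreover have "m' = m" using meq_scale.prems(1)[of "(m', u)"] by simp
  ultimately show ?case using meq_scale.prems(1) meq.meq_scale[OF meq_scale(1)] by auto
next
  case (meq_pair m' u v M)
  have m: "m' = m" using meq_pair.prems(1)[of "(m', u)"] by simp
  obtain e where e: "m dvd w * e - 1" using meq_pair.prems by (auto simp: unit_mod_def)
  have ue: "unit_mod m e" using e unit_mod_cong[OF unit_mod_1] by (metis dvd_diff_commute mult.commute unit_mod_factor)
  have "unit_mod m (w * (u + v))"
    using unit_mod_mult[OF meq_pair.prems(2)] meq_pair(1) m by blast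
  then have "unit_mod m (w * u + w * v)" unfolding distrib_left .
  then have "meq (add_mset (m, w * u) (add_mset (m, w * v) (scale_mset w M)))
      (add_mset (m, w * u + w * v) (add_mset (m, (w * u) * (w * v) * (w * u + w * v)) (scale_mset w M)))"
    by (rule meq.meq_pair)
  \<comment> \<open>The pair move for the scaled entries produces three factors \<open>w\<close> in
    the product; the square of \<open>e\<close>, an inverse of \<open>w\<close>, removes two of
    them.\<close>
  moreover have "meq (add_mset (m, (w * u) * (w * v) * (w * u + w * v)) (scale_mset w M))
      (add_mset (m, w * (u * v * (u + v))) (scale_mset w M))"
  proof (rule meq.meq_scale[OF ue])
    have "m dvd (w * e - 1) * (- ((w * e + 1) * (w * (u * v * (u + v)))))" using e by simp
    then show "m dvd w * (u * v * (u + v)) - (w * u) * (w * v) * (w * u + w * v) * e\<^sup>2"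
      by (simp add: power2_eq_square algebra_simps)
  qed
  ultimately have "meq (add_mset (m, w * u) (add_mset (m, w * v) (scale_mset w M)))
      (add_mset (m, w * u + w * v) (add_mset (m, w * (u * v * (u + v))) (scale_mset w M)))"
    using meq_add_mset meq_trans by blast
  then have "meq (scale_mset w (add_mset (m', u) (add_mset (m', v) M)))
      (scale_mset w (add_mset (m', u + v) (add_mset (m', u * v * (u + v)) M)))"
    unfolding m scale_mset_simps distrib_left[of w u v] .
  moreover have "fst a = m" if "a \<in># add_mset (m', u + v) (add_mset (m', u * v * (u + v)) M)" for a
    using that meq_pair.prems(1)[of a] m by auto
  ultimately show ?case by blast
next
  case (meq_trans M N L)
  then show ?case using meq.meq_trans by blast
qed

lemma meq_repeat_scale:
  assumes "meq (repeat_mset n {#(m, u)#}) (repeat_mset n {#(m, v)#})" "unit_mod m w"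
  shows "meq (repeat_mset n {#(m, w * u)#}) (repeat_mset n {#(m, w * v)#})"
proof -
  have "fst a = m" if "a \<in># repeat_mset n {#(m, u)#}" for a using that by (simp split: if_splits)
  from meq_scale_mset[OF assms(1) this assms(2)] show ?thesis by simp
qed

lemma meq_repeat_pair:
  assumes "unit_mod m (u + v)"
  shows "meq (repeat_mset n {#(m, u)#} + repeat_mset n {#(m, v)#})
    (repeat_mset n {#(m, u + v)#} + repeat_mset n {#(m, u * v * (u + v))#})"
proof -
  have "meq (repeat_mset n {#(m, u), (m, v)#}) (repeat_mset n {#(m, u + v), (m, u * v * (u + v))#})"
    by (rule meq_repeat[OF meq_pair[OF assms]])
  then show ?thesis by (simp add: repeat_mset_distrib2[symmetric] del: repeat_mset_distrib2)
qed

definition sum_squares :: "'k::field poly list \<Rightarrow> 'k poly" where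
  "sum_squares xs = (\<Sum>x\<leftarrow>xs. x\<^sup>2)"

text \<open>Let \<open>n\<close> copies of 1 become \<open>n\<close> copies of
  \<open>t' = sum_squares xs\<close>. Then \<open>2 * n\<close> copies of 1 become \<open>n\<close>
  each of \<open>t'\<close> and \<open>x\<^sup>2\<close>, then by the pair move \<open>n\<close>
  each of \<open>t\<close> and \<open>t * t'\<close> up to squares, and finally \<open>2 * n\<close>
  copies of \<open>t\<close>, since \<open>t'\<close> can be traded back for 1.\<close>

lemma meq_sum_squares:
  fixes p :: "'k::field_char_0 poly"
  assumes p: "irreducible p" and k: "0 < k" and t: "unit_mod p t" "p dvd t - sum_squares xs"
  shows "\<exists>n\<ge>1. meq (repeat_mset n {#(p ^ k, 1)#}) (repeat_mset n {#(p ^ k, t)#})"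
  using t
proof (induction xs arbitrary: t)
  case Nil
  then show ?case using irreducible_not_unit_mod[OF p] by (auto simp: sum_squares_def)
next
  case (Cons x xs)
  define m where "m = p ^ k"
  define t' where "t' = sum_squares xs"
  have t: "p dvd t - (x\<^sup>2 + t')" using Cons.prems(2) by (simp add: sum_squares_def t'_def)
  \<comment> \<open>If \<open>x\<close> or \<open>t'\<close> vanishes modulo \<open>p\<close>, then
    \<open>t\<close> is a shorter sum of squares or a single square; otherwise both are units, as
    the moves require.\<close>
  consider "p dvd x" | "p dvd t'" "\<not> p dvd x" | "\<not> p dvd t'" "\<not> p dvd x" by blast
  then show ?case
  proof cases
    case 1
    then have "p dvd (t - (x\<^sup>2 + t')) + x * x" using t by (intro dvd_add) auto
    then have "p dvd t - sum_squares xs" by (simp add: t'_def power2_eq_square algebra_simps)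
    then show ?thesis using Cons by blast
  next
    case 2
    then have "p dvd (t - (x\<^sup>2 + t')) + t'" using t by (intro dvd_add)
    then have "p dvd t - 1 * x\<^sup>2" by (simp add: algebra_simps)
    then have "meq {#(p ^ k, 1)#} {#(p ^ k, t)#}"
      using meq_residue_square[OF k unit_mod_irreducible[OF p 2(2)] unit_mod_1] by blast
    then show ?thesis by (intro exI[of _ 1]) simp
  next
    case 3
    have u: "unit_mod p x" "unit_mod p t'" using unit_mod_irreducible[OF p] 3 by auto
    then have um: "unit_mod m x" "unit_mod m t'" "unit_mod m t"
      unfolding m_def using unit_mod_power_modulus Cons.prems by blast+
    obtain n where n: "n \<ge> 1" "meq (repeat_mset n {#(m, 1)#}) (repeat_mset n {#(m, t')#})"
      using Cons.IH[of t'] u(2) by (auto simp: t'_def m_def)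
    have "p dvd - (t - (x\<^sup>2 + t'))" unfolding dvd_minus_iff by (rule t)
    then have tt: "p dvd (t' + x\<^sup>2) - t * 1\<^sup>2" by (simp add: algebra_simps)
    have utx: "unit_mod p (t' + x\<^sup>2)"
      using unit_mod_cong[OF Cons.prems(1), of "t' + x\<^sup>2"] t by (simp add: add.commute)
    have x2: "meq (repeat_mset n {#(m, 1)#}) (repeat_mset n {#(m, x\<^sup>2)#})"
      by (intro meq_repeat meq_scale[OF um(1)]) simp
    have t'1: "meq (repeat_mset n {#(m, t')#}) (repeat_mset n {#(m, 1)#})"
    proof -
      have "meq (repeat_mset n {#(m, t' * 1)#}) (repeat_mset n {#(m, t' * t')#})"
        by (rule meq_repeat_scale[OF n(2) um(2)])
      moreover obtain e where e: "m dvd t' * e - 1" using um(2) by (auto simp: unit_mod_def)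
      have ue: "unit_mod m e" using e unit_mod_cong[OF unit_mod_1] by (metis dvd_diff_commute mult.commute unit_mod_factor)
      have "m dvd (t' * e - 1) * (- (t' * e + 1))" using e by simp
      then have "m dvd 1 - t' * t' * e\<^sup>2" by (simp add: power2_eq_square algebra_simps)
      then have "meq (repeat_mset n {#(m, t' * t')#}) (repeat_mset n {#(m, 1)#})"
        by (intro meq_repeat meq_scale[OF ue])
      ultimately show ?thesis using meq_trans by simp
    qed
    have "meq (repeat_mset n {#(m, t')#} + repeat_mset n {#(m, x\<^sup>2)#})
        (repeat_mset n {#(m, t' + x\<^sup>2)#} + repeat_mset n {#(m, t' * x\<^sup>2 * (t' + x\<^sup>2))#})"
      using utx by (intro meq_repeat_pair) (simp add: m_def unit_mod_power_modulus)
    moreover have "meq {#(m, t' + x\<^sup>2)#} {#(m, t)#}"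
      unfolding m_def using tt by (intro meq_residue_square[OF k unit_mod_1 utx])
        (metis dvd_diff_commute mult.right_neutral one_power2)
    moreover have "meq {#(m, t' * x\<^sup>2 * (t' + x\<^sup>2))#} {#(m, t * t')#}"
    proof -
      obtain e where e: "p dvd x * e - 1" using u(1) by (auto simp: unit_mod_def)
      have ue: "unit_mod p e" using e unit_mod_cong[OF unit_mod_1] by (metis dvd_diff_commute mult.commute unit_mod_factor)
      have "p dvd (t - (x\<^sup>2 + t')) * t' - (x * e - 1) * ((x * e + 1) * (t' * (t' + x\<^sup>2)))"
        by (rule dvd_diff[OF dvd_mult2[OF t] dvd_mult2[OF e]])
      then have "p dvd t * t' - t' * x\<^sup>2 * (t' + x\<^sup>2) * e\<^sup>2" by (simp add: power2_eq_square algebra_simps)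
      then show ?thesis unfolding m_def
        by (intro meq_residue_square[OF k ue]) (intro unit_mod_mult unit_mod_power u utx)
    qed
    moreover have "meq (repeat_mset n {#(m, t * t')#}) (repeat_mset n {#(m, t)#})"
      using meq_repeat_scale[OF t'1 um(3)] by simp
    ultimately have "meq (repeat_mset n {#(m, t')#} + repeat_mset n {#(m, x\<^sup>2)#})
        (repeat_mset n {#(m, t)#} + repeat_mset n {#(m, t)#})"
      by (meson meq_trans meq_add2 meq_repeat)
    then have "meq (repeat_mset n {#(m, 1)#} + repeat_mset n {#(m, 1)#})
        (repeat_mset n {#(m, t)#} + repeat_mset n {#(m, t)#})"
      using meq_add2[OF n(2) x2] meq_trans by blast
    then have "meq (repeat_mset (n + n) {#(m, 1)#}) (repeat_mset (n + n) {#(m, t)#})"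
      unfolding repeat_mset_plus .
    moreover have "n + n \<ge> 1" using n(1) by simp
    ultimately show ?thesis unfolding m_def by blast
  qed
qed

section \<open>Orderings of residue fields\<close>

text \<open>Preorders of the field \<open>K[X]/(p)\<close>, pulled back to \<open>K[X]\<close>; by
  \<open>Q_add\<close> and \<open>Q_dvd\<close> they are unions of residue classes.\<close>

locale residue_preorder =
  fixes p :: "'k::field_char_0 poly" and Q :: "'k poly set"
  assumes Q_add: "f \<in> Q \<Longrightarrow> g \<in> Q \<Longrightarrow> f + g \<in> Q" and Q_mult: "f \<in> Q \<Longrightarrow> g \<in> Q \<Longrightarrow> f * g \<in> Q"
    and Q_square: "f\<^sup>2 \<in> Q" and Q_dvd: "p dvd f \<Longrightarrow> f \<in> Q" and Q_proper: "- 1 \<notin> Q"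

locale residue_ordering = residue_preorder +
  assumes Q_total: "f \<in> Q \<or> - f \<in> Q" and Q_antisym: "f \<in> Q \<Longrightarrow> - f \<in> Q \<Longrightarrow> p dvd f"

text \<open>Artin and Schreier: a maximal preorder is total. If neither \<open>f\<close> nor
  \<open>- f\<close> belongs to \<open>Q\<close>, then by maximality -1 is both
  \<open>a + f * c\<close> and \<open>d - f * e\<close> with \<open>a\<close>, \<open>c\<close>,
  \<open>d\<close>, \<open>e\<close> in \<open>Q\<close>, and multiplying \<open>f * c\<close> by
  \<open>f * e\<close> puts -1 into \<open>Q\<close>.\<close>

lemma residue_ordering_extension:
  assumes p: "irreducible p" and "residue_preorder p Q0"
  shows "\<exists>Q. Q0 \<subseteq> Q \<and> residue_ordering p Q"
proof -
  define \<C> where "\<C> = {Q. Q0 \<subseteq> Q \<and> residue_preorder p Q}"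
  have "\<exists>Q\<in>\<C>. \<forall>Q'\<in>\<C>. Q \<subseteq> Q' \<longrightarrow> Q' = Q"
  proof (rule subset_Zorn_nonempty)
    show "\<C> \<noteq> {}" using assms(2) by (auto simp: \<C>_def)
    fix C assume C: "C \<noteq> {}" "subset.chain \<C> C"
    have CC: "residue_preorder p Q" "Q0 \<subseteq> Q" if "Q \<in> C" for Q
      using C(2) that by (auto simp: subset.chain_def \<C>_def)
    have two: "\<exists>Q\<in>C. f \<in> Q \<and> g \<in> Q" if "f \<in> \<Union>C" "g \<in> \<Union>C" for f g
    proof -
      obtain A B where AB: "A \<in> C" "B \<in> C" "f \<in> A" "g \<in> B" using \<open>f \<in> \<Union>C\<close> \<open>g \<in> \<Union>C\<close> by blast
      then have "A \<subseteq> B \<or> B \<subseteq> A" using C(2) by (auto simp: subset.chain_def)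
      then show ?thesis using AB by blast
    qed
    obtain A where A: "A \<in> C" using C(1) by blast
    have "residue_preorder p (\<Union>C)"
    proof
      show "f + g \<in> \<Union>C" "f * g \<in> \<Union>C" if "f \<in> \<Union>C" "g \<in> \<Union>C" for f g
        using two[OF that] CC(1) residue_preorder.Q_add residue_preorder.Q_mult by blast+
      show "f\<^sup>2 \<in> \<Union>C" for f using residue_preorder.Q_square[OF CC(1)[OF A]] A by blast
      show "f \<in> \<Union>C" if "p dvd f" for f using residue_preorder.Q_dvd[OF CC(1)[OF A] that] A by blast
      show "- 1 \<notin> \<Union>C" using residue_preorder.Q_proper[OF CC(1)] by blast
    qed
    then show "\<Union>C \<in> \<C>" using CC(2) A by (auto simp: \<C>_def)
  qed
  then obtain Q where Q: "Q0 \<subseteq> Q" "residue_preorder p Q"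
    and max: "\<And>Q'. residue_preorder p Q' \<Longrightarrow> Q \<subseteq> Q' \<Longrightarrow> Q' = Q" by (auto simp: \<C>_def)
  interpret residue_preorder p Q by fact
  have 01: "0 \<in> Q" "1 \<in> Q" using Q_dvd[of 0] Q_square[of 1] by auto
  have ext: "\<exists>a\<in>Q. \<exists>c\<in>Q. - 1 = a + f * c" if f: "f \<notin> Q" for f
  proof (rule ccontr)
    assume no: "\<not> ?thesis"
    define Q' where "Q' = {a + f * c | a c. a \<in> Q \<and> c \<in> Q}"
    have sub: "Q \<subseteq> Q'"
    proof
      fix g assume "g \<in> Q"
      moreover have "g = g + f * 0" by simp
      ultimately show "g \<in> Q'" unfolding Q'_def using 01 by blast
    qed
    have "residue_preorder p Q'"
    proof
      fix g h assume "g \<in> Q'" "h \<in> Q'"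
      then obtain a c d e where gh: "g = a + f * c" "h = d + f * e" "a \<in> Q" "c \<in> Q" "d \<in> Q" "e \<in> Q"
        by (auto simp: Q'_def)
      have "g + h = (a + d) + f * (c + e)" by (simp add: gh algebra_simps)
      then show "g + h \<in> Q'" unfolding Q'_def using gh Q_add by blast
      have "g * h = (a * d + f\<^sup>2 * (c * e)) + f * (a * e + c * d)" by (simp add: gh algebra_simps power2_eq_square)
      moreover have "a * d + f\<^sup>2 * (c * e) \<in> Q" "a * e + c * d \<in> Q"
        using gh by (auto intro!: Q_add Q_mult Q_square)
      ultimately show "g * h \<in> Q'" unfolding Q'_def by blast
    next
      show "g\<^sup>2 \<in> Q'" for g using sub Q_square by blast
      show "g \<in> Q'" if "p dvd g" for g using sub Q_dvd[OF that] by blast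
      show "- 1 \<notin> Q'" unfolding Q'_def using no by blast
    qed
    then have "Q' = Q" using max sub by blast
    moreover have "f = 0 + f * 1" by simp
    then have "f \<in> Q'" unfolding Q'_def using 01 by blast
    ultimately show False using f by simp
  qed
  have total: "f \<in> Q \<or> - f \<in> Q" for f
  proof (rule ccontr)
    assume "\<not> ?thesis"
    then obtain a c d e where *: "- 1 = a + f * c" "- 1 = d + - f * e" "a \<in> Q" "c \<in> Q" "d \<in> Q" "e \<in> Q"
      using ext[of f] ext[of "-f"] by blast
    have "f * c = (a + f * c) - a" "f * e = d - (d + - f * e)" by simp_all
    then have "f * c = - 1 - a" "f * e = 1 + d" unfolding *(1,2)[symmetric] by simp_all
    then have fcfe: "(f * c) * (f * e) = (- 1 - a) * (1 + d)" by (simp only:)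
    have "a + d + a * d + f\<^sup>2 * (c * e) = (f * c) * (f * e) - (- 1 - a) * (1 + d) - 1"
      by (simp add: algebra_simps power2_eq_square)
    then have "a + d + a * d + f\<^sup>2 * (c * e) = - 1" unfolding fcfe by simp
    moreover have "a + d + a * d + f\<^sup>2 * (c * e) \<in> Q" using * by (intro Q_add Q_mult Q_square)
    ultimately show False using Q_proper by simp
  qed
  have "residue_ordering p Q"
  proof
    show "f \<in> Q \<or> - f \<in> Q" for f by (rule total)
    fix f assume f: "f \<in> Q" "- f \<in> Q"
    show "p dvd f"
    proof (rule ccontr)
      assume "\<not> p dvd f"
      then obtain e where e: "p dvd f * e - 1" using unit_mod_irreducible[OF p] by (auto simp: unit_mod_def)
      have "(f * e - 1) + f * (- e) = - 1" "(f * e - 1) + (- f) * e = - 1" by simp_all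
      then show False
        using Q_add[OF Q_dvd[OF e] Q_mult[OF f(1), of "- e"]] Q_add[OF Q_dvd[OF e] Q_mult[OF f(2), of e]]
          total[of e] Q_proper by metis
    qed
  qed
  then show ?thesis using Q(1) by blast
qed

text \<open>A real place of the residue field \<open>K[X]/(p)\<close>, as a homomorphism on \<open>K[X]\<close>.\<close>

definition place :: "'k::field_char_0 poly \<Rightarrow> ('k poly \<Rightarrow> real) \<Rightarrow> bool" where
  "place p \<chi> \<longleftrightarrow> (\<forall>f g. \<chi> (f + g) = \<chi> f + \<chi> g) \<and> (\<forall>f g. \<chi> (f * g) = \<chi> f * \<chi> g) \<and> \<chi> 1 = 1 \<and> \<chi> p = 0"


section \<open>Real places of number fields\<close>

abbreviation rat_const :: "rat \<Rightarrow> 'k::field_char_0 poly" where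
  "rat_const q \<equiv> [:of_rat q:]"

lemma rat_const_add: "rat_const (q + r) = rat_const q + rat_const r"
  and rat_const_mult: "rat_const (q * r) = rat_const q * rat_const r"
  by (simp_all add: of_rat_add of_rat_mult)

lemma rat_const_sum: "rat_const (\<Sum>i\<in>I. q i) = (\<Sum>i\<in>I. rat_const (q i))"
proof (induction I rule: infinite_finite_induct)
  case (insert x F)
  show ?case unfolding sum.insert[OF insert(1,2)] rat_const_add insert(3) ..
qed auto

context residue_ordering
begin

lemma Q_0: "0 \<in> Q"
  using Q_dvd[of 0] by simp

lemma Q_1: "1 \<in> Q"
  using Q_square[of 1] by simp

lemma Q_sum: "(\<And>i. i \<in> I \<Longrightarrow> f i \<in> Q) \<Longrightarrow> sum f I \<in> Q"
  by (induction I rule: infinite_finite_induct) (auto intro: Q_0 Q_add)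

lemma Q_of_nat: "of_nat n \<in> Q"
  by (induction n) (auto intro: Q_0 Q_1 Q_add)

lemma Q_rat_const: assumes "0 \<le> q" shows "rat_const q \<in> Q"
proof -
  obtain a c where ac: "quotient_of q = (a, c)" by fastforce
  then have c: "c > 0" "q = of_int a / of_int c" using quotient_of_denom_pos quotient_of_div by blast+
  then have a: "a \<ge> 0" using assms by (simp add: zero_le_divide_iff)
  have "q = of_nat (nat (a * c)) * (1 / of_int c)\<^sup>2"
    using a c by (simp add: power2_eq_square)
  then have "rat_const q = rat_const (of_nat (nat (a * c))) * (rat_const (1 / of_int c))\<^sup>2"
    by (simp only: rat_const_mult power2_eq_square)
  then have "rat_const q = of_nat (nat (a * c)) * (rat_const (1 / of_int c))\<^sup>2"
    by (simp only: of_nat_poly of_rat_of_nat_eq)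
  then show ?thesis using Q_mult Q_of_nat Q_square by metis
qed

lemma Q_cong: "f \<in> Q \<Longrightarrow> p dvd g - f \<Longrightarrow> g \<in> Q"
  using Q_add[of f "g - f"] Q_dvd[of "g - f"] by simp

lemma Q_cancel:
  assumes p: "irreducible p" and "f * g \<in> Q" "g \<in> Q" "\<not> p dvd g"
  shows "f \<in> Q"
proof (rule ccontr)
  assume "f \<notin> Q"
  then have "- f \<in> Q" using Q_total by blast
  then have "- (f * g) \<in> Q" using Q_mult[of "-f" g] assms by simp
  then have "p dvd f * g" using Q_antisym assms by blast
  then have "p dvd f" using irreducible_dvd_mult[OF p] assms by blast
  then show False using Q_dvd \<open>f \<notin> Q\<close> by blast
qed

definition qabs :: "'a poly \<Rightarrow> 'a poly" where
  "qabs f = (if f \<in> Q then f else - f)"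

lemma qabs_in: "qabs f \<in> Q"
  using Q_total by (auto simp: qabs_def)

lemma qabs_pm: "qabs f + f \<in> Q" "qabs f - f \<in> Q"
  using Q_total[of f] Q_0 Q_add[of f f] Q_add[of "- f" "- f"] by (auto simp: qabs_def)

lemma qabs_max: "finite E \<Longrightarrow> E \<noteq> {} \<Longrightarrow> \<exists>m\<in>E. \<forall>e\<in>E. qabs m - qabs e \<in> Q"
proof (induction E rule: finite_ne_induct)
  case (singleton x)
  then show ?case using Q_0 by simp
next
  case (insert x E)
  then obtain m where m: "m \<in> E" "\<And>e. e \<in> E \<Longrightarrow> qabs m - qabs e \<in> Q" by blast
  show ?case
  proof (cases "qabs m - qabs x \<in> Q")
    case True
    then show ?thesis using m by blast
  next
    case False
    then have xm: "qabs x - qabs m \<in> Q" using Q_total[of "qabs m - qabs x"] by simp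
    have "qabs x - qabs e \<in> Q" if "e \<in> E" for e
      using Q_add[OF xm m(2)[OF that]] by simp
    then show ?thesis using Q_0 by (intro bexI[of _ x]) auto
  qed
qed

text \<open>Let \<open>m\<close> be the generator of largest absolute value for \<open>Q\<close>.
  Expanding \<open>f * m\<close> in the generators bounds its absolute value by \<open>D\<close>
  times that of \<open>m\<close>, which can be cancelled. The bound involves only the structure
  constants \<open>c\<close> and not the ordering.\<close>

lemma structure_bound:
  assumes p: "irreducible p" and E: "finite E" "\<And>g. \<exists>c :: 'a poly \<Rightarrow> rat. p dvd g - (\<Sum>e\<in>E. rat_const (c e) * e)"
    and c: "\<And>e. e \<in> E \<Longrightarrow> p dvd f * e - (\<Sum>e'\<in>E. rat_const (c e e') * e')"
    and C: "(\<Sum>e\<in>E. \<Sum>e'\<in>E. \<bar>c e e'\<bar>) \<le> of_nat C"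
  shows "of_nat C - f \<in> Q" "of_nat C + f \<in> Q"
proof -
  have "E \<noteq> {}"
  proof (rule notI)
    assume "E = {}"
    then have "p dvd 1" using E(2)[of 1] by simp
    then show False using p by (simp add: irreducible_not_unit)
  qed
  from qabs_max[OF E(1) this] obtain m where m: "m \<in> E" "\<And>e. e \<in> E \<Longrightarrow> qabs m - qabs e \<in> Q" by blast
  \<comment> \<open>If the largest generator vanished modulo \<open>p\<close>, then all generators
    would, and so would 1.\<close>
  have pm: "\<not> p dvd qabs m"
  proof
    assume pm: "p dvd qabs m"
    have "p dvd e" if e: "e \<in> E" for e
    proof -
      have "p dvd - qabs m" using pm by simp
      then have "- qabs e \<in> Q" using Q_add[OF m(2)[OF e] Q_dvd, of "- qabs m"] by simp
      then have "p dvd qabs e" using Q_antisym qabs_in by blast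
      then show ?thesis by (auto simp: qabs_def split: if_splits)
    qed
    then have sumdvd: "p dvd (\<Sum>e\<in>E. g e * e)" for g by (intro dvd_sum dvd_mult)
    obtain d where d: "p dvd 1 - (\<Sum>e\<in>E. rat_const (d e) * e)" using E(2) by blast
    have "p dvd (1 - (\<Sum>e\<in>E. rat_const (d e) * e)) + (\<Sum>e\<in>E. rat_const (d e) * e)"
      by (rule dvd_add[OF d sumdvd])
    then show False using p by (simp add: irreducible_not_unit)
  qed
  define d where "d = c m"
  define D where "D = (\<Sum>e\<in>E. \<bar>d e\<bar>)"
  have term_in: "rat_const \<bar>d e\<bar> * qabs m - rat_const (d e) * e \<in> Q" "rat_const \<bar>d e\<bar> * qabs m + rat_const (d e) * e \<in> Q"
    if e: "e \<in> E" for e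
  proof -
    have nn: "rat_const \<bar>d e\<bar> \<in> Q" by (rule Q_rat_const) simp
    have 1: "rat_const \<bar>d e\<bar> * (qabs m - qabs e) \<in> Q" using Q_mult[OF nn m(2)[OF e]] .
    have "rat_const \<bar>d e\<bar> * (qabs e - e) \<in> Q" "rat_const \<bar>d e\<bar> * (qabs e + e) \<in> Q"
      by (rule Q_mult[OF nn qabs_pm(2)], rule Q_mult[OF nn qabs_pm(1)])
    from this[THEN Q_add[OF 1]]
    have "rat_const \<bar>d e\<bar> * qabs m - rat_const \<bar>d e\<bar> * e \<in> Q" "rat_const \<bar>d e\<bar> * qabs m + rat_const \<bar>d e\<bar> * e \<in> Q"
      by (simp_all add: right_diff_distrib distrib_left)
    then show "rat_const \<bar>d e\<bar> * qabs m - rat_const (d e) * e \<in> Q" "rat_const \<bar>d e\<bar> * qabs m + rat_const (d e) * e \<in> Q"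
      by (cases "d e \<ge> 0"; simp add: of_rat_minus)+
  qed
  have sumD: "(\<Sum>e\<in>E. rat_const \<bar>d e\<bar> * qabs m) = rat_const D * qabs m"
    unfolding D_def rat_const_sum by (simp add: sum_distrib_right)
  have fm: "p dvd f * m - (\<Sum>e\<in>E. rat_const (d e) * e)" unfolding d_def by (rule c[OF m(1)])
  have m1: "rat_const D * qabs m - f * m \<in> Q"
  proof (rule Q_cong)
    show "(\<Sum>e\<in>E. rat_const \<bar>d e\<bar> * qabs m - rat_const (d e) * e) \<in> Q" using term_in by (intro Q_sum)
    show "p dvd rat_const D * qabs m - f * m - (\<Sum>e\<in>E. rat_const \<bar>d e\<bar> * qabs m - rat_const (d e) * e)"
      unfolding sum_subtractf sumD using fm by (simp add: dvd_diff_commute)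
  qed
  have m2: "rat_const D * qabs m + f * m \<in> Q"
  proof (rule Q_cong)
    show "(\<Sum>e\<in>E. rat_const \<bar>d e\<bar> * qabs m + rat_const (d e) * e) \<in> Q" using term_in by (intro Q_sum)
    show "p dvd rat_const D * qabs m + f * m - (\<Sum>e\<in>E. rat_const \<bar>d e\<bar> * qabs m + rat_const (d e) * e)"
      unfolding sum.distrib sumD using fm by simp
  qed
  have "(rat_const D - f) * qabs m \<in> Q" "(rat_const D + f) * qabs m \<in> Q"
    using m1 m2 by (auto simp: qabs_def left_diff_distrib distrib_right)
  then have Df: "rat_const D - f \<in> Q" "rat_const D + f \<in> Q"
    using Q_cancel[OF p _ qabs_in pm] by blast+
  have "D \<le> (\<Sum>e\<in>E. \<Sum>e'\<in>E. \<bar>c e e'\<bar>)"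
    unfolding D_def d_def using m(1) E(1)
    by (intro member_le_sum[of m E "\<lambda>e. \<Sum>e'\<in>E. \<bar>c e e'\<bar>"]) (auto intro: sum_nonneg)
  then have "rat_const (of_nat C - D) \<in> Q" using C by (intro Q_rat_const) simp
  then have CD: "of_nat C - rat_const D \<in> Q" by (simp add: of_rat_diff of_nat_poly)
  show "of_nat C - f \<in> Q" "of_nat C + f \<in> Q"
    using Q_add[OF CD Df(1)] Q_add[OF CD Df(2)] by simp_all
qed

end

text \<open>The products of generators of \<open>K\<close> over the rationals with powers of
  \<open>X\<close> generate \<open>K[X]/(p)\<close> over the rationals. One constant serves all
  orderings: this makes them Archimedean and later bounds the values at all places at once.\<close>

lemma number_field_bound:
  fixes p :: "'k::field_char_0 poly"
  assumes nf: "number_field TYPE('k)" and p: "irreducible p"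
  shows "\<exists>C::nat. \<forall>Q. residue_ordering p Q \<longrightarrow> of_nat C - f \<in> Q \<and> of_nat C + f \<in> Q"
proof -
  interpret K: vector_space "\<lambda>(r::rat) (x::'k). of_rat r * x"
    by unfold_locales (auto simp: algebra_simps of_rat_add of_rat_mult)
  interpret KX: vector_space "\<lambda>(r::rat) (x::'k poly). rat_const r * x"
    by unfold_locales (auto simp: algebra_simps of_rat_add of_rat_mult smult_add_right smult_add_left)
  obtain B :: "'k set" where B: "finite B" "K.span B = UNIV" using nf by (auto simp: number_field_def)
  have dp: "0 < degree p" using p is_unit_iff_degree[of p] by (auto simp: Factorial_Ring.irreducible_def)
  define E where "E = (\<lambda>(\<beta>, j). monom \<beta> j) ` (B \<times> {..<degree p})"
  have E: "finite E" using B by (simp add: E_def)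
  have mono: "monom a j \<in> KX.span E" if j: "j < degree p" for a j
  proof -
    have "a \<in> K.span B" using B by simp
    then show ?thesis
    proof (induction rule: K.span_induct_alt)
      case base
      then show ?case using KX.span_zero by simp
    next
      case (step c x y)
      have "monom x j \<in> KX.span E" using step j by (intro KX.span_base) (auto simp: E_def)
      then have "rat_const c * monom x j + monom y j \<in> KX.span E" using step by (intro KX.span_add KX.span_scale)
      then show ?case by (simp add: smult_monom add_monom)
    qed
  qed
  have repr: "\<exists>c :: 'k poly \<Rightarrow> rat. p dvd g - (\<Sum>e\<in>E. rat_const (c e) * e)" for g
  proof -
    have "(\<Sum>i\<le>degree (g mod p). monom (coeff (g mod p) i) i) \<in> KX.span E"
      using degree_mod_less_pos[OF dp, of g] by (intro KX.span_sum mono) auto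
    then have "g mod p \<in> KX.span E" by (simp add: poly_as_sum_of_monoms)
    then obtain c where c: "g mod p = (\<Sum>e\<in>E. rat_const (c e) * e)" using KX.span_finite[OF E] by auto
    have "p dvd g - g mod p" by simp
    then show ?thesis unfolding c by blast
  qed
  have "\<exists>c. \<forall>e. p dvd f * e - (\<Sum>e'\<in>E. rat_const (c e e') * e')"
    using repr by (intro choice) blast
  then obtain c where c: "\<And>e. p dvd f * e - (\<Sum>e'\<in>E. rat_const (c e e') * e')" by blast
  obtain C where C: "(\<Sum>e\<in>E. \<Sum>e'\<in>E. \<bar>c e e'\<bar>) \<le> of_nat C" using reals_Archimedean2 less_imp_le by blast
  show ?thesis using residue_ordering.structure_bound[OF _ p E repr c C] by blast
qed

locale archimedean_residue_ordering = residue_ordering +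
  assumes irr: "irreducible p" and arch: "\<exists>C::nat. of_nat C - f \<in> Q \<and> of_nat C + f \<in> Q"
begin

text \<open>Hoelder's embedding of an Archimedean ordered field into the reals, by the cut that an
  element makes in the rationals.\<close>

definition chi :: "'a poly \<Rightarrow> real" where
  "chi f = Sup {of_rat q | q. f - rat_const q \<in> Q}"

lemma rat_const_in_iff: "rat_const q \<in> Q \<longleftrightarrow> 0 \<le> q"
proof
  assume q: "rat_const q \<in> Q"
  show "0 \<le> q"
  proof (rule ccontr)
    assume "\<not> 0 \<le> q"
    then have "rat_const (- q) \<in> Q" by (intro Q_rat_const) simp
    then have "p dvd rat_const q" using Q_antisym q by (simp add: of_rat_minus)
    moreover have "is_unit (rat_const q :: 'a poly)" using \<open>\<not> 0 \<le> q\<close> by (simp add: is_unit_const_poly_iff dvd_field_iff)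
    ultimately show False using irr by (meson dvd_trans irreducible_not_unit)
  qed
qed (rule Q_rat_const)

lemma chi_lower: "f - rat_const q \<in> Q \<Longrightarrow> of_rat q \<le> chi f"
  and chi_upper: "rat_const q - f \<in> Q \<Longrightarrow> chi f \<le> of_rat q"
proof -
  have le: "r \<le> q" if "f - rat_const r \<in> Q" "rat_const q - f \<in> Q" for q r
  proof -
    have "rat_const (q - r) \<in> Q" using Q_add[OF that] by (simp add: of_rat_diff)
    then show ?thesis by (simp only: rat_const_in_iff diff_ge_0_iff_ge)
  qed
  obtain C :: nat where C: "of_nat C - f \<in> Q" "of_nat C + f \<in> Q" using arch by blast
  have "f - rat_const (- of_nat C) = of_nat C + f"
    by (subst diff_conv_add_uminus) (simp add: of_rat_minus of_nat_poly add.commute)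
  then have C': "rat_const (of_nat C) - f \<in> Q" "f - rat_const (- of_nat C) \<in> Q"
    using C by (simp_all only: of_nat_poly of_rat_of_nat_eq)
  have bdd: "bdd_above {real_of_rat q | q. f - rat_const q \<in> Q}"
  proof (rule bdd_aboveI)
    fix x assume "x \<in> {real_of_rat q | q. f - rat_const q \<in> Q}"
    then show "x \<le> real_of_rat (of_nat C)" using le[OF _ C'(1)] unfolding mem_Collect_eq by (metis of_rat_less_eq)
  qed
  show "f - rat_const q \<in> Q \<Longrightarrow> of_rat q \<le> chi f"
    unfolding chi_def by (rule cSup_upper[OF _ bdd]) blast
  show "rat_const q - f \<in> Q \<Longrightarrow> chi f \<le> of_rat q"
    unfolding chi_def using C'(2) le by (intro cSup_least) (auto simp: of_rat_less_eq)
qed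

lemma less_chi: "of_rat q < chi f \<Longrightarrow> f - rat_const q \<in> Q"
  using chi_upper[of q f] Q_total[of "f - rat_const q"] by fastforce

lemma chi_less: "chi f < of_rat q \<Longrightarrow> rat_const q - f \<in> Q"
  using chi_lower[of f q] Q_total[of "rat_const q - f"] by fastforce

lemma chi_nonneg: "f \<in> Q \<Longrightarrow> 0 \<le> chi f"
  using chi_lower[of f 0] by simp

lemma chi_rat: "chi (rat_const q) = of_rat q"
  using chi_lower[of "rat_const q" q] chi_upper[of q "rat_const q"] Q_0 by simp

lemma chi_add: "chi (f + g) = chi f + chi g"
proof (rule antisym)
  show "chi (f + g) \<le> chi f + chi g"
  proof (rule field_le_epsilon)
    fix e :: real assume e: "0 < e"
    obtain q where q: "chi f < of_rat q" "of_rat q < chi f + e / 2" using of_rat_dense[of "chi f" "chi f + e/2"] e by auto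
    obtain r where r: "chi g < of_rat r" "of_rat r < chi g + e / 2" using of_rat_dense[of "chi g" "chi g + e/2"] e by auto
    have "rat_const (q + r) - (f + g) \<in> Q"
      using Q_add[OF chi_less[OF q(1)] chi_less[OF r(1)]] by (simp add: of_rat_add algebra_simps)
    then have "chi (f + g) \<le> of_rat (q + r)" by (rule chi_upper)
    then show "chi (f + g) \<le> chi f + chi g + e" using q r by (simp add: of_rat_add)
  qed
  show "chi f + chi g \<le> chi (f + g)"
  proof (rule field_le_epsilon)
    fix e :: real assume e: "0 < e"
    obtain q where q: "chi f - e / 2 < of_rat q" "of_rat q < chi f" using of_rat_dense[of "chi f - e/2" "chi f"] e by auto
    obtain r where r: "chi g - e / 2 < of_rat r" "of_rat r < chi g" using of_rat_dense[of "chi g - e/2" "chi g"] e by auto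
    have "(f + g) - rat_const (q + r) \<in> Q"
      using Q_add[OF less_chi[OF q(2)] less_chi[OF r(2)]] by (simp add: of_rat_add algebra_simps)
    then have "of_rat (q + r) \<le> chi (f + g)" by (rule chi_lower)
    then show "chi f + chi g \<le> chi (f + g) + e" using q r by (simp add: of_rat_add)
  qed
qed

lemma chi_0: "chi 0 = 0"
  using chi_add[of 0 0] by simp

lemma chi_minus: "chi (- f) = - chi f"
  using chi_add[of f "-f"] chi_0 by simp

lemma chi_diff: "chi (f - g) = chi f - chi g"
  using chi_add[of f "-g"] chi_minus by simp

lemma chi_of_nat_mult: "chi (of_nat n * f) = of_nat n * chi f"
  by (induction n) (auto simp: chi_0 chi_add distrib_right)

lemma chi_rat_mult: "chi (rat_const q * f) = of_rat q * chi f"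
proof -
  obtain a c where ac: "quotient_of q = (a, c)" by fastforce
  then have c: "c > 0" "q = of_int a / of_int c" using quotient_of_denom_pos quotient_of_div by blast+
  have int: "chi (rat_const (of_int a) * f) = of_int a * chi f" for a f
  proof (cases "a \<ge> 0")
    case True
    then have "chi (rat_const (of_int a) * f) = chi (of_nat (nat a) * f)" by (simp add: of_nat_poly)
    then show ?thesis using True by (simp only: chi_of_nat_mult) simp
  next
    case False
    then have "chi (rat_const (of_int a) * f) = chi (- (of_nat (nat (- a)) * f))" by (simp add: of_nat_poly)
    then show ?thesis using False by (simp only: chi_minus chi_of_nat_mult) simp
  qed
  have "rat_const (of_int c) * (rat_const q * f) = rat_const (of_int a) * f"
    using c by (simp add: of_rat_divide)
  then have "chi (rat_const (of_int c) * (rat_const q * f)) = chi (rat_const (of_int a) * f)" by (simp only:)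
  then have "of_int c * chi (rat_const q * f) = of_int a * chi f" unfolding int .
  then have "chi (rat_const q * f) = of_int a / of_int c * chi f"
    using c(1) by (simp add: eq_divide_eq mult.commute)
  also have "of_int a / of_int c = real_of_rat q" by (simp add: c(2) of_rat_divide)
  finally show ?thesis .
qed

text \<open>Inequalities between \<open>f\<close> and rational numbers may be multiplied by
  \<open>g\<close> when \<open>g\<close> is nonnegative. The case \<open>chi g = 0\<close> is
  separate, as the comparison divides by \<open>chi g\<close>.\<close>

lemma chi_mult_nonneg:
  assumes g: "g \<in> Q" shows "chi (f * g) = chi f * chi g"
proof (rule antisym)
  have up: "chi (f * g) \<le> of_rat q * chi g" if "chi f < of_rat q" for q
    using chi_nonneg[OF Q_mult[OF chi_less[OF that] g]] by (simp add: left_diff_distrib chi_diff chi_rat_mult del: mult_pCons_left)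
  have lo: "of_rat q * chi g \<le> chi (f * g)" if "of_rat q < chi f" for q
    using chi_nonneg[OF Q_mult[OF less_chi[OF that] g]] by (simp add: left_diff_distrib chi_diff chi_rat_mult del: mult_pCons_left)
  have cg: "0 \<le> chi g" using g by (rule chi_nonneg)
  show "chi (f * g) \<le> chi f * chi g"
  proof (rule ccontr)
    assume n: "\<not> ?thesis"
    show False
    proof (cases "chi g = 0")
      case True
      obtain q where "chi f < of_rat q" using of_rat_dense[of "chi f" "chi f + 1"] by auto
      then show False using up[of q] n True by simp
    next
      case False
      then have "chi f < chi (f * g) / chi g" using n cg by (simp add: field_simps)
      then obtain q where "chi f < of_rat q" "of_rat q < chi (f * g) / chi g" using of_rat_dense by blast
      then show False using up[of q] False cg by (simp add: field_simps)
    qed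
  qed
  show "chi f * chi g \<le> chi (f * g)"
  proof (rule ccontr)
    assume n: "\<not> ?thesis"
    show False
    proof (cases "chi g = 0")
      case True
      obtain q where "of_rat q < chi f" using of_rat_dense[of "chi f - 1" "chi f"] by auto
      then show False using lo[of q] n True by simp
    next
      case False
      then have "chi (f * g) / chi g < chi f" using n cg by (simp add: field_simps)
      then obtain q where "of_rat q < chi f" "chi (f * g) / chi g < of_rat q" using of_rat_dense by blast
      then show False using lo[of q] False cg by (simp add: field_simps)
    qed
  qed
qed

lemma chi_mult: "chi (f * g) = chi f * chi g"
proof (cases "g \<in> Q")
  case False
  then have "chi (f * (- g)) = chi f * chi (- g)" using Q_total by (intro chi_mult_nonneg) blast
  then show ?thesis by (simp add: chi_minus)
qed (rule chi_mult_nonneg)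

lemma place_chi: "place p chi"
proof -
  have "chi 1 = 1" using chi_rat[of 1] by (simp add: one_pCons)
  moreover have "chi p = 0"
    using chi_nonneg[of p] chi_nonneg[of "- p"] Q_dvd[of p] Q_dvd[of "-p"] by (simp add: chi_minus)
  ultimately show ?thesis by (simp add: place_def chi_add chi_mult)
qed

end

lemma place_0: "place p \<chi> \<Longrightarrow> \<chi> 0 = 0"
  unfolding place_def by (metis add_cancel_right_right)

lemma place_minus: assumes "place p \<chi>" shows "\<chi> (- f) = - \<chi> f"
proof -
  have "\<chi> (f + - f) = \<chi> f + \<chi> (- f)" using assms unfolding place_def by blast
  then show ?thesis using place_0[OF assms] by simp
qed

lemma place_add: "place p \<chi> \<Longrightarrow> \<chi> (f + g) = \<chi> f + \<chi> g"
  and place_mult: "place p \<chi> \<Longrightarrow> \<chi> (f * g) = \<chi> f * \<chi> g"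
  and place_1: "place p \<chi> \<Longrightarrow> \<chi> 1 = 1"
  and place_p: "place p \<chi> \<Longrightarrow> \<chi> p = 0"
  by (simp_all add: place_def)

lemma place_diff: "place p \<chi> \<Longrightarrow> \<chi> (f - g) = \<chi> f - \<chi> g"
  using place_add[of p \<chi> f "-g"] place_minus[of p \<chi> g] by simp

lemma place_dvd: "place p \<chi> \<Longrightarrow> p dvd f \<Longrightarrow> \<chi> f = 0"
  by (auto elim!: dvdE simp: place_mult place_p)

lemma place_cong: "place p \<chi> \<Longrightarrow> p dvd f - g \<Longrightarrow> \<chi> f = \<chi> g"
  using place_dvd[of p \<chi> "f - g"] place_diff[of p \<chi> f g] by simp

lemma place_unit: "place p \<chi> \<Longrightarrow> unit_mod p u \<Longrightarrow> \<chi> u \<noteq> 0"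
proof
  assume \<chi>: "place p \<chi>" and u: "unit_mod p u" "\<chi> u = 0"
  obtain v where "p dvd u * v - 1" using u by (auto simp: unit_mod_def)
  then have "\<chi> (u * v) = \<chi> 1" by (rule place_cong[OF \<chi>])
  then show False using u by (simp add: place_mult[OF \<chi>] place_1[OF \<chi>])
qed

lemma place_of_nat: "place p \<chi> \<Longrightarrow> \<chi> (of_nat n) = of_nat n"
  by (induction n) (auto simp: place_0 place_1 place_add)

lemma place_power: "place p \<chi> \<Longrightarrow> \<chi> (f ^ n) = \<chi> f ^ n"
  by (induction n) (auto simp: place_1 place_mult)

lemma place_residue_ordering:
  assumes p: "irreducible p" and \<chi>: "place p \<chi>"
  shows "residue_ordering p {f. 0 \<le> \<chi> f}"
proof
  show "p dvd f" if "f \<in> {f. 0 \<le> \<chi> f}" "- f \<in> {f. 0 \<le> \<chi> f}" for f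
    using that place_unit[OF \<chi> unit_mod_irreducible[OF p, of f]] by (auto simp: place_minus[OF \<chi>])
qed (auto simp: place_add[OF \<chi>] place_mult[OF \<chi>] place_minus[OF \<chi>] place_1[OF \<chi>] place_dvd[OF \<chi>] power2_eq_square)

text \<open>Every place induces an ordering, to which the uniform bound applies. It takes over the
  role of the compactness of the set of places.\<close>

lemma place_bound:
  fixes p :: "'k::field_char_0 poly"
  assumes nf: "number_field TYPE('k)" and p: "irreducible p"
  shows "\<exists>C::nat. \<forall>\<chi>. place p \<chi> \<longrightarrow> \<bar>\<chi> f\<bar> \<le> of_nat C"
proof -
  obtain C :: nat where C: "\<And>Q. residue_ordering p Q \<Longrightarrow> of_nat C - f \<in> Q \<and> of_nat C + f \<in> Q"
    using number_field_bound[OF nf p] by blast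
  have "\<bar>\<chi> f\<bar> \<le> of_nat C" if \<chi>: "place p \<chi>" for \<chi>
    using C[OF place_residue_ordering[OF p \<chi>]]
    by (auto simp: place_add[OF \<chi>] place_diff[OF \<chi>] place_of_nat[OF \<chi>])
  then show ?thesis by blast
qed

lemma ordering_place:
  fixes p :: "'k::field_char_0 poly"
  assumes nf: "number_field TYPE('k)" and p: "irreducible p" and Q: "residue_ordering p Q"
  obtains \<chi> where "place p \<chi>" "\<And>f. f \<in> Q \<Longrightarrow> 0 \<le> \<chi> f"
proof -
  interpret residue_ordering p Q by fact
  interpret archimedean_residue_ordering p Q
    using number_field_bound[OF nf p] Q by unfold_locales (auto simp: p)
  show ?thesis using that[OF place_chi chi_nonneg] .
qed

definition sum_squares_mod :: "'k::field poly \<Rightarrow> 'k poly set" where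
  "sum_squares_mod p = {f. \<exists>xs. p dvd f - sum_squares xs}"

lemma sum_squares_mod_closed:
  assumes "f \<in> sum_squares_mod p" "g \<in> sum_squares_mod p"
  shows "f + g \<in> sum_squares_mod p" "f * g \<in> sum_squares_mod p"
proof -
  obtain xs ys where xy: "p dvd f - sum_squares xs" "p dvd g - sum_squares ys" using assms by (auto simp: sum_squares_mod_def)
  have "p dvd (f - sum_squares xs) + (g - sum_squares ys)" by (rule dvd_add[OF xy])
  moreover have "sum_squares (xs @ ys) = sum_squares xs + sum_squares ys" by (simp add: sum_squares_def)
  ultimately have "p dvd (f + g) - sum_squares (xs @ ys)" by (simp add: algebra_simps)
  then show "f + g \<in> sum_squares_mod p" unfolding sum_squares_mod_def by blast
  have sc: "sum_squares (map ((*) x) ys) = x\<^sup>2 * sum_squares ys" for x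
    by (induction ys) (auto simp: sum_squares_def power_mult_distrib distrib_left)
  have "\<exists>zs. sum_squares zs = sum_squares xs * sum_squares ys"
  proof (induction xs)
    case Nil
    show ?case by (intro exI[of _ "[]"]) (simp add: sum_squares_def)
  next
    case (Cons x xs)
    then obtain zs where "sum_squares zs = sum_squares xs * sum_squares ys" by blast
    then have "sum_squares (map ((*) x) ys @ zs) = sum_squares (x # xs) * sum_squares ys"
      using sc[of x] by (simp add: sum_squares_def distrib_right)
    then show ?case by blast
  qed
  then obtain zs where zs: "sum_squares zs = sum_squares xs * sum_squares ys" by blast
  have "p dvd (f - sum_squares xs) * g + sum_squares xs * (g - sum_squares ys)"
    by (rule dvd_add[OF dvd_mult2[OF xy(1)] dvd_mult[OF xy(2)]])
  then have "p dvd f * g - sum_squares zs" by (simp add: zs algebra_simps)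
  then show "f * g \<in> sum_squares_mod p" unfolding sum_squares_mod_def by blast
qed

lemma square_in_sum_squares_mod: "x\<^sup>2 \<in> sum_squares_mod p"
  unfolding sum_squares_mod_def by (auto intro!: exI[of _ "[x]"] simp: sum_squares_def)

lemma dvd_in_sum_squares_mod: "p dvd x \<Longrightarrow> x \<in> sum_squares_mod p"
  unfolding sum_squares_mod_def by (auto intro!: exI[of _ "[]"] simp: sum_squares_def)

lemma sum_squares_mod_cong: "f \<in> sum_squares_mod p \<Longrightarrow> p dvd g - f \<Longrightarrow> g \<in> sum_squares_mod p"
  using sum_squares_mod_closed(1)[of f p "g - f"] dvd_in_sum_squares_mod[of p "g - f"] by simp

text \<open>Artin's theorem. If \<open>a\<close> is not a sum of squares, then the elements
  \<open>x - a * y\<close> with sums of squares \<open>x\<close> and \<open>y\<close> form a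
  preorder, and an ordering above it gives a place where \<open>a\<close> is not positive. If there
  is no place at all, the hypothesis is void and every \<open>a\<close> is a sum of squares.\<close>

lemma totally_positive_sum_squares:
  fixes p :: "'k::field_char_0 poly"
  assumes nf: "number_field TYPE('k)" and p: "irreducible p"
    and pos: "\<And>\<chi>. place p \<chi> \<Longrightarrow> 0 < \<chi> a"
  shows "a \<in> sum_squares_mod p"
proof (rule ccontr)
  let ?S = "sum_squares_mod p"
  assume a: "a \<notin> ?S"
  note S_add = sum_squares_mod_closed(1)[of _ p] and S_mult = sum_squares_mod_closed(2)[of _ p]
  note S_sq = square_in_sum_squares_mod[of _ p]
  have S01: "0 \<in> ?S" "1 \<in> ?S" using S_sq[of 0] S_sq[of 1] by auto
  have m1: "- 1 \<notin> ?S"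
  proof
    assume "- 1 \<in> ?S"
    \<comment> \<open>\<open>a\<close> is the difference of the squares of
      \<open>(a + 1) / 2\<close> and \<open>(a - 1) / 2\<close>, so it would be a sum of squares if
      -1 were one.\<close>
    define h where "h = ([:1 / 2:] :: 'k poly)"
    have h: "h + h = 1" by (simp add: h_def one_pCons)
    have "(h * (a + 1))\<^sup>2 + (- 1) * (h * (a - 1))\<^sup>2 = (h + h) * (h + h) * a"
      by (simp add: power2_eq_square algebra_simps)
    moreover have "(h * (a + 1))\<^sup>2 + (- 1) * (h * (a - 1))\<^sup>2 \<in> ?S"
      by (intro S_add S_mult S_sq \<open>- 1 \<in> ?S\<close>)
    ultimately show False using a h by simp
  qed
  define T where "T = {x - a * y | x y. x \<in> ?S \<and> y \<in> ?S}"
  have sub: "?S \<subseteq> T"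
  proof
    fix x assume "x \<in> ?S"
    moreover have "x = x - a * 0" by simp
    ultimately show "x \<in> T" unfolding T_def using S01 by blast
  qed
  have "residue_preorder p T"
  proof
    fix f g assume "f \<in> T" "g \<in> T"
    then obtain x y z w where *: "f = x - a * y" "g = z - a * w" "x \<in> ?S" "y \<in> ?S" "z \<in> ?S" "w \<in> ?S"
      by (auto simp: T_def)
    have "f + g = (x + z) - a * (y + w)" by (simp add: * algebra_simps)
    moreover have "x + z \<in> ?S" "y + w \<in> ?S" by (intro S_add *)+
    ultimately show "f + g \<in> T" unfolding T_def by blast
    have "f * g = (x * z + a\<^sup>2 * (y * w)) - a * (x * w + y * z)" by (simp add: * algebra_simps power2_eq_square)
    moreover have "x * z + a\<^sup>2 * (y * w) \<in> ?S" "x * w + y * z \<in> ?S"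
      by (intro S_add S_mult S_sq *)+
    ultimately show "f * g \<in> T" unfolding T_def by blast
  next
    show "f\<^sup>2 \<in> T" for f using sub S_sq by blast
    show "f \<in> T" if "p dvd f" for f using sub dvd_in_sum_squares_mod[OF that] by blast
    show "- 1 \<notin> T"
    proof
      assume "- 1 \<in> T"
      then obtain x y where xy: "- 1 = x - a * y" "x \<in> ?S" "y \<in> ?S" by (auto simp: T_def)
      have "a * y = x - (x - a * y)" by simp
      then have ay: "a * y = x + 1" unfolding xy(1)[symmetric] by simp
      show False
      proof (cases "p dvd y")
        case True
        then have "p dvd - (a * y)" by simp
        moreover have "- (a * y) = - 1 - x" by (simp add: ay)
        ultimately have "p dvd - 1 - x" by (simp only:)
        then show False using sum_squares_mod_cong[OF xy(2)] m1 by blast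
      next
        case False
        \<comment> \<open>Division of \<open>a * y = x + 1\<close> by \<open>y\<close>, written as
          multiplication by \<open>y\<close> and by the square of an inverse \<open>e\<close>,
          exhibits \<open>a\<close> as a sum of squares.\<close>
        then obtain e where e: "p dvd y * e - 1" using unit_mod_irreducible[OF p] by (auto simp: unit_mod_def)
        have "(x + 1) * y * e\<^sup>2 \<in> ?S" by (intro S_mult S_add S_sq S01 xy)
        moreover have "p dvd a - (x + 1) * y * e\<^sup>2"
        proof -
          have "p dvd (y * e - 1) * (- (a * (y * e + 1)))" using e by simp
          then show ?thesis unfolding ay[symmetric] by (simp add: algebra_simps power2_eq_square)
        qed
        ultimately show False using sum_squares_mod_cong a by blast
      qed
    qed
  qed
  then obtain Q where Q: "T \<subseteq> Q" "residue_ordering p Q" using residue_ordering_extension[OF p] by blast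
  obtain \<chi> where \<chi>: "place p \<chi>" "\<And>f. f \<in> Q \<Longrightarrow> 0 \<le> \<chi> f" using ordering_place[OF nf p Q(2)] by blast
  have "- a = 0 - a * 1" by simp
  then have "- a \<in> T" unfolding T_def using S01 by blast
  then have "0 \<le> \<chi> (- a)" using \<chi>(2) Q(1) by blast
  then show False using pos[OF \<chi>(1)] by (simp add: place_minus[OF \<chi>(1)])
qed


section \<open>Signatures at real places\<close>

abbreviation nonneg_reals :: "real set" where
  "nonneg_reals \<equiv> {r. 0 \<le> r}"

abbreviation rsgn :: "real \<Rightarrow> int" where
  "rsgn \<equiv> sgn_in nonneg_reals"

lemma field_ordering_nonneg_reals: "field_ordering nonneg_reals"
  unfolding field_ordering_def
proof (intro conjI)
  show "nonneg_reals \<union> uminus ` nonneg_reals = UNIV"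
  proof (intro equalityI subsetI)
    fix x :: real
    show "x \<in> nonneg_reals \<union> uminus ` nonneg_reals"
      by (cases "0 \<le> x") (auto intro!: image_eqI[of x uminus "- x"])
  qed auto
qed auto

lemma sum_mset_uminus: "(\<Sum>x\<in>#M. - f x) = - (\<Sum>x\<in>#M. f x :: int)"
  by (induction M) auto

lemma (in sym_bilinear) orthogonal_independent:
  assumes "finite X" "\<forall>x\<in>X. \<forall>y\<in>X. x \<noteq> y \<longrightarrow> b x y = 0" "\<And>x. x \<in> X \<Longrightarrow> b x x \<noteq> 0"
  shows "independent X"
proof (rule independent_if_scalars_zero[OF assms(1)])
  fix f y assume f: "(\<Sum>x\<in>X. s (f x) x) = 0" "y \<in> X"
  have "b (\<Sum>x\<in>X. s (f x) x) y = (\<Sum>x\<in>X. f x * b x y)" by (simp add: b_sum_left b_scale_left)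
  also have "\<dots> = (\<Sum>x\<in>X. if x = y then f y * b y y else 0)" using assms(2) f(2) by (intro sum.cong) auto
  also have "\<dots> = f y * b y y" using assms(1) f(2) by simp
  finally show "f y = 0" using f assms(3)[OF f(2)] by simp
qed

text \<open>A basis vector with value 0 would lie in the radical, which is trivial because
  \<open>u\<close> is a unit.\<close>

lemma residue_orthobasis_nonzero:
  fixes m :: "'k::field_char_0 poly"
  assumes m: "nonconst_monic m" and u: "unit_mod m u"
    and X: "sym_bilinear.orthobasis smult (residue_form m u) (residues m) X" and x: "x \<in> X"
  shows "residue_form m u x x \<noteq> 0"
proof
  interpret sym_bilinear smult "residue_form m u" by (rule sym_bilinear_residue_form)
  assume 0: "residue_form m u x x = 0"
  have X': "finite X" "poly_space.independent X" "poly_space.span X = residues m" using X by (auto simp: orthobasis_def)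
  have xy: "residue_form m u x y = 0" if "y \<in> residues m" for y
  proof -
    have "y \<in> poly_space.span X" using that X'(3) by simp
    then have "residue_form m u y x = 0"
    proof (rule b_span_left_0)
      show "residue_form m u a x = 0" if "a \<in> X" for a
        using X x that 0 by (cases "a = x") (auto simp: orthobasis_def)
    qed
    then show ?thesis using b_commute by metis
  qed
  have "top_coeff m (u * x * g) = 0" for g
  proof -
    have "m dvd u * x * (g - g mod m)" by simp
    then have "m dvd u * x * g - u * x * (g mod m)" by (simp only: right_diff_distrib)
    then have "top_coeff m (u * x * g) = residue_form m u x (g mod m)"
      unfolding residue_form_def by (rule top_coeff_cong)
    then show ?thesis using xy mod_in_residues[of m g] m by simp
  qed
  then have "m dvd u * x" by (rule top_coeff_nondegenerate[OF m])
  then have "m dvd x" using unit_mod_dvd_cancel u by blast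
  moreover have "x \<in> residues m" using x X' poly_space.span_base by blast
  ultimately have "x = 0" using dvd_smaller_degree by (auto simp: residues_def)
  then show False using X'(2) x poly_space.dependent_zero by blast
qed

locale real_embedding =
  fixes \<sigma> :: "'k::field_char_0 \<Rightarrow> real"
  assumes add: "\<sigma> (a + b) = \<sigma> a + \<sigma> b" and mult: "\<sigma> (a * b) = \<sigma> a * \<sigma> b" and one: "\<sigma> 1 = 1"
begin

lemma zero: "\<sigma> 0 = 0"
  using add[of 0 0] by simp

lemma minus: "\<sigma> (- a) = - \<sigma> a"
  using add[of a "-a"] zero by simp

lemma diff: "\<sigma> (a - b) = \<sigma> a - \<sigma> b"
  using add[of a "-b"] minus by simp

lemma zero_iff: "\<sigma> a = 0 \<longleftrightarrow> a = 0"
proof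
  assume a: "\<sigma> a = 0"
  show "a = 0"
  proof (rule ccontr)
    assume "a \<noteq> 0"
    then have "\<sigma> (a * inverse a) = 1" using one by simp
    then show False using a by (simp add: mult)
  qed
qed (simp add: zero)

lemma sum: "\<sigma> (sum f A) = (\<Sum>x\<in>A. \<sigma> (f x))"
  by (induction A rule: infinite_finite_induct) (auto simp: zero add)

lemma of_nat: "\<sigma> (of_nat n) = of_nat n"
  by (induction n) (auto simp: zero add one)

lemma of_int: "\<sigma> (of_int n) = of_int n"
  by (cases n rule: int_diff_cases) (simp add: diff of_nat)

lemma of_rat: "\<sigma> (of_rat q) = of_rat q"
proof -
  obtain a c where ac: "quotient_of q = (a, c)" by fastforce
  then have c: "c > 0" "q = of_int a / of_int c" using quotient_of_denom_pos quotient_of_div by blast+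
  then have "of_rat q * of_int c = (of_int a :: 'k)" by (simp add: of_rat_divide)
  then have "\<sigma> (of_rat q * of_int c) = \<sigma> (of_int a)" by (simp only:)
  then have "\<sigma> (of_rat q) * of_int c = of_int a" by (simp only: mult of_int)
  then have "\<sigma> (of_rat q) = of_int a / of_int c" using c(1) by (simp add: eq_divide_eq)
  then show ?thesis using c(2) by (simp add: of_rat_divide)
qed

definition P\<sigma> :: "'k set" where
  "P\<sigma> = {a. 0 \<le> \<sigma> a}"

lemma field_ordering_P: "field_ordering P\<sigma>"
  unfolding field_ordering_def
proof (intro conjI)
  show "P\<sigma> \<union> uminus ` P\<sigma> = UNIV"
  proof (intro equalityI subsetI)
    fix x :: 'k
    show "x \<in> P\<sigma> \<union> uminus ` P\<sigma>"
      by (cases "0 \<le> \<sigma> x") (auto simp: P\<sigma>_def minus intro!: image_eqI[of x uminus "- x"])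
  qed auto
  show "P\<sigma> \<inter> uminus ` P\<sigma> = {0}"
    by (auto simp: P\<sigma>_def minus zero intro!: image_eqI[of 0 uminus 0]) (metis antisym neg_0_le_iff_le zero_iff)
qed (auto simp: P\<sigma>_def add mult)

lemma sgn_in_P: "sgn_in P\<sigma> a = rsgn (\<sigma> a)"
  by (simp add: sgn_in_def P\<sigma>_def zero_iff)

abbreviation mp :: "'k poly \<Rightarrow> real poly" where
  "mp \<equiv> map_poly \<sigma>"

lemma coeff_mp: "coeff (mp f) i = \<sigma> (coeff f i)"
  by (simp add: coeff_map_poly zero)

lemma mp_add: "mp (f + g) = mp f + mp g" and mp_diff: "mp (f - g) = mp f - mp g"
  by (auto intro!: poly_eqI simp: coeff_mp add diff)

lemma mp_mult: "mp (f * g) = mp f * mp g"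
  by (intro poly_eqI) (simp add: coeff_mp coeff_mult sum mult)

lemma mp_1: "mp 1 = 1"
  by (intro poly_eqI) (simp add: coeff_mp one zero)

lemma mp_smult: "mp (smult c f) = smult (\<sigma> c) (mp f)"
  by (intro poly_eqI) (simp add: coeff_mp mult)

lemma mp_pCons: "mp (pCons a f) = pCons (\<sigma> a) (mp f)"
  by (intro poly_eqI) (simp add: coeff_mp coeff_pCons split: nat.split)

lemma mp_sum: "mp (sum f A) = (\<Sum>x\<in>A. mp (f x))"
  by (induction A rule: infinite_finite_induct) (auto simp: mp_add)

lemma degree_mp: "degree (mp f) = degree f"
  by (rule degree_map_poly) (simp add: zero_iff)

lemma mp_eq_0: "mp f = 0 \<longleftrightarrow> f = 0"
  by (auto simp: poly_eq_iff coeff_mp zero_iff)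

lemma inj_mp: "inj mp"
  by (rule injI) (metis eq_iff_diff_eq_0 mp_diff mp_eq_0)

lemma mp_dvd: "f dvd g \<Longrightarrow> mp f dvd mp g"
  by (auto elim!: dvdE simp: mp_mult)

lemma unit_mod_mp: "unit_mod m u \<Longrightarrow> unit_mod (mp m) (mp u)"
  unfolding unit_mod_def by (metis mp_1 mp_diff mp_dvd mp_mult)

lemma nonconst_monic_mp: "nonconst_monic m \<Longrightarrow> nonconst_monic (mp m)"
  by (simp add: degree_mp coeff_mp one)

lemma mp_monom: "mp (monom 1 i) = monom 1 i"
  by (intro poly_eqI) (simp add: coeff_mp coeff_monom one zero)

lemma mp_pderiv: "mp (pderiv f) = pderiv (mp f)"
  by (intro poly_eqI) (simp add: coeff_mp coeff_pderiv mult add one of_nat)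

lemma top_coeff_mp:
  assumes "nonconst_monic m" shows "top_coeff (mp m) (mp f) = \<sigma> (top_coeff m f)"
proof -
  have "mp m dvd mp f - mp (f mod m)" using mp_dvd[of m "f - f mod m"] by (simp add: mp_diff)
  then have "mp f mod mp m = mp (f mod m) mod mp m" by (rule mod_eq_if_dvd_diff)
  also have "\<dots> = mp (f mod m)"
    using degree_mod_less_pos[of m f] assms by (intro mod_poly_less) (simp add: degree_mp)
  finally show ?thesis by (simp add: top_coeff_def coeff_mp degree_mp)
qed

text \<open>An orthogonal basis over \<open>K\<close> maps to one over the reals, and the values
  keep their signs. Over the reals a root can be split off the modulus, which is impossible over
  \<open>K\<close> for an irreducible modulus of degree above 1.\<close>

lemma residue_sig_mp:
  assumes m: "nonconst_monic m" and u: "unit_mod m u"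
  shows "residue_sig nonneg_reals (mp m) (mp u) = residue_sig P\<sigma> m u"
proof -
  interpret A: sym_bilinear smult "residue_form m u" by (rule sym_bilinear_residue_form)
  interpret B: sym_bilinear smult "residue_form (mp m) (mp u)" by (rule sym_bilinear_residue_form)
  obtain X where X: "A.orthobasis (residues m) X"
    using A.orthobasis_exists[OF subspace_residues residues_subset_span] m by auto
  then have X': "finite X" "poly_space.span X = residues m" by (auto simp: A.orthobasis_def)
  have nz: "residue_form m u x x \<noteq> 0" if "x \<in> X" for x using residue_orthobasis_nonzero[OF m u X that] .
  have form: "residue_form (mp m) (mp u) (mp x) (mp y) = \<sigma> (residue_form m u x y)" for x y
    by (simp add: residue_form_def top_coeff_mp[OF m] flip: mp_mult)
  have Xsub: "X \<subseteq> residues m" using X'(2) poly_space.span_superset by blast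
  have ob: "B.orthobasis (residues (mp m)) (mp ` X)"
    unfolding B.orthobasis_def
  proof (intro conjI)
    show "finite (mp ` X)" using X' by simp
    show orth: "\<forall>x\<in>mp ` X. \<forall>y\<in>mp ` X. x \<noteq> y \<longrightarrow> residue_form (mp m) (mp u) x y = 0"
    proof (intro ballI impI)
      fix x y assume "x \<in> mp ` X" "y \<in> mp ` X" "x \<noteq> y"
      then obtain a c where "x = mp a" "y = mp c" "a \<in> X" "c \<in> X" "a \<noteq> c" by blast
      then show "residue_form (mp m) (mp u) x y = 0" using X by (simp add: A.orthobasis_def form zero)
    qed
    then show "poly_space.independent (mp ` X)"
      using nz X'(1) by (intro B.orthogonal_independent) (auto simp: form zero_iff)
    show "poly_space.span (mp ` X) = residues (mp m)"
    proof
      show "poly_space.span (mp ` X) \<subseteq> residues (mp m)"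
        using Xsub m by (intro poly_space.span_minimal subspace_residues) (auto simp: residues_def degree_mp)
      have "monom 1 i \<in> poly_space.span (mp ` X)" if i: "i < degree m" for i
      proof -
        have "monom 1 i \<in> poly_space.span X" unfolding X'(2) using i by (simp add: residues_def degree_monom_eq)
        then obtain f where "monom 1 i = (\<Sum>x\<in>X. smult (f x) x)" using poly_space.span_finite[OF X'(1)] by auto
        then have "mp (monom 1 i) = (\<Sum>x\<in>X. smult (\<sigma> (f x)) (mp x))" by (simp only: mp_sum mp_smult)
        then show ?thesis unfolding mp_monom
          by (simp only:) (auto intro: poly_space.span_sum poly_space.span_scale poly_space.span_base)
      qed
      then have "poly_space.span (monom 1 ` {..<degree (mp m)}) \<subseteq> poly_space.span (mp ` X)"
        by (intro poly_space.span_minimal) (auto simp: degree_mp)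
      then show "residues (mp m) \<subseteq> poly_space.span (mp ` X)" using residues_subset_span by blast
    qed
  qed
  have sums: "(\<Sum>x\<in>mp ` X. rsgn (residue_form (mp m) (mp u) x x)) = (\<Sum>x\<in>X. sgn_in P\<sigma> (residue_form m u x x))"
    using inj_mp by (subst sum.reindex) (auto simp: form sgn_in_P inj_on_def)
  have "B.has_sig nonneg_reals (residues (mp m)) (\<Sum>x\<in>X. sgn_in P\<sigma> (residue_form m u x x))"
    unfolding B.has_sig_def by (intro exI[of _ "mp ` X"] conjI ob sums[symmetric])
  then have "(\<Sum>x\<in>X. sgn_in P\<sigma> (residue_form m u x x)) = residue_sig nonneg_reals (mp m) (mp u)"
    using residue_sig_iff[OF field_ordering_nonneg_reals] nonconst_monic_mp[OF m] by blast
  moreover have "A.has_sig P\<sigma> (residues m) (\<Sum>x\<in>X. sgn_in P\<sigma> (residue_form m u x x))"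
    unfolding A.has_sig_def by (intro exI[of _ X] conjI X refl)
  then have "(\<Sum>x\<in>X. sgn_in P\<sigma> (residue_form m u x x)) = residue_sig P\<sigma> m u"
    using residue_sig_iff[OF field_ordering_P] m by blast
  ultimately show ?thesis by simp
qed

end

lemma finite_min_pos:
  "finite X \<Longrightarrow> (\<And>x. x \<in> X \<Longrightarrow> 0 < (f x :: real)) \<Longrightarrow> \<exists>\<mu>>0. \<forall>x\<in>X. \<mu> \<le> f x"
proof (induction X rule: finite_induct)
  case empty
  show ?case by (intro exI[of _ 1]) auto
next
  case (insert x X)
  then obtain \<mu> where "0 < \<mu>" "\<forall>x\<in>X. \<mu> \<le> f x" by auto
  then show ?case using insert.prems[of x] by (intro exI[of _ "min \<mu> (f x)"]) auto
qed

text \<open>Lower semicontinuity of the positive index. For \<open>v\<close> in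
  \<open>span A\<close> let \<open>N\<close> be the sum of the squares of its coordinates. Then
  \<open>b v v\<close> is at least \<open>\<mu> * N\<close>, and \<open>b' v v\<close> is at most
  \<open>M * N\<close> in absolute value, so a perturbation with a factor below
  \<open>\<mu> / M\<close> stays positive definite there.\<close>

lemma pos_part_stable:
  fixes s :: "real \<Rightarrow> 'a::ab_group_add \<Rightarrow> 'a"
  assumes b: "sym_bilinear s b" and b': "sym_bilinear s b'" and X: "sym_bilinear.orthobasis s b W X"
  shows "\<exists>\<delta>>0. \<forall>e Y. \<bar>e\<bar> < \<delta> \<longrightarrow> sym_bilinear.orthobasis s (\<lambda>x y. b x y + e * b' x y) W Y \<longrightarrow>
    card {x\<in>X. 0 < b x x} \<le> card {y\<in>Y. 0 < b y y + e * b' y y}"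
proof -
  interpret b: sym_bilinear s b by fact
  interpret b': sym_bilinear s b' by fact
  define A where "A = {x\<in>X. 0 < b x x}"
  have X': "finite X" "b.independent X" "b.span X = W" using X by (auto simp: b.orthobasis_def)
  have A: "finite A" "b.independent A" "A \<subseteq> W"
    using X' b.independent_mono[OF X'(2), of A] b.span_superset[of X] by (auto simp: A_def)
  have orthA: "\<forall>x\<in>A. \<forall>y\<in>A. x \<noteq> y \<longrightarrow> b x y = 0" using X by (auto simp: b.orthobasis_def A_def)
  obtain \<mu> where \<mu>: "0 < \<mu>" "\<And>x. x \<in> A \<Longrightarrow> \<mu> \<le> b x x"
    using finite_min_pos[OF A(1), of "\<lambda>x. b x x"] by (auto simp: A_def)
  \<comment> \<open>The summand 1 keeps \<open>M\<close> positive when \<open>A\<close> is empty or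
    \<open>b'\<close> vanishes on it.\<close>
  define M where "M = (\<Sum>x\<in>A. \<Sum>y\<in>A. \<bar>b' x y\<bar>) + 1"
  have M: "0 < M" unfolding M_def by (smt (verit) abs_ge_zero sum_nonneg)
  show ?thesis
  proof (intro exI[of _ "\<mu> / M"] conjI allI impI)
    show "0 < \<mu> / M" using \<mu> M by simp
    fix e Y assume e: "\<bar>e\<bar> < \<mu> / M" and Y: "sym_bilinear.orthobasis s (\<lambda>x y. b x y + e * b' x y) W Y"
    interpret be: sym_bilinear s "\<lambda>x y. b x y + e * b' x y"
    proof
      show "b x y + e * b' x y = b y x + e * b' y x" for x y using b.b_commute[of x y] b'.b_commute[of x y] by simp
    qed (simp_all add: b.b_add_left b'.b_add_left b.b_scale_left b'.b_scale_left algebra_simps)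
    have pos: "0 < b v v + e * b' v v" if v: "v \<in> b.span A" "v \<noteq> 0" for v
    proof -
      obtain f where f: "v = (\<Sum>x\<in>A. s (f x) x)" using v(1) b.span_finite[OF A(1)] by auto
      define N where "N = (\<Sum>x\<in>A. (f x)\<^sup>2)"
      have fN: "(f x)\<^sup>2 \<le> N" if "x \<in> A" for x unfolding N_def using A(1) that by (intro member_le_sum) auto
      have "\<exists>x\<in>A. f x \<noteq> 0" using v(2) f by (metis (no_types, lifting) b.scale_zero_left sum.neutral)
      then obtain x where "x \<in> A" "f x \<noteq> 0" by blast
      then have N: "0 < N" using fN[of x] by (smt (verit) zero_less_power2)
      have "\<mu> * N \<le> b v v"
        unfolding f b.b_orthogonal_sum[OF A(1) orthA] N_def sum_distrib_left
        by (intro sum_mono) (metis \<mu>(2) mult.commute mult_left_mono zero_le_power2)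
      moreover have "\<bar>b' v v\<bar> \<le> M * N"
      proof -
        have "b' v v = (\<Sum>x\<in>A. f x * (\<Sum>y\<in>A. f y * b' x y))"
          unfolding f b'.b_sum_left b'.b_scale_left unfolding b'.b_sum_right b'.b_scale_right ..
        also have "\<dots> = (\<Sum>x\<in>A. \<Sum>y\<in>A. f x * f y * b' x y)" by (simp add: sum_distrib_left mult.assoc)
        finally have "\<bar>b' v v\<bar> \<le> (\<Sum>x\<in>A. \<bar>\<Sum>y\<in>A. f x * f y * b' x y\<bar>)" by (simp add: sum_abs)
        also have "\<dots> \<le> (\<Sum>x\<in>A. \<Sum>y\<in>A. \<bar>f x * f y * b' x y\<bar>)" by (intro sum_mono sum_abs)
        also have "\<dots> \<le> (\<Sum>x\<in>A. \<Sum>y\<in>A. N * \<bar>b' x y\<bar>)"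
        proof (intro sum_mono)
          fix x y assume "x \<in> A" "y \<in> A"
          then have "(f x)\<^sup>2 \<le> N" "(f y)\<^sup>2 \<le> N" using fN by auto
          moreover have "2 * \<bar>f x * f y\<bar> \<le> (f x)\<^sup>2 + (f y)\<^sup>2"
            using sum_squares_bound[of "\<bar>f x\<bar>" "\<bar>f y\<bar>"] by (simp add: abs_mult)
          ultimately have "\<bar>f x * f y\<bar> \<le> N" by linarith
          then show "\<bar>f x * f y * b' x y\<bar> \<le> N * \<bar>b' x y\<bar>" by (simp add: abs_mult mult_right_mono)
        qed
        also have "\<dots> = N * (M - 1)" by (simp add: M_def sum_distrib_left)
        also have "\<dots> \<le> M * N" using N by (simp add: algebra_simps)
        finally show ?thesis .
      qed
      then have "\<bar>e\<bar> * \<bar>b' v v\<bar> \<le> \<bar>e\<bar> * (M * N)" by (intro mult_left_mono) auto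
      then have "\<bar>e * b' v v\<bar> \<le> (\<bar>e\<bar> * M) * N" by (simp add: abs_mult mult.assoc)
      moreover have "(\<bar>e\<bar> * M) * N < \<mu> * N" using e M N by (intro mult_strict_right_mono) (simp_all add: field_simps)
      ultimately show ?thesis by linarith
    qed
    have "card A \<le> card {x\<in>Y. b x x + e * b' x x \<in> nonneg_reals \<and> b x x + e * b' x x \<noteq> 0}"
      by (rule be.pos_definite_card_le[OF field_ordering_nonneg_reals Y A(2,3)]) (use pos in fastforce)
    also have "{x\<in>Y. b x x + e * b' x x \<in> nonneg_reals \<and> b x x + e * b' x x \<noteq> 0} = {y\<in>Y. 0 < b y y + e * b' y y}" by auto
    finally show "card {x\<in>X. 0 < b x x} \<le> card {y\<in>Y. 0 < b y y + e * b' y y}" unfolding A_def .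
  qed
qed

text \<open>Neither the positive nor the negative index drops under a small perturbation. Before it
  they sum up to the dimension, as the form is nondegenerate, so neither can grow.\<close>

lemma residue_sig_stable:
  fixes m :: "real poly"
  assumes m: "nonconst_monic m" and u: "unit_mod m u"
  shows "\<exists>\<delta>>0. \<forall>e. \<bar>e\<bar> < \<delta> \<longrightarrow> residue_sig nonneg_reals m (u + smult e g) = residue_sig nonneg_reals m u"
proof -
  interpret b: sym_bilinear smult "residue_form m u" by (rule sym_bilinear_residue_form)
  let ?b = "residue_form m u" and ?g = "residue_form m g"
  obtain X where X: "b.orthobasis (residues m) X"
    using b.orthobasis_exists[OF subspace_residues residues_subset_span] m by auto
  have nz: "?b x x \<noteq> 0" if "x \<in> X" for x using residue_orthobasis_nonzero[OF m u X that] .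
  obtain \<delta>1 where \<delta>1: "\<delta>1 > 0" "\<And>e Y. \<bar>e\<bar> < \<delta>1 \<Longrightarrow> sym_bilinear.orthobasis smult (\<lambda>x y. ?b x y + e * ?g x y) (residues m) Y \<Longrightarrow>
    card {x\<in>X. 0 < ?b x x} \<le> card {y\<in>Y. 0 < ?b y y + e * ?g y y}"
    using pos_part_stable[OF sym_bilinear_residue_form sym_bilinear_residue_form[of m g] X] by blast
  have X': "sym_bilinear.orthobasis smult (\<lambda>x y. - ?b x y) (residues m) X" using X unfolding b.orthobasis_minus .
  obtain \<delta>2 where \<delta>2: "\<delta>2 > 0" "\<And>e Y. \<bar>e\<bar> < \<delta>2 \<Longrightarrow> sym_bilinear.orthobasis smult (\<lambda>x y. - ?b x y + e * ?g x y) (residues m) Y \<Longrightarrow>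
    card {x\<in>X. 0 < - ?b x x} \<le> card {y\<in>Y. 0 < - ?b y y + e * ?g y y}"
    using pos_part_stable[OF b.sym_bilinear_minus sym_bilinear_residue_form[of m g] X'] by blast
  have "residue_sig nonneg_reals m (u + smult e g) = residue_sig nonneg_reals m u" if e: "\<bar>e\<bar> < min \<delta>1 \<delta>2" for e
  proof -
    interpret be: sym_bilinear smult "residue_form m (u + smult e g)" by (rule sym_bilinear_residue_form)
    have form: "residue_form m (u + smult e g) x y = ?b x y + e * ?g x y" for x y
      by (simp add: residue_form_def distrib_right top_coeff_add top_coeff_smult)
    then have form': "residue_form m (u + smult e g) = (\<lambda>x y. ?b x y + e * ?g x y)" by blast
    obtain Y where Y: "be.orthobasis (residues m) Y"
      using be.orthobasis_exists[OF subspace_residues residues_subset_span] m by auto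
    have "card {x\<in>X. 0 < ?b x x} \<le> card {y\<in>Y. 0 < ?b y y + e * ?g y y}"
      using \<delta>1(2)[of e Y] e Y unfolding form' by simp
    moreover have "card {x\<in>X. 0 < - ?b x x} \<le> card {y\<in>Y. 0 < - (?b y y + e * ?g y y)}"
    proof -
      have "sym_bilinear.orthobasis smult (\<lambda>x y. - ?b x y + (- e) * ?g x y) (residues m) Y"
        using Y unfolding be.orthobasis_minus[symmetric] form by (simp add: add.commute)
      then show ?thesis using \<delta>2(2)[of "- e" Y] e by (simp add: add.commute)
    qed
    moreover have fin: "finite X" "finite Y" using X Y by (auto simp: b.orthobasis_def be.orthobasis_def)
    have "card X = card Y"
    proof (rule antisym)
      show "card X \<le> card Y"
        using poly_space.independent_span_bound[OF fin(2), of X] X Y poly_space.span_superset[of X]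
        by (auto simp: b.orthobasis_def be.orthobasis_def)
      show "card Y \<le> card X"
        using poly_space.independent_span_bound[OF fin(1), of Y] X Y poly_space.span_superset[of Y]
        by (auto simp: b.orthobasis_def be.orthobasis_def)
    qed
    moreover have "card X = card {x\<in>X. 0 < ?b x x} + card {x\<in>X. 0 < - ?b x x}"
      using fin nz by (subst card_Un_disjoint[symmetric]) (auto intro!: arg_cong[where f = card] simp: not_less_iff_gr_or_eq linorder_neq_iff)
    moreover have "card {y\<in>Y. 0 < ?b y y + e * ?g y y} + card {y\<in>Y. 0 < - (?b y y + e * ?g y y)} \<le> card Y"
      using fin by (subst card_Un_disjoint[symmetric]) (auto intro!: card_mono)
    ultimately have eq: "card {x\<in>X. 0 < ?b x x} = card {y\<in>Y. 0 < ?b y y + e * ?g y y}"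
      "card {x\<in>X. 0 < - ?b x x} = card {y\<in>Y. 0 < - (?b y y + e * ?g y y)}" by linarith+
    have conv: "{x\<in>Z. q x \<in> nonneg_reals \<and> q x \<noteq> 0} = {x\<in>Z. 0 < q x}"
      "{x\<in>Z. - q x \<in> nonneg_reals \<and> q x \<noteq> 0} = {x\<in>Z. 0 < - q x}" for Z :: "real poly set" and q :: "real poly \<Rightarrow> real" by auto
    have "(\<Sum>x\<in>X. rsgn (?b x x)) = (\<Sum>y\<in>Y. rsgn (residue_form m (u + smult e g) y y))"
      unfolding b.sum_sgn_in[OF field_ordering_nonneg_reals fin(1)] b.sum_sgn_in[OF field_ordering_nonneg_reals fin(2)] conv form
      using eq by simp
    moreover have "(\<Sum>x\<in>X. rsgn (?b x x)) = residue_sig nonneg_reals m u"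
      using residue_sig_iff[OF field_ordering_nonneg_reals, of m u] m X unfolding b.has_sig_def by blast
    moreover have "(\<Sum>y\<in>Y. rsgn (residue_form m (u + smult e g) y y)) = residue_sig nonneg_reals m (u + smult e g)"
      using residue_sig_iff[OF field_ordering_nonneg_reals, of m "u + smult e g"] m Y unfolding be.has_sig_def by blast
    ultimately show ?thesis by simp
  qed
  then show ?thesis using \<delta>1(1) \<delta>2(1) by (intro exI[of _ "min \<delta>1 \<delta>2"]) auto
qed

text \<open>
  If \<open>c\<close> passes the root \<open>\<rho>\<close> of the modulus, then the signature of \<open>(X - c) u\<close> jumps by
  twice the sign of \<open>u (\<rho>)\<close>, up to a sign that does not depend on \<open>u\<close>.
\<close>

lemma place_signature_0:
  fixes p :: "'k::field_char_0 poly"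
  assumes p: "irreducible p" "lead_coeff p = 1" and U: "\<And>u. u \<in># U \<Longrightarrow> unit_mod p u"
    and sig: "\<And>P c. field_ordering P \<Longrightarrow> (\<Sum>u\<in>#U. residue_sig P p (c * u)) = 0"
    and \<chi>: "place p \<chi>"
  shows "(\<Sum>u\<in>#U. rsgn (\<chi> u)) = 0"
proof -
  define \<sigma> where "\<sigma> a = \<chi> [:a:]" for a
  interpret real_embedding \<sigma>
  proof
    show "\<sigma> (a + b) = \<sigma> a + \<sigma> b" for a b using place_add[OF \<chi>, of "[:a:]" "[:b:]"] by (simp add: \<sigma>_def)
    show "\<sigma> (a * b) = \<sigma> a * \<sigma> b" for a b using place_mult[OF \<chi>, of "[:a:]" "[:b:]"] by (simp add: \<sigma>_def mult.commute)
    show "\<sigma> 1 = 1" using place_1[OF \<chi>] by (simp add: \<sigma>_def one_pCons)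
  qed
  define \<rho> where "\<rho> = \<chi> [:0, 1:]"
  have \<chi>_eq: "\<chi> f = poly (mp f) \<rho>" for f
  proof (induction f)
    case (pCons a f)
    have "pCons a f = [:a:] + [:0, 1:] * f" by simp
    then have "\<chi> (pCons a f) = \<sigma> a + \<rho> * \<chi> f" by (simp only: place_add[OF \<chi>] place_mult[OF \<chi>] \<sigma>_def \<rho>_def)
    then show ?case using pCons.IH by (simp add: mp_pCons)
  qed (simp add: place_0[OF \<chi>])
  have dp: "0 < degree p" using p is_unit_iff_degree[of p] by (auto simp: Factorial_Ring.irreducible_def)
  have pm: "nonconst_monic p" using p dp by simp
  \<comment> \<open>For linear \<open>p\<close> the sign is itself a signature. Otherwise
    \<open>p\<close> does not divide \<open>X - c\<close> for any \<open>c\<close>, and the cofactor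
    \<open>n\<close> of \<open>X - \<rho>\<close> in the real modulus is not constant.\<close>
  show ?thesis
  proof (cases "degree p = 1")
    case True
    then obtain e f where "p = [:e, f:]" by (metis One_nat_def degree1_coeffs)
    then have pe: "p = [:- (- e), 1:]" using p(2) True by (auto split: if_splits)
    have "\<rho> = \<sigma> (- e)"
    proof -
      have "\<chi> p = 0" by (rule place_p[OF \<chi>])
      then show ?thesis unfolding \<chi>_eq unfolding pe by (simp add: mp_pCons one minus)
    qed
    moreover have "poly (mp f) (\<sigma> a) = \<sigma> (poly f a)" for f a
      by (induction f) (simp_all add: mp_pCons add mult zero)
    ultimately have "rsgn (\<chi> u) = residue_sig P\<sigma> p (1 * u)" for u
      unfolding pe residue_sig_linear[OF field_ordering_P] sgn_in_P \<chi>_eq by simp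
    then show ?thesis using sig[OF field_ordering_P, of 1] by simp
  next
    case False
    define l where "l = [:- \<rho>, 1:]"
    have "poly (mp p) \<rho> = 0" using place_p[OF \<chi>] \<chi>_eq by simp
    then obtain n where n: "mp p = l * n" by (auto simp: l_def poly_eq_0_iff_dvd elim: dvdE)
    have mpm: "nonconst_monic (mp p)" by (rule nonconst_monic_mp[OF pm])
    have ln: "l \<noteq> 0" "n \<noteq> 0" using mpm n by auto
    have "degree (mp p) = 1 + degree n" unfolding n using ln by (subst degree_mult_eq) (auto simp: l_def)
    then have "0 < degree n" using dp False unfolding degree_mp by linarith
    moreover have "lead_coeff (mp p) = lead_coeff l * lead_coeff n" unfolding n by (rule lead_coeff_mult)
    then have "lead_coeff n = 1" using mpm by (simp add: l_def)
    ultimately have nm: "nonconst_monic n" by simp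
    have lm: "nonconst_monic l" by (simp add: l_def)
    \<comment> \<open>\<open>\<rho>\<close> is a simple root, as an irreducible polynomial in
      characteristic 0 is prime to its derivative; at \<open>\<rho>\<close> the derivative of
      \<open>l * n\<close> has the value of \<open>n\<close>.\<close>
    have n\<rho>: "poly n \<rho> \<noteq> 0"
    proof -
      have "pderiv p \<noteq> 0" using dp by (simp add: pderiv_eq_0_iff)
      then have "\<not> p dvd pderiv p" using dvd_imp_degree_le[of p "pderiv p"] dp by (auto simp: degree_pderiv)
      then have "\<chi> (pderiv p) \<noteq> 0" using place_unit[OF \<chi>] unit_mod_irreducible[OF p(1)] by blast
      then have "poly (pderiv (l * n)) \<rho> \<noteq> 0" unfolding \<chi>_eq mp_pderiv n .
      moreover have "poly (pderiv (l * n)) \<rho> = poly n \<rho>" unfolding pderiv_mult by (simp add: l_def pderiv_pCons)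
      ultimately show ?thesis by (simp only: not_False_eq_True)
    qed
    have cop: "unit_mod l n"
    proof -
      have "l dvd n - [:poly n \<rho>:]" by (simp add: l_def poly_eq_0_iff_dvd[symmetric])
      moreover have "unit_mod l [:poly n \<rho>:]"
        unfolding unit_mod_def by (intro exI[of _ "[:1 / poly n \<rho>:]"]) (simp add: n\<rho> one_pCons)
      ultimately show ?thesis using unit_mod_cong by (metis dvd_diff_commute)
    qed
    have split: "residue_sig nonneg_reals (mp p) v = rsgn (poly v \<rho> * poly n \<rho>) + residue_sig nonneg_reals n (v * l)" for v
      unfolding n residue_sig_coprime[OF field_ordering_nonneg_reals lm nm cop]
      by (simp add: l_def residue_sig_linear[OF field_ordering_nonneg_reals])
    \<comment> \<open>One factor \<open>l\<close> is \<open>X - c\<close> at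
      \<open>c = \<rho>\<close>, the other one stems from the splitting of the modulus. For
      \<open>c\<close> near \<open>\<rho>\<close> the part of the signature modulo \<open>n\<close>
      does not depend on \<open>c\<close>.\<close>
    have "\<exists>\<delta>>0. \<forall>e. \<bar>e\<bar> < \<delta> \<longrightarrow> residue_sig nonneg_reals n (l * mp u * l + smult e (mp u * l)) = residue_sig nonneg_reals n (l * mp u * l)"
      if u: "u \<in># U" for u
    proof (rule residue_sig_stable[OF nm])
      have "unit_mod n (mp u)" using unit_mod_mp[OF U[OF u]] unit_mod_dvd[of "mp p" "mp u" n] n by simp
      then show "unit_mod n (l * mp u * l)" using unit_mod_commute[OF cop] by (intro unit_mod_mult)
    qed
    then obtain \<delta> where \<delta>: "\<And>u. u \<in># U \<Longrightarrow> 0 < \<delta> u"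
      "\<And>u e. u \<in># U \<Longrightarrow> \<bar>e\<bar> < \<delta> u \<Longrightarrow> residue_sig nonneg_reals n (l * mp u * l + smult e (mp u * l)) = residue_sig nonneg_reals n (l * mp u * l)"
      by metis
    obtain d where d: "0 < d" "\<And>u. u \<in># U \<Longrightarrow> d \<le> \<delta> u" using finite_min_pos[of "set_mset U" \<delta>] \<delta>(1) by auto
    define K where "K = (\<Sum>u\<in>#U. residue_sig nonneg_reals n (l * mp u * l))"
    \<comment> \<open>\<open>c\<close> is rational, so that \<open>X - c\<close> has coefficients in
      \<open>K\<close> and the assumption on signatures applies to it.\<close>
    have main: "(\<Sum>u\<in>#U. rsgn ((\<rho> - of_rat c) * (\<chi> u * poly n \<rho>))) + K = 0" if c: "\<bar>\<rho> - of_rat c\<bar> < d" "\<rho> \<noteq> of_rat c" for c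
    proof -
      define x where "x = [:- of_rat c, 1 :: 'k:]"
      have ux: "unit_mod p x" 
      proof (rule unit_mod_irreducible[OF p(1)])
        show "\<not> p dvd x" using dvd_imp_degree_le[of p x] False dp by (auto simp: x_def)
      qed
      have mx: "mp x = l + [:\<rho> - of_rat c:]" by (simp add: x_def mp_pCons one minus of_rat l_def)
      have "residue_sig P\<sigma> p (x * u) = rsgn ((\<rho> - of_rat c) * (\<chi> u * poly n \<rho>)) + residue_sig nonneg_reals n (l * mp u * l)"
        if u: "u \<in># U" for u
      proof -
        have "residue_sig P\<sigma> p (x * u) = residue_sig nonneg_reals (mp p) (mp (x * u))"
          using residue_sig_mp[OF pm unit_mod_mult[OF ux U[OF u]]] by simp
        also have "\<dots> = rsgn (poly (mp x * mp u) \<rho> * poly n \<rho>) + residue_sig nonneg_reals n (mp x * mp u * l)"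
          by (simp only: split mp_mult)
        also have "poly (mp x * mp u) \<rho> = (\<rho> - of_rat c) * \<chi> u" by (simp add: mx l_def \<chi>_eq left_diff_distrib)
        also have "mp x * mp u * l = l * mp u * l + smult (\<rho> - of_rat c) (mp u * l)" by (simp add: mx algebra_simps)
        also have "residue_sig nonneg_reals n (l * mp u * l + smult (\<rho> - of_rat c) (mp u * l)) = residue_sig nonneg_reals n (l * mp u * l)"
          using \<delta>(2)[OF u, of "\<rho> - of_rat c"] c d(2)[OF u] by linarith
        finally show ?thesis by (simp add: mult.assoc)
      qed
      then have "(\<Sum>u\<in>#U. residue_sig P\<sigma> p (x * u)) =
          (\<Sum>u\<in>#U. rsgn ((\<rho> - of_rat c) * (\<chi> u * poly n \<rho>)) + residue_sig nonneg_reals n (l * mp u * l))"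
        by (intro arg_cong[where f = sum_mset] image_mset_cong) auto
      then show ?thesis using sig[OF field_ordering_P, of x] by (simp add: sum_mset.distrib K_def)
    qed
    \<comment> \<open>On the two sides of \<open>\<rho>\<close> the first sum in \<open>main\<close>
      has opposite values while \<open>K\<close> stays the same, so both vanish.\<close>
    obtain c0 where c0: "\<rho> - d < of_rat c0" "of_rat c0 < \<rho>" using of_rat_dense[of "\<rho> - d" \<rho>] d by auto
    obtain c1 where c1: "\<rho> < of_rat c1" "of_rat c1 < \<rho> + d" using of_rat_dense[of \<rho> "\<rho> + d"] d by auto
    note sm = sgn_in_mult[OF field_ordering_nonneg_reals]
    have r0: "rsgn (\<rho> - of_rat c0) = 1" and r1: "rsgn (\<rho> - of_rat c1) = -1" using c0 c1 by (simp_all add: sgn_in_def)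
    have "(\<Sum>u\<in>#U. rsgn (\<chi> u) * rsgn (poly n \<rho>)) + K = 0" using main[of c0] c0 d by (simp add: sm r0)
    moreover have "- (\<Sum>u\<in>#U. rsgn (\<chi> u) * rsgn (poly n \<rho>)) + K = 0"
      using main[of c1] c1 d by (simp add: sm r1 sum_mset_uminus)
    ultimately have "(\<Sum>u\<in>#U. rsgn (\<chi> u) * rsgn (poly n \<rho>)) = 0" by simp
    then have "(\<Sum>u\<in>#U. rsgn (\<chi> u)) * rsgn (poly n \<rho>) = 0" by (simp add: sum_mset_distrib_right)
    then show ?thesis using n\<rho> by (auto simp: sgn_in_def split: if_splits)
  qed
qed


section \<open>The local criterion over number fields\<close>

lemma place_unit_iff:
  assumes "irreducible p" "place p \<chi>" "\<chi> u \<noteq> 0" shows "unit_mod p u"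
  using assms unit_mod_irreducible place_dvd by blast

lemma rsgn_simps: "0 < x \<Longrightarrow> rsgn x = 1" "x < 0 \<Longrightarrow> rsgn x = - 1"
  by (simp_all add: sgn_in_def)

text \<open>Let \<open>a1\<close> be \<open>a\<close>, rescaled by a square to absolute value below
  1 at all places. The even power \<open>(1 + a1) ^ (2 * N)\<close> enlarges positive values and
  shrinks negative ones. As a result, the sum of two units prepared in this way is positive wherever
  one of them is.\<close>

lemma place_amplify:
  fixes p :: "'k::field_char_0 poly"
  assumes nf: "number_field TYPE('k)" and p: "irreducible p" and a: "unit_mod p a" and \<chi>0: "place p \<chi>0"
  shows "\<exists>w. unit_mod p w \<and> (\<forall>\<chi>. place p \<chi> \<longrightarrow>
    (0 < \<chi> a \<longrightarrow> 1 < \<chi> (a * w\<^sup>2)) \<and> (\<chi> a < 0 \<longrightarrow> - 1 < \<chi> (a * w\<^sup>2) \<and> \<chi> (a * w\<^sup>2) < 0))"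
proof -
  obtain e where e: "p dvd a * e - 1" using a by (auto simp: unit_mod_def)
  obtain C D :: nat where C: "\<And>\<chi>. place p \<chi> \<Longrightarrow> \<bar>\<chi> a\<bar> \<le> C" and D: "\<And>\<chi>. place p \<chi> \<Longrightarrow> \<bar>\<chi> e\<bar> \<le> D"
    using place_bound[OF nf p] by metis
  \<comment> \<open>\<open>Suc C\<close> exceeds the values of \<open>a\<close> at all places; the
    scaling uses the square of \<open>r\<close>, so that it stays within the square class.\<close>
  define r where "r = 1 / real (Suc C)"
  define rp where "rp = ([:1 / of_nat (Suc C):] :: 'k poly)"
  have r: "0 < r" "r \<le> 1" by (simp_all add: r_def)
  have rp: "\<chi> rp = r" if \<chi>: "place p \<chi>" for \<chi>
  proof -
    have "of_nat (Suc C) * rp = 1" by (simp add: rp_def of_nat_poly one_pCons del: of_nat_Suc)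
    then have "\<chi> (of_nat (Suc C)) * \<chi> rp = 1" using place_mult[OF \<chi>] place_1[OF \<chi>] by metis
    then show ?thesis unfolding place_of_nat[OF \<chi>] r_def by (simp add: field_simps del: of_nat_Suc)
  qed
  define a1 where "a1 = a * rp\<^sup>2"
  have a1: "\<chi> a1 = \<chi> a * r\<^sup>2" if "place p \<chi>" for \<chi>
    using rp[OF that] place_mult[OF that] by (simp add: a1_def power2_eq_square)
  have a1_small: "\<bar>\<chi> a1\<bar> < 1" if \<chi>: "place p \<chi>" for \<chi>
  proof -
    have "\<bar>\<chi> a * r\<bar> < 1" using C[OF \<chi>] r(1) by (simp add: abs_mult r_def field_simps)
    moreover have "\<bar>\<chi> a1\<bar> = \<bar>\<chi> a * r\<bar> * r" using r(1) by (simp add: a1[OF \<chi>] abs_mult power2_eq_square)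
    ultimately show ?thesis using r mult_mono[of "\<bar>\<chi> a * r\<bar>" "\<bar>\<chi> a * r\<bar>" r 1] by simp
  qed
  \<comment> \<open>A lower bound for the positive values of \<open>a1\<close>: those of
    \<open>a\<close> are at least \<open>1 / Suc D\<close>, as the inverse \<open>e\<close> is
    bounded by \<open>D\<close>.\<close>
  define \<delta> where "\<delta> = r\<^sup>2 / real (Suc D)"
  have \<delta>: "0 < \<delta>" using r by (simp add: \<delta>_def)
  have a1_large: "\<delta> \<le> \<chi> a1" if \<chi>: "place p \<chi>" "0 < \<chi> a" for \<chi>
  proof -
    have "\<chi> a * \<chi> e = 1" using place_cong[OF \<chi>(1) e] place_mult[OF \<chi>(1)] place_1[OF \<chi>(1)] by simp
    moreover have "\<chi> a * \<chi> e \<le> \<chi> a * real (Suc D)" using D[OF \<chi>(1)] \<chi>(2) by (intro mult_left_mono) auto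
    ultimately have "1 / real (Suc D) \<le> \<chi> a" by (simp add: field_simps)
    then have "r\<^sup>2 * (1 / real (Suc D)) \<le> r\<^sup>2 * \<chi> a" by (intro mult_left_mono) auto
    then show ?thesis by (simp add: a1[OF \<chi>(1)] \<delta>_def mult.commute)
  qed
  \<comment> \<open>One exponent for all places: \<open>(1 + \<delta>) ^ N\<close> lifts
    \<open>\<delta>\<close> above 1 even before squaring.\<close>
  obtain N where N: "1 / \<delta> < (1 + \<delta>) ^ N" using real_arch_pow[of "1 + \<delta>"] \<delta> by auto
  define w where "w = rp * (1 + a1) ^ N"
  have aw: "\<chi> (a * w\<^sup>2) = \<chi> a1 * ((1 + \<chi> a1) ^ N)\<^sup>2" "\<chi> w = r * (1 + \<chi> a1) ^ N" if \<chi>: "place p \<chi>" for \<chi>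
    using rp[OF \<chi>] a1[OF \<chi>] by (simp_all add: w_def place_mult[OF \<chi>] place_power[OF \<chi>] place_add[OF \<chi>] place_1[OF \<chi>] power_mult_distrib)
  have "\<chi>0 w \<noteq> 0" using aw(2)[OF \<chi>0] r a1_small[OF \<chi>0] by auto
  then have "unit_mod p w" using place_unit_iff[OF p \<chi>0] by blast
  moreover have "1 < \<chi> (a * w\<^sup>2)" if \<chi>: "place p \<chi>" "0 < \<chi> a" for \<chi>
  proof -
    have le: "(1 + \<delta>) ^ N \<le> (1 + \<chi> a1) ^ N" using a1_large[OF \<chi>] \<delta> by (intro power_mono) auto
    have one: "1 \<le> (1 + \<delta>) ^ N" using \<delta> by simp
    then have "(1 + \<delta>) ^ N \<le> ((1 + \<chi> a1) ^ N)\<^sup>2"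
      using le mult_mono[of 1 "(1 + \<chi> a1) ^ N" "(1 + \<delta>) ^ N" "(1 + \<chi> a1) ^ N"] unfolding power2_eq_square by simp
    then have "\<delta> * (1 + \<delta>) ^ N \<le> \<chi> a1 * ((1 + \<chi> a1) ^ N)\<^sup>2"
      using a1_large[OF \<chi>] \<delta> one by (intro mult_mono) auto
    moreover have "1 < \<delta> * (1 + \<delta>) ^ N" using N \<delta> by (simp add: field_simps)
    ultimately show ?thesis using aw(1)[OF \<chi>(1)] by simp
  qed
  moreover have "- 1 < \<chi> (a * w\<^sup>2) \<and> \<chi> (a * w\<^sup>2) < 0" if \<chi>: "place p \<chi>" "\<chi> a < 0" for \<chi>
  proof -
    have neg: "\<chi> a1 < 0" using \<chi>(2) r by (simp add: a1[OF \<chi>(1)] mult_less_0_iff)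
    have "0 < 1 + \<chi> a1" "1 + \<chi> a1 \<le> 1" using neg a1_small[OF \<chi>(1)] by auto
    then have "0 < ((1 + \<chi> a1) ^ N)\<^sup>2" "((1 + \<chi> a1) ^ N)\<^sup>2 \<le> 1" by (auto intro!: power_le_one)
    moreover define t where "t = ((1 + \<chi> a1) ^ N)\<^sup>2"
    ultimately have t: "0 < t" "t \<le> 1" by auto
    have "\<chi> a1 * t < 0" using neg t by (simp add: mult_neg_pos)
    moreover have "\<chi> a1 * 1 \<le> \<chi> a1 * t" using neg t by (intro mult_left_mono_neg) auto
    ultimately show ?thesis using a1_small[OF \<chi>(1)] aw(1)[OF \<chi>(1)] by (simp add: t_def)
  qed
  ultimately show ?thesis by blast
qed

text \<open>After amplification, the pair move sends two entries to their sum \<open>c\<close>,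
  whose sign is governed by the positive one, and to \<open>d\<close>, whose sign makes up for the
  change.\<close>

lemma place_merge:
  fixes p :: "'k::field_char_0 poly"
  assumes nf: "number_field TYPE('k)" and p: "irreducible p" and a: "unit_mod p a" and b: "unit_mod p b"
    and \<chi>0: "place p \<chi>0"
  obtains c d where "unit_mod p c" "unit_mod p d"
    "\<And>M. meq (add_mset (p ^ k, a) (add_mset (p ^ k, b) M)) (add_mset (p ^ k, c) (add_mset (p ^ k, d) M))"
    "\<And>\<chi>. place p \<chi> \<Longrightarrow> 0 < \<chi> c \<longleftrightarrow> 0 < \<chi> a \<or> 0 < \<chi> b"
    "\<And>\<chi>. place p \<chi> \<Longrightarrow> rsgn (\<chi> c) + rsgn (\<chi> d) = rsgn (\<chi> a) + rsgn (\<chi> b)"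
proof -
  obtain w where w: "unit_mod p w" "\<And>\<chi>. place p \<chi> \<Longrightarrow> 0 < \<chi> a \<Longrightarrow> 1 < \<chi> (a * w\<^sup>2)"
    "\<And>\<chi>. place p \<chi> \<Longrightarrow> \<chi> a < 0 \<Longrightarrow> - 1 < \<chi> (a * w\<^sup>2) \<and> \<chi> (a * w\<^sup>2) < 0"
    using place_amplify[OF nf p a \<chi>0] by blast
  obtain v where v: "unit_mod p v" "\<And>\<chi>. place p \<chi> \<Longrightarrow> 0 < \<chi> b \<Longrightarrow> 1 < \<chi> (b * v\<^sup>2)"
    "\<And>\<chi>. place p \<chi> \<Longrightarrow> \<chi> b < 0 \<Longrightarrow> - 1 < \<chi> (b * v\<^sup>2) \<and> \<chi> (b * v\<^sup>2) < 0"
    using place_amplify[OF nf p b \<chi>0] by blast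
  define a' b' where "a' = a * w\<^sup>2" and "b' = b * v\<^sup>2"
  define c d where "c = a' + b'" and "d = a' * b' * (a' + b')"
  have sgns: "(0 < \<chi> c \<longleftrightarrow> 0 < \<chi> a \<or> 0 < \<chi> b) \<and> \<chi> c \<noteq> 0 \<and> rsgn (\<chi> c) + rsgn (\<chi> d) = rsgn (\<chi> a) + rsgn (\<chi> b)"
    if \<chi>: "place p \<chi>" for \<chi>
  proof -
    have c: "\<chi> c = \<chi> a' + \<chi> b'" and d: "\<chi> d = \<chi> a' * \<chi> b' * \<chi> c"
      by (simp_all add: c_def d_def place_add[OF \<chi>] place_mult[OF \<chi>])
    have wv: "(0 < \<chi> a \<and> 1 < \<chi> a') \<or> (\<chi> a < 0 \<and> - 1 < \<chi> a' \<and> \<chi> a' < 0)"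
      "(0 < \<chi> b \<and> 1 < \<chi> b') \<or> (\<chi> b < 0 \<and> - 1 < \<chi> b' \<and> \<chi> b' < 0)"
      using w(2,3)[OF \<chi>] v(2,3)[OF \<chi>] place_unit[OF \<chi> a] place_unit[OF \<chi> b] unfolding a'_def b'_def
      by linarith+
    have "rsgn (\<chi> d) = rsgn (\<chi> a') * rsgn (\<chi> b') * rsgn (\<chi> c)"
      unfolding d sgn_in_mult[OF field_ordering_nonneg_reals] ..
    note rd = this
    show ?thesis
    proof (cases "0 < \<chi> a")
      case a: True
      show ?thesis
      proof (cases "0 < \<chi> b")
        case True
        then have "0 < \<chi> a'" "0 < \<chi> b'" "0 < \<chi> c" using a wv c by linarith+
        then show ?thesis using a True rd by (simp add: rsgn_simps)
      next
        case False
        then have "0 < \<chi> a'" "\<chi> b' < 0" "0 < \<chi> c" "\<chi> b < 0" using a wv c by linarith+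
        then show ?thesis using a rd by (simp add: rsgn_simps)
      qed
    next
      case a: False
      show ?thesis
      proof (cases "0 < \<chi> b")
        case True
        then have "\<chi> a' < 0" "0 < \<chi> b'" "0 < \<chi> c" "\<chi> a < 0" using a wv c by linarith+
        then show ?thesis using True rd by (simp add: rsgn_simps)
      next
        case False
        then have "\<chi> a' < 0" "\<chi> b' < 0" "\<chi> c < 0" "\<chi> a < 0" "\<chi> b < 0" using a wv c by linarith+
        then show ?thesis using rd by (simp add: rsgn_simps)
      qed
    qed
  qed
  have uc: "unit_mod p c" using sgns[OF \<chi>0] place_unit_iff[OF p \<chi>0] by blast
  have uab: "unit_mod p a'" "unit_mod p b'" unfolding a'_def b'_def by (intro unit_mod_mult unit_mod_power a b w v)+
  have ud: "unit_mod p d" unfolding d_def using uc uab by (intro unit_mod_mult) (auto simp: c_def)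
  have "meq (add_mset (p ^ k, a) (add_mset (p ^ k, b) M)) (add_mset (p ^ k, c) (add_mset (p ^ k, d) M))" for M
  proof -
    have "meq (add_mset (p ^ k, a) (add_mset (p ^ k, b) M)) (add_mset (p ^ k, a') (add_mset (p ^ k, b) M))"
      by (rule meq_scale[OF unit_mod_power_modulus[OF w(1)]]) (simp add: a'_def)
    moreover have "meq (add_mset (p ^ k, a') (add_mset (p ^ k, b) M)) (add_mset (p ^ k, a') (add_mset (p ^ k, b') M))"
      by (intro meq_add_mset meq_scale[OF unit_mod_power_modulus[OF v(1)]]) (simp add: b'_def)
    moreover have "meq (add_mset (p ^ k, a') (add_mset (p ^ k, b') M)) (add_mset (p ^ k, c) (add_mset (p ^ k, d) M))"
      unfolding c_def d_def by (rule meq_pair) (use uc in \<open>simp add: c_def unit_mod_power_modulus\<close>)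
    ultimately show ?thesis using meq_trans by blast
  qed
  then show ?thesis using that[OF uc ud] sgns by blast
qed

text \<open>Repeated merging collects the positive signs of all entries in a single one, while the
  total sign at each place is preserved.\<close>

lemma place_extract:
  fixes p :: "'k::field_char_0 poly"
  assumes nf: "number_field TYPE('k)" and p: "irreducible p" and \<chi>0: "place p \<chi>0"
    and "U \<noteq> {#}" "\<And>u. u \<in># U \<Longrightarrow> unit_mod p u"
  shows "\<exists>c V. unit_mod p c \<and> (\<forall>v\<in>#V. unit_mod p v) \<and> size U = Suc (size V) \<and>
    meq (image_mset (Pair (p ^ k)) U) (add_mset (p ^ k, c) (image_mset (Pair (p ^ k)) V)) \<and>
    (\<forall>\<chi>. place p \<chi> \<longrightarrow> (0 < \<chi> c \<longleftrightarrow> (\<exists>u\<in>#U. 0 < \<chi> u)) \<and>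
      rsgn (\<chi> c) + (\<Sum>v\<in>#V. rsgn (\<chi> v)) = (\<Sum>u\<in>#U. rsgn (\<chi> u)))"
  using assms(4,5)
proof (induction U)
  case (add a U)
  show ?case
  proof (cases "U = {#}")
    case True
    then show ?thesis using add.prems by (intro exI[of _ a] exI[of _ "{#}"]) (auto intro: meq_refl)
  next
    case False
    then obtain b V where b: "unit_mod p b" "\<forall>v\<in>#V. unit_mod p v" "size U = Suc (size V)"
      "meq (image_mset (Pair (p ^ k)) U) (add_mset (p ^ k, b) (image_mset (Pair (p ^ k)) V))"
      "\<And>\<chi>. place p \<chi> \<Longrightarrow> (0 < \<chi> b \<longleftrightarrow> (\<exists>u\<in>#U. 0 < \<chi> u)) \<and>
      rsgn (\<chi> b) + (\<Sum>v\<in>#V. rsgn (\<chi> v)) = (\<Sum>u\<in>#U. rsgn (\<chi> u))"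
      using add.IH add.prems by auto
    have ua: "unit_mod p a" using add.prems by auto
    obtain c d where cd: "unit_mod p c" "unit_mod p d"
      "\<And>M. meq (add_mset (p ^ k, a) (add_mset (p ^ k, b) M)) (add_mset (p ^ k, c) (add_mset (p ^ k, d) M))"
      "\<And>\<chi>. place p \<chi> \<Longrightarrow> 0 < \<chi> c \<longleftrightarrow> 0 < \<chi> a \<or> 0 < \<chi> b"
      "\<And>\<chi>. place p \<chi> \<Longrightarrow> rsgn (\<chi> c) + rsgn (\<chi> d) = rsgn (\<chi> a) + rsgn (\<chi> b)"
      using place_merge[OF nf p ua b(1) \<chi>0] by metis
    have "meq (image_mset (Pair (p ^ k)) (add_mset a U)) (add_mset (p ^ k, c) (image_mset (Pair (p ^ k)) (add_mset d V)))"
      using meq_trans[OF meq_add_mset[OF b(4), of "(p ^ k, a)"] cd(3)] by simp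
    moreover have "(0 < \<chi> c \<longleftrightarrow> (\<exists>u\<in>#add_mset a U. 0 < \<chi> u)) \<and>
      rsgn (\<chi> c) + (\<Sum>v\<in>#add_mset d V. rsgn (\<chi> v)) = (\<Sum>u\<in>#add_mset a U. rsgn (\<chi> u))" if \<chi>: "place p \<chi>" for \<chi>
      using cd(4,5)[OF \<chi>] b(5)[OF \<chi>] by auto
    ultimately show ?thesis using cd(1,2) b(2,3) by (intro exI[of _ c] exI[of _ "add_mset d V"]) auto
  qed
qed simp

lemma hyperbolic_mset_pairs: "hyperbolic_mset (repeat_mset n {#(m, u)#} + repeat_mset n {#(m, - u)#})"
proof (induction n)
  case (Suc n)
  then show ?case using hyperbolic_add[OF Suc, of m u] by (simp add: add_mset_commute)
qed (auto intro: hyperbolic_mset.intros)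

lemma weakly_hyperbolic_meq: "meq M N \<Longrightarrow> weakly_hyperbolic N \<Longrightarrow> weakly_hyperbolic M"
  unfolding weakly_hyperbolic_def using meq_repeat meq_trans by blast

text \<open>Half of \<open>2 * n\<close> copies are turned into their negatives, which pair off with
  the other half.\<close>

lemma weakly_hyperbolic_if_minus:
  assumes "n \<ge> 1" "meq (repeat_mset n {#(m, u)#}) (repeat_mset n {#(m, - u)#})"
  shows "weakly_hyperbolic {#(m, u)#}"
proof -
  have "meq (repeat_mset (n + n) {#(m, u)#}) (repeat_mset n {#(m, u)#} + repeat_mset n {#(m, - u)#})"
    unfolding repeat_mset_plus by (rule meq_add2[OF meq_refl assms(2)])
  then show ?thesis unfolding weakly_hyperbolic_def
    using hyperbolic_mset_pairs[of n m u] assms(1) by (intro exI[of _ "n + n"]) auto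
qed

lemma weakly_hyperbolic_all:
  "(\<And>u. u \<in># U \<Longrightarrow> weakly_hyperbolic {#(m, u)#}) \<Longrightarrow> weakly_hyperbolic (image_mset (Pair m) U)"
proof (induction U)
  case (add u U)
  then show ?case using weakly_hyperbolic_plus[of "{#(m, u)#}" "image_mset (Pair m) U"] by simp
qed (simp add: weakly_hyperbolic_empty)

text \<open>Scaling the given move by \<open>t\<close> turns copies of \<open>t\<close> into copies
  of \<open>t * t\<close>, and this differs from 1 by the square of a unit.\<close>

lemma meq_reverse:
  assumes "meq (repeat_mset n {#(m, 1)#}) (repeat_mset n {#(m, t)#})" and t: "unit_mod m t"
  shows "meq (repeat_mset n {#(m, t)#}) (repeat_mset n {#(m, 1)#})"
proof -
  have "meq (repeat_mset n {#(m, t * 1)#}) (repeat_mset n {#(m, t * t)#})"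
    by (rule meq_repeat_scale[OF assms])
  moreover obtain e where e: "m dvd t * e - 1" using t by (auto simp: unit_mod_def)
  have ue: "unit_mod m e" using e unit_mod_cong[OF unit_mod_1] by (metis dvd_diff_commute mult.commute unit_mod_factor)
  have "m dvd (t * e - 1) * (- (t * e + 1))" using e by simp
  then have "m dvd 1 - t * t * e\<^sup>2" by (simp add: power2_eq_square algebra_simps)
  then have "meq (repeat_mset n {#(m, t * t)#}) (repeat_mset n {#(m, 1)#})"
    by (intro meq_repeat meq_scale[OF ue])
  ultimately show ?thesis using meq_trans by simp
qed

lemma totally_positive_meq:
  fixes p :: "'k::field_char_0 poly"
  assumes nf: "number_field TYPE('k)" and p: "irreducible p" and k: "0 < k"
    and c: "unit_mod p c" "\<And>\<chi>. place p \<chi> \<Longrightarrow> 0 < \<chi> c"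
  shows "\<exists>n\<ge>1. meq (repeat_mset n {#(p ^ k, 1)#}) (repeat_mset n {#(p ^ k, c)#}) \<and>
    meq (repeat_mset n {#(p ^ k, c)#}) (repeat_mset n {#(p ^ k, 1)#})"
proof -
  obtain xs where "p dvd c - sum_squares xs"
    using totally_positive_sum_squares[OF nf p, of c] c(2) by (auto simp: sum_squares_mod_def)
  then show ?thesis
    using meq_sum_squares[OF p k c(1)] meq_reverse unit_mod_power_modulus[OF c(1)] by blast
qed

lemma meq_repeat_mult:
  assumes "meq (repeat_mset n M) (repeat_mset n N)" shows "meq (repeat_mset (k * n) M) (repeat_mset (k * n) N)"
  using meq_repeat[OF assms, of k] by simp

text \<open>Since the signs cancel, every place has a positive entry, and the entry \<open>c\<close>
  extracted from a nonempty \<open>U\<close> is totally positive. The remaining signs add up to -1,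
  so in the same way a totally negative entry \<open>- d\<close> is extracted. Multiples of
  \<open>c\<close> and \<open>- d\<close> cancel as those of 1 and -1 do, and two entries fewer are
  left.\<close>

lemma number_field_places_weakly_hyperbolic:
  fixes p :: "'k::field_char_0 poly"
  assumes nf: "number_field TYPE('k)" and p: "irreducible p" and k: "0 < k" and \<chi>0: "place p \<chi>0"
    and "\<And>u. u \<in># U \<Longrightarrow> unit_mod p u" "\<And>\<chi>. place p \<chi> \<Longrightarrow> (\<Sum>u\<in>#U. rsgn (\<chi> u)) = 0"
  shows "weakly_hyperbolic (image_mset (Pair (p ^ k)) U)"
  using assms(5,6)
proof (induction "size U" arbitrary: U rule: less_induct)
  case less
  define m where "m = p ^ k"
  have ex_pos: "\<exists>u\<in>#V. 0 < \<chi> u" if V: "V \<noteq> {#}" "\<And>u. u \<in># V \<Longrightarrow> unit_mod p u" "(\<Sum>u\<in>#V. rsgn (\<chi> u)) \<ge> 0" and \<chi>: "place p \<chi>" for V \<chi>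
  proof (rule ccontr)
    assume no: "\<not> ?thesis"
    have "rsgn (\<chi> u) = - 1" if "u \<in># V" for u
    proof -
      have "\<chi> u \<noteq> 0" by (rule place_unit[OF \<chi> V(2)[OF that]])
      moreover have "\<not> 0 < \<chi> u" using no that by blast
      ultimately show ?thesis by (intro rsgn_simps(2)) linarith
    qed
    then have "(\<Sum>u\<in>#V. rsgn (\<chi> u)) = (\<Sum>u\<in>#V. - 1)" by (intro arg_cong[where f = sum_mset] image_mset_cong)
    also have "\<dots> = - int (size V)" by simp
    finally show False using V(1,3) by (simp add: nonempty_has_size)
  qed
  show ?case
  proof (cases "U = {#}")
    case True
    then show ?thesis by (simp add: weakly_hyperbolic_empty)
  next
    case False
    obtain c V where c: "unit_mod p c" "\<forall>v\<in>#V. unit_mod p v" "size U = Suc (size V)"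
      "meq (image_mset (Pair m) U) (add_mset (m, c) (image_mset (Pair m) V))"
      "\<And>\<chi>. place p \<chi> \<Longrightarrow> (0 < \<chi> c \<longleftrightarrow> (\<exists>u\<in>#U. 0 < \<chi> u)) \<and>
        rsgn (\<chi> c) + (\<Sum>v\<in>#V. rsgn (\<chi> v)) = (\<Sum>u\<in>#U. rsgn (\<chi> u))"
      using place_extract[OF nf p \<chi>0 False less.prems(1), of k] unfolding m_def by blast
    have c_pos: "0 < \<chi> c" if "place p \<chi>" for \<chi>
      using ex_pos[OF False less.prems(1) _ that] less.prems(2)[OF that] c(5)[OF that] by auto
    have V_sum: "(\<Sum>v\<in>#V. rsgn (\<chi> v)) = - 1" if "place p \<chi>" for \<chi>
      using c(5)[OF that] less.prems(2)[OF that] rsgn_simps(1)[OF c_pos[OF that]] by simp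
    \<comment> \<open>Extraction favours positive signs, so it is applied to the negatives of the
      entries, and the result is scaled back by -1 below.\<close>
    define V' where "V' = image_mset uminus V"
    have V'_sum: "(\<Sum>v\<in>#V'. rsgn (\<chi> v)) = 1" if \<chi>: "place p \<chi>" for \<chi>
    proof -
      have "(\<Sum>v\<in>#V'. rsgn (\<chi> v)) = (\<Sum>v\<in>#V. - rsgn (\<chi> v))"
        by (simp add: V'_def image_mset.compositionality comp_def place_minus[OF \<chi>] sgn_in_minus[OF field_ordering_nonneg_reals])
      also have "\<dots> = - (\<Sum>v\<in>#V. rsgn (\<chi> v))" by (rule sum_mset_uminus)
      finally show ?thesis using V_sum[OF \<chi>] by simp
    qed
    have V': "V' \<noteq> {#}" "\<And>v. v \<in># V' \<Longrightarrow> unit_mod p v"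
      using V'_sum[OF \<chi>0] c(2) unit_mod_minus by (auto simp: V'_def)
    obtain d W where d: "unit_mod p d" "\<forall>v\<in>#W. unit_mod p v" "size V' = Suc (size W)"
      "meq (image_mset (Pair m) V') (add_mset (m, d) (image_mset (Pair m) W))"
      "\<And>\<chi>. place p \<chi> \<Longrightarrow> (0 < \<chi> d \<longleftrightarrow> (\<exists>u\<in>#V'. 0 < \<chi> u)) \<and>
        rsgn (\<chi> d) + (\<Sum>v\<in>#W. rsgn (\<chi> v)) = (\<Sum>u\<in>#V'. rsgn (\<chi> u))"
      using place_extract[OF nf p \<chi>0 V', of k] unfolding m_def by blast
    have d_pos: "0 < \<chi> d" if "place p \<chi>" for \<chi>
      using ex_pos[OF V' _ that] V'_sum[OF that] d(5)[OF that] by auto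
    define W' where "W' = image_mset uminus W"
    have "(\<Sum>v\<in>#W'. rsgn (\<chi> v)) = 0" if \<chi>: "place p \<chi>" for \<chi>
    proof -
      have "(\<Sum>v\<in>#W'. rsgn (\<chi> v)) = (\<Sum>v\<in>#W. - rsgn (\<chi> v))"
        by (simp add: W'_def image_mset.compositionality comp_def place_minus[OF \<chi>] sgn_in_minus[OF field_ordering_nonneg_reals])
      also have "\<dots> = - (\<Sum>v\<in>#W. rsgn (\<chi> v))" by (rule sum_mset_uminus)
      finally show ?thesis using d(5)[OF \<chi>] V'_sum[OF \<chi>] rsgn_simps(1)[OF d_pos[OF \<chi>]] by simp
    qed
    moreover have "size W' < size U" using c(3) d(3) by (simp add: W'_def V'_def)
    moreover have "unit_mod p v" if "v \<in># W'" for v using that d(2) unit_mod_minus by (auto simp: W'_def)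
    ultimately have wW': "weakly_hyperbolic (image_mset (Pair m) W')" unfolding m_def by (intro less.hyps)
    have "meq (scale_mset (- 1) (image_mset (Pair m) V')) (scale_mset (- 1) (add_mset (m, d) (image_mset (Pair m) W)))"
    proof (rule conjunct2[OF meq_scale_mset[OF d(4), of m]])
      show "unit_mod m (- 1)" by (rule unit_mod_minus[OF unit_mod_1])
    qed auto
    moreover have "scale_mset (- 1) (image_mset (Pair m) V') = image_mset (Pair m) V"
      by (simp add: scale_mset_def V'_def image_mset.compositionality comp_def)
    moreover have "scale_mset (- 1) (image_mset (Pair m) W) = image_mset (Pair m) W'"
      by (simp add: scale_mset_def W'_def image_mset.compositionality comp_def)
    ultimately have "meq (image_mset (Pair m) V) (add_mset (m, - d) (image_mset (Pair m) W'))" by simp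
    then have "meq (image_mset (Pair m) U) (add_mset (m, c) (add_mset (m, - d) (image_mset (Pair m) W')))"
      using meq_trans[OF c(4) meq_add_mset] by blast
    then have step: "meq (image_mset (Pair m) U) ({#(m, c), (m, - d)#} + image_mset (Pair m) W')" by simp
    obtain n where n: "n \<ge> 1" "meq (repeat_mset n {#(m, c)#}) (repeat_mset n {#(m, 1)#})"
      using totally_positive_meq[OF nf p k, of c] c(1) c_pos unfolding m_def by blast
    obtain l where l: "l \<ge> 1" "meq (repeat_mset l {#(m, d)#}) (repeat_mset l {#(m, 1)#})"
      using totally_positive_meq[OF nf p k, of d] d(1) d_pos unfolding m_def by blast
    have l': "meq (repeat_mset l {#(m, - d)#}) (repeat_mset l {#(m, - 1)#})"
      using meq_repeat_scale[OF l(2), of "- 1"] unit_mod_minus[OF unit_mod_1, of m] by simp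
    have "meq (repeat_mset (l * n) {#(m, c)#} + repeat_mset (l * n) {#(m, - d)#})
        (repeat_mset (l * n) {#(m, 1)#} + repeat_mset (l * n) {#(m, - 1)#})"
      using meq_add2[OF meq_repeat_mult[OF n(2), of l] meq_repeat_mult[OF l', of n]] by (simp only: mult.commute[of n l])
    moreover have "repeat_mset (l * n) {#(m, c), (m, - d)#} = repeat_mset (l * n) {#(m, c)#} + repeat_mset (l * n) {#(m, - d)#}"
      by (intro multiset_eqI) simp
    moreover have "l * n \<ge> 1" using l(1) n(1) by simp
    ultimately have "weakly_hyperbolic {#(m, c), (m, - d)#}"
      unfolding weakly_hyperbolic_def using hyperbolic_mset_pairs[of "l * n" m 1] by metis
    then show ?thesis using weakly_hyperbolic_meq[OF step] weakly_hyperbolic_plus[OF _ wW'] unfolding m_def by blast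
  qed
qed

lemma number_field_local:
  fixes p :: "'k::field_char_0 poly"
  assumes nf: "number_field TYPE('k)" and p: "irreducible p" "lead_coeff p = 1" and k: "0 < k"
    and U: "\<And>u. u \<in># U \<Longrightarrow> unit_mod p u"
    and sig: "\<And>P c. field_ordering P \<Longrightarrow> (\<Sum>u\<in>#U. residue_sig P p (c * u)) = 0"
  shows "weakly_hyperbolic (image_mset (Pair (p ^ k)) U)"
proof (cases "\<exists>\<chi>0. place p \<chi>0")
  case True
  then obtain \<chi>0 where "place p \<chi>0" by blast
  then show ?thesis
    using number_field_places_weakly_hyperbolic[OF nf p(1) k _ U] place_signature_0[OF p U sig] by blast
next
  case False
  \<comment> \<open>Without real places -1 is vacuously totally positive, so a multiple of 1 can be
    moved to the same multiple of -1, and scaling carries this over to every unit.\<close>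
  obtain n where n: "n \<ge> 1" "meq (repeat_mset n {#(p ^ k, 1)#}) (repeat_mset n {#(p ^ k, - 1)#})"
    using totally_positive_meq[OF nf p(1) k, of "- 1"] unit_mod_minus[OF unit_mod_1, of p] False by blast
  show ?thesis
  proof (rule weakly_hyperbolic_all)
    fix u assume "u \<in># U"
    then have "unit_mod (p ^ k) u" using U unit_mod_power_modulus by blast
    from meq_repeat_scale[OF n(2) this]
    show "weakly_hyperbolic {#(p ^ k, u)#}" by (intro weakly_hyperbolic_if_minus[OF n(1)]) simp
  qed
qed

section \<open>The local criterion over real closed fields\<close>

text \<open>For linear \<open>p\<close> each unit is plus or minus a square modulo \<open>p\<close>,
  and the vanishing signature equates the numbers of both kinds. For quadratic \<open>p\<close> the
  residue field contains a square root of -1, so that \<open>u\<close> and \<open>- u\<close> have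
  the same class.\<close>

lemma real_closed_local:
  fixes p :: "'k::field_char_0 poly" and P :: "'k set"
  assumes P: "field_ordering P" "\<And>a. a \<in> P \<Longrightarrow> \<exists>b. a = b ^ 2"
    and p: "(\<exists>a. p = [:- a, 1:]) \<or> (\<exists>a c. c \<noteq> 0 \<and> p = [:a * a + c * c, - (2 * a), 1:])" and k: "0 < k"
    and U: "\<And>u. u \<in># U \<Longrightarrow> unit_mod p u"
    and sig: "\<And>P c. field_ordering P \<Longrightarrow> (\<Sum>u\<in>#U. residue_sig P p (c * u)) = 0"
  shows "weakly_hyperbolic (image_mset (Pair (p ^ k)) U)"
  using p
proof (elim disjE exE conjE)
  note meq_trans [trans]
  fix a assume pa: "p = [:- a, 1:]"
  have res: "p dvd f - [:poly f a:]" for f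
    unfolding pa by (simp add: poly_eq_0_iff_dvd[symmetric])
  have "\<exists>x y. meq (image_mset (Pair (p ^ k)) U) (repeat_mset x {#(p ^ k, 1)#} + repeat_mset y {#(p ^ k, - 1)#}) \<and>
      int x - int y = (\<Sum>u\<in>#U. sgn_in P (poly u a))" using U
  proof (induction U)
    case empty
    show ?case by (intro exI[of _ 0]) (simp add: meq_refl)
  next
    case (add u U)
    then obtain x y where xy: "meq (image_mset (Pair (p ^ k)) U) (repeat_mset x {#(p ^ k, 1)#} + repeat_mset y {#(p ^ k, - 1)#})"
      "int x - int y = (\<Sum>u\<in>#U. sgn_in P (poly u a))" by auto
    have up: "unit_mod p u" using add.prems by simp
    have nz: "poly u a \<noteq> 0"
    proof
      assume "poly u a = 0"
      then have "p dvd u" using res[of u] by simp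
      moreover have "irreducible p" unfolding pa by (rule irreducible_linear_field_poly) simp
      ultimately show False using irreducible_not_unit_mod up by blast
    qed
    have sq: "meq (add_mset (p ^ k, u) M) (add_mset (p ^ k, [:e:]) M)" if e: "poly u a = e * b ^ 2" "e * e = 1" for e b M
    proof (rule meq_residue_square[OF k _ up])
      have b: "b \<noteq> 0" using nz e by auto
      show "unit_mod p [:1 / b:]"
        unfolding unit_mod_def by (intro exI[of _ "[:b:]"]) (simp add: b one_pCons)
      have "poly ([:e:] - u * [:1 / b:]\<^sup>2) a = 0" using e b by (simp add: power2_eq_square)
      then show "p dvd [:e:] - u * [:1 / b:]\<^sup>2" by (simp only: pa poly_eq_0_iff_dvd)
    qed
    show ?case
    proof (cases "poly u a \<in> P")
      case True
      then obtain b where "poly u a = 1 * b ^ 2" using P(2) by auto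
      then have "meq (image_mset (Pair (p ^ k)) (add_mset u U)) (add_mset (p ^ k, 1) (image_mset (Pair (p ^ k)) U))"
        using sq[of 1 b] by (simp add: one_pCons)
      also have "meq \<dots> (add_mset (p ^ k, 1) (repeat_mset x {#(p ^ k, 1)#} + repeat_mset y {#(p ^ k, - 1)#}))"
        by (rule meq_add_mset[OF xy(1)])
      finally have "meq (image_mset (Pair (p ^ k)) (add_mset u U)) (repeat_mset (Suc x) {#(p ^ k, 1)#} + repeat_mset y {#(p ^ k, - 1)#})"
        by simp
      then show ?thesis using xy(2) True nz by (intro exI[of _ "Suc x"] exI[of _ y]) (simp add: sgn_in_def)
    next
      case False
      then have "- poly u a \<in> P" using field_ordering_total[OF P(1)] by blast
      then obtain b where "- poly u a = b ^ 2" using P(2) by blast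
      then have "poly u a = (- 1) * b ^ 2" by (metis minus_minus mult_minus1)
      then have "meq (image_mset (Pair (p ^ k)) (add_mset u U)) (add_mset (p ^ k, - 1) (image_mset (Pair (p ^ k)) U))"
        using sq[of "- 1" b] by (simp add: one_pCons)
      also have "meq \<dots> (add_mset (p ^ k, - 1) (repeat_mset x {#(p ^ k, 1)#} + repeat_mset y {#(p ^ k, - 1)#}))"
        by (rule meq_add_mset[OF xy(1)])
      finally have "meq (image_mset (Pair (p ^ k)) (add_mset u U)) (repeat_mset x {#(p ^ k, 1)#} + repeat_mset (Suc y) {#(p ^ k, - 1)#})"
        by simp
      then show ?thesis using xy(2) False nz by (intro exI[of _ x] exI[of _ "Suc y"]) (simp add: sgn_in_def)
    qed
  qed
  then obtain x y where xy: "meq (image_mset (Pair (p ^ k)) U) (repeat_mset x {#(p ^ k, 1)#} + repeat_mset y {#(p ^ k, - 1)#})"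
    "int x - int y = (\<Sum>u\<in>#U. sgn_in P (poly u a))" by blast
  have "(\<Sum>u\<in>#U. sgn_in P (poly u a)) = 0"
    using sig[OF P(1), of 1] by (simp add: pa residue_sig_linear[OF P(1)])
  then have "x = y" using xy(2) by simp
  then show ?thesis unfolding weakly_hyperbolic_def
    using xy(1) hyperbolic_mset_pairs[of x "p ^ k" 1] by (intro exI[of _ 1]) auto
next
  fix a c assume c: "c \<noteq> 0" and pac: "p = [:a * a + c * c, - (2 * a), 1:]"
  \<comment> \<open>With the class of \<open>X\<close> in the role of \<open>a + i c\<close>, this
    is the imaginary unit modulo \<open>p\<close>.\<close>
  define w where "w = [:- a / c, 1 / c:]"
  have ww: "w\<^sup>2 + 1 = smult (1 / (c * c)) p"
    using c by (simp add: w_def pac power2_eq_square one_pCons field_simps)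
  then have "w * (- w) - 1 = p * [:- (1 / (c * c)):]" by (simp add: power2_eq_square algebra_simps)
  then have uw: "unit_mod p w" unfolding unit_mod_def by (metis dvd_triv_left)
  show ?thesis
  proof (rule weakly_hyperbolic_all)
    fix u assume "u \<in># U"
    then have up: "unit_mod p u" using U by blast
    have "p dvd - u - u * w\<^sup>2"
    proof -
      have "- u - u * w\<^sup>2 = - u * (w\<^sup>2 + 1)" by (simp add: algebra_simps)
      then show ?thesis unfolding ww by (simp add: dvd_smult)
    qed
    then have "meq {#(p ^ k, u)#} {#(p ^ k, - u)#}" by (rule meq_residue_square[OF k uw up])
    then show "weakly_hyperbolic {#(p ^ k, u)#}" by (intro weakly_hyperbolic_if_minus[of 1]) auto
  qed
qed


section \<open>Descent of nonsingularity\<close>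

lemma finite_dim_span:
  assumes "finite_dim_vector_space s"
  obtains A where "finite A" "\<not> module.dependent s A" "module.span s A = UNIV"
proof -
  interpret vector_space s using assms by (simp add: finite_dim_vector_space_def)
  obtain B where B: "finite B" "span B = UNIV" using assms by (auto simp: finite_dim_vector_space_def)
  obtain A where A: "A \<subseteq> B" "independent A" "B \<subseteq> span A" using maximal_independent_subset[of B] by blast
  then have "span A = UNIV" using B(2) by (metis span_mono span_span top.extremum_uniqueI)
  then show ?thesis using that A finite_subset[OF A(1) B(1)] by blast
qed

lemma comm_ring_hom_poly_map_poly:
  assumes "field_embedding h" shows "comm_ring_hom (\<lambda>p. poly (map_poly h p) z)"
proof -
  note h = assms[unfolded field_embedding_def] field_embedding_0[OF assms]
  have eval: "poly (map_poly h (pCons a p)) z = h a + z * poly (map_poly h p) z" for a p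
    using h by (simp add: map_poly_pCons)
  have add: "poly (map_poly h (p + q)) z = poly (map_poly h p) z + poly (map_poly h q) z" for p q
  proof (induction p arbitrary: q)
    case (pCons a p)
    show ?case
    proof (cases q)
      fix c r assume "q = pCons c r"
      then show ?thesis using h by (simp add: eval pCons.IH algebra_simps)
    qed
  qed simp
  have smult: "poly (map_poly h (smult a p)) z = h a * poly (map_poly h p) z" for a p
    by (induction p) (use h in \<open>simp_all add: eval algebra_simps\<close>)
  have "poly (map_poly h (p * q)) z = poly (map_poly h p) z * poly (map_poly h q) z" for p q
    by (induction p) (use h in \<open>simp_all add: eval add smult algebra_simps\<close>)
  then show ?thesis using add h by unfold_locales (simp_all add: one_pCons eval)
qed

text \<open>The determinant of \<open>B + X C\<close> is a polynomial over \<open>K\<close> with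
  infinitely many zeros, hence it is 0 and remains 0 at all elements of the larger field. The point
  at infinity of the pencil, \<open>x = 0\<close>, is treated apart.\<close>

lemma pencil_det_0:
  fixes h :: "'k::field_char_0 \<Rightarrow> 'l::field" and B C :: "nat \<Rightarrow> nat \<Rightarrow> 'k"
  assumes h: "field_embedding h"
    and zero: "\<And>\<alpha> \<beta>. det (mat n n (\<lambda>(i, k). \<alpha> * B i k + \<beta> * C i k)) = 0"
  shows "det (mat n n (\<lambda>(i, k). x * h (B i k) + y * h (C i k))) = 0"
proof -
  interpret H: comm_ring_hom h
    using h field_embedding_0[OF h] by unfold_locales (auto simp: field_embedding_def)
  define D where "D = det (mat n n (\<lambda>(i, k). [:B i k, C i k:]))"
  have "poly D \<beta> = 0" for \<beta>
  proof -
    interpret E: comm_ring_hom "\<lambda>p. poly p \<beta>" by unfold_locales auto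
    have "map_mat (\<lambda>p. poly p \<beta>) (mat n n (\<lambda>(i, k). [:B i k, C i k:])) = mat n n (\<lambda>(i, k). 1 * B i k + \<beta> * C i k)"
      by (rule eq_matI) auto
    then have "poly D \<beta> = det (mat n n (\<lambda>(i, k). 1 * B i k + \<beta> * C i k))"
      unfolding D_def by (simp only: E.hom_det[symmetric])
    then show ?thesis by (simp only: zero)
  qed
  then have D0: "D = 0" using poly_all_0_iff_0 by blast
  have affine: "det (mat n n (\<lambda>(i, k). h (B i k) + z * h (C i k))) = 0" for z
  proof -
    interpret E: comm_ring_hom "\<lambda>p. poly (map_poly h p) z"
      by (rule comm_ring_hom_poly_map_poly[OF h])
    have "map_mat (\<lambda>p. poly (map_poly h p) z) (mat n n (\<lambda>(i, k). [:B i k, C i k:])) =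
        mat n n (\<lambda>(i, k). h (B i k) + z * h (C i k))"
      by (rule eq_matI) (auto simp: map_poly_pCons)
    then have "det (mat n n (\<lambda>(i, k). h (B i k) + z * h (C i k))) = poly (map_poly h D) z"
      unfolding D_def by (simp only: E.hom_det[symmetric])
    then show ?thesis by (simp add: D0)
  qed
  show ?thesis
  proof (cases "x = 0")
    case True
    have "map_mat h (mat n n (\<lambda>(i, k). 0 * B i k + 1 * C i k)) = mat n n (\<lambda>(i, k). h (C i k))"
      by (rule eq_matI) auto
    then have "det (mat n n (\<lambda>(i, k). h (C i k))) = h (det (mat n n (\<lambda>(i, k). 0 * B i k + 1 * C i k)))"
      by (simp only: H.hom_det[symmetric])
    then have "det (mat n n (\<lambda>(i, k). h (C i k))) = 0" by (simp only: zero H.hom_zero)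
    moreover have "mat n n (\<lambda>(i, k). x * h (B i k) + y * h (C i k)) = y \<cdot>\<^sub>m mat n n (\<lambda>(i, k). h (C i k))"
      by (rule eq_matI) (auto simp: True)
    ultimately show ?thesis by simp
  next
    case False
    have "mat n n (\<lambda>(i, k). x * h (B i k) + y * h (C i k)) =
        x \<cdot>\<^sub>m mat n n (\<lambda>(i, k). h (B i k) + (y / x) * h (C i k))"
      by (rule eq_matI) (auto simp: False distrib_left)
    then show ?thesis using affine[of "y / x"] by simp
  qed
qed

text \<open>A kernel vector of the Gram matrix is the coordinate vector of an element of the
  radical.\<close>

lemma gram_det_nonzero_iff:
  fixes s :: "'k::field \<Rightarrow> 'v::ab_group_add \<Rightarrow> 'v" and e :: "nat \<Rightarrow> 'v"
  assumes s: "vector_space s"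
    and e: "inj_on e {..<n}" "\<not> module.dependent s (e ` {..<n})" "module.span s (e ` {..<n}) = UNIV"
    and add: "\<And>x y z. b x (y + z) = b x y + b x z" and scale: "\<And>x c y. b x (s c y) = c * b x y"
    and commute: "\<And>x y. b x y = b y x"
  shows "det (mat n n (\<lambda>(i, k). b (e i) (e k))) \<noteq> 0 \<longleftrightarrow> (\<forall>x. (\<forall>y. b x y = 0) \<longrightarrow> x = 0)"
proof -
  interpret vector_space s by (rule s)
  let ?A = "mat n n (\<lambda>(i, k). b (e i) (e k))"
  have zero: "b x 0 = 0" for x using scale[of x 0 0] by simp
  have sum: "b x (\<Sum>k<m. s (c k) (e k)) = (\<Sum>k<m. c k * b x (e k))" for x c and m :: nat
    by (induction m) (auto simp: zero add scale)
  have "(\<exists>v. v \<in> carrier_vec n \<and> v \<noteq> 0\<^sub>v n \<and> ?A *\<^sub>v v = 0\<^sub>v n) \<longleftrightarrow> (\<exists>x. (\<forall>y. b x y = 0) \<and> x \<noteq> 0)"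
  proof (intro iffI; elim exE conjE)
    fix v assume v: "v \<in> carrier_vec n" "v \<noteq> 0\<^sub>v n" "?A *\<^sub>v v = 0\<^sub>v n"
    define x where "x = (\<Sum>k<n. s (v $ k) (e k))"
    have ex: "b (e i) x = 0" if i: "i < n" for i
    proof -
      have "b (e i) x = (\<Sum>k<n. b (e i) (e k) * v $ k)" by (simp add: x_def sum mult.commute)
      also have "\<dots> = (?A *\<^sub>v v) $ i"
        using i v(1) by (simp add: scalar_prod_def atLeast0LessThan)
      also have "\<dots> = 0" using i by (simp only: v(3)) simp
      finally show ?thesis .
    qed
    have "b x y = 0" for y
    proof -
      have "y \<in> span (e ` {..<n})" using e(3) by simp
      then show ?thesis
        by (induction rule: span_induct_alt) (auto simp: zero add scale commute[of x "e _"] ex)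
    qed
    moreover have "x \<noteq> 0"
    proof
      assume "x = 0"
      then have "(\<Sum>w\<in>e ` {..<n}. s (v $ inv_into {..<n} e w) w) = 0"
        using e(1) by (simp add: x_def sum.reindex)
      then have all: "v $ inv_into {..<n} e w = 0" if "w \<in> e ` {..<n}" for w
        using independentD[OF e(2) _ order_refl _ \<open>w \<in> _\<close>, of "\<lambda>w. v $ inv_into {..<n} e w"] by simp
      have "v $ k = 0" if "k < n" for k using all[of "e k"] e(1) \<open>k < n\<close> by simp
      then show False using v(1,2) by (metis eq_vecI carrier_vecD index_zero_vec(1,2))
    qed
    ultimately show "\<exists>x. (\<forall>y. b x y = 0) \<and> x \<noteq> 0" by blast
  next
    fix x assume x: "\<forall>y. b x y = 0" "x \<noteq> 0"
    have "x \<in> span (e ` {..<n})" using e(3) by simp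
    then obtain c where "x = (\<Sum>w\<in>e ` {..<n}. s (c w) w)"
      using span_finite[of "e ` {..<n}"] by auto
    then have xc: "x = (\<Sum>k<n. s (c (e k)) (e k))" using e(1) by (simp add: sum.reindex)
    define v where "v = vec n (\<lambda>k. c (e k))"
    have "?A *\<^sub>v v = 0\<^sub>v n"
    proof (rule eq_vecI)
      fix i assume "i < dim_vec (0\<^sub>v n :: 'k vec)"
      then have i: "i < n" by simp
      have "(?A *\<^sub>v v) $ i = (\<Sum>k<n. c (e k) * b (e i) (e k))"
        using i by (simp add: v_def scalar_prod_def atLeast0LessThan mult.commute)
      also have "\<dots> = b (e i) x" by (subst xc) (simp only: sum)
      also have "\<dots> = 0" using x(1) commute by metis
      finally show "(?A *\<^sub>v v) $ i = 0\<^sub>v n $ i" using i by simp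
    qed (simp add: v_def)
    moreover have "v \<noteq> 0\<^sub>v n"
    proof
      assume "v = 0\<^sub>v n"
      then have "c (e k) = 0" if "k < n" for k
        using \<open>k < n\<close> by (metis index_vec index_zero_vec(1) v_def)
      then have "x = 0" unfolding xc by (intro sum.neutral) auto
      then show False using x(2) by blast
    qed
    ultimately show "\<exists>v. v \<in> carrier_vec n \<and> v \<noteq> 0\<^sub>v n \<and> ?A *\<^sub>v v = 0\<^sub>v n"
      by (intro exI[of _ v]) (auto simp: v_def)
  qed
  then show ?thesis using det_0_iff_vec_prod_zero_field[of ?A n] by auto
qed

text \<open>Induction over the span reduces the unimodular form to two coefficients, which describe
  it on the image of \<open>j\<close>.\<close>

lemma nonsingular_combination:
  fixes h :: "'k::field \<Rightarrow> 'l::field" and t :: "'l \<Rightarrow> 'w::ab_group_add \<Rightarrow> 'w"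
  assumes ns: "nonsingular_over h t j {q1, q2}"
  obtains r a c where "unimodular r" "\<And>x y z. bil r x (y + z) = bil r x y + bil r x z"
    "\<And>x d y. bil r x (t d y) = d * bil r x y"
    "\<And>x y. bil r (j x) (j y) = a * h (bil q1 x y) + c * h (bil q2 x y)"
proof -
  have fun_space: "vector_space (\<lambda>c (f :: 'w \<Rightarrow> 'l) w. c * f w)"
    by unfold_locales (auto simp: algebra_simps fun_eq_iff)
  obtain r where r: "r \<in> module.span (\<lambda>c f x. c * f x) {r. \<exists>q\<in>{q1, q2}. base_change_form h t j q r}" "unimodular r"
    using ns by (auto simp: nonsingular_over_def)
  interpret F: vector_space "\<lambda>c (f :: 'w \<Rightarrow> 'l) w. c * f w" by (rule fun_space)
  have "(\<forall>x y z. bil r x (y + z) = bil r x y + bil r x z) \<and> (\<forall>x d y. bil r x (t d y) = d * bil r x y) \<and>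
    (\<exists>a c. \<forall>x y. bil r (j x) (j y) = a * h (bil q1 x y) + c * h (bil q2 x y))"
    using r(1)
  proof (induction rule: F.span_induct_alt)
    case base
    show ?case by (intro conjI exI[of _ 0]) (auto simp: bil_def)
  next
    case (step d f g)
    from step(1) obtain q where q: "q = q1 \<or> q = q2" "quadratic_form t f" "\<And>x y. bil f (j x) (j y) = h (bil q x y)"
      by (auto simp: base_change_form_def)
    have bil: "bil ((\<lambda>w. d * f w) + g) x y = d * bil f x y + bil g x y" for x y
      by (simp add: bil_def add_divide_distrib diff_divide_distrib algebra_simps)
    obtain a c where ac: "\<And>x y. bil g (j x) (j y) = a * h (bil q1 x y) + c * h (bil q2 x y)" using step(2) by blast
    have "\<exists>a c. \<forall>x y. bil ((\<lambda>w. d * f w) + g) (j x) (j y) = a * h (bil q1 x y) + c * h (bil q2 x y)"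
      using q(1)
    proof
      assume eq: "q = q1"
      show ?thesis
        by (rule exI[of _ "d + a"], rule exI[of _ c], intro allI, simp only: bil q(3) eq ac, simp add: algebra_simps)
    next
      assume eq: "q = q2"
      show ?thesis
        by (rule exI[of _ a], rule exI[of _ "d + c"], intro allI, simp only: bil q(3) eq ac, simp add: algebra_simps)
    qed
    moreover have f: "bil f x (y + z) = bil f x y + bil f x z" "bil f x (t e y) = e * bil f x y" for x y z e
      using q(2) by (auto simp: quadratic_form_def Vector_Spaces.linear_iff)
    have g: "bil g x (y + z) = bil g x y + bil g x z" "bil g x (t e y) = e * bil g x y" for x y z e
      using step(2) by blast+
    have "bil ((\<lambda>w. d * f w) + g) x (y + z) = bil ((\<lambda>w. d * f w) + g) x y + bil ((\<lambda>w. d * f w) + g) x z"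
      "bil ((\<lambda>w. d * f w) + g) x (t e y) = e * bil ((\<lambda>w. d * f w) + g) x y" for x y z e
      unfolding bil f g by (simp_all add: algebra_simps)
    ultimately show ?case by blast
  qed
  then show ?thesis using that[OF r(2)] by blast
qed

lemma bil_commute: "bil q x y = bil q y x"
  by (simp add: bil_def add.commute)

lemma quadratic_formD:
  assumes "quadratic_form s q"
  shows "bil q (x + y) z = bil q x z + bil q y z" "bil q x (y + z) = bil q x y + bil q x z"
    "bil q (s c x) y = c * bil q x y" "bil q x (s c y) = c * bil q x y" "q (s c x) = c ^ 2 * q x"
  using assms by (auto simp: quadratic_form_def Vector_Spaces.linear_iff)

text \<open>A basis of \<open>V\<close> is mapped by \<open>j\<close> to a basis of the base change,
  so the Gram matrix of a unimodular combination is a member of the pencil over the extension. If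
  all members over \<open>K\<close> were degenerate, its determinant would be 0.\<close>

lemma nonsingular_descent:
  fixes s :: "'k::field_char_0 \<Rightarrow> 'v::ab_group_add \<Rightarrow> 'v" and h :: "'k \<Rightarrow> 'l::field"
  assumes V: "finite_dim_vector_space s" and q1: "quadratic_form s q1" and q2: "quadratic_form s q2"
    and bc: "base_change h s t j" and ns: "nonsingular_over h t j {q1, q2}"
  shows "\<exists>\<alpha> \<beta>. \<forall>x. (\<forall>y. \<alpha> * bil q1 x y + \<beta> * bil q2 x y = 0) \<longrightarrow> x = 0"
proof -
  have s: "vector_space s" and t: "vector_space t" and h: "field_embedding h"
    and j: "Vector_Spaces.linear s (\<lambda>c. t (h c)) j"
    using V bc by (auto simp: finite_dim_vector_space_def base_change_def)
  interpret V: vector_space s by (rule s)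
  interpret W: vector_space t by (rule t)
  obtain A where A: "finite A" "V.independent A" "V.span A = UNIV" using finite_dim_span[OF V] by blast
  obtain xs where xs: "set xs = A" "distinct xs" using finite_distinct_list A(1) by blast
  define n where "n = length xs"
  define e where "e = nth xs"
  have e: "inj_on e {..<n}" "e ` {..<n} = A"
    using xs by (auto simp: e_def n_def nth_image lessThan_atLeast0 intro!: inj_on_nth)
  have jA: "inj_on j A" "W.independent (j ` A)" using bc A(2) by (auto simp: base_change_def)
  have "range j \<subseteq> W.span (j ` A)"
  proof
    fix w assume "w \<in> range j"
    then obtain x where x: "w = j x" by blast
    have "x \<in> V.span A" using A(3) by simp
    then show "w \<in> W.span (j ` A)" unfolding x
    proof (induction rule: V.span_induct_alt)
      case base
      have "j (0 + 0) = j 0 + j 0" using j by (simp only: Vector_Spaces.linear_iff)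
      then have "j 0 = 0" by simp
      then show ?case by (simp add: W.span_zero)
    next
      case (step c x y)
      have "j (s c x + y) = t (h c) (j x) + j y" using j by (simp add: Vector_Spaces.linear_iff)
      then show ?case using step by (simp add: W.span_add W.span_scale W.span_base)
    qed
  qed
  moreover have "W.span (range j) = UNIV" using bc by (simp add: base_change_def)
  ultimately have spanW: "W.span (j ` A) = UNIV" by (metis W.span_mono W.span_span top.extremum_uniqueI)
  define f where "f i = j (e i)" for i
  have fA: "f ` {..<n} = j ` A" using e(2) by (auto simp: f_def)
  have f: "inj_on f {..<n}" using e jA(1) by (auto simp: f_def inj_on_def)
  show ?thesis
  proof (rule ccontr)
    assume no: "\<not> ?thesis"
    have "det (mat n n (\<lambda>(i, k). \<alpha> * bil q1 (e i) (e k) + \<beta> * bil q2 (e i) (e k))) = 0" for \<alpha> \<beta>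
    proof -
      have "\<not> (\<forall>x. (\<forall>y. \<alpha> * bil q1 x y + \<beta> * bil q2 x y = 0) \<longrightarrow> x = 0)" using no by blast
      moreover have "det (mat n n (\<lambda>(i, k). \<alpha> * bil q1 (e i) (e k) + \<beta> * bil q2 (e i) (e k))) \<noteq> 0 \<longleftrightarrow>
          (\<forall>x. (\<forall>y. \<alpha> * bil q1 x y + \<beta> * bil q2 x y = 0) \<longrightarrow> x = 0)"
      proof (rule gram_det_nonzero_iff[OF s e(1), of "\<lambda>x y. \<alpha> * bil q1 x y + \<beta> * bil q2 x y"])
        show "V.independent (e ` {..<n})" "V.span (e ` {..<n}) = UNIV" using e(2) A by auto
        show "\<alpha> * bil q1 x y + \<beta> * bil q2 x y = \<alpha> * bil q1 y x + \<beta> * bil q2 y x" for x y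
          using bil_commute[of q1 x y] bil_commute[of q2 x y] by simp
      qed (simp_all add: quadratic_formD[OF q1] quadratic_formD[OF q2] algebra_simps)
      ultimately show ?thesis by blast
    qed
    note det0 = pencil_det_0[OF h this]
    obtain r a c where r: "unimodular r" "\<And>x y z. bil r x (y + z) = bil r x y + bil r x z"
      "\<And>x d y. bil r x (t d y) = d * bil r x y"
      "\<And>x y. bil r (j x) (j y) = a * h (bil q1 x y) + c * h (bil q2 x y)"
      using nonsingular_combination[OF ns] by blast
    have "det (mat n n (\<lambda>(i, k). bil r (f i) (f k))) \<noteq> 0"
      using gram_det_nonzero_iff[OF t f _ _ r(2,3) bil_commute] jA(2) spanW r(1) fA
      by (auto simp: unimodular_def)
    then show False using det0[of a c] by (simp add: f_def r(4))
  qed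
qed


section \<open>Hyperbolicity and the closure of a pair\<close>

text \<open>The vectors of an orthogonal basis are anisotropic by nondegeneracy, and the expansion
  in such a basis provides the map.\<close>

lemma (in sym_bilinear) representing_map:
  assumes X: "orthobasis UNIV X" and nondeg: "\<And>x. (\<And>y. b x y = 0) \<Longrightarrow> x = 0"
    and c: "sym_bilinear s c"
  obtains T where "Vector_Spaces.linear s s T" "\<And>x y. c x y = b x (T y)"
proof
  interpret C: sym_bilinear s c by fact
  have X': "finite X" "independent X" "span X = UNIV" "\<And>x y. x \<in> X \<Longrightarrow> y \<in> X \<Longrightarrow> x \<noteq> y \<Longrightarrow> b x y = 0"
    using X by (auto simp: orthobasis_def)
  define T where "T y = (\<Sum>x\<in>X. s (c x y / b x x) x)" for y
  show "Vector_Spaces.linear s s T"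
    unfolding Vector_Spaces.linear_iff T_def using vector_space_axioms
    by (auto simp: C.b_add_right C.b_scale_right add_divide_distrib scale_left_distrib sum.distrib scale_sum_right)
  have bxx: "b x x \<noteq> 0" if x: "x \<in> X" for x
  proof
    assume "b x x = 0"
    then have xX: "b y x = 0" if "y \<in> X" for y using X'(4)[OF \<open>y \<in> X\<close> x] by (cases "y = x") auto
    have "b y x = 0" for y using b_span_left_0[of y X x] X'(3) xX by auto
    then have "x = 0" using nondeg b_commute by metis
    then show False using X'(2) x dependent_zero by blast
  qed
  have "c x y = b x (T y)" if x: "x \<in> X" for x y
  proof -
    have "b x (T y) = (\<Sum>z\<in>X. c z y / b z z * b x z)" by (simp add: T_def b_sum_right b_scale_right)
    also have "\<dots> = (\<Sum>z\<in>X. if z = x then c x y else 0)"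
      by (rule sum.cong) (use x X'(4) bxx in auto)
    also have "\<dots> = c x y" using x X'(1) by simp
    finally show ?thesis by simp
  qed
  note onX = this
  show "c x y = b x (T y)" for x y
  proof -
    have "x \<in> span X" using X'(3) by simp
    then show ?thesis
      by (induction rule: span_induct_alt) (simp_all add: b_add_left b_scale_left C.b_add_left C.b_scale_left onX)
  qed
qed

lemma (in selfadjoint_form) pencil_polynomials:
  assumes \<alpha>: "\<alpha> \<noteq> 0" and q1: "\<And>x y. bil q1 x y = b x (T1 y)" and T: "\<And>x y. bil q2 x y = b x (T y)"
    and b: "\<And>x y. b x y = \<alpha> * bil q1 x y + \<beta> * bil q2 x y"
  shows "bil q1 x y = b x (pact [:1 / \<alpha>, - \<beta> / \<alpha>:] y)" "bil q2 x y = b x (pact [:0, 1:] y)"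
proof -
  have pact: "b x (pact [:d, e:] y) = d * b x y + e * bil q2 x y" for d e
    by (simp add: pact_pCons T_scale b_add_right b_scale_right T)
  have "b x (pact [:1 / \<alpha>, - \<beta> / \<alpha>:] y) = (b x y - \<beta> * bil q2 x y) / \<alpha>"
    unfolding pact by (simp add: diff_divide_distrib)
  also have "\<dots> = bil q1 x y" using \<alpha> by (simp add: b)
  finally show "bil q1 x y = b x (pact [:1 / \<alpha>, - \<beta> / \<alpha>:] y)" by simp
  show "bil q2 x y = b x (pact [:0, 1:] y)" by (simp add: pact_X T)
qed

text \<open>\<open>T\<close> represents one of the two given forms, recorded by \<open>q\<close> for
  the proof that \<open>T\<close> commutes with the adjoints. The other form is obtained from the
  combination \<open>b\<close> by dividing by its coefficient, so the roles depend on which of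
  \<alpha> and \<beta> is nonzero.\<close>

lemma pencil_selfadjoint:
  fixes s :: "'k::field_char_0 \<Rightarrow> 'v::ab_group_add \<Rightarrow> 'v"
  assumes V: "finite_dim_vector_space s" and q1: "quadratic_form s q1" and q2: "quadratic_form s q2"
    and b_def: "\<And>x y. b x y = \<alpha> * bil q1 x y + \<beta> * bil q2 x y" and nd: "\<And>x. (\<And>y. b x y = 0) \<Longrightarrow> x = 0"
  obtains T q f1 f2 where "selfadjoint_form s b T"
    "q \<in> {q1, q2}" "\<And>x y. bil q x y = b x (T y)"
    "\<And>x y. bil q1 x y = b x (selfadjoint_form.pact s T f1 y)"
    "\<And>x y. bil q2 x y = b x (selfadjoint_form.pact s T f2 y)"
proof -
  have s: "vector_space s" using V by (simp add: finite_dim_vector_space_def)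
  have sb: "sym_bilinear s b"
  proof -
    interpret vector_space s by (rule s)
    show ?thesis
      by unfold_locales (simp_all add: b_def quadratic_formD[OF q1] quadratic_formD[OF q2]
        bil_commute[of _ _ _] algebra_simps)
  qed
  interpret sym_bilinear s b by (rule sb)
  obtain A where A: "finite A" "independent A" "span A = UNIV" using finite_dim_span[OF V] by blast
  obtain X where X: "orthobasis UNIV X" using orthobasis_exists_aux[OF A(2,1)] A(3) by auto
  obtain T1 where T1: "Vector_Spaces.linear s s T1" "\<And>x y. bil q1 x y = b x (T1 y)"
    using representing_map[OF X nd quadratic_form_sym_bilinear[OF s q1]] by blast
  obtain T2 where T2: "Vector_Spaces.linear s s T2" "\<And>x y. bil q2 x y = b x (T2 y)"
    using representing_map[OF X nd quadratic_form_sym_bilinear[OF s q2]] by blast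
  have sa: "selfadjoint_form s b T" if "Vector_Spaces.linear s s T" "\<And>x y. bil q x y = b x (T y)" for T q
  proof (intro selfadjoint_form.intro selfadjoint_form_axioms.intro)
    show "sym_bilinear s b" by (rule sb)
    show "Vector_Spaces.linear s s T" by (rule that(1))
    show "b (T x) y = b x (T y)" for x y
      using b_commute[of "T x" y] bil_commute[of q x y] by (simp flip: that(2))
  qed
  note fin = that
  show ?thesis
  proof (cases "\<alpha> \<noteq> 0 \<or> \<beta> \<noteq> 0")
    \<comment> \<open>Here \<open>b\<close> vanishes identically, and so do the bilinear forms of
      \<open>q1\<close> and \<open>q2\<close>, being represented by \<open>b\<close>; the zero
      polynomial serves for both.\<close>
    case False
    then have "b x y = 0" for x y by (simp add: b_def)
    then have "bil q1 x y = b x z" "bil q2 x y = b x z" for x y z using T1(2) T2(2) by simp_all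
    then show ?thesis using fin[OF sa[OF T1], of q1 0 0] T1(2) by blast
  next
    case True
    then show ?thesis
    proof
      assume \<alpha>: "\<alpha> \<noteq> 0"
      interpret selfadjoint_form s b T2 by (rule sa[OF T2])
      show ?thesis
        by (rule fin[OF sa[OF T2] _ T2(2) pencil_polynomials[OF \<alpha> T1(2) T2(2) b_def]]) simp
    next
      assume \<beta>: "\<beta> \<noteq> 0"
      interpret selfadjoint_form s b T1 by (rule sa[OF T1])
      have "b x y = \<beta> * bil q2 x y + \<alpha> * bil q1 x y" for x y by (simp add: b_def)
      from pencil_polynomials[OF \<beta> T2(2) T1(2) this]
      show ?thesis by (intro fin[OF sa[OF T1] _ T1(2)]) auto
    qed
  qed
qed

text \<open>The component \<open>\<phi>\<close> of an adjoint pair commutes with \<open>T\<close>: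
  both \<open>b x y\<close> and \<open>b x (T y)\<close> satisfy the adjunction, and
  \<open>b\<close> is nondegenerate. Hence it commutes with all polynomials in
  \<open>T\<close>.\<close>

lemma closure_polynomial_form:
  fixes s :: "'k::field_char_0 \<Rightarrow> 'v::ab_group_add \<Rightarrow> 'v"
  assumes sa: "selfadjoint_form s b T" and b_def: "\<And>x y. b x y = \<alpha> * bil q1 x y + \<beta> * bil q2 x y"
    and q: "q \<in> {q1, q2}" "\<And>x y. bil q x y = b x (T y)"
    and nondeg: "\<And>x. (\<And>y. b x y = 0) \<Longrightarrow> x = 0"
  defines "r \<equiv> \<lambda>f x. b x (selfadjoint_form.pact s T f x)"
  shows "r f \<in> Cl s {q1, q2}"
    "bil (r f) x y = b x (selfadjoint_form.pact s T f y)"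
proof -
  interpret selfadjoint_form s b T by (rule sa)
  have r: "r f x = b x (pact f x)" for x by (simp add: r_def)
  have bil: "bil (r f) x y = b x (pact f y)" for x y
  proof -
    have "b y (pact f x) = b x (pact f y)" using pact_selfadjoint b_commute by metis
    then show ?thesis by (simp add: bil_def r pact_add_right b_add_left b_add_right)
  qed
  then show "bil (r f) x y = b x (pact f y)" .
  have "vector_space ((*) :: 'k \<Rightarrow> 'k \<Rightarrow> 'k)" by unfold_locales (auto simp: algebra_simps)
  then have "quadratic_form s (r f)"
    unfolding quadratic_form_def Vector_Spaces.linear_iff bil
    using vector_space_axioms
    by (auto simp: r pact_add_right pact_scale_right b_add_left b_add_right b_scale_left b_scale_right
      power2_eq_square)
  moreover have "b (\<psi> x) (pact f y) = b x (pact f (\<phi> y))" if adj: "(\<phi>, \<psi>) \<in> adjoints s {q1, q2}" for \<phi> \<psi> x y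
  proof -
    have \<phi>: "Vector_Spaces.linear s s \<phi>" and q12: "\<And>p x y. p \<in> {q1, q2} \<Longrightarrow> bil p (\<psi> x) y = bil p x (\<phi> y)"
      using adj by (auto simp: adjoints_def)
    have b: "b (\<psi> x) y = b x (\<phi> y)" for x y by (simp add: b_def q12)
    have "\<phi> (T y) = T (\<phi> y)" for y
    proof -
      have "b x (\<phi> (T y)) = b x (T (\<phi> y))" for x
      proof -
        have qb: "bil q x y = b x (T y)" for x y by (rule q(2))
        have "b x (\<phi> (T y)) = b (\<psi> x) (T y)" by (simp only: b)
        also have "\<dots> = bil q (\<psi> x) y" by (simp only: qb)
        also have "\<dots> = bil q x (\<phi> y)" by (rule q12[OF q(1)])
        also have "\<dots> = b x (T (\<phi> y))" by (simp only: qb)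
        finally show ?thesis .
      qed
      then have "b (\<phi> (T y) - T (\<phi> y)) x = 0" for x
        unfolding b_diff_left using b_commute[of "\<phi> (T y)" x] b_commute[of "T (\<phi> y)" x] by simp
      then show ?thesis using nondeg by (metis eq_iff_diff_eq_0)
    qed
    then have "\<phi> (pact f y) = pact f (\<phi> y)" for y
    proof (induction f)
      case 0
      have "\<phi> (s 0 0) = s 0 (\<phi> 0)" using \<phi> by (simp only: Vector_Spaces.linear_iff)
      then show ?case by simp
    next
      case (pCons a f)
      then show ?case using \<phi> by (simp add: pact_pCons Vector_Spaces.linear_iff)
    qed
    then show ?thesis by (simp add: b)
  qed
  ultimately show "r f \<in> Cl s {q1, q2}" unfolding Cl_def by (auto simp: bil)
qed

lemma signature_zero_imp_hyperbolic:
  fixes s :: "'k::field_char_0 \<Rightarrow> 'v::ab_group_add \<Rightarrow> 'v"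
  assumes K: "number_field TYPE('k) \<or> real_closed_field TYPE('k)"
    and V: "finite_dim_vector_space s" and q1: "quadratic_form s q1" and q2: "quadratic_form s q2"
    and nondeg: "\<And>x. (\<And>y. \<alpha> * bil q1 x y + \<beta> * bil q2 x y = 0) \<Longrightarrow> x = 0"
    and sig: "\<And>q. q \<in> Cl s {q1, q2} \<Longrightarrow> signature_zero s q"
  shows "\<exists>n\<ge>1. hyperbolic (power_scale s) (power_space n) (times_form n ` {q1, q2})"
proof -
  define b where "b x y = \<alpha> * bil q1 x y + \<beta> * bil q2 x y" for x y
  have nd: "x = 0" if "\<And>y. b x y = 0" for x using nondeg that by (simp add: b_def)
  have s: "vector_space s" using V by (simp add: finite_dim_vector_space_def)
  obtain T q f1 f2 where sa: "selfadjoint_form s b T"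
    and q: "q \<in> {q1, q2}" "\<And>x y. bil q x y = b x (T y)"
    and f: "\<And>x y. bil q1 x y = b x (selfadjoint_form.pact s T f1 y)"
      "\<And>x y. bil q2 x y = b x (selfadjoint_form.pact s T f2 y)"
  proof (rule pencil_selfadjoint[OF V q1 q2 b_def])
    show "x = 0" if "\<And>y. b x y = 0" for x by (rule nd[OF that])
  qed (rule that; assumption)
  interpret selfadjoint_form s b T by (rule sa)
  obtain A where A: "finite A" "independent A" "span A = UNIV" using finite_dim_span[OF V] by blast
  have "tsub (span A)" using A(3) by (simp add: tsub_def)
  then obtain M where M: "frame UNIV M" "prime_power_mset M"
    using frame_exists[OF A(1,2)] nd A(3) by auto
  have "(\<Sum>(m, u)\<in>#M. residue_sig P m (f * u)) = 0" if P: "field_ordering P" for P f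
  proof -
    let ?r = "\<lambda>x. b x (pact f x)"
    have cl: "?r \<in> Cl s {q1, q2}" "\<And>x y. bil ?r x y = b x (pact f y)"
      by (rule closure_polynomial_form[OF sa b_def q], simp_all add: nd)+
    have "quadratic_form s ?r" using cl(1) by (simp add: Cl_def)
    moreover have "sym_bilinear.has_sig s (bil ?r) P UNIV (\<Sum>(m, u)\<in>#M. residue_sig P m (f * u))"
      using frame_signature[OF P M(1), of f] unfolding cl(2)[abs_def] by (simp add: cl(2)[abs_def])
    ultimately have "sgn_form s P ?r = (\<Sum>(m, u)\<in>#M. residue_sig P m (f * u))"
      using sgn_form_eq[OF V _ P] by blast
    then show ?thesis using sig[OF cl(1)] P by (simp add: signature_zero_def)
  qed
  then have "weakly_hyperbolic M"
  proof (rule weakly_hyperbolic_if_signature_0[OF _ M, rotated])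
    fix p :: "'k poly" and k :: nat and U
    assume p: "irreducible p" "lead_coeff p = 1" "0 < k" and U: "\<And>u. u \<in># U \<Longrightarrow> unit_mod p u"
      and sg: "\<And>P c. field_ordering P \<Longrightarrow> (\<Sum>u\<in>#U. residue_sig P p (c * u)) = 0"
    from K show "weakly_hyperbolic (image_mset (Pair (p ^ k)) U)"
    proof
      assume "number_field TYPE('k)"
      then show ?thesis using number_field_local[OF _ p U sg] by blast
    next
      assume R: "real_closed_field TYPE('k)"
      then obtain P :: "'k set" where P: "field_ordering P" "\<And>a. a \<in> P \<Longrightarrow> \<exists>b. a = b ^ 2"
        by (auto simp: real_closed_field_def)
      interpret R: real_closed P using P R by unfold_locales (auto simp: real_closed_field_def)
      show ?thesis by (rule real_closed_local[OF P R.irreducible_cases[OF p(1,2)] p(3) U sg])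
    qed
  qed
  moreover have "q1 x = b x (pact f1 x)" "q2 x = b x (pact f2 x)" for x
    using f[of x x] bil_self[OF q1 s] bil_self[OF q2 s] by simp_all
  ultimately show ?thesis using weakly_hyperbolic_imp_hyperbolic[OF M(1)] by blast
qed

lemma has_sig_power:
  fixes s :: "'k::field_char_0 \<Rightarrow> 'v::ab_group_add \<Rightarrow> 'v"
  assumes sb: "sym_bilinear s b" and P: "field_ordering P" and z: "sym_bilinear.has_sig s b P UNIV z"
  shows "sym_bilinear.has_sig (power_scale s) (power_form n b) P (power_space n) (int n * z)"
proof -
  interpret A: sym_bilinear s b by (rule sb)
  interpret B: sym_bilinear "power_scale s" "power_form n b" by (rule sym_bilinear_power[OF sb])
  have "k \<le> n \<Longrightarrow> B.has_sig P (power_space k) (int k * z)" for k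
  proof (induction k)
    case 0
    have "power_space 0 = {0 :: nat \<Rightarrow> 'v}" by (auto simp: power_space_def)
    then show ?case using B.has_sig_zero by simp
  next
    case (Suc k)
    define \<iota> where "\<iota> x = (\<lambda>i. if i = k then x else 0)" for x :: 'v
    have \<iota>: "Vector_Spaces.linear s (power_scale s) \<iota>"
      unfolding Vector_Spaces.linear_iff using A.vector_space_axioms B.vector_space_axioms
      by (auto simp: \<iota>_def power_scale_def fun_eq_iff)
    have "(\<Sum>i<n. b (\<iota> x i) (\<iota> y i)) = (\<Sum>i<n. if i = k then b x y else 0)" for x y
      by (rule sum.cong) (auto simp: \<iota>_def)
    then have form: "power_form n b (\<iota> x) (\<iota> y) = 1 * b x y" for x y
      using Suc.prems by (simp add: power_form_def)
    have inj: "inj_on \<iota> UNIV" by (auto simp: inj_on_def \<iota>_def fun_eq_iff split: if_splits)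
    have "B.has_sig P (range \<iota>) (sgn_in P 1 * z)"
      by (rule has_sig_image[OF sb B.sym_bilinear_axioms P \<iota> inj _ z]) (rule form)
    then have "B.has_sig P (range \<iota>) z" using field_ordering_1[OF P] by (simp add: sgn_in_def)
    moreover have "B.has_sig P (power_space k) (int k * z)" using Suc by simp
    moreover have "power_form n b x y = 0" if "x \<in> range \<iota>" "y \<in> power_space k" for x y
      using that by (auto simp: power_form_def power_space_def \<iota>_def intro!: sum.neutral)
    moreover have "range \<iota> \<inter> power_space k = {0}"
    proof (intro equalityI subsetI)
      fix x assume "x \<in> range \<iota> \<inter> power_space k"
      then obtain v where v: "x = \<iota> v" "\<forall>i\<ge>k. x i = 0" by (auto simp: power_space_def)
      then have "v = 0" by (metis \<iota>_def order_refl)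
      then show "x \<in> {0}" using v(1) by (auto simp: \<iota>_def)
    next
      fix x :: "nat \<Rightarrow> 'v" assume "x \<in> {0}"
      then have "x = \<iota> 0" "x \<in> power_space k" by (auto simp: \<iota>_def power_space_def)
      then show "x \<in> range \<iota> \<inter> power_space k" by blast
    qed
    ultimately have "B.has_sig P {u + w | u w. u \<in> range \<iota> \<and> w \<in> power_space k} (z + int k * z)"
      by (rule B.has_sig_orthogonal_sum)
    moreover have "{u + w | u w. u \<in> range \<iota> \<and> w \<in> power_space k} = power_space (Suc k)" (is "?L = ?R")
    proof (intro equalityI subsetI)
      fix x assume "x \<in> ?L"
      then show "x \<in> ?R" by (auto simp: power_space_def \<iota>_def)
    next
      fix x assume x: "x \<in> ?R"
      define y where "y = (\<lambda>i. if i < k then x i else 0)"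
      have "x = \<iota> (x k) + y" using x by (auto simp: \<iota>_def y_def power_space_def fun_eq_iff)
      moreover have "y \<in> power_space k" by (auto simp: y_def power_space_def)
      ultimately show "x \<in> ?L" by blast
    qed
    ultimately show ?case by (simp add: distrib_right)
  qed
  then show ?thesis by simp
qed

lemma bil_times_form: "bil (times_form n q) x y = power_form n (bil q) x y"
  by (simp add: bil_def times_form_def power_form_def sum_subtractf flip: sum_divide_distrib)

lemma hyperbolic_imp_signature_zero:
  fixes s :: "'k::field_char_0 \<Rightarrow> 'v::ab_group_add \<Rightarrow> 'v"
  assumes V: "finite_dim_vector_space s" and Q: "\<And>q. q \<in> Q \<Longrightarrow> quadratic_form s q"
    and n: "n \<ge> 1" and hyp: "hyperbolic (power_scale s) (power_space n) (times_form n ` Q)"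
    and q: "q \<in> Cl s Q"
  shows "signature_zero s q"
proof -
  have s: "vector_space s" using V by (simp add: finite_dim_vector_space_def)
  interpret A: vector_space s by (rule s)
  interpret N: vector_space "power_scale s" by (rule vector_space_power_scale[OF s])
  obtain U U' where U: "N.subspace U" "N.subspace U'"
    "power_space n = {u + u' | u u'. u \<in> U \<and> u' \<in> U'}" "U \<inter> U' = {0}"
    and iso: "\<And>q u. q \<in> Q \<Longrightarrow> u \<in> U \<Longrightarrow> times_form n q u = 0" "\<And>q u. q \<in> Q \<Longrightarrow> u \<in> U' \<Longrightarrow> times_form n q u = 0"
    using hyp unfolding hyperbolic_def by blast
  have sub: "u \<in> power_space n" if "u \<in> U \<or> u \<in> U'" for u
    unfolding U(3) using that
  proof
    assume "u \<in> U"
    then show "u \<in> {u + u' | u u'. u \<in> U \<and> u' \<in> U'}"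
      using N.subspace_0[OF U(2)] by (intro CollectI exI[of _ u] exI[of _ 0]) simp
  next
    assume "u \<in> U'"
    then show "u \<in> {u + u' | u u'. u \<in> U \<and> u' \<in> U'}"
      using N.subspace_0[OF U(1)] by (intro CollectI exI[of _ 0] exI[of _ u]) simp
  qed
  \<comment> \<open>\<open>power_space n\<close> is a subspace of the space of all sequences;
    truncation extends the projections linearly to the whole type.\<close>
  define tr where "tr x = (\<lambda>i. if i < n then x i else 0)" for x :: "nat \<Rightarrow> 'v"
  have tr: "tr x \<in> power_space n" "x \<in> power_space n \<Longrightarrow> tr x = x" for x
    by (auto simp: tr_def power_space_def fun_eq_iff)
  have tr_linear: "tr (x + y) = tr x + tr y" "tr (power_scale s c x) = power_scale s c (tr x)" for x y c
    by (auto simp: tr_def power_scale_def fun_eq_iff)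
  have uniq: "u = v" if "u \<in> U" "v \<in> U" "x - u \<in> U'" "x - v \<in> U'" for x u v
  proof -
    have "u - v = (x - v) - (x - u)" by simp
    then have "u - v \<in> U'" using N.subspace_diff[OF U(2) that(4,3)] by (simp only:)
    then have "u - v \<in> U \<inter> U'" using N.subspace_diff[OF U(1) that(1,2)] by blast
    then show ?thesis using U(4) by simp
  qed
  have "\<exists>u. u \<in> U \<and> tr x - u \<in> U'" for x
  proof -
    obtain u u' where "tr x = u + u'" "u \<in> U" "u' \<in> U'" using tr(1)[of x] unfolding U(3) by blast
    then show ?thesis by (intro exI[of _ u]) simp
  qed
  then obtain E where E: "\<And>x. E x \<in> U" "\<And>x. tr x - E x \<in> U'" by metis
  define F where "F x = tr x - E x" for x
  have F: "F x \<in> U'" for x using E(2) by (simp add: F_def)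
  have E_eq: "E x = u" if "u \<in> U" "tr x - u \<in> U'" for x u using uniq E that by blast
  have E_add: "E (x + y) = E x + E y" for x y
  proof (rule E_eq)
    show "E x + E y \<in> U" using N.subspace_add[OF U(1)] E(1) by blast
    have "tr (x + y) - (E x + E y) = (tr x - E x) + (tr y - E y)" by (simp add: tr_linear)
    then show "tr (x + y) - (E x + E y) \<in> U'" using N.subspace_add[OF U(2)] E(2) by metis
  qed
  have E_scale: "E (power_scale s c x) = power_scale s c (E x)" for c x
  proof (rule E_eq)
    show "power_scale s c (E x) \<in> U" using N.subspace_scale[OF U(1)] E(1) by blast
    have "tr (power_scale s c x) - power_scale s c (E x) = power_scale s c (tr x - E x)"
      by (simp add: tr_linear N.scale_right_diff_distrib)
    then show "tr (power_scale s c x) - power_scale s c (E x) \<in> U'" using N.subspace_scale[OF U(2)] E(2) by metis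
  qed
  have F_add: "F (x + y) = F x + F y" for x y by (simp add: F_def E_add tr_linear)
  have F_scale: "F (power_scale s c x) = power_scale s c (F x)" for c x
    by (simp add: F_def E_scale tr_linear N.scale_right_diff_distrib)
  have EF: "E x + F x = tr x" for x by (simp add: F_def)
  have EU: "E u = u" "F u = 0" if "u \<in> U" for u
  proof -
    show "E u = u" using that sub tr(2) N.subspace_0[OF U(2)] by (intro E_eq) auto
    then show "F u = 0" using that sub tr(2) by (auto simp: F_def)
  qed
  have EU': "E u = 0" "F u = u" if "u \<in> U'" for u
  proof -
    show "E u = 0" using that sub tr(2) N.subspace_0[OF U(1)] by (intro E_eq) auto
    then show "F u = u" using that sub tr(2) by (auto simp: F_def)
  qed
  \<comment> \<open>By isotropy of \<open>U\<close> and \<open>U'\<close>, both sides reduce to the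
    pairing of \<open>E x\<close> with \<open>F y\<close>.\<close>
  have adj: "power_form n (bil p) (E x) y = power_form n (bil p) x (F y)" if p: "p \<in> Q" for p x y
  proof -
    interpret P: sym_bilinear "power_scale s" "power_form n (bil p)"
      by (rule sym_bilinear_power[OF quadratic_form_sym_bilinear[OF s Q[OF p]]])
    have U0: "power_form n (bil p) u v = 0" if "u \<in> U" "v \<in> U" for u v
      using iso(1)[OF p] that N.subspace_add[OF U(1)] by (simp add: bil_def flip: bil_times_form)
    have U'0: "power_form n (bil p) u v = 0" if "u \<in> U'" "v \<in> U'" for u v
      using iso(2)[OF p] that N.subspace_add[OF U(2)] by (simp add: bil_def flip: bil_times_form)
    have trunc: "power_form n (bil p) (E x) y = power_form n (bil p) (E x) (E y + F y)"
      "power_form n (bil p) x (F y) = power_form n (bil p) (E x + F x) (F y)"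
      unfolding EF by (simp_all add: power_form_def tr_def)
    show ?thesis unfolding trunc using U0[OF E(1) E(1)] U'0[OF F F] by (simp add: P.b_add_left P.b_add_right)
  qed
  define \<iota> where "\<iota> i x = (\<lambda>k. if k = i then x else 0)" for i :: nat and x :: 'v
  have \<iota>_add: "\<iota> i (x + y) = \<iota> i x + \<iota> i y" and \<iota>_scale: "\<iota> i (s c x) = power_scale s c (\<iota> i x)" for i x y c
    by (auto simp: \<iota>_def power_scale_def fun_eq_iff)
  have \<iota>_left: "power_form n c (\<iota> i x) y = c x (y i)" and \<iota>_right: "power_form n c y (\<iota> i x) = c (y i) x"
    if "i < n" "\<And>z. c 0 z = 0" "\<And>z. c z 0 = 0" for c :: "'v \<Rightarrow> 'v \<Rightarrow> 'k" and i x y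
  proof -
    have "power_form n c (\<iota> i x) y = (\<Sum>k<n. if k = i then c x (y i) else 0)"
      "power_form n c y (\<iota> i x) = (\<Sum>k<n. if k = i then c (y i) x else 0)"
      unfolding power_form_def by (rule sum.cong; auto simp: \<iota>_def that)+
    then show "power_form n c (\<iota> i x) y = c x (y i)" "power_form n c y (\<iota> i x) = c (y i) x"
      using that(1) by simp_all
  qed
  have qf: "quadratic_form s q" and q_adj: "\<And>\<phi> \<psi> x y. (\<phi>, \<psi>) \<in> adjoints s Q \<Longrightarrow> bil q (\<psi> x) y = bil q x (\<phi> y)"
    using q by (auto simp: Cl_def)
  interpret q1: sym_bilinear s "bil q" by (rule quadratic_form_sym_bilinear[OF s qf])
  interpret q: sym_bilinear "power_scale s" "power_form n (bil q)"
    by (rule sym_bilinear_power[OF q1.sym_bilinear_axioms])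
  \<comment> \<open>A block of \<open>E\<close> and the block of \<open>F\<close> with exchanged
    indices form a pair of adjoints on \<open>V\<close>, to which the assumption on \<open>q\<close>
    applies.\<close>
  have block: "bil q (E (\<iota> i x) k) y = bil q x (F (\<iota> k y) i)" if ik: "i < n" "k < n" for i k x y
  proof (rule q_adj)
    have "bil p (E (\<iota> i x) k) y = bil p x (F (\<iota> k y) i)" if p: "p \<in> Q" for p x y
    proof -
      interpret p: sym_bilinear s "bil p" by (rule quadratic_form_sym_bilinear[OF s Q[OF p]])
      show ?thesis
        using adj[OF p, of "\<iota> i x" "\<iota> k y"] by (simp add: \<iota>_left \<iota>_right ik)
    qed
    moreover have "F (\<iota> k (s c y)) i = s c (F (\<iota> k y) i)" "E (\<iota> i (s c y)) k = s c (E (\<iota> i y) k)" for c y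
      unfolding \<iota>_scale E_scale F_scale by (simp_all only: power_scale_def)
    ultimately show "(\<lambda>y. F (\<iota> k y) i, \<lambda>x. E (\<iota> i x) k) \<in> adjoints s Q"
      using s by (simp add: adjoints_def Vector_Spaces.linear_iff \<iota>_add E_add F_add)
  qed
  have sum_\<iota>: "tr x = (\<Sum>i<n. \<iota> i (x i))" for x
  proof -
    have "(\<lambda>i. if i < m then x i else 0) = (\<Sum>i<m. \<iota> i (x i))" for m
    proof (induction m)
      case (Suc m)
      have "(\<lambda>i. if i < Suc m then x i else 0) = (\<lambda>i. if i < m then x i else 0) + \<iota> m (x m)"
        by (auto simp: \<iota>_def fun_eq_iff less_Suc_eq)
      then show ?case unfolding Suc by (simp add: plus_fun_def)
    qed (simp add: zero_fun_def)
    then show ?thesis by (simp add: tr_def)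
  qed
  have E_tr: "E (tr x) = E x" and F_tr: "F (tr x) = F x" for x
  proof -
    have "tr (tr x) = tr x" by (auto simp: tr_def)
    then show "E (tr x) = E x" using E by (intro E_eq) auto
    then show "F (tr x) = F x" using \<open>tr (tr x) = tr x\<close> by (simp add: F_def)
  qed
  have E_sum: "E (sum g {..<k}) = (\<Sum>i<k. E (g i))" and F_sum: "F (sum g {..<k}) = (\<Sum>i<k. F (g i))" for g and k :: nat
    using EU(1,2)[OF N.subspace_0[OF U(1)]] by (induction k) (simp_all add: E_add F_add)
  \<comment> \<open>The adjunction for the power of \<open>q\<close> is assembled from the blocks,
    over the coordinates of both arguments.\<close>
  have q_adj': "power_form n (bil q) (E x) y = power_form n (bil q) x (F y)" for x y
  proof -
    have "power_form n (bil q) (E x) (tr y) = (\<Sum>i<n. \<Sum>k<n. power_form n (bil q) (E (\<iota> i (x i))) (\<iota> k (y k)))"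
      unfolding E_tr[symmetric, of x] sum_\<iota> E_sum q.b_sum_left q.b_sum_right by (rule sum.swap)
    also have "\<dots> = (\<Sum>i<n. \<Sum>k<n. power_form n (bil q) (\<iota> i (x i)) (F (\<iota> k (y k))))"
      by (intro sum.cong refl) (simp add: \<iota>_left \<iota>_right block)
    also have "\<dots> = power_form n (bil q) (tr x) (F y)"
      unfolding F_tr[symmetric, of y] sum_\<iota> F_sum q.b_sum_left q.b_sum_right by (rule sum.swap)
    finally show ?thesis by (simp add: power_form_def tr_def)
  qed
  have q_iso: "power_form n (bil q) u v = 0" if "u \<in> U \<and> v \<in> U \<or> u \<in> U' \<and> v \<in> U'" for u v
    using that q_adj'[of u v] EU EU' by auto
  \<comment> \<open>On \<open>power_space n\<close> this is an involution that reverses the sign of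
    the power form, so \<open>n\<close> times the signature of \<open>q\<close> equals its own
    negative.\<close>
  define J where "J x = E x - F x" for x
  have J: "Vector_Spaces.linear (power_scale s) (power_scale s) J"
    unfolding Vector_Spaces.linear_iff using N.vector_space_axioms
    by (simp add: J_def E_add F_add E_scale F_scale N.scale_right_diff_distrib)
  have JJ: "J (J x) = x" if "x \<in> power_space n" for x
  proof -
    have diff: "E (x - y) = E x - E y" "F (x - y) = F x - F y" for x y
      using E_add[of "x - y" y] F_add[of "x - y" y] by simp_all
    have "J (J x) = E x + F x" by (simp add: J_def diff EU[OF E(1)] EU'[OF F])
    then show ?thesis using EF tr(2)[OF that] by simp
  qed
  have J_space: "J x \<in> power_space n" for x
    using sub[of "E x"] sub[of "F x"] E(1)[of x] F[of x] by (auto simp: J_def power_space_def)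
  have J_form: "power_form n (bil q) (J x) (J y) = - 1 * power_form n (bil q) x y"
    if "x \<in> power_space n" "y \<in> power_space n" for x y
  proof -
    have xy: "x = E x + F x" "y = E y + F y" using EF tr(2) that by simp_all
    have 0: "power_form n (bil q) (E x) (E y) = 0" "power_form n (bil q) (F x) (F y) = 0"
      using q_iso E(1) F by blast+
    have "power_form n (bil q) x y = power_form n (bil q) (E x) (F y) + power_form n (bil q) (F x) (E y)"
      by (subst xy(1), subst xy(2)) (simp add: q.b_add_left q.b_add_right 0)
    moreover have "power_form n (bil q) (J x) (J y) = - power_form n (bil q) (E x) (F y) - power_form n (bil q) (F x) (E y)"
      by (simp add: J_def q.b_diff_left q.b_diff_right 0)
    ultimately show ?thesis by simp
  qed
  have "sgn_form s P q = 0" if P: "field_ordering P" for P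
  proof -
    obtain B where B: "finite B" "A.span B = UNIV" using V by (auto simp: finite_dim_vector_space_def)
    obtain z where z: "q1.has_sig P UNIV z"
      using q1.has_sig_exists[OF A.subspace_UNIV _ B(1)] B(2) by auto
    have nz: "q.has_sig P (power_space n) (int n * z)" by (rule has_sig_power[OF q1.sym_bilinear_axioms P z])
    have sig: "q.has_sig P (J ` power_space n) (sgn_in P (- 1) * (int n * z))"
    proof (rule has_sig_image[OF q.sym_bilinear_axioms q.sym_bilinear_axioms P J _ _ nz])
      show "power_form n (bil q) (J x) (J y) = - 1 * power_form n (bil q) x y"
        if "x \<in> power_space n" "y \<in> power_space n" for x y by (rule J_form[OF that])
      show "inj_on J (power_space n)" using JJ by (metis inj_on_inverseI)
    qed
    have img: "J ` power_space n = power_space n"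
    proof (intro equalityI subsetI)
      fix x :: "nat \<Rightarrow> 'v" assume "x \<in> power_space n"
      then show "x \<in> J ` power_space n" using JJ[of x] J_space[of x] by (metis image_eqI)
    qed (use J_space in auto)
    have "sgn_in P (- 1) = - 1"
      unfolding sgn_in_minus[OF P] using field_ordering_1[OF P] by (simp add: sgn_in_def)
    then have "q.has_sig P (power_space n) (- 1 * (int n * z))" using sig by (simp only: img)
    from q.has_sig_unique[OF P nz this] have "int n * z = 0" by linarith
    then have "z = 0" using n by simp
    then show ?thesis using sgn_form_eq[OF V qf P z] by simp
  qed
  then show ?thesis by (simp add: signature_zero_def)
qed

theorem theorem2:
  fixes s :: "'k::field_char_0 \<Rightarrow> 'v::ab_group_add \<Rightarrow> 'v"
    and q1 q2 :: "'v \<Rightarrow> 'k"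
    and h :: "'k \<Rightarrow> 'l::field"
    and t :: "'l \<Rightarrow> 'w::ab_group_add \<Rightarrow> 'w"
    and j :: "'v \<Rightarrow> 'w"
  assumes "number_field TYPE('k) \<or> real_closed_field TYPE('k)"
    and "finite_dim_vector_space s"
    and "quadratic_form s q1" and "quadratic_form s q2"
    and "base_change h s t j"
    and "nonsingular_over h t j {q1, q2}"
  shows "(\<exists>n\<ge>1. hyperbolic (power_scale s) (power_space n) (times_form n ` {q1, q2})) \<longleftrightarrow>
         (\<forall>q \<in> Cl s {q1, q2}. signature_zero s q)"
proof
  assume "\<exists>n\<ge>1. hyperbolic (power_scale s) (power_space n) (times_form n ` {q1, q2})"
  then obtain n where "n \<ge> 1" "hyperbolic (power_scale s) (power_space n) (times_form n ` {q1, q2})" by blast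
  then show "\<forall>q \<in> Cl s {q1, q2}. signature_zero s q"
    using hyperbolic_imp_signature_zero[OF assms(2), of "{q1, q2}" n] assms(3,4) by blast
next
  assume sig: "\<forall>q \<in> Cl s {q1, q2}. signature_zero s q"
  obtain \<alpha> \<beta> where "\<forall>x. (\<forall>y. \<alpha> * bil q1 x y + \<beta> * bil q2 x y = 0) \<longrightarrow> x = 0"
    using nonsingular_descent[OF assms(2-6)] by blast
  then show "\<exists>n\<ge>1. hyperbolic (power_scale s) (power_space n) (times_form n ` {q1, q2})"
    using sig by (intro signature_zero_imp_hyperbolic[OF assms(1-4), of \<alpha> \<beta>]) blast+
qed

end
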